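(* Let $d\in\{2,3\}$, let $\omega\subset\omega^*$ be concentric open cubes in $\mathbb{R}^d$ with side lengths $\sigma$ and $(1+\rho)\sigma$, $\rho>0$, and let $A$ be a coefficient matrix on $\omega^*$ with bounds $\alpha,\beta$. Let $u\in H_A^0(\omega^* )$. Then there exists $v_u\in\mathcal{F}_n(\omega,\omega^* )$ with $$\|u-v_u\|_{\mathcal{E}(\omega)}=\inf_{v\in\mathcal{F}_n(\omega,\omega^* )}\|u-v\|_{\mathcal{E}(\omega)}\le I(\omega,\omega^* )\,C_n\,\|u\|_{\mathcal{E}(\omega^* )},$$ where $I(\omega,\omega^* )=2\frac{\gamma_d^{1/d}}{\sqrt{\pi}}\frac{1+\rho}{\rho}(\beta/\alpha)^{1/2}$, $\gamma_d$ is the volume of the unit ball in $\mathbb{R}^d$, and $C_n$ is a number depending only on $n$ and $d$ with $C_n=n^{-1/d}(1+o(1))$ as $n\to\infty$.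
   Context: $A$ is a measurable symmetric matrix field with $\alpha|v|^2\le v^TA(x)v\le\beta|v|^2$, $0<\alpha\le\beta<\infty$. For an open $S$: $(u,v)_{\mathcal{E}(S)}=\int_SA\nabla u\cdot\nabla v\,dx$, $\|u\|_{\mathcal{E}(S)}=(u,u)_{\mathcal{E}(S)}^{1/2}$; $H_A(S)$ is the set of $v\in H^1(S)$ with $\int_SA\nabla v\cdot\nabla\varphi\,dx=0$ for all $\varphi\in C_0^\infty(S)$; $H_A^0(S)$ is the subspace of $H_A(S)$ of functions with zero average over $S$. Let $v_1,\ldots,v_n\in H^1(\omega^* )$ be the first $n$ non-constant eigenfunctions of the Neumann eigenvalue problem $(v_i,w)_{\mathcal{E}(\omega^* )}=\lambda_i\int_{\omega^*}v_iw\,dx$ for all $w\in H^1(\omega^* )$. For each $i$ let $h_i\in H_A(\omega^* )$ be the $A$-harmonic function with $h_i=v_i$ on $\partial\omega^*$ and $w_i=h_i-\frac{1}{|\omega^*|}\int_{\omega^*}h_i$. Then $W_n(\omega^* )=\mathrm{span}\{w_1,\ldots,w_n\}$ and $\mathcal{F}_n(\omega,\omega^* )$ is the space of restrictions to $\omega$ of elements of $W_n(\omega^* )$. *)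

theory Defs
  imports "HOL-Analysis.Analysis"
begin

coinductive smooth_fun :: "('a::euclidean_space \<Rightarrow> real) \<Rightarrow> bool" where
  "(\<forall>x. f differentiable (at x)) \<Longrightarrow>
   (\<forall>b\<in>Basis. smooth_fun (\<lambda>x. frechet_derivative f (at x) b)) \<Longrightarrow> smooth_fun f"

definition clgrad :: "(real^'d \<Rightarrow> real) \<Rightarrow> real^'d \<Rightarrow> real^'d" where
  "clgrad \<phi> x = (\<chi> i. frechet_derivative \<phi> (at x) (axis i 1))"

definition test_fun :: "(real^'d) set \<Rightarrow> (real^'d \<Rightarrow> real) \<Rightarrow> bool" where
  "test_fun S \<phi> \<longleftrightarrow> smooth_fun \<phi> \<and> compact (closure {x. \<phi> x \<noteq> 0})
      \<and> closure {x. \<phi> x \<noteq> 0} \<subseteq> S"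

definition L2 :: "(real^'d) set \<Rightarrow> (real^'d \<Rightarrow> real) \<Rightarrow> bool" where
  "L2 S f \<longleftrightarrow> f \<in> borel_measurable (lebesgue_on S) \<and> integrable (lebesgue_on S) (\<lambda>x. (f x)\<^sup>2)"

definition weak_grad :: "(real^'d) set \<Rightarrow> (real^'d \<Rightarrow> real) \<Rightarrow> (real^'d \<Rightarrow> real^'d) \<Rightarrow> bool" where
  "weak_grad S f g \<longleftrightarrow> (\<forall>\<phi>. test_fun S \<phi> \<longrightarrow> (\<forall>i.
      integrable (lebesgue_on S) (\<lambda>x. f x * clgrad \<phi> x $ i) \<and>
      integrable (lebesgue_on S) (\<lambda>x. g x $ i * \<phi> x) \<and>
      (\<integral>x. f x * clgrad \<phi> x $ i \<partial>lebesgue_on S) = - (\<integral>x. g x $ i * \<phi> x \<partial>lebesgue_on S)))"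

definition H1 :: "(real^'d) set \<Rightarrow> (real^'d \<Rightarrow> real) \<Rightarrow> bool" where
  "H1 S f \<longleftrightarrow> L2 S f \<and> (\<exists>g. weak_grad S f g \<and> (\<forall>i. L2 S (\<lambda>x. g x $ i)))"

definition grad :: "(real^'d) set \<Rightarrow> (real^'d \<Rightarrow> real) \<Rightarrow> real^'d \<Rightarrow> real^'d" where
  "grad S f = (SOME g. weak_grad S f g \<and> (\<forall>i. L2 S (\<lambda>x. g x $ i)))"

definition H01 :: "(real^'d) set \<Rightarrow> (real^'d \<Rightarrow> real) \<Rightarrow> bool" where
  "H01 S f \<longleftrightarrow> H1 S f \<and> (\<exists>\<phi>. (\<forall>k. test_fun S (\<phi> k)) \<and>
     ((\<lambda>k. (\<integral>x. (\<phi> k x - f x)\<^sup>2 + (norm (clgrad (\<phi> k) x - grad S f x))\<^sup>2 \<partial>lebesgue_on S))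
        \<longlonglongrightarrow> 0))"

definition energy_ip :: "(real^'d \<Rightarrow> real^'d^'d) \<Rightarrow> (real^'d) set \<Rightarrow> (real^'d \<Rightarrow> real) \<Rightarrow> (real^'d \<Rightarrow> real) \<Rightarrow> real" where
  "energy_ip A S u v = (\<integral>x. (A x *v grad S u x) \<bullet> grad S v x \<partial>lebesgue_on S)"

definition energy_norm :: "(real^'d \<Rightarrow> real^'d^'d) \<Rightarrow> (real^'d) set \<Rightarrow> (real^'d \<Rightarrow> real) \<Rightarrow> real" where
  "energy_norm A S u = sqrt (energy_ip A S u u)"

definition coeff_matrix :: "(real^'d) set \<Rightarrow> (real^'d \<Rightarrow> real^'d^'d) \<Rightarrow> real \<Rightarrow> real \<Rightarrow> bool" where
  "coeff_matrix S A \<alpha> \<beta> \<longleftrightarrow> 0 < \<alpha> \<and> \<alpha> \<le> \<beta> \<and> A \<in> borel_measurable (lebesgue_on S) \<and>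
     (\<forall>x\<in>S. transpose (A x) = A x \<and>
        (\<forall>\<xi>. \<alpha> * (norm \<xi>)\<^sup>2 \<le> \<xi> \<bullet> (A x *v \<xi>) \<and> \<xi> \<bullet> (A x *v \<xi>) \<le> \<beta> * (norm \<xi>)\<^sup>2))"

definition A_harmonic :: "(real^'d \<Rightarrow> real^'d^'d) \<Rightarrow> (real^'d) set \<Rightarrow> (real^'d \<Rightarrow> real) \<Rightarrow> bool" where
  "A_harmonic A S v \<longleftrightarrow> H1 S v \<and>
     (\<forall>\<phi>. test_fun S \<phi> \<longrightarrow> (\<integral>x. (A x *v grad S v x) \<bullet> clgrad \<phi> x \<partial>lebesgue_on S) = 0)"

definition avg :: "(real^'d) set \<Rightarrow> (real^'d \<Rightarrow> real) \<Rightarrow> real" where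
  "avg S f = (\<integral>x. f x \<partial>lebesgue_on S) / measure lebesgue S"

definition A_harmonic0 :: "(real^'d \<Rightarrow> real^'d^'d) \<Rightarrow> (real^'d) set \<Rightarrow> (real^'d \<Rightarrow> real) \<Rightarrow> bool" where
  "A_harmonic0 A S v \<longleftrightarrow> A_harmonic A S v \<and> (\<integral>x. v x \<partial>lebesgue_on S) = 0"

definition neumann_eig :: "(real^'d \<Rightarrow> real^'d^'d) \<Rightarrow> (real^'d) set \<Rightarrow> (real^'d \<Rightarrow> real) \<Rightarrow> real \<Rightarrow> bool" where
  "neumann_eig A S v lam \<longleftrightarrow> H1 S v \<and>
     (\<forall>w. H1 S w \<longrightarrow> energy_ip A S v w = lam * (\<integral>x. v x * w x \<partial>lebesgue_on S))"

definition nonconstant :: "(real^'d) set \<Rightarrow> (real^'d \<Rightarrow> real) \<Rightarrow> bool" where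
  "nonconstant S v \<longleftrightarrow> \<not> (\<exists>c. AE x in lebesgue_on S. v x = c)"

definition first_nonconst_eigs :: "(real^'d \<Rightarrow> real^'d^'d) \<Rightarrow> (real^'d) set \<Rightarrow> nat \<Rightarrow> (nat \<Rightarrow> real^'d \<Rightarrow> real) \<Rightarrow> (nat \<Rightarrow> real) \<Rightarrow> bool" where
  "first_nonconst_eigs A S n v lam \<longleftrightarrow>
     (\<forall>i<n. neumann_eig A S (v i) (lam i) \<and> nonconstant S (v i)) \<and>
     (\<forall>i<n. \<forall>j<n. (\<integral>x. v i x * v j x \<partial>lebesgue_on S) = (if i = j then 1 else 0)) \<and>
     (\<forall>i j. i \<le> j \<longrightarrow> j < n \<longrightarrow> lam i \<le> lam j) \<and>
     (\<forall>w mu. neumann_eig A S w mu \<and> nonconstant S w \<and>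
         (\<forall>i<n. (\<integral>x. w x * v i x \<partial>lebesgue_on S) = 0) \<longrightarrow> (\<forall>i<n. lam i \<le> mu))"

definition harmonic_ext :: "(real^'d \<Rightarrow> real^'d^'d) \<Rightarrow> (real^'d) set \<Rightarrow> (real^'d \<Rightarrow> real) \<Rightarrow> (real^'d \<Rightarrow> real) \<Rightarrow> bool" where
  "harmonic_ext A S v h \<longleftrightarrow> A_harmonic A S h \<and> H01 S (\<lambda>x. h x - v x)"

text \<open>\<open>F_n(\<omega>,\<omega>^*)\<close>, built from the harmonic extensions \<open>h i\<close> (only values on \<open>\<omega>\<close> matter).\<close>
definition Fn :: "(real^'d) set \<Rightarrow> nat \<Rightarrow> (nat \<Rightarrow> real^'d \<Rightarrow> real) \<Rightarrow> (real^'d \<Rightarrow> real) set" where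
  "Fn S n h = {f. \<exists>c::nat \<Rightarrow> real. f = (\<lambda>x. \<Sum>i<n. c i * (h i x - avg S (h i)))}"

definition cube :: "real^'d \<Rightarrow> real \<Rightarrow> (real^'d) set" where
  "cube c s = box (c - (s/2) *\<^sub>R One) (c + (s/2) *\<^sub>R One)"

end

(*
The error e of the energy projection of u onto W_n is A-harmonic and energy-orthogonal to every h_i. Since
h_i - v_i is a limit of test functions, e is energy-orthogonal to v_i as well, and the eigenvalue equation
turns this into L2-orthogonality of e to v_1, ..., v_n; moreover e has zero average.

The minimality of the eigenvalues gives lam_i ||e||^2 <= ||e||_E^2: otherwise, by Rellich compactness, a
minimizer of the Rayleigh quotient on the orthogonal complement would be an eigenfunction with a smaller
eigenvalue. Hence the Rayleigh quotient of e is the largest one on span {1, v_1, ..., v_n, e}. That space has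
dimension n + 2, so it contains a nonzero function whose averages over m^d <= n + 1 congruent subcubes vanish;
the Poincare inequality on the subcubes bounds ||e||_L2 by (sqrt d / 2) (side / m) alpha^(-1/2) ||e||_E.
Together with the Caccioppoli inequality with constant 1 this yields the claim: the Poincare constant sqrt d / 2
of the unit cube is not optimal, but sqrt d / 2 * sqrt pi < gamma_d^(1/d) for d = 2, 3, so that
C_n = n^(-1/d) is admissible for all large n.
*)

theory Submission
  imports Defs "HOL-Complex_Analysis.Great_Picard"
begin

section \<open>Smooth functions\<close>

text \<open>Two obstacles shape the analysis: \<open>grad\<close> is an arbitrary choice among
  almost everywhere equal fields, and test functions do not approximate an H1 function up to the
  boundary of the cube. Mollification answers both: a cut-off times an H1 function is a limit of
  test functions together with the gradients. This gives uniqueness of weak gradients, and estimates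
  on a cube are obtained as limits of estimates on smaller concentric cubes. The Poincare constant
  arises from averaging (phi x - phi y)^2 over pairs of points of the cube and moving from x to y
  one coordinate at a time. The number m of subcubes per side is the integer part of (n + 1)^(1/d).
  The strictness of the inequality between the two constants pays for this rounding. Orthogonality
  is available in the energy of the large cube, where the eigenfunctions and boundary values live,
  whereas the infimum concerns the small cube. It is attained by a second projection, and the one
  described above is a competitor for it.\<close>

lemma smooth_funD:
  assumes "smooth_fun f"
  shows "f differentiable (at x)"
    and "b \<in> Basis \<Longrightarrow> smooth_fun (\<lambda>x. frechet_derivative f (at x) b)"
  using assms by (auto elim: smooth_fun.cases)

lemma smooth_fun_has_derivative:
  "smooth_fun f \<Longrightarrow> (f has_derivative frechet_derivative f (at x)) (at x)"
  using smooth_funD(1) frechet_derivative_works by blast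

lemma smooth_fun_continuous: "smooth_fun f \<Longrightarrow> continuous_on S f"
  by (meson continuous_at_imp_continuous_on differentiable_imp_continuous_within smooth_funD(1))

lemma smooth_fun_measurable [measurable_dest]: "smooth_fun f \<Longrightarrow> f \<in> borel_measurable borel"
  by (intro borel_measurable_continuous_onI smooth_fun_continuous)

lemma smooth_fun_coinductI:
  assumes "P f"
    and "\<And>f x. P f \<Longrightarrow> f differentiable (at x)"
    and "\<And>f b. P f \<Longrightarrow> b \<in> Basis \<Longrightarrow> P (\<lambda>x. frechet_derivative f (at x) b)"
  shows "smooth_fun f"
  using assms(1)
proof (coinduction arbitrary: f rule: smooth_fun.coinduct)
  case smooth_fun
  then show ?case using assms(2,3) by blast
qed

text \<open>Products alone are not an invariant for coinduction, since the derivative of a product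
  is a sum of products. The algebra generated by the smooth functions is closed under partial
  derivatives.\<close>

inductive smooth_alg :: "('a::euclidean_space \<Rightarrow> real) \<Rightarrow> bool" where
  base: "smooth_fun f \<Longrightarrow> smooth_alg f"
| add: "smooth_alg f \<Longrightarrow> smooth_alg g \<Longrightarrow> smooth_alg (\<lambda>x. f x + g x)"
| mult: "smooth_alg f \<Longrightarrow> smooth_alg g \<Longrightarrow> smooth_alg (\<lambda>x. f x * g x)"

lemma frechet_derivative_mult_real:
  fixes f g :: "'a::euclidean_space \<Rightarrow> real"
  assumes "f differentiable (at x)" "g differentiable (at x)"
  shows "frechet_derivative (\<lambda>x. f x * g x) (at x) =
    (\<lambda>h. f x * frechet_derivative g (at x) h + frechet_derivative f (at x) h * g x)"
  using assms
  by (intro frechet_derivative_at[symmetric] has_derivative_mult)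
     (auto simp: frechet_derivative_works)

lemma frechet_derivative_add_real:
  fixes f g :: "'a::euclidean_space \<Rightarrow> real"
  assumes "f differentiable (at x)" "g differentiable (at x)"
  shows "frechet_derivative (\<lambda>x. f x + g x) (at x) =
    (\<lambda>h. frechet_derivative f (at x) h + frechet_derivative g (at x) h)"
  using assms
  by (intro frechet_derivative_at[symmetric] has_derivative_add)
     (auto simp: frechet_derivative_works)

lemma smooth_alg_step:
  assumes "smooth_alg f"
  shows "(\<forall>x. f differentiable (at x)) \<and>
         (\<forall>b\<in>Basis. smooth_alg (\<lambda>x. frechet_derivative f (at x) b))"
  using assms
proof induction
  case (base f)
  then show ?case using smooth_funD smooth_alg.base by blast
next
  case (add f g)
  then show ?case
    by (auto simp: frechet_derivative_add_real intro: smooth_alg.add differentiable_add)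
next
  case (mult f g)
  then show ?case
    by (auto simp: frechet_derivative_mult_real intro!: smooth_alg.add smooth_alg.mult differentiable_mult)
qed

lemma smooth_alg_smooth: "smooth_alg f \<Longrightarrow> smooth_fun f"
  by (rule smooth_fun_coinductI[of smooth_alg]) (use smooth_alg_step in blast)+

lemma smooth_fun_mult: "smooth_fun f \<Longrightarrow> smooth_fun g \<Longrightarrow> smooth_fun (\<lambda>x. f x * g x)"
  by (simp add: smooth_alg_smooth smooth_alg.mult smooth_alg.base)

lemma smooth_fun_const: "smooth_fun (\<lambda>x. c)"
  by (rule smooth_fun_coinductI[of "\<lambda>f. \<exists>c. f = (\<lambda>x. c)"]) auto

lemma smooth_fun_prod:
  "finite I \<Longrightarrow> (\<And>i. i \<in> I \<Longrightarrow> smooth_fun (f i)) \<Longrightarrow> smooth_fun (\<lambda>x. \<Prod>i\<in>I. f i x)"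
  by (induction I rule: finite_induct) (auto intro: smooth_fun_const smooth_fun_mult)

lemma frechet_derivative_affine:
  fixes f :: "'a::euclidean_space \<Rightarrow> real"
  assumes "\<And>x. f differentiable (at x)"
  shows "((\<lambda>x. s * f (a + r *\<^sub>R x)) has_derivative
    (\<lambda>h. s * r * frechet_derivative f (at (a + r *\<^sub>R x)) h)) (at x)"
proof -
  have f: "(f has_derivative frechet_derivative f (at (a + r *\<^sub>R x))) (at (a + r *\<^sub>R x))"
    using assms frechet_derivative_works by blast
  have "((\<lambda>x. a + r *\<^sub>R x) has_derivative (\<lambda>h. r *\<^sub>R h)) (at x)"
    by (auto intro!: derivative_eq_intros)
  from has_derivative_compose[OF this f]
  have "((\<lambda>x. f (a + r *\<^sub>R x)) has_derivative
      (\<lambda>h. frechet_derivative f (at (a + r *\<^sub>R x)) (r *\<^sub>R h))) (at x)" .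
  moreover have "frechet_derivative f (at (a + r *\<^sub>R x)) (r *\<^sub>R h)
      = r * frechet_derivative f (at (a + r *\<^sub>R x)) h" for h
    using f linear_cmul[OF has_derivative_linear[OF f]] by simp
  ultimately show ?thesis
    by (auto intro!: derivative_eq_intros simp: mult_ac)
qed

text \<open>Each derivative of \<open>f (a + r *\<^sub>R x)\<close> produces a factor
  \<open>r\<close>; carrying an arbitrary scalar \<open>s\<close> closes the family under
  differentiation.\<close>

lemma smooth_fun_affine:
  fixes f :: "'a::euclidean_space \<Rightarrow> real"
  assumes "smooth_fun f"
  shows "smooth_fun (\<lambda>x. s * f (a + r *\<^sub>R x))"
proof (rule smooth_fun_coinductI[of "\<lambda>F. \<exists>s f. smooth_fun f \<and> F = (\<lambda>x. s * f (a + r *\<^sub>R x))"])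
  show "\<exists>s' f'. smooth_fun f' \<and> (\<lambda>x. s * f (a + r *\<^sub>R x)) = (\<lambda>x. s' * f' (a + r *\<^sub>R x))"
    using assms by blast
next
  fix F and x :: 'a
  assume "\<exists>s f. smooth_fun f \<and> F = (\<lambda>x. s * f (a + r *\<^sub>R x))"
  then show "F differentiable (at x)"
    using frechet_derivative_affine smooth_funD(1) unfolding differentiable_def by blast
next
  fix F and b :: 'a
  assume "\<exists>s f. smooth_fun f \<and> F = (\<lambda>x. s * f (a + r *\<^sub>R x))" and b: "b \<in> Basis"
  then obtain s f where f: "smooth_fun f" and F: "F = (\<lambda>x. s * f (a + r *\<^sub>R x))" by blast
  have "frechet_derivative F (at x) b = s * r * frechet_derivative f (at (a + r *\<^sub>R x)) b" for x
    unfolding F using frechet_derivative_at[OF frechet_derivative_affine[OF smooth_funD(1)[OF f]]]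
    by metis
  then show "\<exists>s f'. smooth_fun f' \<and> (\<lambda>x. frechet_derivative F (at x) b) = (\<lambda>x. s * f' (a + r *\<^sub>R x))"
    using smooth_funD(2)[OF f b] by (intro exI[of _ "s * r"] exI[of _ "\<lambda>x. frechet_derivative f (at x) b"]) auto
qed

text \<open>Differentiation along \<open>c\<close> produces the factor \<open>c \<bullet> b\<close>,
  absorbed by the scalar \<open>s\<close> of the invariant. This lifts functions of one real
  variable to the coordinates of a space.\<close>

lemma smooth_fun_inner:
  fixes g :: "real \<Rightarrow> real" and b :: "'a::euclidean_space"
  assumes "smooth_fun g"
  shows "smooth_fun (\<lambda>x. g (x \<bullet> b))"
proof -
  have D: "((\<lambda>x. s * g (x \<bullet> b)) has_derivative (\<lambda>h. s * (h \<bullet> b) * frechet_derivative g (at (x \<bullet> b)) 1)) (at x)"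
    if "smooth_fun g" for x :: 'a and g s
  proof -
    have g: "(g has_derivative frechet_derivative g (at (x \<bullet> b))) (at (x \<bullet> b))"
      using that by (rule smooth_fun_has_derivative)
    have "((\<lambda>x. x \<bullet> b) has_derivative (\<lambda>h. h \<bullet> b)) (at x)"
      by (auto intro!: derivative_eq_intros)
    from has_derivative_compose[OF this g]
    have "((\<lambda>x. g (x \<bullet> b)) has_derivative (\<lambda>h. frechet_derivative g (at (x \<bullet> b)) (h \<bullet> b))) (at x)" .
    moreover have "frechet_derivative g (at (x \<bullet> b)) (h \<bullet> b) = (h \<bullet> b) * frechet_derivative g (at (x \<bullet> b)) 1" for h
      using linear_cmul[OF has_derivative_linear[OF g], of "h \<bullet> b" 1] by simp
    ultimately show ?thesis
      by (auto intro!: derivative_eq_intros simp: mult_ac)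
  qed
  have "smooth_fun (\<lambda>x. 1 * g (x \<bullet> b))"
  proof (rule smooth_fun_coinductI[of "\<lambda>F. \<exists>s g. smooth_fun g \<and> F = (\<lambda>x. s * g (x \<bullet> b))"])
    fix F and x :: 'a
    assume "\<exists>s g. smooth_fun g \<and> F = (\<lambda>x. s * g (x \<bullet> b))"
    then show "F differentiable (at x)"
      using D unfolding differentiable_def by blast
  next
    fix F and c :: 'a
    assume "\<exists>s g. smooth_fun g \<and> F = (\<lambda>x. s * g (x \<bullet> b))" and c: "c \<in> Basis"
    then obtain s g where f: "smooth_fun g" and F: "F = (\<lambda>x. s * g (x \<bullet> b))" by blast
    have "frechet_derivative F (at x) c = s * (c \<bullet> b) * frechet_derivative g (at (x \<bullet> b)) 1" for x
      unfolding F using frechet_derivative_at[OF D[OF f]] by metis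
    then show "\<exists>s g. smooth_fun g \<and> (\<lambda>x. frechet_derivative F (at x) c) = (\<lambda>x. s * g (x \<bullet> b))"
      using smooth_funD(2)[OF f, of 1]
      by (intro exI[of _ "s * (c \<bullet> b)"] exI[of _ "\<lambda>x. frechet_derivative g (at x) 1"]) auto
  qed (use assms in blast)
  then show ?thesis by simp
qed

section \<open>A smooth bump function\<close>

text \<open>The functions p(1/t) exp(-1/t), continued by 0, for all polynomials p at once:
  differentiation only changes the polynomial, so coinduction closes on this family.\<close>

definition exp_flat :: "real poly \<Rightarrow> real \<Rightarrow> real" where
  "exp_flat p t = (if t > 0 then poly p (1/t) * exp (- 1/t) else 0)"

lemma poly_exp_neg_tendsto_0: "((\<lambda>s::real. poly p s * exp (- s)) \<longlongrightarrow> 0) at_top"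
proof (induction p)
  case 0
  then show ?case by simp
next
  case (pCons a p)
  have "((\<lambda>s::real. s ^ k / exp s) \<longlongrightarrow> 0) at_top" for k
    by (rule tendsto_power_div_exp_0)
  then have e: "((\<lambda>s::real. s ^ k * exp (- s)) \<longlongrightarrow> 0) at_top" for k
    by (simp add: exp_minus divide_inverse)
  have m: "((\<lambda>s::real. monom_c * (s ^ k * exp (- s))) \<longlongrightarrow> 0) at_top" for k monom_c
    using tendsto_mult_right_zero[OF e] by blast
  have "((\<lambda>s::real. (\<Sum>k\<le>degree (pCons a p). coeff (pCons a p) k * (s ^ k * exp (- s)))) \<longlongrightarrow> 0) at_top"
    using tendsto_sum[of "{..degree (pCons a p)}" "\<lambda>k s. coeff (pCons a p) k * (s ^ k * exp (- s))" "\<lambda>_. 0" at_top] m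
    by simp
  then show ?case
    by (simp add: poly_altdef sum_distrib_right mult.assoc del: degree_pCons_eq_if)
qed

text \<open>For t > 0 the chain rule gives the polynomial X^2 (p - p'), read at 1/t. At t = 0 the
  exponential decay beats every polynomial in 1/t.\<close>

lemma exp_flat_deriv:
  "(exp_flat p has_real_derivative exp_flat ([:0,0,1:] * (p - pderiv p)) t) (at t)"
proof -
  consider "t > 0" | "t < 0" | "t = 0" by linarith
  then show ?thesis
  proof cases
    case 1
    have "((\<lambda>t. poly p (1/t) * exp (- 1/t)) has_real_derivative
        exp_flat ([:0,0,1:] * (p - pderiv p)) t) (at t)"
      using 1 by (auto intro!: derivative_eq_intros DERIV_chain2[OF poly_DERIV]
          simp: exp_flat_def field_simps power2_eq_square)
    then show ?thesis
      by (rule has_field_derivative_transform_within_open[where S="{0<..}"])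
         (use 1 in \<open>auto simp: exp_flat_def\<close>)
  next
    case 2
    have "((\<lambda>t. 0) has_real_derivative exp_flat ([:0,0,1:] * (p - pderiv p)) t) (at t)"
      using 2 by (auto simp: exp_flat_def)
    then show ?thesis
      by (rule has_field_derivative_transform_within_open[where S="{..<0}"])
         (use 2 in \<open>auto simp: exp_flat_def\<close>)
  next
    case 3
    \<comment> \<open>With s = 1/h the right difference quotient at 0 is s p(s) exp(-s); the factor
      \<open>[:0,1:]\<close> is this s.\<close>
    have "((\<lambda>s::real. poly ([:0,1:] * p) s * exp (- s)) \<longlongrightarrow> 0) at_top"
      by (rule poly_exp_neg_tendsto_0)
    then have "((\<lambda>h::real. poly ([:0,1:] * p) (inverse h) * exp (- inverse h)) \<longlongrightarrow> 0) (at_right 0)"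
      by (rule filterlim_compose[OF _ filterlim_inverse_at_top_right])
    then have R: "((\<lambda>h. (exp_flat p h - 0) / h) \<longlongrightarrow> 0) (at_right 0)"
      by (rule Lim_transform_eventually)
         (auto simp: eventually_at_filter exp_flat_def field_simps)
    have L: "((\<lambda>h. (exp_flat p h - 0) / h) \<longlongrightarrow> 0) (at_left 0)"
      by (rule Lim_transform_eventually[OF tendsto_const])
         (auto simp: eventually_at_filter exp_flat_def)
    from R L have "((\<lambda>h. (exp_flat p h - 0) / h) \<longlongrightarrow> 0) (at 0)"
      by (simp add: filterlim_split_at)
    then show ?thesis
      unfolding 3 by (simp add: DERIV_def exp_flat_def)
  qed
qed

lemma smooth_exp_flat: "smooth_fun (exp_flat p)"
proof (rule smooth_fun_coinductI[of "\<lambda>f. \<exists>p. f = exp_flat p"])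
  fix f and x :: real assume "\<exists>p. f = exp_flat p"
  then show "f differentiable (at x)"
    using exp_flat_deriv real_differentiable_def by blast
next
  fix f and b :: real assume "\<exists>p. f = exp_flat p" and b: "b \<in> Basis"
  then obtain p where f: "f = exp_flat p" by blast
  have "frechet_derivative f (at x) b = exp_flat ([:0,0,1:] * (p - pderiv p)) x" for x
    using b frechet_derivative_at[OF exp_flat_deriv[of p x, unfolded has_field_derivative_def]]
    unfolding f by (metis Basis_real_def mult.right_neutral singletonD)
  then show "\<exists>p. (\<lambda>x. frechet_derivative f (at x) b) = exp_flat p" by blast
qed blast

text \<open>A product over coordinates, so that smoothness reduces to one real variable; it lives on
  a cube rather than on a ball.\<close>

definition bump :: "'a::euclidean_space \<Rightarrow> real" where
  "bump x = (\<Prod>b\<in>Basis. exp_flat 1 (1 - x \<bullet> b) * exp_flat 1 (1 + x \<bullet> b))"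

lemma smooth_bump: "smooth_fun bump"
proof -
  have "smooth_fun (\<lambda>t. 1 * exp_flat 1 (1 + 1 *\<^sub>R t))" "smooth_fun (\<lambda>t. 1 * exp_flat 1 (1 + (-1) *\<^sub>R t))"
    by (rule smooth_fun_affine[OF smooth_exp_flat])+
  then have "smooth_fun (\<lambda>t. exp_flat 1 (1 + t))" "smooth_fun (\<lambda>t. exp_flat 1 (1 - t))"
    by auto
  from this[THEN smooth_fun_inner] show ?thesis
    unfolding bump_def by (intro smooth_fun_prod smooth_fun_mult) auto
qed

lemma bump_nonneg: "bump x \<ge> 0"
  unfolding bump_def exp_flat_def by (auto intro!: prod_nonneg)

lemma bump_support: "bump x \<noteq> 0 \<Longrightarrow> x \<in> box (- One) One"
  unfolding bump_def exp_flat_def box_def by (auto simp: inner_minus_left split: if_splits)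

lemma bump_pos: "bump 0 > 0"
  unfolding bump_def exp_flat_def by (auto intro!: prod_pos)

section \<open>Convolution with a smooth kernel\<close>

text \<open>Lets one compact set K serve for a function and all its derivatives.\<close>

lemma frechet_derivative_zero_outside:
  fixes f :: "'a::euclidean_space \<Rightarrow> real"
  assumes "closed K" "\<And>y. y \<notin> K \<Longrightarrow> f y = 0" "x \<notin> K"
  shows "frechet_derivative f (at x) = (\<lambda>h. 0)"
proof -
  have "((\<lambda>x. 0) has_derivative (\<lambda>h. 0)) (at x)" by simp
  then have "(f has_derivative (\<lambda>h. 0)) (at x)"
    by (rule has_derivative_transform_within_open[where s="- K"]) (use assms in auto)
  then show ?thesis by (rule frechet_derivative_at[symmetric])
qed

lemma frechet_derivative_expand:
  fixes f :: "'a::euclidean_space \<Rightarrow> real"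
  assumes "f differentiable (at x)"
  shows "frechet_derivative f (at x) h = (\<Sum>b\<in>Basis. (h \<bullet> b) * frechet_derivative f (at x) b)"
proof -
  have l: "linear (frechet_derivative f (at x))"
    using assms frechet_derivative_works has_derivative_linear by blast
  have "frechet_derivative f (at x) h = frechet_derivative f (at x) (\<Sum>b\<in>Basis. (h \<bullet> b) *\<^sub>R b)"
    by (simp add: euclidean_representation)
  also have "\<dots> = (\<Sum>b\<in>Basis. (h \<bullet> b) * frechet_derivative f (at x) b)"
    by (simp add: linear_sum[OF l] linear_cmul[OF l])
  finally show ?thesis .
qed

lemma smooth_compact_bounded:
  assumes "smooth_fun f" "compact K" "\<And>y. y \<notin> K \<Longrightarrow> f y = 0"
  obtains M where "M \<ge> 0" "\<And>x. \<bar>f x\<bar> \<le> M"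
proof -
  have "compact (f ` K)"
    using assms by (intro compact_continuous_image smooth_fun_continuous)
  then obtain M where M: "\<And>y. y \<in> f ` K \<Longrightarrow> norm y \<le> M"
    using compact_imp_bounded bounded_iff by metis
  show thesis
  proof (rule that[of "max 0 M"])
    show "\<bar>f x\<bar> \<le> max 0 M" for x
      using M[of "f x"] assms(3)[of x] by (cases "x \<in> K") auto
  qed simp
qed

lemma smooth_compact_lipschitz:
  fixes f :: "'a::euclidean_space \<Rightarrow> real"
  assumes "smooth_fun f" "compact K" "\<And>y. y \<notin> K \<Longrightarrow> f y = 0"
  obtains L where "L \<ge> 0" "\<And>x y. \<bar>f x - f y\<bar> \<le> L * norm (x - y)"
proof -
  have "\<forall>b\<in>Basis. \<exists>M\<ge>0. \<forall>x. \<bar>frechet_derivative f (at x) b\<bar> \<le> M"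
  proof
    fix b :: 'a assume b: "b \<in> Basis"
    show "\<exists>M\<ge>0. \<forall>x. \<bar>frechet_derivative f (at x) b\<bar> \<le> M"
      by (rule smooth_compact_bounded[OF smooth_funD(2)[OF assms(1) b] assms(2)])
         (use frechet_derivative_zero_outside[OF compact_imp_closed[OF assms(2)] assms(3)] in auto)
  qed
  then obtain M where M: "\<And>b. b \<in> Basis \<Longrightarrow> M b \<ge> 0" "\<And>b x. b \<in> Basis \<Longrightarrow> \<bar>frechet_derivative f (at x) b\<bar> \<le> M b"
    by metis
  have on: "onorm (frechet_derivative f (at x)) \<le> (\<Sum>b\<in>Basis. M b)" for x
  proof (rule onorm_bound)
    show "0 \<le> (\<Sum>b\<in>Basis. M b)" using M by (auto intro: sum_nonneg)
    fix h :: 'a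
    have "\<bar>frechet_derivative f (at x) h\<bar> \<le> (\<Sum>b\<in>Basis. \<bar>(h \<bullet> b) * frechet_derivative f (at x) b\<bar>)"
      unfolding frechet_derivative_expand[OF smooth_funD(1)[OF assms(1)], of _ h] by (rule sum_abs)
    also have "\<dots> \<le> (\<Sum>b\<in>Basis. norm h * M b)"
      unfolding abs_mult using M Basis_le_norm
      by (intro sum_mono mult_mono) auto
    finally show "norm (frechet_derivative f (at x) h) \<le> (\<Sum>b\<in>Basis. M b) * norm h"
      by (simp add: sum_distrib_left mult.commute)
  qed
  show thesis
  proof (rule that)
    show "0 \<le> (\<Sum>b\<in>Basis. M b)" using M by (auto intro: sum_nonneg)
    fix x y
    have "norm (f x - f y) \<le> (\<Sum>b\<in>Basis. M b) * norm (x - y)"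
      by (rule differentiable_bound[where S=UNIV and f'="\<lambda>x. frechet_derivative f (at x)"])
         (use on smooth_fun_has_derivative[OF assms(1)] in auto)
    then show "\<bar>f x - f y\<bar> \<le> (\<Sum>b\<in>Basis. M b) * norm (x - y)" by simp
  qed
qed

text \<open>The partial derivatives are Lipschitz, so the linearization error is quadratic with a
  constant that is uniform in x. Uniformity permits differentiation under the integral sign by a
  direct estimate.\<close>

lemma smooth_compact_remainder:
  fixes f :: "'a::euclidean_space \<Rightarrow> real"
  assumes "smooth_fun f" "compact K" "\<And>y. y \<notin> K \<Longrightarrow> f y = 0"
  obtains C where "C \<ge> 0"
    "\<And>x h. \<bar>f (x + h) - f x - frechet_derivative f (at x) h\<bar> \<le> C * (norm h)\<^sup>2"
proof -
  have "\<forall>b\<in>Basis. \<exists>L\<ge>0. \<forall>x y. \<bar>frechet_derivative f (at x) b - frechet_derivative f (at y) b\<bar> \<le> L * norm (x - y)"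
  proof
    fix b :: 'a assume b: "b \<in> Basis"
    show "\<exists>L\<ge>0. \<forall>x y. \<bar>frechet_derivative f (at x) b - frechet_derivative f (at y) b\<bar> \<le> L * norm (x - y)"
      by (rule smooth_compact_lipschitz[OF smooth_funD(2)[OF assms(1) b] assms(2)])
         (use frechet_derivative_zero_outside[OF compact_imp_closed[OF assms(2)] assms(3)] in auto)
  qed
  then obtain L where L: "\<And>b. b \<in> Basis \<Longrightarrow> L b \<ge> 0"
     "\<And>b x y. b \<in> Basis \<Longrightarrow> \<bar>frechet_derivative f (at x) b - frechet_derivative f (at y) b\<bar> \<le> L b * norm (x - y)"
    by metis
  define C where "C = (\<Sum>b\<in>Basis. L b)"
  have C0: "C \<ge> 0" unfolding C_def using L by (auto intro: sum_nonneg)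
  have lip: "\<bar>frechet_derivative f (at y) h - frechet_derivative f (at x) h\<bar> \<le> C * norm (y - x) * norm h" for x y h
  proof -
    have "frechet_derivative f (at y) h - frechet_derivative f (at x) h
       = (\<Sum>b\<in>Basis. (h \<bullet> b) * (frechet_derivative f (at y) b - frechet_derivative f (at x) b))"
      by (simp add: frechet_derivative_expand[OF smooth_funD(1)[OF assms(1)], of _ h]
          right_diff_distrib sum_subtractf)
    also have "\<bar>\<dots>\<bar> \<le> (\<Sum>b\<in>Basis. \<bar>(h \<bullet> b) * (frechet_derivative f (at y) b - frechet_derivative f (at x) b)\<bar>)"
      by (rule sum_abs)
    also have "\<dots> \<le> (\<Sum>b\<in>Basis. norm h * (L b * norm (y - x)))"
      unfolding abs_mult using L Basis_le_norm by (intro sum_mono mult_mono) auto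
    finally show ?thesis
      by (simp add: C_def sum_distrib_left sum_distrib_right mult_ac)
  qed
  show thesis
  proof (rule that[OF C0])
    fix x h :: 'a
    let ?g = "\<lambda>y. f y - frechet_derivative f (at x) y"
    have dx: "bounded_linear (frechet_derivative f (at x))"
      using smooth_fun_has_derivative[OF assms(1)] has_derivative_bounded_linear by blast
    \<comment> \<open>Mean value inequality for f minus its linear part at x, whose derivative at y
      has norm at most C |y - x|.\<close>
    have "norm (?g (x + h) - ?g x) \<le> (C * norm h) * norm (x + h - x)"
    proof (rule differentiable_bound[where S="cball x (norm h)"])
      show "(?g has_derivative (\<lambda>k. frechet_derivative f (at y) k - frechet_derivative f (at x) k)) (at y within cball x (norm h))" for y
        by (intro has_derivative_diff has_derivative_at_withinI[OF smooth_fun_has_derivative[OF assms(1)]]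
            bounded_linear_imp_has_derivative dx)
      fix y assume y: "y \<in> cball x (norm h)"
      show "onorm (\<lambda>k. frechet_derivative f (at y) k - frechet_derivative f (at x) k) \<le> C * norm h"
      proof (rule onorm_bound)
        show "0 \<le> C * norm h" using C0 by simp
        fix k :: 'a
        have "norm (y - x) \<le> norm h" using y by (simp add: dist_norm norm_minus_commute)
        then have "C * norm (y - x) * norm k \<le> C * norm h * norm k"
          using C0 by (intro mult_right_mono mult_left_mono) auto
        then show "norm (frechet_derivative f (at y) k - frechet_derivative f (at x) k) \<le> C * norm h * norm k"
          using lip[of y k x] by simp
      qed
    qed (auto simp: dist_norm)
    moreover have "frechet_derivative f (at x) (x + h) = frechet_derivative f (at x) x + frechet_derivative f (at x) h"
      using dx by (simp add: bounded_linear.linear linear_add)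
    ultimately show "\<bar>f (x + h) - f x - frechet_derivative f (at x) h\<bar> \<le> C * (norm h)\<^sup>2"
      by (simp add: power2_eq_square mult_ac algebra_simps)
  qed
qed

definition conv :: "('a::euclidean_space \<Rightarrow> real) \<Rightarrow> ('a \<Rightarrow> real) \<Rightarrow> 'a \<Rightarrow> real" where
  "conv F \<psi> x = (\<integral>y. F y * \<psi> (x - y) \<partial>lborel)"

lemma integrable_mult_bounded:
  fixes F g :: "'a \<Rightarrow> real"
  assumes "integrable M F" "g \<in> borel_measurable M" "\<And>x. \<bar>g x\<bar> \<le> B"
  shows "integrable M (\<lambda>x. F x * g x)"
proof (rule Bochner_Integration.integrable_bound)
  show "integrable M (\<lambda>x. B * F x)" using assms by simp
  show "AE x in M. norm (F x * g x) \<le> norm (B * F x)"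
  proof (intro AE_I2)
    fix x
    have "\<bar>F x\<bar> * \<bar>g x\<bar> \<le> \<bar>F x\<bar> * \<bar>B\<bar>"
      using assms(3)[of x] by (intro mult_left_mono) auto
    then show "norm (F x * g x) \<le> norm (B * F x)" by (simp add: abs_mult mult.commute)
  qed
qed (use assms in measurable)

lemma conv_integrable:
  assumes "integrable lborel F" "smooth_fun \<psi>" "compact K" "\<And>y. y \<notin> K \<Longrightarrow> \<psi> y = 0"
  shows "integrable lborel (\<lambda>y. F y * \<psi> (x - y))"
proof -
  obtain M where M: "\<And>x. \<bar>\<psi> x\<bar> \<le> M"
    using smooth_compact_bounded[OF assms(2,3,4)] by metis
  have [measurable]: "\<psi> \<in> borel_measurable borel" using assms(2) by (rule smooth_fun_measurable)
  show ?thesis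
    by (rule integrable_mult_bounded[OF assms(1) _ M]) measurable
qed

text \<open>The linearization error of the kernel is at most C |h|^2 everywhere; integrated against
  |F| it is still quadratic in |h|.\<close>

lemma conv_has_derivative:
  fixes F :: "'a::euclidean_space \<Rightarrow> real"
  assumes F: "integrable lborel F" and psi: "smooth_fun \<psi>" "compact K" "\<And>y. y \<notin> K \<Longrightarrow> \<psi> y = 0"
  shows "(conv F \<psi> has_derivative
    (\<lambda>h. \<Sum>b\<in>Basis. (h \<bullet> b) * conv F (\<lambda>y. frechet_derivative \<psi> (at y) b) x)) (at x)"
proof -
  let ?D = "\<lambda>y b. frechet_derivative \<psi> (at y) b"
  have D0: "\<And>y. y \<notin> K \<Longrightarrow> ?D y b = 0" for b
    using frechet_derivative_zero_outside[OF compact_imp_closed[OF psi(2)] psi(3)] by simp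
  obtain C where C: "C \<ge> 0" "\<And>x h. \<bar>\<psi> (x + h) - \<psi> x - frechet_derivative \<psi> (at x) h\<bar> \<le> C * (norm h)\<^sup>2"
    using smooth_compact_remainder[OF psi] by metis
  have I: "integrable lborel (\<lambda>y. F y * \<psi> (x - y))" for x
    by (rule conv_integrable[OF F psi])
  have ID: "b \<in> Basis \<Longrightarrow> integrable lborel (\<lambda>y. F y * ?D (x - y) b)" for x b
    by (rule conv_integrable[OF F smooth_funD(2)[OF psi(1)] psi(2) D0])
  define B where "B = C * (\<integral>y. \<bar>F y\<bar> \<partial>lborel)"
  have est: "\<bar>conv F \<psi> (x + h) - conv F \<psi> x - (\<Sum>b\<in>Basis. (h \<bullet> b) * conv F (\<lambda>y. ?D y b) x)\<bar> \<le> B * (norm h)\<^sup>2" for h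
  proof -
    have "(\<Sum>b\<in>Basis. (h \<bullet> b) * conv F (\<lambda>y. ?D y b) x) = (\<integral>y. (\<Sum>b\<in>Basis. (h \<bullet> b) * (F y * ?D (x - y) b)) \<partial>lborel)"
      unfolding conv_def using ID by (subst Bochner_Integration.integral_sum) auto
    also have "\<dots> = (\<integral>y. F y * frechet_derivative \<psi> (at (x - y)) h \<partial>lborel)"
      by (simp add: frechet_derivative_expand[OF smooth_funD(1)[OF psi(1)], of _ h] sum_distrib_left mult_ac)
    finally have e1: "(\<Sum>b\<in>Basis. (h \<bullet> b) * conv F (\<lambda>y. ?D y b) x) = (\<integral>y. F y * frechet_derivative \<psi> (at (x - y)) h \<partial>lborel)" .
    have "integrable lborel (\<lambda>y. (\<Sum>b\<in>Basis. (h \<bullet> b) * (F y * ?D (x - y) b)))"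
      using ID by (intro Bochner_Integration.integrable_sum integrable_mult_right) auto
    then have i1: "integrable lborel (\<lambda>y. F y * frechet_derivative \<psi> (at (x - y)) h)"
      by (simp add: frechet_derivative_expand[OF smooth_funD(1)[OF psi(1)], of _ h] sum_distrib_left mult_ac)
    have "conv F \<psi> (x + h) - conv F \<psi> x - (\<Sum>b\<in>Basis. (h \<bullet> b) * conv F (\<lambda>y. ?D y b) x)
       = (\<integral>y. F y * \<psi> (x + h - y) - F y * \<psi> (x - y) - F y * frechet_derivative \<psi> (at (x - y)) h \<partial>lborel)"
      unfolding e1 unfolding conv_def using I i1
      by (subst Bochner_Integration.integral_diff; (subst Bochner_Integration.integral_diff)?) auto
    also have "\<bar>\<dots>\<bar> \<le> (\<integral>y. C * (norm h)\<^sup>2 * \<bar>F y\<bar> \<partial>lborel)"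
      unfolding real_norm_def[symmetric]
    proof (rule order_trans[OF integral_norm_bound], rule integral_mono)
      show "norm (F y * \<psi> (x + h - y) - F y * \<psi> (x - y) - F y * frechet_derivative \<psi> (at (x - y)) h)
         \<le> C * (norm h)\<^sup>2 * norm (F y)" for y
      proof -
        have "F y * \<psi> (x + h - y) - F y * \<psi> (x - y) - F y * frechet_derivative \<psi> (at (x - y)) h
          = F y * (\<psi> (x - y + h) - \<psi> (x - y) - frechet_derivative \<psi> (at (x - y)) h)"
          by (simp add: algebra_simps)
        moreover have "\<bar>F y\<bar> * \<bar>\<psi> (x - y + h) - \<psi> (x - y) - frechet_derivative \<psi> (at (x - y)) h\<bar>
            \<le> \<bar>F y\<bar> * (C * (norm h)\<^sup>2)"
          by (intro mult_left_mono C) auto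
        ultimately show ?thesis by (simp add: abs_mult mult_ac)
      qed
    qed (use I i1 F in auto)
    also have "\<dots> = B * (norm h)\<^sup>2" by (simp add: B_def)
    finally show ?thesis .
  qed
  have B0: "B \<ge> 0" unfolding B_def using C by simp
  show ?thesis
    unfolding has_derivative_at
  proof
    show "bounded_linear (\<lambda>h. \<Sum>b\<in>Basis. (h \<bullet> b) * conv F (\<lambda>y. ?D y b) x)"
      by (intro bounded_linear_sum bounded_linear_mult_const bounded_linear_inner_left)
    show "(\<lambda>h. norm (conv F \<psi> (x + h) - conv F \<psi> x - (\<Sum>b\<in>Basis. (h \<bullet> b) * conv F (\<lambda>y. ?D y b) x)) / norm h) \<midarrow>0\<rightarrow> 0"
    proof (rule tendsto_sandwich[where f="\<lambda>_. 0" and h="\<lambda>h. B * norm h"])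
      have "norm (conv F \<psi> (x + h) - conv F \<psi> x - (\<Sum>b\<in>Basis. (h \<bullet> b) * conv F (\<lambda>y. ?D y b) x)) / norm h \<le> B * norm h"
        if "h \<noteq> 0" for h
        using est[of h] that by (simp add: field_simps power2_eq_square)
      then show "\<forall>\<^sub>F h in at 0. norm (conv F \<psi> (x + h) - conv F \<psi> x - (\<Sum>b\<in>Basis. (h \<bullet> b) * conv F (\<lambda>y. ?D y b) x)) / norm h \<le> B * norm h"
        by (auto simp: eventually_at_filter)
      show "(\<lambda>h. B * norm h) \<midarrow>0\<rightarrow> 0"
        by (rule tendsto_eq_intros refl | simp)+
    qed auto
  qed
qed

lemma conv_frechet_derivative:
  fixes F :: "'a::euclidean_space \<Rightarrow> real"
  assumes "integrable lborel F" "smooth_fun \<psi>" "compact K" "\<And>y. y \<notin> K \<Longrightarrow> \<psi> y = 0" "b \<in> Basis"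
  shows "frechet_derivative (conv F \<psi>) (at x) b = conv F (\<lambda>y. frechet_derivative \<psi> (at y) b) x"
proof -
  have "frechet_derivative (conv F \<psi>) (at x) b
      = (\<Sum>c\<in>Basis. (b \<bullet> c) * conv F (\<lambda>y. frechet_derivative \<psi> (at y) c) x)"
    by (subst frechet_derivative_at[OF conv_has_derivative[OF assms(1-4)], symmetric]) auto
  also have "\<dots> = (\<Sum>c\<in>Basis. if b = c then conv F (\<lambda>y. frechet_derivative \<psi> (at y) c) x else 0)"
    using assms(5) by (intro sum.cong) (auto simp: inner_Basis)
  finally show ?thesis using assms(5) by simp
qed

text \<open>The invariant fixes F and K and lets the kernel vary: partial derivatives fall on the
  kernel, and the new kernel again vanishes off K.\<close>

lemma smooth_conv:
  fixes F :: "'a::euclidean_space \<Rightarrow> real"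
  assumes F: "integrable lborel F" and "smooth_fun \<psi>" "compact K" "\<And>y. y \<notin> K \<Longrightarrow> \<psi> y = 0"
  shows "smooth_fun (conv F \<psi>)"
proof (rule smooth_fun_coinductI[of "\<lambda>f. \<exists>\<psi>. smooth_fun \<psi> \<and> (\<forall>y. y \<notin> K \<longrightarrow> \<psi> y = 0) \<and> f = conv F \<psi>"])
  fix f and x :: 'a
  assume "\<exists>\<psi>. smooth_fun \<psi> \<and> (\<forall>y. y \<notin> K \<longrightarrow> \<psi> y = 0) \<and> f = conv F \<psi>"
  then obtain \<psi> where p: "smooth_fun \<psi>" "\<And>y. y \<notin> K \<Longrightarrow> \<psi> y = 0" and f: "f = conv F \<psi>" by blast
  show "f differentiable (at x)"
    unfolding differentiable_def f using conv_has_derivative[OF F p(1) assms(3) p(2)] by blast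
next
  fix f and b :: 'a
  assume "\<exists>\<psi>. smooth_fun \<psi> \<and> (\<forall>y. y \<notin> K \<longrightarrow> \<psi> y = 0) \<and> f = conv F \<psi>" and b: "b \<in> Basis"
  then obtain \<psi> where p: "smooth_fun \<psi>" "\<And>y. y \<notin> K \<Longrightarrow> \<psi> y = 0" and f: "f = conv F \<psi>" by blast
  have "(\<lambda>x. frechet_derivative f (at x) b) = conv F (\<lambda>y. frechet_derivative \<psi> (at y) b)"
    unfolding f using conv_frechet_derivative[OF F p(1) assms(3) p(2) b] by blast
  moreover have "y \<notin> K \<Longrightarrow> frechet_derivative \<psi> (at y) b = 0" for y
    using frechet_derivative_zero_outside[OF compact_imp_closed[OF assms(3)] p(2)] by simp
  ultimately show "\<exists>\<psi>. smooth_fun \<psi> \<and> (\<forall>y. y \<notin> K \<longrightarrow> \<psi> y = 0) \<and> (\<lambda>x. frechet_derivative f (at x) b) = conv F \<psi>"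
    using smooth_funD(2)[OF p(1) b] by blast
qed (use assms in blast)

section \<open>Mollifiers\<close>

definition mollifier :: "real \<Rightarrow> ('a::euclidean_space \<Rightarrow> real) \<Rightarrow> bool" where
  "mollifier r \<psi> \<longleftrightarrow> smooth_fun \<psi> \<and> (\<forall>x. \<psi> x \<ge> 0) \<and> (\<forall>x. \<psi> x \<noteq> 0 \<longrightarrow> norm x \<le> r) \<and>
     integrable lborel \<psi> \<and> (\<integral>x. \<psi> x \<partial>lborel) = 1"

lemma smooth_compact_integrable:
  fixes f :: "'a::euclidean_space \<Rightarrow> real"
  assumes "smooth_fun f" "compact K" "\<And>y. y \<notin> K \<Longrightarrow> f y = 0"
  shows "integrable lborel f"
proof -
  have "integrable lborel (\<lambda>x. indicator K x *\<^sub>R f x)"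
    by (rule borel_integrable_compact[OF assms(2) smooth_fun_continuous[OF assms(1)]])
  moreover have "(\<lambda>x. indicator K x *\<^sub>R f x) = f"
    using assms(3) by (force simp: indicator_def fun_eq_iff)
  ultimately show ?thesis by simp
qed

lemma mollifier_exists:
  assumes "r > 0"
  shows "\<exists>\<psi> :: 'a::euclidean_space \<Rightarrow> real. mollifier r \<psi>"
proof -
  \<comment> \<open>The rescaled bump lives in the cube of half side 1/t, whose points have l1 norm
    at most DIM('a)/t = r.\<close>
  define t where "t = real DIM('a) / r"
  have t: "t > 0" using assms by (simp add: t_def)
  define f :: "'a \<Rightarrow> real" where "f x = 1 * bump (0 + t *\<^sub>R x)" for x
  have sm: "smooth_fun f" unfolding f_def by (rule smooth_fun_affine[OF smooth_bump])
  have nn: "f x \<ge> 0" for x unfolding f_def using bump_nonneg by auto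
  have supp: "norm x \<le> r" if "f x \<noteq> 0" for x
  proof -
    have "t *\<^sub>R x \<in> box (- One) One" using that bump_support unfolding f_def by auto
    then have "\<bar>x \<bullet> b\<bar> \<le> 1 / t" if "b \<in> Basis" for b
      using that t by (auto simp: box_def inner_minus_left field_simps abs_le_iff less_imp_le dest!: bspec[of _ _ b])
    then have "(\<Sum>b\<in>Basis. \<bar>x \<bullet> b\<bar>) \<le> (\<Sum>b\<in>(Basis::'a set). 1 / t)"
      by (intro sum_mono) auto
    then show ?thesis using norm_le_l1[of x] assms by (simp add: t_def)
  qed
  have int: "integrable lborel f"
    by (rule smooth_compact_integrable[OF sm compact_cball[of 0 r]]) (use supp in force)
  \<comment> \<open>A nonnegative function with integral 0 vanishes almost everywhere. Its zero set
    is closed by continuity and would contain 0, where the bump is positive.\<close>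
  have "(\<integral>x. f x \<partial>lborel) \<noteq> 0"
  proof
    assume "(\<integral>x. f x \<partial>lborel) = 0"
    then have "AE x in lborel. f x = 0"
      using integral_nonneg_eq_0_iff_AE[OF int] nn by auto
    then have "AE x in lebesgue. x \<in> {x. f x = 0}" by (simp add: AE_completion)
    moreover have "closed {x. f x = 0}"
      by (intro closed_Collect_eq continuous_on_const smooth_fun_continuous[OF sm])
    ultimately have "0 \<in> {x. f x = 0}" by (intro mem_closed_if_AE_lebesgue)
    then show False using bump_pos[where 'a='a] by (simp add: f_def)
  qed
  then have pos: "(\<integral>x. f x \<partial>lborel) > 0" using nn by (simp add: less_le)
  define c where "c = 1 / (\<integral>x. f x \<partial>lborel)"
  have "smooth_fun (\<lambda>x. c * f (0 + 1 *\<^sub>R x))" by (rule smooth_fun_affine[OF sm])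
  then have "smooth_fun (\<lambda>x. c * f x)" by simp
  then have "mollifier r (\<lambda>x. c * f x)"
    unfolding mollifier_def using int nn pos supp by (auto simp: c_def)
  then show ?thesis by blast
qed

section \<open>Continuity of translations and mollification in L2\<close>

lemma lborel_distr_translate:
  fixes h :: "'a::euclidean_space"
  shows "distr lborel borel (\<lambda>x. x + h) = lborel"
proof -
  have "(\<lambda>x. x + h) = (+) h" by (auto simp: add.commute)
  then show ?thesis by (simp only: lborel_distr_plus)
qed

lemma lborel_distr_reflect:
  fixes a :: "'a::euclidean_space"
  shows "distr lborel borel (\<lambda>x. a - x) = lborel"
  using lborel_affine[of "-1" a] by (simp add: density_1)

lemma integrable_translate:
  fixes f :: "'a::euclidean_space \<Rightarrow> real"
  assumes "integrable lborel f"
  shows "integrable lborel (\<lambda>x. f (x + h))"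
proof -
  have "integrable (distr lborel borel (\<lambda>x. x + h)) f" using assms by (simp add: lborel_distr_translate)
  then show ?thesis by (subst (asm) integrable_distr_eq) (use assms in auto)
qed

lemma integral_translate:
  fixes f :: "'a::euclidean_space \<Rightarrow> real"
  assumes "f \<in> borel_measurable borel"
  shows "(\<integral>x. f (x + h) \<partial>lborel) = (\<integral>x. f x \<partial>lborel)"
proof -
  have "(\<integral>x. f x \<partial>lborel) = (\<integral>x. f x \<partial>distr lborel borel (\<lambda>x. x + h))" by (simp add: lborel_distr_translate)
  also have "\<dots> = (\<integral>x. f (x + h) \<partial>lborel)" by (rule integral_distr) (use assms in auto)
  finally show ?thesis by simp
qed

lemma nn_integral_translate:
  fixes f :: "'a::euclidean_space \<Rightarrow> ennreal"
  assumes "f \<in> borel_measurable borel"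
  shows "(\<integral>\<^sup>+x. f (x + h) \<partial>lborel) = (\<integral>\<^sup>+x. f x \<partial>lborel)"
proof -
  have "(\<integral>\<^sup>+x. f x \<partial>lborel) = (\<integral>\<^sup>+x. f x \<partial>distr lborel borel (\<lambda>x. x + h))" by (simp add: lborel_distr_translate)
  also have "\<dots> = (\<integral>\<^sup>+x. f (x + h) \<partial>lborel)" by (rule nn_integral_distr) (use assms in auto)
  finally show ?thesis by simp
qed

lemma integral_reflect:
  fixes f :: "'a::euclidean_space \<Rightarrow> real"
  assumes "f \<in> borel_measurable borel"
  shows "(\<integral>x. f (a - x) \<partial>lborel) = (\<integral>x. f x \<partial>lborel)"
proof -
  have "(\<integral>x. f x \<partial>lborel) = (\<integral>x. f x \<partial>distr lborel borel (\<lambda>x. a - x))" by (simp add: lborel_distr_reflect)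
  also have "\<dots> = (\<integral>x. f (a - x) \<partial>lborel)" by (rule integral_distr) (use assms in auto)
  finally show ?thesis by simp
qed

text \<open>A triangle inequality with three terms: by translation invariance the outer two both
  equal the L1 distance of F and G. Continuity of translations thus passes to L1 limits.\<close>

lemma L1_translation_approx:
  fixes F :: "'a::euclidean_space \<Rightarrow> real"
  assumes F: "integrable lborel F"
    and approx: "\<And>e. e > 0 \<Longrightarrow> \<exists>G. integrable lborel G \<and> (\<lambda>k. \<integral>x. \<bar>G (x + h k) - G x\<bar> \<partial>lborel) \<longlonglongrightarrow> 0 \<and> (\<integral>x. \<bar>F x - G x\<bar> \<partial>lborel) \<le> e"
  shows "(\<lambda>k. \<integral>x. \<bar>F (x + h k) - F x\<bar> \<partial>lborel) \<longlonglongrightarrow> (0::real)"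
proof (rule LIMSEQ_I)
  fix e :: real assume e: "e > 0"
  obtain G where G: "integrable lborel G" "(\<lambda>k. \<integral>x. \<bar>G (x + h k) - G x\<bar> \<partial>lborel) \<longlonglongrightarrow> 0"
     "(\<integral>x. \<bar>F x - G x\<bar> \<partial>lborel) \<le> e / 4"
    using approx[of "e/4"] e by auto
  obtain N where N: "\<And>k. k \<ge> N \<Longrightarrow> norm ((\<integral>x. \<bar>G (x + h k) - G x\<bar> \<partial>lborel) - 0) < e / 4"
    using LIMSEQ_D[OF G(2), of "e/4"] e by auto
  show "\<exists>N. \<forall>k\<ge>N. norm ((\<integral>x. \<bar>F (x + h k) - F x\<bar> \<partial>lborel) - 0) < e"
  proof (intro exI allI impI)
    fix k assume k: "k \<ge> N"
    have [measurable]: "F \<in> borel_measurable borel" "G \<in> borel_measurable borel"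
      using F G(1) by (auto dest: borel_measurable_integrable)
    have i: "integrable lborel (\<lambda>x. \<bar>F x - G x\<bar>)" using F G by auto
    have it: "integrable lborel (\<lambda>x. \<bar>F (x + h k) - G (x + h k)\<bar>)"
      using integrable_translate[OF i] by simp
    have iG: "integrable lborel (\<lambda>x. \<bar>G (x + h k) - G x\<bar>)"
      using G integrable_translate[OF G(1)] by auto
    have iF: "integrable lborel (\<lambda>x. \<bar>F (x + h k) - F x\<bar>)"
      using F integrable_translate[OF F] by auto
    have "(\<integral>x. \<bar>F (x + h k) - F x\<bar> \<partial>lborel) \<le> (\<integral>x. \<bar>F (x + h k) - G (x + h k)\<bar> + \<bar>G (x + h k) - G x\<bar> + \<bar>F x - G x\<bar> \<partial>lborel)"
      using i it iG iF by (intro integral_mono) auto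
    also have "\<dots> = (\<integral>x. \<bar>F (x + h k) - G (x + h k)\<bar> \<partial>lborel) + (\<integral>x. \<bar>G (x + h k) - G x\<bar> \<partial>lborel) + (\<integral>x. \<bar>F x - G x\<bar> \<partial>lborel)"
      using i it iG by simp
    also have "(\<integral>x. \<bar>F (x + h k) - G (x + h k)\<bar> \<partial>lborel) = (\<integral>x. \<bar>F x - G x\<bar> \<partial>lborel)"
      using integral_translate[of "\<lambda>x. \<bar>F x - G x\<bar>" "h k"] by simp
    also have "(\<integral>x. \<bar>F x - G x\<bar> \<partial>lborel) + (\<integral>x. \<bar>G (x + h k) - G x\<bar> \<partial>lborel) + (\<integral>x. \<bar>F x - G x\<bar> \<partial>lborel) < e"
      using N[OF k] G(3) e unfolding real_norm_def by linarith
    finally have "(\<integral>x. \<bar>F (x + h k) - F x\<bar> \<partial>lborel) < e" .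
    moreover have "0 \<le> (\<integral>x. \<bar>F (x + h k) - F x\<bar> \<partial>lborel)" by simp
    ultimately show "norm ((\<integral>x. \<bar>F (x + h k) - F x\<bar> \<partial>lborel) - 0) < e" by simp
  qed
qed

text \<open>U and its translates have equal measure, so the symmetric difference has twice the
  measure of the part of U that is moved out of U. On this one side openness gives pointwise
  convergence of the indicators, while at boundary points it may fail.\<close>

lemma L1_translation_indicator_open:
  fixes U :: "'a::euclidean_space set"
  assumes U: "open U" "emeasure lborel U < \<infinity>" and h: "h \<longlonglongrightarrow> 0"
  shows "(\<lambda>k. \<integral>x. \<bar>indicat_real U (x + h k) - indicator U x\<bar> \<partial>lborel) \<longlonglongrightarrow> 0"
proof -
  have [measurable]: "U \<in> sets borel" using U by auto
  have iU: "integrable lborel (indicat_real U)" using U by (auto simp: integrable_indicator_iff)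
  have iUt: "integrable lborel (\<lambda>x. indicat_real U (x + h k))" for k
    by (rule integrable_translate[OF iU])
  have lim: "(\<lambda>k. \<integral>x. indicat_real U x * (1 - indicator U (x + h k)) \<partial>lborel) \<longlonglongrightarrow> (\<integral>x. (0::real) \<partial>(lborel::'a measure))"
  proof (rule integral_dominated_convergence[where w="indicat_real U"])
    show "AE x in lborel. (\<lambda>k. indicat_real U x * (1 - indicator U (x + h k))) \<longlonglongrightarrow> 0"
    proof (intro AE_I2)
      fix x :: 'a
      show "(\<lambda>k. indicat_real U x * (1 - indicator U (x + h k))) \<longlonglongrightarrow> 0"
      proof (cases "x \<in> U")
        case True
        have "(\<lambda>k. x + h k) \<longlonglongrightarrow> x" using tendsto_add[OF tendsto_const h, of x] by simp
        then have "\<forall>\<^sub>F k in sequentially. x + h k \<in> U"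
          using U(1) True topological_tendstoD by blast
        then have "\<forall>\<^sub>F k in sequentially. 0 = indicat_real U x * (1 - indicator U (x + h k))"
          by eventually_elim simp
        then show ?thesis by (rule Lim_transform_eventually[OF tendsto_const])
      qed simp
    qed
  qed (use iU in \<open>auto simp: indicator_def\<close>)
  have "(\<integral>x. \<bar>indicat_real U (x + h k) - indicator U x\<bar> \<partial>lborel) = 2 * (\<integral>x. indicat_real U x * (1 - indicator U (x + h k)) \<partial>lborel)" for k
  proof -
    have i: "integrable lborel (\<lambda>x. indicat_real U x * (1 - indicator U (x + h k)))"
      by (rule Bochner_Integration.integrable_bound[OF iU]) (auto simp: indicator_def)
    have "(\<integral>x. \<bar>indicat_real U (x + h k) - indicator U x\<bar> \<partial>lborel)
       = (\<integral>x. indicat_real U (x + h k) - indicator U x + 2 * (indicat_real U x * (1 - indicator U (x + h k))) \<partial>lborel)"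
      by (intro Bochner_Integration.integral_cong) (auto simp: indicator_def)
    also have "\<dots> = (\<integral>x. indicat_real U (x + h k) \<partial>lborel) - (\<integral>x. indicat_real U x \<partial>lborel) + 2 * (\<integral>x. indicat_real U x * (1 - indicator U (x + h k)) \<partial>lborel)"
      using iU iUt i by simp
    also have "(\<integral>x. indicat_real U (x + h k) \<partial>lborel) = (\<integral>x. indicat_real U x \<partial>lborel)"
      by (rule integral_translate) simp
    finally show ?thesis by simp
  qed
  then show ?thesis using tendsto_mult_right_zero[of _ _ 2] lim by simp
qed

text \<open>Outer regularity approximates a measurable set by open ones; sums follow from the
  triangle inequality and dominated limits again by approximation.\<close>

lemma L1_translation:
  fixes F :: "'a::euclidean_space \<Rightarrow> real"
  assumes "integrable lborel F" and h: "h \<longlonglongrightarrow> 0"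
  shows "(\<lambda>k. \<integral>x. \<bar>F (x + h k) - F x\<bar> \<partial>lborel) \<longlonglongrightarrow> 0"
  using assms(1)
proof (induction F rule: integrable_induct)
  case (base A c)
  show ?case
  proof (rule L1_translation_approx)
    show "integrable lborel (\<lambda>x. indicat_real A x *\<^sub>R c)" using base by auto
    fix e :: real assume e: "e > 0"
    have pos: "e / (\<bar>c\<bar> + 1) > 0" using e by auto
    have Ab: "A \<in> sets borel" using base by simp
    obtain U where U: "open U" "A \<subseteq> U" "emeasure lborel (U - A) < e / (\<bar>c\<bar> + 1)"
      using outer_regular_lborel[OF Ab pos] by metis
    have [measurable]: "U \<in> sets borel" "A \<in> sets borel" using U Ab by auto
    have "emeasure lborel U = emeasure lborel (A \<union> (U - A))" using U by (simp add: Un_absorb1)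
    also have "\<dots> \<le> emeasure lborel A + emeasure lborel (U - A)"
      by (rule emeasure_subadditive) auto
    also have "\<dots> < \<infinity>" using base U(3) by (auto simp: less_top order.strict_trans[OF U(3)])
    finally have Uf: "emeasure lborel U < \<infinity>" .
    have fUA: "emeasure lborel (U - A) < \<infinity>" using U(3) by (auto simp: less_top order.strict_trans)
    have mUA: "measure lborel (U - A) \<le> e / (\<bar>c\<bar> + 1)"
      using U(3) pos fUA by (simp add: emeasure_eq_ennreal_measure less_top ennreal_less_iff)
    have "(\<integral>x. \<bar>indicat_real A x *\<^sub>R c - c * indicator U x\<bar> \<partial>lborel) = (\<integral>x. \<bar>c\<bar> * indicat_real (U - A) x \<partial>lborel)"
      using U(2) by (intro Bochner_Integration.integral_cong) (auto simp: indicator_def)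
    also have "\<dots> = \<bar>c\<bar> * measure lborel (U - A)" by simp
    also have "\<dots> \<le> \<bar>c\<bar> * (e / (\<bar>c\<bar> + 1))" using mUA by (intro mult_left_mono) auto
    also have "\<dots> \<le> e" using e by (simp add: field_simps)
    finally have c1: "(\<integral>x. \<bar>indicat_real A x *\<^sub>R c - c * indicator U x\<bar> \<partial>lborel) \<le> e" .
    have "(\<lambda>k. \<bar>c\<bar> * (\<integral>x. \<bar>indicat_real U (x + h k) - indicator U x\<bar> \<partial>lborel)) \<longlonglongrightarrow> 0"
      using tendsto_mult_right_zero L1_translation_indicator_open[OF U(1) Uf h] by blast
    then have "(\<lambda>k. (\<integral>x. \<bar>c * indicat_real U (x + h k) - c * indicator U x\<bar> \<partial>lborel)) \<longlonglongrightarrow> 0"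
      by (simp add: abs_mult right_diff_distrib[symmetric])
    moreover have "integrable lborel (\<lambda>x. c * indicat_real U x)" using Uf by auto
    ultimately show "\<exists>G. integrable lborel G \<and> (\<lambda>k. \<integral>x. \<bar>G (x + h k) - G x\<bar> \<partial>lborel) \<longlonglongrightarrow> 0 \<and> (\<integral>x. \<bar>indicat_real A x *\<^sub>R c - G x\<bar> \<partial>lborel) \<le> e"
      using c1 by blast
  qed
next
  case (add f g)
  show ?case
  proof (rule tendsto_sandwich[where f="\<lambda>_. 0"])
    show "(\<lambda>k. (\<integral>x. \<bar>f (x + h k) - f x\<bar> \<partial>lborel) + (\<integral>x. \<bar>g (x + h k) - g x\<bar> \<partial>lborel)) \<longlonglongrightarrow> 0"
      using tendsto_add[OF add.IH] by simp
    show "\<forall>\<^sub>F k in sequentially. (\<integral>x. \<bar>f (x + h k) + g (x + h k) - (f x + g x)\<bar> \<partial>lborel)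
        \<le> (\<integral>x. \<bar>f (x + h k) - f x\<bar> \<partial>lborel) + (\<integral>x. \<bar>g (x + h k) - g x\<bar> \<partial>lborel)"
    proof (intro always_eventually allI)
      fix k
      have i: "integrable lborel (\<lambda>x. \<bar>f (x + h k) - f x\<bar>)" "integrable lborel (\<lambda>x. \<bar>g (x + h k) - g x\<bar>)"
        using add.hyps integrable_translate[OF add.hyps(1)] integrable_translate[OF add.hyps(2)] by auto
      have j: "integrable lborel (\<lambda>x. \<bar>f (x + h k) + g (x + h k) - (f x + g x)\<bar>)"
        using add.hyps integrable_translate[OF add.hyps(1)] integrable_translate[OF add.hyps(2)] by auto
      have "(\<integral>x. \<bar>f (x + h k) + g (x + h k) - (f x + g x)\<bar> \<partial>lborel) \<le> (\<integral>x. \<bar>f (x + h k) - f x\<bar> + \<bar>g (x + h k) - g x\<bar> \<partial>lborel)"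
        using i j by (intro integral_mono) auto
      then show "(\<integral>x. \<bar>f (x + h k) + g (x + h k) - (f x + g x)\<bar> \<partial>lborel)
        \<le> (\<integral>x. \<bar>f (x + h k) - f x\<bar> \<partial>lborel) + (\<integral>x. \<bar>g (x + h k) - g x\<bar> \<partial>lborel)"
        using i by simp
    qed
  qed auto
next
  case (lim f s)
  show ?case
  proof (rule L1_translation_approx[OF lim.hyps(4)])
    fix e :: real assume e: "e > 0"
    have [measurable]: "f \<in> borel_measurable borel" "\<And>i. s i \<in> borel_measurable borel"
      using lim.hyps(4) lim.hyps(1) by (auto dest: borel_measurable_integrable)
    have "(\<lambda>i. \<integral>x. \<bar>f x - s i x\<bar> \<partial>lborel) \<longlonglongrightarrow> (\<integral>x. (0::real) \<partial>(lborel::'a measure))"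
    proof (rule integral_dominated_convergence[where w="\<lambda>x. 3 * \<bar>f x\<bar>"])
      show "AE x in lborel. (\<lambda>i. \<bar>f x - s i x\<bar>) \<longlonglongrightarrow> 0"
      proof (intro AE_I2)
        fix x
        have "(\<lambda>i. f x - s i x) \<longlonglongrightarrow> f x - f x" using lim.hyps(2)[of x] by (intro tendsto_intros) auto
        then show "(\<lambda>i. \<bar>f x - s i x\<bar>) \<longlonglongrightarrow> 0" using tendsto_rabs_zero by fastforce
      qed
      show "AE x in lborel. norm \<bar>f x - s i x\<bar> \<le> 3 * \<bar>f x\<bar>" for i
      proof (intro AE_I2)
        fix x show "norm \<bar>f x - s i x\<bar> \<le> 3 * \<bar>f x\<bar>" using lim.hyps(3)[of x i] by simp
      qed
    qed (use lim.hyps(4) in auto)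
    then have "\<forall>\<^sub>F i in sequentially. (\<integral>x. \<bar>f x - s i x\<bar> \<partial>lborel) < e"
      using e by (intro order_tendstoD) auto
    then obtain i where "(\<integral>x. \<bar>f x - s i x\<bar> \<partial>lborel) < e" by (auto simp: eventually_sequentially)
    then show "\<exists>G. integrable lborel G \<and> (\<lambda>k. \<integral>x. \<bar>G (x + h k) - G x\<bar> \<partial>lborel) \<longlonglongrightarrow> 0 \<and> (\<integral>x. \<bar>f x - G x\<bar> \<partial>lborel) \<le> e"
      using lim.IH[of i] lim.hyps(1)[of i] by (intro exI[of _ "s i"]) auto
  qed
qed

lemma diff_square_le: "(a - b :: real)\<^sup>2 \<le> 2 * a\<^sup>2 + 2 * b\<^sup>2"
proof -
  have "2 * a\<^sup>2 + 2 * b\<^sup>2 - (a - b)\<^sup>2 = (a + b)\<^sup>2" by (simp add: power2_eq_square algebra_simps)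
  then show ?thesis using zero_le_power2[of "a + b"] by linarith
qed

lemma integrable_square_diff:
  fixes f g :: "'a \<Rightarrow> real"
  assumes [measurable]: "f \<in> borel_measurable M" "g \<in> borel_measurable M"
    and "integrable M (\<lambda>x. (f x)\<^sup>2)" "integrable M (\<lambda>x. (g x)\<^sup>2)"
  shows "integrable M (\<lambda>x. (f x - g x)\<^sup>2)"
proof (rule Bochner_Integration.integrable_bound)
  show "integrable M (\<lambda>x. 2 * (f x)\<^sup>2 + 2 * (g x)\<^sup>2)" using assms by auto
  show "AE x in M. norm ((f x - g x)\<^sup>2) \<le> norm (2 * (f x)\<^sup>2 + 2 * (g x)\<^sup>2)"
    using diff_square_le[of "f _" "g _"] by (auto intro!: AE_I2)
qed measurable

text \<open>For a, b >= 0 one has (a - b)^2 <= |a^2 - b^2|. Applied to the positive and the negative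
  part, this reduces the claim to L1 translations of their squares.\<close>

lemma L2_translation_sequentially:
  fixes F :: "'a::euclidean_space \<Rightarrow> real"
  assumes [measurable]: "F \<in> borel_measurable borel"
    and F2: "integrable lborel (\<lambda>x. (F x)\<^sup>2)" and h: "h \<longlonglongrightarrow> 0"
  shows "(\<lambda>k. \<integral>x. (F (x + h k) - F x)\<^sup>2 \<partial>lborel) \<longlonglongrightarrow> 0"
proof -
  define P N where "P x = max (F x) 0" and "N x = max (- F x) 0" for x
  have [measurable]: "P \<in> borel_measurable borel" "N \<in> borel_measurable borel"
    unfolding P_def[abs_def] N_def[abs_def] by measurable
  have iP: "integrable lborel (\<lambda>x. (P x)\<^sup>2)"
    by (rule Bochner_Integration.integrable_bound[OF F2]) (auto simp: P_def max_def)
  have iN: "integrable lborel (\<lambda>x. (N x)\<^sup>2)"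
    by (rule Bochner_Integration.integrable_bound[OF F2]) (auto simp: N_def max_def)
  have pw: "(F y - F x)\<^sup>2 \<le> 2 * \<bar>(P y)\<^sup>2 - (P x)\<^sup>2\<bar> + 2 * \<bar>(N y)\<^sup>2 - (N x)\<^sup>2\<bar>" for x y
  proof -
    have sq: "(a - b)\<^sup>2 \<le> \<bar>a\<^sup>2 - b\<^sup>2\<bar>" if "a \<ge> 0" "b \<ge> 0" for a b :: real
    proof -
      have "(a - b)\<^sup>2 = \<bar>a - b\<bar> * \<bar>a - b\<bar>" by (simp add: power2_eq_square)
      also have "\<dots> \<le> \<bar>a - b\<bar> * \<bar>a + b\<bar>" using that by (intro mult_left_mono) auto
      also have "\<dots> = \<bar>a\<^sup>2 - b\<^sup>2\<bar>" by (simp add: abs_mult[symmetric] power2_eq_square algebra_simps)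
      finally show ?thesis .
    qed
    have "F y - F x = (P y - P x) - (N y - N x)" unfolding P_def N_def by (auto simp: max_def)
    then have "(F y - F x)\<^sup>2 \<le> 2 * (P y - P x)\<^sup>2 + 2 * (N y - N x)\<^sup>2"
      using diff_square_le[of "P y - P x" "N y - N x"] by simp
    then show ?thesis
      using sq[of "P y" "P x"] sq[of "N y" "N x"] by (simp add: P_def N_def)
  qed
  show ?thesis
  proof (rule tendsto_sandwich[where f="\<lambda>_. 0"])
    show "(\<lambda>k. 2 * (\<integral>x. \<bar>(P (x + h k))\<^sup>2 - (P x)\<^sup>2\<bar> \<partial>lborel) + 2 * (\<integral>x. \<bar>(N (x + h k))\<^sup>2 - (N x)\<^sup>2\<bar> \<partial>lborel)) \<longlonglongrightarrow> 0"
      using tendsto_add[OF tendsto_mult_right_zero[OF L1_translation[OF iP h], of 2] tendsto_mult_right_zero[OF L1_translation[OF iN h], of 2]] by simp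
    show "\<forall>\<^sub>F k in sequentially. (\<integral>x. (F (x + h k) - F x)\<^sup>2 \<partial>lborel) \<le>
      2 * (\<integral>x. \<bar>(P (x + h k))\<^sup>2 - (P x)\<^sup>2\<bar> \<partial>lborel) + 2 * (\<integral>x. \<bar>(N (x + h k))\<^sup>2 - (N x)\<^sup>2\<bar> \<partial>lborel)"
    proof (intro always_eventually allI)
      fix k
      have i: "integrable lborel (\<lambda>x. \<bar>(P (x + h k))\<^sup>2 - (P x)\<^sup>2\<bar>)" "integrable lborel (\<lambda>x. \<bar>(N (x + h k))\<^sup>2 - (N x)\<^sup>2\<bar>)"
        using iP iN integrable_translate[OF iP] integrable_translate[OF iN] by auto
      have j: "integrable lborel (\<lambda>x. (F (x + h k) - F x)\<^sup>2)"
        by (rule integrable_square_diff) (use F2 integrable_translate[OF F2] in auto)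
      have "(\<integral>x. (F (x + h k) - F x)\<^sup>2 \<partial>lborel) \<le> (\<integral>x. 2 * \<bar>(P (x + h k))\<^sup>2 - (P x)\<^sup>2\<bar> + 2 * \<bar>(N (x + h k))\<^sup>2 - (N x)\<^sup>2\<bar> \<partial>lborel)"
        by (rule integral_mono[OF j _ pw]) (use i in auto)
      also have "\<dots> = 2 * (\<integral>x. \<bar>(P (x + h k))\<^sup>2 - (P x)\<^sup>2\<bar> \<partial>lborel) + 2 * (\<integral>x. \<bar>(N (x + h k))\<^sup>2 - (N x)\<^sup>2\<bar> \<partial>lborel)"
        using i by simp
      finally show "(\<integral>x. (F (x + h k) - F x)\<^sup>2 \<partial>lborel) \<le>
        2 * (\<integral>x. \<bar>(P (x + h k))\<^sup>2 - (P x)\<^sup>2\<bar> \<partial>lborel) + 2 * (\<integral>x. \<bar>(N (x + h k))\<^sup>2 - (N x)\<^sup>2\<bar> \<partial>lborel)" .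
    qed
  qed auto
qed

lemma L2_translation:
  fixes F :: "'a::euclidean_space \<Rightarrow> real"
  assumes [measurable]: "F \<in> borel_measurable borel"
    and F2: "integrable lborel (\<lambda>x. (F x)\<^sup>2)" and e: "e > 0"
  obtains d where "d > 0" "\<And>h. norm h \<le> d \<Longrightarrow> (\<integral>x. (F (x + h) - F x)\<^sup>2 \<partial>lborel) \<le> e"
proof (rule ccontr)
  assume "\<not> thesis"
  then have "\<forall>k. \<exists>h. norm h \<le> 1 / real (Suc k) \<and> (\<integral>x. (F (x + h) - F x)\<^sup>2 \<partial>lborel) > e"
    using that by (meson not_le of_nat_0_less_iff zero_less_Suc zero_less_divide_1_iff)
  then obtain h where h: "\<And>k. norm (h k) \<le> 1 / real (Suc k)" "\<And>k. (\<integral>x. (F (x + h k) - F x)\<^sup>2 \<partial>lborel) > e"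
    by metis
  have "h \<longlonglongrightarrow> 0"
    by (rule Lim_null_comparison[of _ "\<lambda>k. 1 / real (Suc k)"])
       (use h(1) LIMSEQ_Suc[OF lim_1_over_n] in \<open>auto\<close>)
  from L2_translation_sequentially[OF assms(1,2) this]
  have "\<forall>\<^sub>F k in sequentially. (\<integral>x. (F (x + h k) - F x)\<^sup>2 \<partial>lborel) < e"
    using e by (intro order_tendstoD) auto
  then show False using h(2) by (auto simp: eventually_sequentially not_less less_imp_le dest: order.asym)
qed

text \<open>The error at x is the mean of F(x - z) - F(x) for the probability density psi.
  Cauchy-Schwarz with psi = sqrt psi * sqrt psi bounds its square by the mean of the squares, and
  after Fubini only translation errors with |z| <= r remain.\<close>

lemma mollify_L2_bound:
  fixes F :: "'a::euclidean_space \<Rightarrow> real"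
  assumes m: "mollifier r \<psi>" and F: "integrable lborel F" "integrable lborel (\<lambda>x. (F x)\<^sup>2)"
    and e: "\<And>h. norm h \<le> r \<Longrightarrow> (\<integral>x. (F (x + h) - F x)\<^sup>2 \<partial>lborel) \<le> e" "e \<ge> 0"
  shows "integrable lborel (\<lambda>x. (conv F \<psi> x - F x)\<^sup>2)"
    and "(\<integral>x. (conv F \<psi> x - F x)\<^sup>2 \<partial>lborel) \<le> e"
proof -
  have psi: "smooth_fun \<psi>" "\<And>x. \<psi> x \<ge> 0" "\<And>x. \<psi> x \<noteq> 0 \<Longrightarrow> norm x \<le> r" "integrable lborel \<psi>" "(\<integral>x. \<psi> x \<partial>lborel) = 1"
    using m by (auto simp: mollifier_def)
  have psi0: "\<And>x. x \<notin> cball 0 r \<Longrightarrow> \<psi> x = 0" using psi(3) by force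
  have [measurable]: "F \<in> borel_measurable borel" "\<psi> \<in> borel_measurable borel"
    using F psi smooth_fun_measurable by (auto dest: borel_measurable_integrable)
  have [measurable]: "conv F \<psi> \<in> borel_measurable borel"
    by (rule smooth_fun_measurable[OF smooth_conv[OF F(1) psi(1) compact_cball psi0]])
  have pw: "ennreal ((conv F \<psi> x - F x)\<^sup>2) \<le> (\<integral>\<^sup>+z. ennreal (\<psi> z) * ennreal ((F (x - z) - F x)\<^sup>2) \<partial>lborel)" for x
  proof -
    have i1: "integrable lborel (\<lambda>z. F (x - z) * \<psi> z)"
    proof -
      have "integrable lborel (\<lambda>y. F y * \<psi> (x - y))"
        by (rule conv_integrable[OF F(1) psi(1) compact_cball psi0])
      then have "integrable (distr lborel borel (\<lambda>z. x - z)) (\<lambda>y. F y * \<psi> (x - y))"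
        by (simp add: lborel_distr_reflect)
      then show ?thesis by (subst (asm) integrable_distr_eq) auto
    qed
    have "conv F \<psi> x = (\<integral>z. F (x - z) * \<psi> z \<partial>lborel)"
      unfolding conv_def using integral_reflect[of "\<lambda>y. F y * \<psi> (x - y)" x] by simp
    moreover have "F x = (\<integral>z. F x * \<psi> z \<partial>lborel)" using psi by simp
    ultimately have eq: "conv F \<psi> x - F x = (\<integral>z. \<psi> z * (F (x - z) - F x) \<partial>lborel)"
      using i1 psi(4) by (simp add: right_diff_distrib mult.commute)
    have i2: "integrable lborel (\<lambda>z. \<psi> z * (F (x - z) - F x))"
      using Bochner_Integration.integrable_diff[OF i1 integrable_mult_right[OF psi(4), of "F x"]] by (simp add: algebra_simps)
    have "ennreal \<bar>conv F \<psi> x - F x\<bar> \<le> (\<integral>\<^sup>+z. ennreal (\<psi> z * \<bar>F (x - z) - F x\<bar>) \<partial>lborel)"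
      using integral_norm_bound_ennreal[OF i2] psi(2) by (simp add: eq abs_mult)
    also have "\<dots> = (\<integral>\<^sup>+z. ennreal (sqrt (\<psi> z)) * ennreal (sqrt (\<psi> z) * \<bar>F (x - z) - F x\<bar>) \<partial>lborel)"
      using psi(2) by (intro nn_integral_cong) (simp add: ennreal_mult[symmetric] mult.assoc[symmetric])
    finally have "(ennreal \<bar>conv F \<psi> x - F x\<bar>)\<^sup>2 \<le> (\<integral>\<^sup>+z. ennreal (sqrt (\<psi> z)) * ennreal (sqrt (\<psi> z) * \<bar>F (x - z) - F x\<bar>) \<partial>lborel)\<^sup>2"
      by (rule power_mono) simp
    also have "\<dots> \<le> (\<integral>\<^sup>+z. (ennreal (sqrt (\<psi> z)))\<^sup>2 \<partial>lborel) * (\<integral>\<^sup>+z. (ennreal (sqrt (\<psi> z) * \<bar>F (x - z) - F x\<bar>))\<^sup>2 \<partial>lborel)"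
      by (rule Cauchy_Schwarz_nn_integral) measurable
    also have "(\<integral>\<^sup>+z. (ennreal (sqrt (\<psi> z)))\<^sup>2 \<partial>lborel) = (\<integral>\<^sup>+z. ennreal (\<psi> z) \<partial>lborel)"
      using psi(2) by (intro nn_integral_cong) (simp add: ennreal_power)
    also have "\<dots> = 1" using nn_integral_eq_integral[OF psi(4)] psi by simp
    also have "(\<integral>\<^sup>+z. (ennreal (sqrt (\<psi> z) * \<bar>F (x - z) - F x\<bar>))\<^sup>2 \<partial>lborel) = (\<integral>\<^sup>+z. ennreal (\<psi> z) * ennreal ((F (x - z) - F x)\<^sup>2) \<partial>lborel)"
      using psi(2) by (intro nn_integral_cong) (simp add: ennreal_power power_mult_distrib ennreal_mult)
    finally show ?thesis by (simp add: ennreal_power)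
  qed
  have iT: "integrable lborel (\<lambda>x. (F (x + h) - F x)\<^sup>2)" for h
    by (rule integrable_square_diff) (use F(2) integrable_translate[OF F(2)] in auto)
  have "(\<integral>\<^sup>+x. ennreal ((conv F \<psi> x - F x)\<^sup>2) \<partial>lborel) \<le> (\<integral>\<^sup>+x. (\<integral>\<^sup>+z. ennreal (\<psi> z) * ennreal ((F (x - z) - F x)\<^sup>2) \<partial>lborel) \<partial>lborel)"
    by (intro nn_integral_mono pw)
  also have "\<dots> = (\<integral>\<^sup>+z. (\<integral>\<^sup>+x. ennreal (\<psi> z) * ennreal ((F (x - z) - F x)\<^sup>2) \<partial>lborel) \<partial>lborel)"
    by (rule lborel_pair.Fubini') measurable
  also have "\<dots> = (\<integral>\<^sup>+z. ennreal (\<psi> z) * (\<integral>\<^sup>+x. ennreal ((F (x - z) - F x)\<^sup>2) \<partial>lborel) \<partial>lborel)"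
    by (intro nn_integral_cong nn_integral_cmult) measurable
  also have "\<dots> \<le> (\<integral>\<^sup>+z. ennreal (\<psi> z) * ennreal e \<partial>lborel)"
  proof (intro nn_integral_mono)
    fix z :: 'a
    show "ennreal (\<psi> z) * (\<integral>\<^sup>+x. ennreal ((F (x - z) - F x)\<^sup>2) \<partial>lborel) \<le> ennreal (\<psi> z) * ennreal e"
    proof (cases "\<psi> z = 0")
      case False
      have "(\<integral>\<^sup>+x. ennreal ((F (x - z) - F x)\<^sup>2) \<partial>lborel) = ennreal (\<integral>x. (F (x - z) - F x)\<^sup>2 \<partial>lborel)"
        using nn_integral_eq_integral[OF iT[of "- z"]] by simp
      also have "\<dots> \<le> ennreal e" using e(1)[of "- z"] psi(3)[OF False] by (intro ennreal_leI) auto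
      finally show ?thesis by (intro mult_left_mono) auto
    qed simp
  qed
  also have "\<dots> = ennreal e"
    using nn_integral_eq_integral[OF psi(4)] psi by (subst nn_integral_multc) auto
  finally have fin: "(\<integral>\<^sup>+x. ennreal ((conv F \<psi> x - F x)\<^sup>2) \<partial>lborel) \<le> ennreal e" .
  then show i: "integrable lborel (\<lambda>x. (conv F \<psi> x - F x)\<^sup>2)"
    by (intro integrableI_bounded) (auto simp: less_top[symmetric] top_unique elim: le_less_trans)
  show "(\<integral>x. (conv F \<psi> x - F x)\<^sup>2 \<partial>lborel) \<le> e"
    using fin e(2) nn_integral_eq_integral[OF i] by simp
qed

lemma mollify_L2_tendsto:
  fixes F :: "'a::euclidean_space \<Rightarrow> real"
  assumes m: "\<And>k. mollifier (r k) (\<psi> k)" and r: "r \<longlonglongrightarrow> 0" "\<And>k. r k > 0"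
    and F: "integrable lborel F" "integrable lborel (\<lambda>x. (F x)\<^sup>2)"
  shows "(\<lambda>k. \<integral>x. (conv F (\<psi> k) x - F x)\<^sup>2 \<partial>lborel) \<longlonglongrightarrow> 0"
proof (rule LIMSEQ_I)
  fix e :: real assume e: "e > 0"
  obtain d where d: "d > 0" "\<And>h. norm h \<le> d \<Longrightarrow> (\<integral>x. (F (x + h) - F x)\<^sup>2 \<partial>lborel) \<le> e / 2"
    using L2_translation[of F "e/2"] F e by (auto dest: borel_measurable_integrable)
  have "\<forall>\<^sub>F k in sequentially. r k < d" using r(1) d(1) by (intro order_tendstoD) auto
  then obtain N where N: "\<And>k. k \<ge> N \<Longrightarrow> r k < d" by (auto simp: eventually_sequentially)
  have "norm ((\<integral>x. (conv F (\<psi> k) x - F x)\<^sup>2 \<partial>lborel) - 0) < e" if "k \<ge> N" for k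
  proof -
    have "(\<integral>x. (conv F (\<psi> k) x - F x)\<^sup>2 \<partial>lborel) \<le> e / 2"
      by (rule mollify_L2_bound(2)[OF m F]) (use N[OF that] d e in auto)
    then show ?thesis using e by simp
  qed
  then show "\<exists>N. \<forall>k\<ge>N. norm ((\<integral>x. (conv F (\<psi> k) x - F x)\<^sup>2 \<partial>lborel) - 0) < e" by blast
qed

section \<open>Square integrable functions and weak gradients\<close>

text \<open>Square integrability for any measure: \<open>L2\<close> is tied to Lebesgue measure on a
  set, while convolutions are estimated on \<open>lborel\<close>.\<close>

definition sqint :: "'a measure \<Rightarrow> ('a \<Rightarrow> real) \<Rightarrow> bool" where
  "sqint M f \<longleftrightarrow> f \<in> borel_measurable M \<and> integrable M (\<lambda>x. (f x)\<^sup>2)"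

lemma L2_sqint: "L2 S f = sqint (lebesgue_on S) f"
  by (simp add: L2_def sqint_def)

lemma sqintD [dest]:
  assumes "sqint M f" shows "f \<in> borel_measurable M" "integrable M (\<lambda>x. (f x)\<^sup>2)"
  using assms by (auto simp: sqint_def)

lemma sqint_cmult: "sqint M f \<Longrightarrow> sqint M (\<lambda>x. a * f x)"
  by (auto simp: sqint_def power_mult_distrib)

lemma sqint_diff: "sqint M f \<Longrightarrow> sqint M g \<Longrightarrow> sqint M (\<lambda>x. f x - g x)"
  by (auto simp: sqint_def intro: integrable_square_diff)

lemma sqint_add: "sqint M f \<Longrightarrow> sqint M g \<Longrightarrow> sqint M (\<lambda>x. f x + g x)"
  using sqint_diff[OF _ sqint_cmult[of M g "-1"]] by simp

lemma sqint_zero: "sqint M (\<lambda>x. 0)"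
  by (simp add: sqint_def)

lemma sqint_sum: "(\<And>i. i \<in> I \<Longrightarrow> sqint M (f i)) \<Longrightarrow> sqint M (\<lambda>x. \<Sum>i\<in>I. f i x)"
  by (induction I rule: infinite_finite_induct) (auto intro: sqint_add sqint_zero)

lemma sqint_mult_bounded:
  assumes "sqint M f" "g \<in> borel_measurable M" "\<And>x. x \<in> space M \<Longrightarrow> \<bar>g x\<bar> \<le> B"
  shows "sqint M (\<lambda>x. g x * f x)"
  unfolding sqint_def
proof
  show m: "(\<lambda>x. g x * f x) \<in> borel_measurable M" using assms by auto
  show "integrable M (\<lambda>x. (g x * f x)\<^sup>2)"
  proof (rule Bochner_Integration.integrable_bound)
    show "integrable M (\<lambda>x. B\<^sup>2 * (f x)\<^sup>2)" using assms by auto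
    show "AE x in M. norm ((g x * f x)\<^sup>2) \<le> norm (B\<^sup>2 * (f x)\<^sup>2)"
    proof (intro AE_I2)
      fix x assume "x \<in> space M"
      then have "\<bar>g x\<bar>\<^sup>2 \<le> B\<^sup>2" using assms(3) by (intro power_mono) auto
      then show "norm ((g x * f x)\<^sup>2) \<le> norm (B\<^sup>2 * (f x)\<^sup>2)"
        by (simp add: power_mult_distrib mult_right_mono)
    qed
  qed (use m in measurable)
qed

lemma sqint_mult_integrable:
  assumes "sqint M f" "sqint M g"
  shows "integrable M (\<lambda>x. f x * g x)"
proof (rule Bochner_Integration.integrable_bound)
  show "integrable M (\<lambda>x. (f x)\<^sup>2 + (g x)\<^sup>2)" using assms by auto
  show "AE x in M. norm (f x * g x) \<le> norm ((f x)\<^sup>2 + (g x)\<^sup>2)"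
  proof (intro AE_I2)
    fix x
    have "2 * \<bar>f x\<bar> * \<bar>g x\<bar> \<le> (f x)\<^sup>2 + (g x)\<^sup>2" using sum_squares_bound[of "\<bar>f x\<bar>" "\<bar>g x\<bar>"] by simp
    moreover have "0 \<le> \<bar>f x\<bar> * \<bar>g x\<bar>" by simp
    ultimately have "\<bar>f x\<bar> * \<bar>g x\<bar> \<le> (f x)\<^sup>2 + (g x)\<^sup>2" by linarith
    then show "norm (f x * g x) \<le> norm ((f x)\<^sup>2 + (g x)\<^sup>2)" by (simp add: abs_mult)
  qed
qed (intro borel_measurable_times sqintD(1)[OF assms(1)] sqintD(1)[OF assms(2)])

lemma sqint_integrable: "finite_measure M \<Longrightarrow> sqint M f \<Longrightarrow> integrable M f"
  using sqint_mult_integrable[of M f "\<lambda>x. 1"] by (auto simp: sqint_def finite_measure.integrable_const)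

text \<open>The common source of the Cauchy-Schwarz inequalities for square integrable functions,
  abstract forms and matrices. The case a = 0 says that a first variation vanishes at a
  minimizer.\<close>

lemma quadratic_nonneg_discriminant:
  fixes a b c :: real
  assumes "\<And>t. a + 2 * t * b + t\<^sup>2 * c \<ge> 0" "c \<ge> 0"
  shows "b\<^sup>2 \<le> a * c"
proof (cases "c = 0")
  case True
  have "b = 0"
  proof (rule ccontr)
    assume "b \<noteq> 0"
    \<comment> \<open>For c = 0 this t makes the quadratic expression equal to -1.\<close>
    then show False using assms(1)[of "- (a + 1) / (2 * b)"] True by (simp add: field_simps)
  qed
  then show ?thesis using True by simp
next
  case False
  then show ?thesis using assms(1)[of "- b / c"] assms(2)
    by (simp add: field_simps power2_eq_square)
qed

lemma sqint_Cauchy_Schwarz: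
  assumes f: "sqint M f" and g: "sqint M g"
  shows "(\<integral>x. f x * g x \<partial>M)\<^sup>2 \<le> (\<integral>x. (f x)\<^sup>2 \<partial>M) * (\<integral>x. (g x)\<^sup>2 \<partial>M)"
proof (rule quadratic_nonneg_discriminant)
  fix t :: real
  have "0 \<le> (\<integral>x. (f x + t * g x)\<^sup>2 \<partial>M)" by simp
  also have "\<dots> = (\<integral>x. (f x)\<^sup>2 + 2 * t * (f x * g x) + t\<^sup>2 * (g x)\<^sup>2 \<partial>M)"
    by (intro Bochner_Integration.integral_cong) (auto simp: power2_eq_square algebra_simps)
  also have "\<dots> = (\<integral>x. (f x)\<^sup>2 \<partial>M) + 2 * t * (\<integral>x. f x * g x \<partial>M) + t\<^sup>2 * (\<integral>x. (g x)\<^sup>2 \<partial>M)"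
    using sqintD(2)[OF f] sqintD(2)[OF g] sqint_mult_integrable[OF f g] by simp
  finally show "0 \<le> (\<integral>x. (f x)\<^sup>2 \<partial>M) + 2 * t * (\<integral>x. f x * g x \<partial>M) + t\<^sup>2 * (\<integral>x. (g x)\<^sup>2 \<partial>M)" .
qed simp

definition L2lim :: "'a measure \<Rightarrow> (nat \<Rightarrow> 'a \<Rightarrow> real) \<Rightarrow> ('a \<Rightarrow> real) \<Rightarrow> bool" where
  "L2lim M f g \<longleftrightarrow> (\<forall>k. sqint M (f k)) \<and> sqint M g \<and> (\<lambda>k. \<integral>x. (f k x - g x)\<^sup>2 \<partial>M) \<longlonglongrightarrow> 0"

lemma L2limD:
  assumes "L2lim M f g"
  shows "sqint M (f k)" "sqint M g" "(\<lambda>k. \<integral>x. (f k x - g x)\<^sup>2 \<partial>M) \<longlonglongrightarrow> 0"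
  using assms by (auto simp: L2lim_def)

lemma L2lim_const: "sqint M f \<Longrightarrow> L2lim M (\<lambda>k. f) f"
  by (simp add: L2lim_def)

lemma L2lim_integral_mult:
  assumes f: "L2lim M f f'" and g: "L2lim M g g'"
  shows "(\<lambda>k. \<integral>x. f k x * g k x \<partial>M) \<longlonglongrightarrow> (\<integral>x. f' x * g' x \<partial>M)"
proof -
  note ff = L2limD(1,2)[OF f] and gg = L2limD(1,2)[OF g]
  define u v where "u k = (\<integral>x. (f k x - f' x)\<^sup>2 \<partial>M)" and "v k = (\<integral>x. (g k x - g' x)\<^sup>2 \<partial>M)" for k
  have uv: "u \<longlonglongrightarrow> 0" "v \<longlonglongrightarrow> 0" using L2limD(3)[OF f] L2limD(3)[OF g] by (auto simp: u_def[abs_def] v_def[abs_def])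
  have abs_le: "\<bar>\<integral>x. p x * q x \<partial>M\<bar> \<le> sqrt ((\<integral>x. (p x)\<^sup>2 \<partial>M) * (\<integral>x. (q x)\<^sup>2 \<partial>M))"
    if "sqint M p" "sqint M q" for p q
    using real_sqrt_le_mono[OF sqint_Cauchy_Schwarz[OF that]] by simp
  have est: "\<bar>(\<integral>x. f k x * g k x \<partial>M) - (\<integral>x. f' x * g' x \<partial>M)\<bar>
     \<le> sqrt (u k * v k) + sqrt (u k * (\<integral>x. (g' x)\<^sup>2 \<partial>M)) + sqrt ((\<integral>x. (f' x)\<^sup>2 \<partial>M) * v k)" for k
  proof -
    note df = sqint_diff[OF ff(1)[of k] ff(2)] and dg = sqint_diff[OF gg(1)[of k] gg(2)]
    note ints = sqint_mult_integrable[OF df dg] sqint_mult_integrable[OF df gg(2)] sqint_mult_integrable[OF ff(2) dg]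
    have "(\<integral>x. f k x * g k x \<partial>M) - (\<integral>x. f' x * g' x \<partial>M) = (\<integral>x. f k x * g k x - f' x * g' x \<partial>M)"
      using sqint_mult_integrable[OF ff(1) gg(1)] sqint_mult_integrable[OF ff(2) gg(2)] by simp
    also have "\<dots> = (\<integral>x. (f k x - f' x) * (g k x - g' x) + (f k x - f' x) * g' x + f' x * (g k x - g' x) \<partial>M)"
      by (intro Bochner_Integration.integral_cong) (auto simp: algebra_simps)
    also have "\<dots> = (\<integral>x. (f k x - f' x) * (g k x - g' x) \<partial>M) + (\<integral>x. (f k x - f' x) * g' x \<partial>M) + (\<integral>x. f' x * (g k x - g' x) \<partial>M)"
      using ints by simp
    finally show ?thesis
      using abs_le[OF df dg] abs_le[OF df gg(2)] abs_le[OF ff(2) dg] unfolding u_def v_def by linarith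
  qed
  have "(\<lambda>k. sqrt (u k * v k) + sqrt (u k * (\<integral>x. (g' x)\<^sup>2 \<partial>M)) + sqrt ((\<integral>x. (f' x)\<^sup>2 \<partial>M) * v k))
     \<longlonglongrightarrow> sqrt (0 * 0) + sqrt (0 * (\<integral>x. (g' x)\<^sup>2 \<partial>M)) + sqrt ((\<integral>x. (f' x)\<^sup>2 \<partial>M) * 0)"
    by (intro tendsto_intros uv)
  then have "(\<lambda>k. sqrt (u k * v k) + sqrt (u k * (\<integral>x. (g' x)\<^sup>2 \<partial>M)) + sqrt ((\<integral>x. (f' x)\<^sup>2 \<partial>M) * v k)) \<longlonglongrightarrow> 0"
    by simp
  then have "(\<lambda>k. (\<integral>x. f k x * g k x \<partial>M) - (\<integral>x. f' x * g' x \<partial>M)) \<longlonglongrightarrow> 0"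
    by (rule Lim_null_comparison[rotated]) (use est in \<open>auto intro!: always_eventually\<close>)
  then show ?thesis by (simp add: LIM_zero_iff)
qed

lemma L2lim_square:
  "L2lim M f f' \<Longrightarrow> (\<lambda>k. \<integral>x. (f k x)\<^sup>2 \<partial>M) \<longlonglongrightarrow> (\<integral>x. (f' x)\<^sup>2 \<partial>M)"
  using L2lim_integral_mult[of M f f' f f'] by (simp add: power2_eq_square)

section \<open>Borel representatives of functions on a set\<close>

lemma lebesgue_on_integral_lborel:
  fixes G :: "'a::euclidean_space \<Rightarrow> real"
  assumes "S \<in> sets borel" "G \<in> borel_measurable borel"
  shows "(\<integral>x. G x \<partial>lebesgue_on S) = (\<integral>x. indicator S x * G x \<partial>lborel)"
    and "integrable (lebesgue_on S) G \<longleftrightarrow> integrable lborel (\<lambda>x. indicator S x * G x)"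
proof -
  have m: "(\<lambda>x. indicator S x * G x) \<in> borel_measurable lborel" using assms by auto
  have S: "S \<inter> space lebesgue \<in> sets lebesgue" using assms by auto
  show "(\<integral>x. G x \<partial>lebesgue_on S) = (\<integral>x. indicator S x * G x \<partial>lborel)"
    using integral_restrict_space[OF S, of G] integral_completion[OF m] by simp
  show "integrable (lebesgue_on S) G \<longleftrightarrow> integrable lborel (\<lambda>x. indicator S x * G x)"
    using integrable_restrict_space[OF S, of G] integrable_completion[OF m] by simp
qed

lemma borel_measurable_lebesgue_on:
  "G \<in> borel_measurable borel \<Longrightarrow> G \<in> borel_measurable (lebesgue_on S)"
  by (simp add: measurable_completion measurable_restrict_space1)

text \<open>The Sobolev definitions use the completed measure, while Fubini and translations are
  applied to Borel functions on \<open>lborel\<close>. Extension by 0 turns integrals over S into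
  integrals over the whole space.\<close>

lemma borel_representative:
  fixes f :: "'a::euclidean_space \<Rightarrow> real"
  assumes S: "S \<in> sets borel" and f: "f \<in> borel_measurable (lebesgue_on S)"
  obtains F where "F \<in> borel_measurable borel" "\<And>x. x \<notin> S \<Longrightarrow> F x = 0"
    "AE x in lebesgue_on S. F x = f x"
proof -
  have Sl: "S \<inter> space lebesgue \<in> sets lebesgue" using S by auto
  have "(\<lambda>x. indicator S x *\<^sub>R f x) \<in> borel_measurable lebesgue"
    using f borel_measurable_restrict_space_iff[OF Sl, of f] by simp
  then obtain F' where F': "F' \<in> borel_measurable lborel" "AE x in lborel. indicator S x *\<^sub>R f x = F' x"
    using completion_ex_borel_measurable_real by blast
  show thesis
  proof (rule that[of "\<lambda>x. indicator S x * F' x"])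
    show "(\<lambda>x. indicator S x * F' x) \<in> borel_measurable borel" using F' S by auto
    have "AE x in lebesgue. x \<in> S \<longrightarrow> indicator S x * F' x = f x"
      using AE_completion[OF F'(2)] by eventually_elim (auto simp: indicator_def)
    then show "AE x in lebesgue_on S. indicator S x * F' x = f x"
      using S by (subst AE_restrict_space_iff) auto
  qed auto
qed

lemma sqint_representative:
  fixes f :: "'a::euclidean_space \<Rightarrow> real"
  assumes S: "S \<in> sets borel" and f: "sqint (lebesgue_on S) f"
  obtains F where "F \<in> borel_measurable borel" "\<And>x. x \<notin> S \<Longrightarrow> F x = 0"
    "AE x in lebesgue_on S. F x = f x" "integrable lborel (\<lambda>x. (F x)\<^sup>2)"
proof -
  obtain F where F: "F \<in> borel_measurable borel" "\<And>x. x \<notin> S \<Longrightarrow> F x = 0" "AE x in lebesgue_on S. F x = f x"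
    using borel_representative[OF S sqintD(1)[OF f]] by blast
  have mF: "F \<in> borel_measurable (lebesgue_on S)" by (rule borel_measurable_lebesgue_on[OF F(1)])
  have "integrable (lebesgue_on S) (\<lambda>x. (F x)\<^sup>2) \<longleftrightarrow> integrable (lebesgue_on S) (\<lambda>x. (f x)\<^sup>2)"
  proof (rule integrable_cong_AE)
    show "AE x in lebesgue_on S. (F x)\<^sup>2 = (f x)\<^sup>2" using F(3) by eventually_elim simp
  qed (use mF f in auto)
  then have "integrable lborel (\<lambda>x. indicator S x * (F x)\<^sup>2)"
    using f lebesgue_on_integral_lborel(2)[OF S, of "\<lambda>x. (F x)\<^sup>2"] F(1) by auto
  moreover have "(\<lambda>x. indicator S x * (F x)\<^sup>2) = (\<lambda>x. (F x)\<^sup>2)" using F(2) by (auto simp: indicator_def fun_eq_iff)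
  ultimately show thesis using that F by simp
qed

section \<open>Weak gradients as explicit data, and test functions\<close>

text \<open>\<open>grad\<close> is a mere choice among the weak gradients. With the gradient as an
  explicit datum, linear combinations, restrictions and limits can be formed directly; almost
  everywhere uniqueness reconciles the result with \<open>grad\<close>.\<close>

definition h1pair :: "(real^'d) set \<Rightarrow> (real^'d \<Rightarrow> real) \<Rightarrow> (real^'d \<Rightarrow> real^'d) \<Rightarrow> bool" where
  "h1pair S f g \<longleftrightarrow> sqint (lebesgue_on S) f \<and> weak_grad S f g \<and> (\<forall>i. sqint (lebesgue_on S) (\<lambda>x. g x $ i))"

lemma h1pair_grad: "H1 S f \<Longrightarrow> h1pair S f (grad S f)"
  unfolding H1_def h1pair_def grad_def L2_sqint[symmetric]
  using someI_ex[of "\<lambda>g. weak_grad S f g \<and> (\<forall>i. L2 S (\<lambda>x. g x $ i))"] by simp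

lemma h1pair_H1: "h1pair S f g \<Longrightarrow> H1 S f"
  unfolding H1_def h1pair_def L2_sqint by blast

lemma test_funD:
  assumes "test_fun S \<phi>"
  shows "smooth_fun \<phi>" "compact (closure {x. \<phi> x \<noteq> 0})" "closure {x. \<phi> x \<noteq> 0} \<subseteq> S"
    "x \<notin> S \<Longrightarrow> \<phi> x = 0" "x \<notin> closure {x. \<phi> x \<noteq> 0} \<Longrightarrow> \<phi> x = 0"
  using assms closure_subset[of "{x. \<phi> x \<noteq> 0}"] by (auto simp: test_fun_def)

lemma test_funI:
  assumes "smooth_fun \<phi>" "compact K" "K \<subseteq> S" "\<And>x. x \<notin> K \<Longrightarrow> \<phi> x = 0"
  shows "test_fun S \<phi>"
proof -
  have "closure {x. \<phi> x \<noteq> 0} \<subseteq> K"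
    using assms by (intro closure_minimal compact_imp_closed) auto
  moreover have "compact (closure {x. \<phi> x \<noteq> 0})"
    using calculation assms(2) by (metis closed_closure compact_Int_closed inf.absorb_iff2)
  ultimately show ?thesis using assms by (auto simp: test_fun_def)
qed

lemma test_fun_mono: "test_fun S \<phi> \<Longrightarrow> S \<subseteq> T \<Longrightarrow> test_fun T \<phi>"
  by (auto simp: test_fun_def)

lemma test_fun_mult_smooth:
  assumes "test_fun S \<phi>" "smooth_fun \<psi>"
  shows "test_fun S (\<lambda>x. \<phi> x * \<psi> x)"
  by (rule test_funI[OF smooth_fun_mult[OF test_funD(1)[OF assms(1)] assms(2)] test_funD(2,3)[OF assms(1)]])
     (metis test_funD(5)[OF assms(1)] mult_zero_left)

lemma clgrad_smooth:
  assumes "smooth_fun \<phi>"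
  shows "smooth_fun (\<lambda>x. clgrad \<phi> x $ i)"
  using smooth_funD(2)[OF assms, of "axis i 1"] by (auto simp: clgrad_def axis_in_Basis_iff)

lemma clgrad_zero_outside:
  assumes "closed K" "\<And>y. y \<notin> K \<Longrightarrow> f y = 0" "x \<notin> K"
  shows "clgrad f x = 0"
  using frechet_derivative_zero_outside[OF assms] by (simp add: clgrad_def vec_eq_iff)

lemma test_fun_clgrad:
  assumes "test_fun S \<phi>"
  shows "test_fun S (\<lambda>x. clgrad \<phi> x $ i)"
proof (rule test_funI[OF clgrad_smooth[OF test_funD(1)[OF assms]] test_funD(2,3)[OF assms]])
  fix x assume "x \<notin> closure {x. \<phi> x \<noteq> 0}"
  then have "clgrad \<phi> x = 0"
    using clgrad_zero_outside[of "closure {x. \<phi> x \<noteq> 0}" \<phi> x] test_funD(5)[OF assms] by blast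
  then show "clgrad \<phi> x $ i = 0" by (simp only: zero_index)
qed

lemma clgrad_mult:
  assumes "smooth_fun \<phi>" "smooth_fun \<psi>"
  shows "clgrad (\<lambda>x. \<phi> x * \<psi> x) x = \<phi> x *\<^sub>R clgrad \<psi> x + \<psi> x *\<^sub>R clgrad \<phi> x"
  by (simp add: clgrad_def vec_eq_iff mult.commute
      frechet_derivative_mult_real[OF smooth_funD(1)[OF assms(1)] smooth_funD(1)[OF assms(2)]])

lemma test_fun_bounded:
  assumes "test_fun S \<phi>" obtains B where "B \<ge> 0" "\<And>x. \<bar>\<phi> x\<bar> \<le> B"
  using smooth_compact_bounded[OF test_funD(1,2,5)[OF assms]] by metis

lemma test_fun_sqint:
  assumes "test_fun S \<phi>" and T: "T \<in> sets lebesgue" shows "sqint (lebesgue_on T) \<phi>"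
proof -
  have t: "test_fun S (\<lambda>x. \<phi> x * \<phi> x)" by (rule test_fun_mult_smooth[OF assms(1) test_funD(1)[OF assms(1)]])
  have m: "\<phi> \<in> borel_measurable borel" by (rule smooth_fun_measurable[OF test_funD(1)[OF assms(1)]])
  have "integrable lborel (\<lambda>x. \<phi> x * \<phi> x)"
    by (rule smooth_compact_integrable[OF test_funD(1,2,5)[OF t]])
  then have i: "integrable lebesgue (\<lambda>x. (\<phi> x)\<^sup>2)"
    using m integrable_completion[of "\<lambda>x. \<phi> x * \<phi> x" lborel] by (simp add: power2_eq_square)
  have "integrable lebesgue (\<lambda>x. indicator T x *\<^sub>R (\<phi> x)\<^sup>2)"
    using integrable_mult_indicator[OF T i] .
  then show ?thesis
    unfolding sqint_def using T by (auto simp: integrable_restrict_space borel_measurable_lebesgue_on m)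
qed

section \<open>Cut-off functions on cubes\<close>

lemma mem_cube: "x \<in> cube c s \<longleftrightarrow> (\<forall>b\<in>Basis. \<bar>(x - c) \<bullet> b\<bar> < s / 2)"
proof -
  have "x \<in> cube c s \<longleftrightarrow> (\<forall>b\<in>Basis. c \<bullet> b - s / 2 < x \<bullet> b \<and> x \<bullet> b < c \<bullet> b + s / 2)"
    by (simp add: cube_def mem_box inner_diff_left inner_add_left)
  also have "\<dots> \<longleftrightarrow> (\<forall>b\<in>Basis. \<bar>(x - c) \<bullet> b\<bar> < s / 2)"
    unfolding inner_diff_left by (intro ball_cong refl) linarith
  finally show ?thesis .
qed

lemma mem_cube_infnorm: "x \<in> cube c s \<longleftrightarrow> infnorm (x - c) < s / 2"
  unfolding mem_cube infnorm_Max by (subst Max_less_iff) auto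

lemma open_cube [simp]: "open (cube c s)" by (simp add: cube_def open_box)

lemma cube_borel [measurable, simp]: "cube c s \<in> sets borel" by (simp add: cube_def)

lemma cube_mono: "s \<le> t \<Longrightarrow> cube c s \<subseteq> cube c t"
  by (auto simp: mem_cube_infnorm)

text \<open>The derivative in the direction of the gradient v itself is |v|^2, and the Lipschitz
  bound makes it at most B |v|. This yields the Euclidean norm without a factor depending on the
  dimension, so that the Caccioppoli constant stays sharp.\<close>

lemma clgrad_lipschitz_bound:
  fixes f :: "real^'d \<Rightarrow> real"
  assumes f: "smooth_fun f" "compact K" "\<And>y. y \<notin> K \<Longrightarrow> f y = 0"
    and lip: "\<And>x y. \<bar>f x - f y\<bar> \<le> B * norm (x - y)" and "B \<ge> 0"
  shows "norm (clgrad f x) \<le> B"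
proof -
  obtain C where C: "C \<ge> 0" "\<And>x h. \<bar>f (x + h) - f x - frechet_derivative f (at x) h\<bar> \<le> C * (norm h)\<^sup>2"
    using smooth_compact_remainder[OF f] by metis
  have lin: "linear (frechet_derivative f (at x))"
    using smooth_fun_has_derivative[OF f(1)] has_derivative_linear by blast
  let ?v = "clgrad f x"
  have "frechet_derivative f (at x) ?v = (\<Sum>b\<in>Basis. (?v \<bullet> b) * frechet_derivative f (at x) b)"
    by (rule frechet_derivative_expand[OF smooth_funD(1)[OF f(1)]])
  also have "\<dots> = (\<Sum>b\<in>Basis. (?v \<bullet> b) * (?v \<bullet> b))"
  proof (rule sum.cong)
    fix b :: "real^'d" assume "b \<in> Basis"
    then obtain i where "b = axis i 1" by (auto simp: Basis_vec_def)
    then show "(?v \<bullet> b) * frechet_derivative f (at x) b = (?v \<bullet> b) * (?v \<bullet> b)"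
      by (simp add: clgrad_def inner_axis)
  qed simp
  also have "\<dots> = (norm ?v)\<^sup>2" by (simp add: power2_norm_eq_inner euclidean_inner[of ?v ?v])
  finally have v: "frechet_derivative f (at x) ?v = (norm ?v)\<^sup>2" .
  have "(norm ?v)\<^sup>2 \<le> B * norm ?v + e" if e: "e > 0" for e
  proof -
    \<comment> \<open>A step length for which the quadratic remainder, divided by t, stays below e;
      the added 1 keeps the denominator positive.\<close>
    define t where "t = e / (C * (norm ?v)\<^sup>2 + 1)"
    have den: "C * (norm ?v)\<^sup>2 + 1 > 0" using C(1) by (simp add: add_nonneg_pos)
    have t: "t > 0" using e den by (simp add: t_def)
    have "t * (norm ?v)\<^sup>2 = frechet_derivative f (at x) (t *\<^sub>R ?v)"
      by (simp add: linear_cmul[OF lin] v)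
    also have "\<dots> \<le> \<bar>f (x + t *\<^sub>R ?v) - f x\<bar> + C * (norm (t *\<^sub>R ?v))\<^sup>2"
      using C(2)[of x "t *\<^sub>R ?v"] by linarith
    also have "\<dots> \<le> B * norm (t *\<^sub>R ?v) + C * (norm (t *\<^sub>R ?v))\<^sup>2"
      using lip[of "x + t *\<^sub>R ?v" x] by simp
    also have "\<dots> = t * (B * norm ?v + t * (C * (norm ?v)\<^sup>2))"
      using t by (simp add: power2_eq_square algebra_simps)
    finally have "(norm ?v)\<^sup>2 \<le> B * norm ?v + t * (C * (norm ?v)\<^sup>2)" using t by simp
    also have "t * (C * (norm ?v)\<^sup>2) \<le> t * (C * (norm ?v)\<^sup>2 + 1)" using t by (intro mult_left_mono) auto
    also have "\<dots> = e" using den by (simp add: t_def)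
    finally show ?thesis by simp
  qed
  then have "(norm ?v)\<^sup>2 \<le> B * norm ?v" by (rule field_le_epsilon)
  then show ?thesis using assms(5) by (cases "norm ?v = 0") (auto simp: power2_eq_square)
qed

text \<open>A ramp of slope B in the maximum norm is mollified. That norm fits the cubes and is
  1-Lipschitz for the Euclidean norm, and averaging preserves Lipschitz constants. The half sides
  differ by (t - s)/2, so \<open>B * (t - s) > 2\<close> leaves spare width for a ramp from 1 to
  0.\<close>

lemma cutoff_exists:
  fixes c :: "real^'d"
  assumes st: "0 \<le> s" "s < t" and B: "B * (t - s) > 2"
  obtains \<eta> where "test_fun (cube c t) \<eta>" "\<And>x. x \<in> cube c s \<Longrightarrow> \<eta> x = 1"
    "\<And>x. 0 \<le> \<eta> x" "\<And>x. \<eta> x \<le> 1" "\<And>x. norm (clgrad \<eta> x) \<le> B"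
proof -
  have B0: "B > 0" using st B by (smt (verit) mult_nonpos_nonneg)
  \<comment> \<open>A third of the spare width. The ramp runs from s/2 + r to t/2 - 2r; mollifying
    at radius r then leaves the value 1 on the inner cube and the value 0 beyond t/2 - r.\<close>
  define r where "r = ((t - s) / 2 - 1 / B) / 3"
  have r: "r > 0" using B B0 by (simp add: r_def field_simps)
  have r3: "B * ((t - s) / 2 - 3 * r) = 1" using B0 by (simp add: r_def field_simps)
  define z where "z x = max 0 (min 1 (B * (t / 2 - 2 * r - infnorm (x - c))))" for x
  have zb: "0 \<le> z x" "z x \<le> 1" for x by (auto simp: z_def)
  have zlip: "\<bar>z x - z y\<bar> \<le> B * norm (x - y)" for x y
  proof -
    have "\<bar>infnorm (x - c) - infnorm (y - c)\<bar> \<le> infnorm ((x - c) - (y - c))" by (rule absdiff_infnorm)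
    also have "\<dots> \<le> norm (x - y)" using infnorm_le_norm[of "x - y"] by simp
    finally have "B * \<bar>infnorm (x - c) - infnorm (y - c)\<bar> \<le> B * norm (x - y)" using B0 by simp
    moreover have "B * \<bar>infnorm (x - c) - infnorm (y - c)\<bar> = \<bar>B * (t / 2 - 2 * r - infnorm (x - c)) - B * (t / 2 - 2 * r - infnorm (y - c))\<bar>"
      using B0 by (simp add: right_diff_distrib[symmetric] abs_mult)
    moreover have "\<bar>max 0 (min 1 p) - max 0 (min 1 q)\<bar> \<le> \<bar>p - q\<bar>" for p q :: real
      by (auto simp: max_def min_def)
    note this[of "B * (t / 2 - 2 * r - infnorm (x - c))" "B * (t / 2 - 2 * r - infnorm (y - c))"]
    ultimately show ?thesis unfolding z_def by linarith
  qed
  have zcont: "continuous_on S z" for S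
    unfolding z_def by (intro continuous_intros) (simp add: continuous_on_infnorm continuous_intros)
  have cp: "compact {x. infnorm (x - c) \<le> a}" for a
  proof -
    have "{x. infnorm (x - c) \<le> a} = {x. \<forall>b\<in>Basis. \<bar>(x - c) \<bullet> b\<bar> \<le> a}"
      unfolding infnorm_Max by (subst Max_le_iff) auto
    also have "\<dots> = cbox (c - a *\<^sub>R One) (c + a *\<^sub>R One)"
    proof (intro set_eqI)
      fix x
      have "(\<forall>b\<in>Basis. \<bar>(x - c) \<bullet> b\<bar> \<le> a) \<longleftrightarrow> (\<forall>b\<in>Basis. c \<bullet> b - a \<le> x \<bullet> b \<and> x \<bullet> b \<le> c \<bullet> b + a)"
        unfolding inner_diff_left by (intro ball_cong refl) linarith
      then show "x \<in> {x. \<forall>b\<in>Basis. \<bar>(x - c) \<bullet> b\<bar> \<le> a} \<longleftrightarrow> x \<in> cbox (c - a *\<^sub>R One) (c + a *\<^sub>R One)"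
        by (simp add: mem_box inner_diff_left inner_add_left)
    qed
    finally show ?thesis by simp
  qed
  have z0: "z x = 0" if "infnorm (x - c) > t / 2 - 2 * r" for x
    using mult_nonneg_nonpos[of B "t / 2 - 2 * r - infnorm (x - c)"] that B0 by (auto simp: z_def)
  have z1: "z x = 1" if "infnorm (x - c) \<le> s / 2 + r" for x
  proof -
    have "1 = B * ((t - s) / 2 - 3 * r)" using r3 by simp
    also have "\<dots> \<le> B * (t / 2 - 2 * r - infnorm (x - c))"
      using that B0 by (intro mult_left_mono) (auto simp: field_simps)
    finally show ?thesis by (simp add: z_def)
  qed
  have zm [measurable]: "z \<in> borel_measurable borel" by (rule borel_measurable_continuous_onI[OF zcont])
  have zint: "integrable lborel z"
  proof -
    have "integrable lborel (\<lambda>x. indicator {x. infnorm (x - c) \<le> t / 2 - 2 * r} x *\<^sub>R z x)"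
      by (rule borel_integrable_compact[OF cp zcont])
    moreover have "(\<lambda>x. indicator {x. infnorm (x - c) \<le> t / 2 - 2 * r} x *\<^sub>R z x) = z"
      using z0 by (force simp: indicator_def fun_eq_iff)
    ultimately show ?thesis by simp
  qed
  obtain \<psi> :: "real^'d \<Rightarrow> real" where m: "mollifier r \<psi>" using mollifier_exists[OF r] by blast
  have psi: "smooth_fun \<psi>" "\<And>x. \<psi> x \<ge> 0" "\<And>x. \<psi> x \<noteq> 0 \<Longrightarrow> norm x \<le> r" "integrable lborel \<psi>" "(\<integral>x. \<psi> x \<partial>lborel) = 1"
    using m by (auto simp: mollifier_def)
  have psi0: "\<And>x. x \<notin> cball 0 r \<Longrightarrow> \<psi> x = 0" using psi(3) by force
  have [measurable]: "\<psi> \<in> borel_measurable borel" by (rule smooth_fun_measurable[OF psi(1)])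
  define \<eta> where "\<eta> = conv z \<psi>"
  have eq: "\<eta> x = (\<integral>y. z (x - y) * \<psi> y \<partial>lborel)" for x
    unfolding \<eta>_def conv_def using integral_reflect[of "\<lambda>y. z y * \<psi> (x - y)" x] by simp
  have ie: "integrable lborel (\<lambda>y. z (x - y) * \<psi> y)" for x
    using integrable_mult_bounded[OF psi(4), of "\<lambda>y. z (x - y)" 1] zb by (simp add: mult.commute)
  have sm: "smooth_fun \<eta>" unfolding \<eta>_def by (rule smooth_conv[OF zint psi(1) compact_cball psi0])
  have inf_near: "infnorm (x - y - c) \<le> infnorm (x - c) + r" "infnorm (x - c) \<le> infnorm (x - y - c) + r" if "\<psi> y \<noteq> 0" for x y
  proof -
    have "infnorm y \<le> r" using psi(3)[OF that] infnorm_le_norm[of y] by linarith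
    then show "infnorm (x - y - c) \<le> infnorm (x - c) + r" "infnorm (x - c) \<le> infnorm (x - y - c) + r"
      using absdiff_infnorm[of "x - y - c" "x - c"] infnorm_neg[of y] by (auto simp: abs_le_iff)
  qed
  have out: "\<eta> x = 0" if "x \<notin> {x. infnorm (x - c) \<le> t / 2 - r}" for x
  proof -
    have "z (x - y) * \<psi> y = 0" for y
      using that inf_near(2)[of y x] z0[of "x - y"] by (cases "\<psi> y = 0") auto
    then show ?thesis unfolding eq by (simp only: Bochner_Integration.integral_zero)
  qed
  show thesis
  proof (rule that)
    show "test_fun (cube c t) \<eta>"
      by (rule test_funI[OF sm cp _ out]) (use r in \<open>auto simp: mem_cube_infnorm\<close>)
    show "\<eta> x = 1" if "x \<in> cube c s" for x
    proof -
      have "z (x - y) * \<psi> y = \<psi> y" for y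
        using that inf_near(1)[of y x] z1[of "x - y"] by (cases "\<psi> y = 0") (auto simp: mem_cube_infnorm)
      then have "\<eta> x = (\<integral>y. \<psi> y \<partial>lborel)" unfolding eq by (simp only:)
      then show ?thesis using psi by simp
    qed
    show "0 \<le> \<eta> x" for x unfolding eq using zb psi by (auto intro!: integral_nonneg_AE)
    show "\<eta> x \<le> 1" for x
    proof -
      have "\<eta> x \<le> (\<integral>y. \<psi> y \<partial>lborel)" unfolding eq
        by (rule integral_mono[OF ie psi(4)]) (use zb psi in \<open>simp add: mult_left_le_one_le\<close>)
      then show ?thesis using psi by simp
    qed
    show "norm (clgrad \<eta> x) \<le> B" for x
    proof (rule clgrad_lipschitz_bound[OF sm cp out])
      fix x y
      have "\<eta> x - \<eta> y = (\<integral>u. z (x - u) * \<psi> u - z (y - u) * \<psi> u \<partial>lborel)" unfolding eq using ie by simp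
      also have "\<bar>\<dots>\<bar> \<le> (\<integral>u. B * norm (x - y) * \<psi> u \<partial>lborel)"
        unfolding real_norm_def[symmetric]
      proof (rule order_trans[OF integral_norm_bound], rule integral_mono)
        fix u
        have "\<bar>z (x - u) - z (y - u)\<bar> * \<psi> u \<le> B * norm (x - y) * \<psi> u"
          using zlip[of "x - u" "y - u"] psi(2)[of u] by (intro mult_right_mono) auto
        then show "norm (z (x - u) * \<psi> u - z (y - u) * \<psi> u) \<le> B * norm (x - y) * \<psi> u"
          using psi(2)[of u] by (simp add: left_diff_distrib[symmetric] abs_mult)
      qed (use ie psi in auto)
      also have "\<dots> = B * norm (x - y)" using psi by simp
      finally show "\<bar>\<eta> x - \<eta> y\<bar> \<le> B * norm (x - y)" .
    qed (use B0 in auto)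
  qed
qed

lemma abs_integral_le:
  fixes f g :: "'a \<Rightarrow> real"
  assumes "integrable M f" "integrable M g" "\<And>x. \<bar>f x\<bar> \<le> g x"
  shows "\<bar>\<integral>x. f x \<partial>M\<bar> \<le> (\<integral>x. g x \<partial>M)"
proof -
  have "\<bar>\<integral>x. f x \<partial>M\<bar> \<le> (\<integral>x. \<bar>f x\<bar> \<partial>M)" by (rule integral_abs_bound)
  also have "\<dots> \<le> (\<integral>x. g x \<partial>M)" using assms by (intro integral_mono) auto
  finally show ?thesis .
qed

text \<open>The integral of f(x + t b) - f(x) is 0 by translation invariance, so t times the
  integral of the derivative is a pure linearization error, at most t^2 times a constant.\<close>

lemma integral_frechet_derivative_zero:
  fixes f :: "'a::euclidean_space \<Rightarrow> real"
  assumes f: "smooth_fun f" "compact K" "\<And>y. y \<notin> K \<Longrightarrow> f y = 0" and b: "b \<in> Basis"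
  shows "(\<integral>x. frechet_derivative f (at x) b \<partial>lborel) = 0"
proof -
  obtain C where C: "C \<ge> 0" "\<And>x h. \<bar>f (x + h) - f x - frechet_derivative f (at x) h\<bar> \<le> C * (norm h)\<^sup>2"
    using smooth_compact_remainder[OF f] by metis
  have D0: "frechet_derivative f (at x) = (\<lambda>h. 0)" if "x \<notin> K" for x
    by (rule frechet_derivative_zero_outside[OF compact_imp_closed[OF f(2)] f(3) that])
  obtain R where R: "K \<subseteq> cball 0 R" using bounded_subset_ballD[OF compact_imp_bounded[OF f(2)], of 0] ball_subset_cball by blast
  have i: "integrable lborel f" by (rule smooth_compact_integrable[OF f])
  have iD: "integrable lborel (\<lambda>x. frechet_derivative f (at x) b)"
    by (rule smooth_compact_integrable[OF smooth_funD(2)[OF f(1) b] f(2)]) (simp add: D0)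
  let ?D = "\<integral>x. frechet_derivative f (at x) b \<partial>lborel"
  \<comment> \<open>The radius R + 1 accommodates shifts \<open>t *\<^sub>R b\<close> of length at
    most 1.\<close>
  define V where "V = measure lborel (cball (0::'a) (R + 1))"
  have est: "\<bar>?D\<bar> \<le> t * (C * V)" if t: "0 < t" "t \<le> 1" for t
  proof -
    have lin: "linear (frechet_derivative f (at x))" for x
      using smooth_fun_has_derivative[OF f(1)] has_derivative_linear by blast
    have "t * ?D = - (\<integral>x. f (x + t *\<^sub>R b) - f x - t * frechet_derivative f (at x) b \<partial>lborel)"
      using i iD integrable_translate[OF i] integral_translate[of f "t *\<^sub>R b"] smooth_fun_measurable[OF f(1)] by simp
    then have "\<bar>t * ?D\<bar> = \<bar>\<integral>x. f (x + t *\<^sub>R b) - f x - t * frechet_derivative f (at x) b \<partial>lborel\<bar>" by simp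
    also have "\<dots> \<le> (\<integral>x. C * t\<^sup>2 * indicator (cball (0::'a) (R + 1)) x \<partial>lborel)"
    proof (rule abs_integral_le)
      show "integrable lborel (\<lambda>x. C * t\<^sup>2 * indicator (cball (0::'a) (R + 1)) x)"
        using emeasure_lborel_cball_finite[of "0::'a" "R + 1"]
        by (intro integrable_mult_right integrable_real_indicator) auto
      fix x :: 'a
      show "\<bar>f (x + t *\<^sub>R b) - f x - t * frechet_derivative f (at x) b\<bar> \<le> C * t\<^sup>2 * indicator (cball (0::'a) (R + 1)) x"
      proof (cases "x \<in> cball 0 (R + 1)")
        case True
        then show ?thesis using C(2)[of x "t *\<^sub>R b"] b t by (simp add: linear_cmul[OF lin])
      next
        case False
        have "norm x \<le> norm (x + t *\<^sub>R b) + norm (t *\<^sub>R b)" by (metis add_diff_cancel_right' norm_triangle_ineq4)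
        then have "x + t *\<^sub>R b \<notin> K" "x \<notin> K" using False R b t by auto
        then show ?thesis using f(3) D0 False by simp
      qed
    qed (use i iD integrable_translate[OF i] in auto)
    also have "\<dots> = C * t\<^sup>2 * V" by (simp add: V_def)
    finally have "t * \<bar>?D\<bar> \<le> t * (t * (C * V))" using t by (simp add: abs_mult power2_eq_square mult_ac)
    then show ?thesis using t by simp
  qed
  have "\<bar>?D\<bar> \<le> 0 + e" if e: "e > 0" for e
  proof -
    have CV: "C * V \<ge> 0" using C by (simp add: V_def)
    define t where "t = min 1 (e / (C * V + 1))"
    have t: "0 < t" "t \<le> 1" using e CV by (auto simp: t_def)
    have "t * (C * V) \<le> e / (C * V + 1) * (C * V)" using CV by (intro mult_right_mono) (auto simp: t_def)
    also have "\<dots> \<le> e" using CV e by (simp add: field_simps)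
    finally show ?thesis using est[OF t] by simp
  qed
  then have "\<bar>?D\<bar> \<le> 0" by (rule field_le_epsilon)
  then show ?thesis by simp
qed

section \<open>Approximation by test functions\<close>

lemma test_fun_sqint_lborel:
  assumes "test_fun S \<phi>" shows "sqint lborel \<phi>"
  using smooth_compact_integrable[OF test_funD(1,2,5)[OF test_fun_mult_smooth[OF assms test_funD(1)[OF assms]]]]
    smooth_fun_measurable[OF test_funD(1)[OF assms]]
  by (simp add: sqint_def power2_eq_square)

lemma integral_AE_representative:
  fixes f F :: "'a::euclidean_space \<Rightarrow> real"
  assumes S: "S \<in> sets borel" and m: "F \<in> borel_measurable borel" "\<phi> \<in> borel_measurable borel"
    and f: "f \<in> borel_measurable (lebesgue_on S)"
    and F: "\<And>x. x \<notin> S \<Longrightarrow> F x = 0" "AE x in lebesgue_on S. F x = f x"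
  shows "(\<integral>x. f x * \<phi> x \<partial>lebesgue_on S) = (\<integral>x. F x * \<phi> x \<partial>lborel)"
proof -
  have "(\<integral>x. f x * \<phi> x \<partial>lebesgue_on S) = (\<integral>x. F x * \<phi> x \<partial>lebesgue_on S)"
  proof (rule integral_cong_AE)
    show "AE x in lebesgue_on S. f x * \<phi> x = F x * \<phi> x" using F(2) by eventually_elim simp
  qed (use f borel_measurable_lebesgue_on[OF m(1)] borel_measurable_lebesgue_on[OF m(2)] in auto)
  also have "\<dots> = (\<integral>x. indicator S x * (F x * \<phi> x) \<partial>lborel)"
    by (rule lebesgue_on_integral_lborel[OF S]) (use m in auto)
  also have "\<dots> = (\<integral>x. F x * \<phi> x \<partial>lborel)"
    by (intro Bochner_Integration.integral_cong) (auto simp: indicator_def F(1))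
  finally show ?thesis .
qed

lemma integral_lebesgue_on_le:
  fixes f :: "'a::euclidean_space \<Rightarrow> real"
  assumes S: "S \<in> sets borel" and i: "integrable lborel f" and "\<And>x. f x \<ge> 0"
  shows "(\<integral>x. f x \<partial>lebesgue_on S) \<le> (\<integral>x. f x \<partial>lborel)" and "integrable (lebesgue_on S) f"
proof -
  have m: "f \<in> borel_measurable borel" using i by (auto dest: borel_measurable_integrable)
  have "integrable lborel (\<lambda>x. indicator S x *\<^sub>R f x)"
    using S by (intro integrable_mult_indicator i) auto
  then have i2: "integrable lborel (\<lambda>x. indicator S x * f x)" by simp
  then show "integrable (lebesgue_on S) f" using lebesgue_on_integral_lborel(2)[OF S m] by simp
  show "(\<integral>x. f x \<partial>lebesgue_on S) \<le> (\<integral>x. f x \<partial>lborel)"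
    unfolding lebesgue_on_integral_lborel(1)[OF S m]
    by (rule integral_mono[OF i2 i]) (use assms(3) in \<open>auto simp: indicator_def\<close>)
qed

lemma L2lim_cong_AE:
  assumes "L2lim M f g" "g' \<in> borel_measurable M" "AE x in M. g x = g' x"
  shows "L2lim M f g'"
proof -
  note f = L2limD[OF assms(1)]
  have "integrable M (\<lambda>x. (g x)\<^sup>2) \<longleftrightarrow> integrable M (\<lambda>x. (g' x)\<^sup>2)"
  proof (rule integrable_cong_AE)
    show "AE x in M. (g x)\<^sup>2 = (g' x)\<^sup>2" using assms(3) by eventually_elim simp
  qed (use assms(2) sqintD(1)[OF f(2)] in auto)
  then have g': "sqint M g'" using assms(2) sqintD(2)[OF f(2)] by (simp add: sqint_def)
  have "(\<integral>x. (f k x - g x)\<^sup>2 \<partial>M) = (\<integral>x. (f k x - g' x)\<^sup>2 \<partial>M)" for k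
  proof (rule integral_cong_AE)
    show "AE x in M. (f k x - g x)\<^sup>2 = (f k x - g' x)\<^sup>2" using assms(3) by eventually_elim simp
  qed (use sqintD(1)[OF f(1)] sqintD(1)[OF f(2)] assms(2) in auto)
  then show ?thesis using f g' by (simp add: L2lim_def)
qed

lemma reflected_smooth:
  "smooth_fun \<psi> \<Longrightarrow> smooth_fun (\<lambda>y. \<psi> (x - y))"
  using smooth_fun_affine[of \<psi> 1 x "-1"] by simp

lemma clgrad_reflected:
  assumes "smooth_fun \<psi>"
  shows "clgrad (\<lambda>y. \<psi> (x - y)) y $ i = - (clgrad \<psi> (x - y) $ i)"
  using frechet_derivative_at[OF frechet_derivative_affine[OF smooth_funD(1)[OF assms], of 1 x "-1" y], symmetric]
  by (simp add: clgrad_def)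

lemma compact_closed_neighbourhood:
  fixes K :: "'a::euclidean_space set"
  assumes "compact K" "open S" "K \<subseteq> S"
  obtains e N where "e > 0" "\<And>x y. y \<in> K \<Longrightarrow> norm (x - y) \<le> e \<Longrightarrow> x \<in> N" "N \<subseteq> S" "compact N"
proof (cases "K = {}")
  case True
  then show thesis using that[of 1 "{}"] by simp
next
  case False
  obtain e where e: "e > 0" "{x. infdist x K \<le> e} \<subseteq> S"
    using compact_in_open_separated[OF False assms(1,2,3)] by blast
  show thesis
  proof (rule that[OF e(1) _ e(2) compact_infdist_le[OF False assms(1) e(1)]])
    fix x y assume "y \<in> K" "norm (x - y) \<le> e"
    then have "infdist x K \<le> e" using infdist_le2[of y K x e] by (simp add: dist_norm)
    then show "x \<in> {x. infdist x K \<le> e}" by simp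
  qed
qed

text \<open>Since \<open>\<eta> \<psi>(x - \<cdot>)\<close> is a test function, the weak derivative can be moved onto the cut-off function.\<close>

lemma mollified_cutoff:
  fixes f :: "real^'d \<Rightarrow> real"
  assumes S: "open S" and h: "h1pair S f g" and \<eta>: "test_fun S \<eta>"
  shows "\<exists>\<phi>. (\<forall>k. test_fun S (\<phi> k)) \<and> L2lim (lebesgue_on S) \<phi> (\<lambda>x. \<eta> x * f x) \<and>
    (\<forall>i. L2lim (lebesgue_on S) (\<lambda>k x. clgrad (\<phi> k) x $ i) (\<lambda>x. \<eta> x * g x $ i + f x * clgrad \<eta> x $ i))"
proof -
  have Sb: "S \<in> sets borel" using S by auto
  have fg: "sqint (lebesgue_on S) f" "weak_grad S f g" "\<And>i. sqint (lebesgue_on S) (\<lambda>x. g x $ i)"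
    using h by (auto simp: h1pair_def)
  obtain F where F: "F \<in> borel_measurable borel" "\<And>x. x \<notin> S \<Longrightarrow> F x = 0"
    "AE x in lebesgue_on S. F x = f x" "integrable lborel (\<lambda>x. (F x)\<^sup>2)"
    using sqint_representative[OF Sb fg(1)] by blast
  have "\<forall>i. \<exists>G. G \<in> borel_measurable borel \<and> (\<forall>x. x \<notin> S \<longrightarrow> G x = 0) \<and>
    (AE x in lebesgue_on S. G x = g x $ i) \<and> integrable lborel (\<lambda>x. (G x)\<^sup>2)"
    by (intro allI, rule sqint_representative[OF Sb fg(3)]) blast
  from choice[OF this] obtain G where G0: "\<forall>i. G i \<in> borel_measurable borel \<and> (\<forall>x. x \<notin> S \<longrightarrow> G i x = 0) \<and>
    (AE x in lebesgue_on S. G i x = g x $ i) \<and> integrable lborel (\<lambda>x. (G i x)\<^sup>2)" by blast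
  have G: "\<And>i. G i \<in> borel_measurable borel" "\<And>i x. x \<notin> S \<Longrightarrow> G i x = 0"
    "\<And>i. AE x in lebesgue_on S. G i x = g x $ i" "\<And>i. integrable lborel (\<lambda>x. (G i x)\<^sup>2)"
    using G0 by blast+
  note [measurable] = F(1) G(1)
  have weak: "(\<integral>x. F x * clgrad \<phi> x $ i \<partial>lborel) = - (\<integral>x. G i x * \<phi> x \<partial>lborel)" if t: "test_fun S \<phi>" for \<phi> i
  proof -
    have m: "\<phi> \<in> borel_measurable borel" "(\<lambda>x. clgrad \<phi> x $ i) \<in> borel_measurable borel"
      by (intro smooth_fun_measurable clgrad_smooth test_funD(1)[OF t])+
    have "(\<integral>x. f x * clgrad \<phi> x $ i \<partial>lebesgue_on S) = - (\<integral>x. g x $ i * \<phi> x \<partial>lebesgue_on S)"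
      using fg(2) t unfolding weak_grad_def by blast
    moreover have "(\<integral>x. f x * clgrad \<phi> x $ i \<partial>lebesgue_on S) = (\<integral>x. F x * clgrad \<phi> x $ i \<partial>lborel)"
      by (rule integral_AE_representative[OF Sb F(1) m(2) sqintD(1)[OF fg(1)] F(2,3)])
    moreover have "(\<integral>x. g x $ i * \<phi> x \<partial>lebesgue_on S) = (\<integral>x. G i x * \<phi> x \<partial>lborel)"
      by (rule integral_AE_representative[OF Sb G(1) m(1) sqintD(1)[OF fg(3)] G(2,3)])
    ultimately show ?thesis by simp
  qed
  obtain B where B: "\<And>x. \<bar>\<eta> x\<bar> \<le> B" using test_fun_bounded[OF \<eta>] by metis
  have "\<forall>i. \<exists>B. \<forall>x. \<bar>clgrad \<eta> x $ i\<bar> \<le> B" using test_fun_bounded[OF test_fun_clgrad[OF \<eta>]] by metis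
  then obtain B' where B': "\<And>i x. \<bar>clgrad \<eta> x $ i\<bar> \<le> B' i" by metis
  have m\<eta> [measurable]: "\<eta> \<in> borel_measurable borel" "(\<lambda>x. clgrad \<eta> x $ i) \<in> borel_measurable borel" for i
    by (intro smooth_fun_measurable clgrad_smooth test_funD(1)[OF \<eta>])+
  \<comment> \<open>\<open>F'\<close> is the zero extension of eta f, and \<open>G'\<close> below is
    that of its gradient by the product rule.\<close>
  define F' where "F' x = \<eta> x * F x" for x
  define G' where "G' i x = \<eta> x * G i x + clgrad \<eta> x $ i * F x" for i x
  have sF: "sqint lborel F" and sG: "sqint lborel (G i)" for i using F G by (auto simp: sqint_def)
  have sF': "sqint lborel F'" unfolding F'_def[abs_def] by (rule sqint_mult_bounded[OF sF _ B]) auto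
  have sG': "sqint lborel (G' i)" for i unfolding G'_def[abs_def]
    by (intro sqint_add sqint_mult_bounded[OF sG _ B] sqint_mult_bounded[OF sF _ B']) auto
  have iF': "integrable lborel F'" unfolding F'_def[abs_def]
    by (rule sqint_mult_integrable[OF test_fun_sqint_lborel[OF \<eta>] sF])
  have iG': "integrable lborel (G' i)" for i unfolding G'_def[abs_def]
    by (intro Bochner_Integration.integrable_add sqint_mult_integrable[OF test_fun_sqint_lborel[OF \<eta>] sG]
        sqint_mult_integrable[OF test_fun_sqint_lborel[OF test_fun_clgrad[OF \<eta>]] sF])
  let ?K = "closure {x. \<eta> x \<noteq> 0}"
  have K: "compact ?K" "?K \<subseteq> S" using test_funD(2,3)[OF \<eta>] by blast+
  obtain e N where e: "e > 0" "\<And>x y. y \<in> ?K \<Longrightarrow> norm (x - y) \<le> e \<Longrightarrow> x \<in> N"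
     "N \<subseteq> S" "compact N"
    using compact_closed_neighbourhood[OF K(1) S K(2)] by blast
  define r where "r k = e / real (Suc k)" for k
  have r: "r k > 0" "r k \<le> e" for k
    using e(1) by (auto simp: r_def field_simps)
  have r0: "r \<longlonglongrightarrow> 0"
    unfolding r_def[abs_def] using tendsto_mult_right_zero[OF LIMSEQ_Suc[OF lim_1_over_n], of e] by simp
  have "\<forall>k. \<exists>\<psi> :: real^'d \<Rightarrow> real. mollifier (r k) \<psi>" using mollifier_exists[OF r(1)] by blast
  from choice[OF this] obtain \<psi> :: "nat \<Rightarrow> real^'d \<Rightarrow> real" where \<psi>: "\<And>k. mollifier (r k) (\<psi> k)" by blast
  have psi: "smooth_fun (\<psi> k)" "\<And>x. \<psi> k x \<noteq> 0 \<Longrightarrow> norm x \<le> r k" for k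
    using \<psi> by (auto simp: mollifier_def)
  have psi0: "\<And>x. x \<notin> cball 0 (r k) \<Longrightarrow> \<psi> k x = 0" for k using psi(2) by force
  define \<phi> where "\<phi> k = conv F' (\<psi> k)" for k
  have test: "test_fun S (\<phi> k)" for k
  proof (rule test_funI[OF _ e(4) e(3)])
    show "smooth_fun (\<phi> k)" unfolding \<phi>_def by (rule smooth_conv[OF iF' psi(1) compact_cball psi0])
    fix x assume x: "x \<notin> N"
    have "F' y * \<psi> k (x - y) = 0" for y
    proof (rule ccontr)
      assume "F' y * \<psi> k (x - y) \<noteq> 0"
      then have "\<eta> y \<noteq> 0" "norm (x - y) \<le> e" using psi(2)[of k "x - y"] r(2)[of k] by (auto simp: F'_def)
      then show False using x e(2)[of y x] closure_subset[of "{x. \<eta> x \<noteq> 0}"] by blast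
    qed
    then show "\<phi> k x = 0" unfolding \<phi>_def conv_def by (simp only: Bochner_Integration.integral_zero)
  qed
  have grad: "clgrad (\<phi> k) x $ i = conv (G' i) (\<psi> k) x" for k x i
  proof -
    have b: "axis i 1 \<in> (Basis :: (real^'d) set)" by (auto simp: axis_in_Basis_iff)
    let ?\<psi> = "\<lambda>y. \<psi> k (x - y)"
    have t: "test_fun S (\<lambda>y. \<eta> y * ?\<psi> y)" by (rule test_fun_mult_smooth[OF \<eta> reflected_smooth[OF psi(1)]])
    obtain M where M: "\<And>y. \<bar>\<psi> k y\<bar> \<le> M" using smooth_compact_bounded[OF psi(1) compact_cball psi0] by metis
    have cz: "clgrad (\<psi> k) y $ i = 0" if "y \<notin> cball 0 (r k)" for y
      using clgrad_zero_outside[of "cball 0 (r k)" "\<psi> k" y] psi0[of _ k] that by auto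
    obtain M' where M': "\<And>y. \<bar>clgrad (\<psi> k) y $ i\<bar> \<le> M'"
      using smooth_compact_bounded[OF clgrad_smooth[OF psi(1)] compact_cball cz] by metis
    have mm [measurable]: "?\<psi> \<in> borel_measurable borel" "(\<lambda>y. clgrad (\<psi> k) (x - y) $ i) \<in> borel_measurable borel"
      by (intro smooth_fun_measurable reflected_smooth clgrad_smooth psi(1))+
    have i1: "integrable lborel (\<lambda>y. F' y * clgrad (\<psi> k) (x - y) $ i)"
      by (rule integrable_mult_bounded[OF iF' _ M']) auto
    have iF2: "integrable lborel (\<lambda>y. clgrad \<eta> y $ i * F y)"
      by (rule sqint_mult_integrable[OF test_fun_sqint_lborel[OF test_fun_clgrad[OF \<eta>]] sF])
    have i2: "integrable lborel (\<lambda>y. (clgrad \<eta> y $ i * F y) * ?\<psi> y)"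
      by (rule integrable_mult_bounded[OF iF2 _ M]) auto
    have i3: "integrable lborel (\<lambda>y. (\<eta> y * G i y) * ?\<psi> y)"
      by (rule integrable_mult_bounded[OF sqint_mult_integrable[OF test_fun_sqint_lborel[OF \<eta>] sG] _ M]) auto
    \<comment> \<open>The gradient of the reflected kernel carries a minus sign. It turns the weak
      identity into a statement about two convolutions at x.\<close>
    have "(\<integral>y. F y * clgrad (\<lambda>y. \<eta> y * ?\<psi> y) y $ i \<partial>lborel) = (\<integral>y. (clgrad \<eta> y $ i * F y) * ?\<psi> y - F' y * clgrad (\<psi> k) (x - y) $ i \<partial>lborel)"
      by (intro Bochner_Integration.integral_cong)
         (auto simp: clgrad_mult[OF test_funD(1)[OF \<eta>] reflected_smooth[OF psi(1)]] clgrad_reflected[OF psi(1)] F'_def algebra_simps)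
    also have "\<dots> = (\<integral>y. (clgrad \<eta> y $ i * F y) * ?\<psi> y \<partial>lborel) - (\<integral>y. F' y * clgrad (\<psi> k) (x - y) $ i \<partial>lborel)"
      using i1 i2 by simp
    finally have "(\<integral>y. F' y * clgrad (\<psi> k) (x - y) $ i \<partial>lborel) = (\<integral>y. (clgrad \<eta> y $ i * F y) * ?\<psi> y \<partial>lborel) + (\<integral>y. (\<eta> y * G i y) * ?\<psi> y \<partial>lborel)"
      using weak[OF t, of i] by (simp add: mult_ac)
    also have "\<dots> = (\<integral>y. G' i y * ?\<psi> y \<partial>lborel)"
      using i2 i3 by (simp add: G'_def distrib_right add.commute flip: Bochner_Integration.integral_add)
    finally have "conv F' (\<lambda>y. clgrad (\<psi> k) y $ i) x = conv (G' i) (\<psi> k) x" by (simp add: conv_def)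
    then show ?thesis
      unfolding \<phi>_def clgrad_def
      using conv_frechet_derivative[where K="cball 0 (r k)" and x=x, OF iF' psi(1)[of k] compact_cball psi0 b] by simp
  qed
  have lim: "L2lim (lebesgue_on S) (\<lambda>k. conv H (\<psi> k)) H'" if H: "integrable lborel H" "sqint lborel H"
      and sq: "\<And>k. sqint (lebesgue_on S) (conv H (\<psi> k))"
      and H': "H' \<in> borel_measurable (lebesgue_on S)" "AE x in lebesgue_on S. H x = H' x" for H H'
  proof (rule L2lim_cong_AE[OF _ H'])
    have HS: "sqint (lebesgue_on S) H"
      using integral_lebesgue_on_le(2)[OF Sb sqintD(2)[OF H(2)]] borel_measurable_lebesgue_on[of H S] sqintD(1)[OF H(2)]
      by (auto simp: sqint_def)
    have "(\<lambda>k. \<integral>x. (conv H (\<psi> k) x - H x)\<^sup>2 \<partial>lebesgue_on S) \<longlonglongrightarrow> 0"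
    proof (rule tendsto_sandwich[where f="\<lambda>_. 0"])
      show "(\<lambda>k. \<integral>x. (conv H (\<psi> k) x - H x)\<^sup>2 \<partial>lborel) \<longlonglongrightarrow> 0"
        by (rule mollify_L2_tendsto[OF \<psi> r0 r(1) H(1) sqintD(2)[OF H(2)]])
      have "integrable lborel (\<lambda>x. (conv H (\<psi> k) x - H x)\<^sup>2)" for k
      proof -
        \<comment> \<open>A crude bound for all shifts, used to see that the squared error is
          integrable over the whole space.\<close>
        obtain C where C: "C \<ge> 0" "\<And>h. norm h \<le> r k \<Longrightarrow> (\<integral>x. (H (x + h) - H x)\<^sup>2 \<partial>lborel) \<le> C"
        proof (rule that[of "4 * (\<integral>x. (H x)\<^sup>2 \<partial>lborel)"])
          fix h
          have i: "integrable lborel (\<lambda>x. (H x)\<^sup>2)" using H(2) by auto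
          note it = integrable_translate[OF i, of h]
          have mH: "H \<in> borel_measurable borel" using H(2) by auto
          have "(\<integral>x. (H (x + h) - H x)\<^sup>2 \<partial>lborel) \<le> (\<integral>x. 2 * (H (x + h))\<^sup>2 + 2 * (H x)\<^sup>2 \<partial>lborel)"
            by (rule integral_mono) (use i it mH diff_square_le in \<open>auto intro!: integrable_square_diff\<close>)
          also have "\<dots> = 4 * (\<integral>x. (H x)\<^sup>2 \<partial>lborel)"
            using i it integral_translate[of "\<lambda>x. (H x)\<^sup>2" h] mH by simp
          finally show "(\<integral>x. (H (x + h) - H x)\<^sup>2 \<partial>lborel) \<le> 4 * (\<integral>x. (H x)\<^sup>2 \<partial>lborel)" .
        qed simp
        show ?thesis
          by (rule mollify_L2_bound(1)[OF \<psi> H(1) sqintD(2)[OF H(2)] C(2) C(1)])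
      qed
      from integral_lebesgue_on_le(1)[OF Sb this]
      show "\<forall>\<^sub>F k in sequentially. (\<integral>x. (conv H (\<psi> k) x - H x)\<^sup>2 \<partial>lebesgue_on S) \<le> (\<integral>x. (conv H (\<psi> k) x - H x)\<^sup>2 \<partial>lborel)"
        by (auto intro!: always_eventually)
    qed auto
    then show "L2lim (lebesgue_on S) (\<lambda>k. conv H (\<psi> k)) H" using sq HS by (simp add: L2lim_def)
  qed
  have Sl: "S \<in> sets lebesgue" using Sb by auto
  have mm2: "\<eta> \<in> borel_measurable (lebesgue_on S)" "(\<lambda>x. clgrad \<eta> x $ i) \<in> borel_measurable (lebesgue_on S)" for i
    by (intro borel_measurable_lebesgue_on m\<eta>)+
  have "L2lim (lebesgue_on S) (\<lambda>k. conv F' (\<psi> k)) (\<lambda>x. \<eta> x * f x)"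
  proof (rule lim[OF iF' sF'])
    show "sqint (lebesgue_on S) (conv F' (\<psi> k))" for k using test_fun_sqint[OF test Sl] by (simp add: \<phi>_def)
    show "(\<lambda>x. \<eta> x * f x) \<in> borel_measurable (lebesgue_on S)" using mm2 sqintD(1)[OF fg(1)] by auto
    show "AE x in lebesgue_on S. F' x = \<eta> x * f x" using F(3) by eventually_elim (simp add: F'_def)
  qed
  moreover have "L2lim (lebesgue_on S) (\<lambda>k. conv (G' i) (\<psi> k)) (\<lambda>x. \<eta> x * g x $ i + f x * clgrad \<eta> x $ i)" for i
  proof (rule lim[OF iG' sG'])
    show "sqint (lebesgue_on S) (conv (G' i) (\<psi> k))" for k
      using test_fun_sqint[OF test_fun_clgrad[OF test, of k i] Sl] by (simp add: grad)
    show "(\<lambda>x. \<eta> x * g x $ i + f x * clgrad \<eta> x $ i) \<in> borel_measurable (lebesgue_on S)"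
      using mm2 sqintD(1)[OF fg(1)] sqintD(1)[OF fg(3)] by auto
    show "AE x in lebesgue_on S. G' i x = \<eta> x * g x $ i + f x * clgrad \<eta> x $ i"
      using F(3) G(3)[of i] by eventually_elim (simp add: G'_def)
  qed
  ultimately show ?thesis
    using test grad by (intro exI[of _ \<phi>]) (simp add: \<phi>_def[symmetric])
qed

section \<open>Uniqueness of weak gradients\<close>

lemma test_fun_zero_closure:
  assumes t: "test_fun S \<phi>" and x: "x \<notin> S"
  shows "\<phi> x = 0 \<and> clgrad \<phi> x = 0"
proof
  show "\<phi> x = 0" by (rule test_funD(4)[OF t x])
  have "x \<notin> closure {x. \<phi> x \<noteq> 0}" using test_funD(3)[OF t] x by blast
  then show "clgrad \<phi> x = 0"
    using clgrad_zero_outside[of "closure {x. \<phi> x \<noteq> 0}" \<phi> x] test_funD(5)[OF t] by blast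
qed

text \<open>Mollifying eta q at x means testing q with eta times a reflected kernel, which is a test
  function. Hence all mollifications vanish identically, while they converge to eta q in L2.\<close>

lemma orthogonal_test_funs_cutoff:
  fixes q :: "real^'d \<Rightarrow> real"
  assumes S: "open S" and q: "sqint (lebesgue_on S) q"
    and orth: "\<And>\<phi>. test_fun S \<phi> \<Longrightarrow> (\<integral>x. q x * \<phi> x \<partial>lebesgue_on S) = 0"
    and \<eta>: "test_fun S \<eta>"
  shows "AE x in lebesgue_on S. \<eta> x * q x = 0"
proof -
  have Sb: "S \<in> sets borel" using S by auto
  obtain F where F: "F \<in> borel_measurable borel" "\<And>x. x \<notin> S \<Longrightarrow> F x = 0"
    "AE x in lebesgue_on S. F x = q x" "integrable lborel (\<lambda>x. (F x)\<^sup>2)"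
    using sqint_representative[OF Sb q] by blast
  note [measurable] = F(1)
  have orth': "(\<integral>x. F x * \<phi> x \<partial>lborel) = 0" if t: "test_fun S \<phi>" for \<phi>
  proof -
    have m: "\<phi> \<in> borel_measurable borel" by (rule smooth_fun_measurable[OF test_funD(1)[OF t]])
    have "(\<integral>x. q x * \<phi> x \<partial>lebesgue_on S) = (\<integral>x. F x * \<phi> x \<partial>lborel)"
      by (rule integral_AE_representative[OF Sb F(1) m sqintD(1)[OF q] F(2,3)])
    then show ?thesis using orth[OF t] by simp
  qed
  have sF: "sqint lborel F" using F by (simp add: sqint_def)
  obtain B where B: "\<And>x. \<bar>\<eta> x\<bar> \<le> B" using test_fun_bounded[OF \<eta>] by metis
  have m\<eta> [measurable]: "\<eta> \<in> borel_measurable borel" by (rule smooth_fun_measurable[OF test_funD(1)[OF \<eta>]])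
  define F' where "F' x = \<eta> x * F x" for x
  have sF': "sqint lborel F'" unfolding F'_def[abs_def] by (rule sqint_mult_bounded[OF sF _ B]) auto
  have iF': "integrable lborel F'" unfolding F'_def[abs_def]
    by (rule sqint_mult_integrable[OF test_fun_sqint_lborel[OF \<eta>] sF])
  define r where "r k = 1 / real (Suc k)" for k
  have r: "r k > 0" for k by (simp add: r_def)
  have r0: "r \<longlonglongrightarrow> 0" unfolding r_def[abs_def] by (rule LIMSEQ_Suc[OF lim_1_over_n])
  have "\<forall>k. \<exists>\<psi> :: real^'d \<Rightarrow> real. mollifier (r k) \<psi>" using mollifier_exists[OF r] by blast
  from choice[OF this] obtain \<psi> :: "nat \<Rightarrow> real^'d \<Rightarrow> real" where \<psi>: "\<And>k. mollifier (r k) (\<psi> k)" by blast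
  have "conv F' (\<psi> k) x = 0" for k x
  proof -
    have "smooth_fun (\<psi> k)" using \<psi>[of k] by (simp add: mollifier_def)
    from orth'[OF test_fun_mult_smooth[OF \<eta> reflected_smooth[OF this, of x]]]
    show ?thesis by (simp add: conv_def F'_def mult_ac)
  qed
  then have "(\<lambda>k::nat. \<integral>x. (F' x)\<^sup>2 \<partial>lborel) \<longlonglongrightarrow> 0"
    using mollify_L2_tendsto[OF \<psi> r0 r iF' sqintD(2)[OF sF']] by simp
  then have "(\<integral>x. (F' x)\<^sup>2 \<partial>lborel) = 0" by (simp add: LIMSEQ_const_iff)
  then have "AE x in lborel. (F' x)\<^sup>2 = 0"
    using integral_nonneg_eq_0_iff_AE[OF sqintD(2)[OF sF']] by simp
  then have "AE x in lebesgue. x \<in> S \<longrightarrow> F' x = 0" by (intro AE_completion) auto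
  then have "AE x in lebesgue_on S. F' x = 0" using Sb by (subst AE_restrict_space_iff) auto
  with F(3) show ?thesis by eventually_elim (simp add: F'_def)
qed

lemma cube_exhaustion:
  assumes x: "x \<in> cube c t"
  obtains j :: nat where "x \<in> cube c (t - t / (real j + 2))"
proof -
  have t: "t > 0" using x infnorm_pos_le[of "x - c"] by (simp add: mem_cube_infnorm)
  define a where "a = t - 2 * infnorm (x - c)"
  have a: "a > 0" using x by (simp add: mem_cube_infnorm a_def)
  obtain j :: nat where j: "t / a < real j" using reals_Archimedean2 by blast
  then have "t < a * real j" using a by (simp add: field_simps)
  also have "\<dots> \<le> a * (real j + 2)" using a by simp
  finally have "t / (real j + 2) < a" by (simp add: field_simps)
  then show thesis using that[of j] by (simp add: mem_cube_infnorm a_def)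
qed

text \<open>The gaps t/(j + 2) start at t/2, which keeps the inner side lengths positive, and tend
  to 0, so that the plateaus exhaust the cube.\<close>

lemma cube_cutoffs:
  fixes c :: "real^'d"
  assumes "t > 0"
  obtains \<eta> :: "nat \<Rightarrow> real^'d \<Rightarrow> real" where "\<And>j. test_fun (cube c t) (\<eta> j)"
    "\<And>j x. x \<in> cube c (t - t / (real j + 2)) \<Longrightarrow> \<eta> j x = 1"
proof -
  have "\<forall>j::nat. \<exists>\<eta>. test_fun (cube c t) \<eta> \<and> (\<forall>x\<in>cube c (t - t / (real j + 2)). \<eta> x = 1)"
  proof
    fix j :: nat
    have "0 \<le> t - t / (real j + 2)" "t - t / (real j + 2) < t" using assms by (auto simp: field_simps)
    \<comment> \<open>This slope times the gap t/(j + 2) is 3, above the bound 2 required of a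
      cut-off.\<close>
    moreover have "(3 * (real j + 2) / t) * (t - (t - t / (real j + 2))) > 2"
    proof -
      have "n > 0 \<Longrightarrow> (3 * n / t) * (t - (t - t / n)) = 3" for n using assms by (simp add: field_simps)
      from this[of "real j + 2"] show ?thesis by simp
    qed
    ultimately show "\<exists>\<eta>. test_fun (cube c t) \<eta> \<and> (\<forall>x\<in>cube c (t - t / (real j + 2)). \<eta> x = 1)"
      by (rule cutoff_exists[of _ _ _ c]) blast
  qed
  from choice[OF this] show thesis using that by blast
qed

text \<open>Countably many cut-offs exhaust the cube, so the union of their exceptional null sets is
  still null.\<close>

lemma orthogonal_test_funs_zero:
  fixes q :: "real^'d \<Rightarrow> real"
  assumes t: "t > 0" and q: "sqint (lebesgue_on (cube c t)) q"
    and orth: "\<And>\<phi>. test_fun (cube c t) \<phi> \<Longrightarrow> (\<integral>x. q x * \<phi> x \<partial>lebesgue_on (cube c t)) = 0"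
  shows "AE x in lebesgue_on (cube c t). q x = 0"
proof -
  obtain \<eta> :: "nat \<Rightarrow> real^'d \<Rightarrow> real" where \<eta>: "\<And>j. test_fun (cube c t) (\<eta> j)"
    "\<And>j x. x \<in> cube c (t - t / (real j + 2)) \<Longrightarrow> \<eta> j x = 1"
    using cube_cutoffs[OF t] by blast
  have "AE x in lebesgue_on (cube c t). \<eta> j x * q x = 0" for j
    by (rule orthogonal_test_funs_cutoff[OF open_cube q orth \<eta>(1)])
  then have "AE x in lebesgue_on (cube c t). \<forall>j. \<eta> j x * q x = 0"
    by (intro AE_all_countable[THEN iffD2] allI)
  then show ?thesis
  proof (rule AE_mp, intro AE_I2 impI)
    fix x assume x: "x \<in> space (lebesgue_on (cube c t))" "\<forall>j. \<eta> j x * q x = 0"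
    then obtain j where "x \<in> cube c (t - t / (real j + 2))" using cube_exhaustion[of x c t] by auto
    then show "q x = 0" using \<eta>(2)[of x j] x(2) by (metis mult_1)
  qed
qed

lemma weak_grad_unique:
  fixes f :: "real^'d \<Rightarrow> real"
  assumes t: "t > 0" and h: "h1pair (cube c t) f g" "h1pair (cube c t) f' g'"
    and ff: "AE x in lebesgue_on (cube c t). f x = f' x"
  shows "AE x in lebesgue_on (cube c t). g x = g' x"
proof -
  let ?M = "lebesgue_on (cube c t)"
  have "AE x in ?M. g x $ i - g' x $ i = 0" for i
  proof (rule orthogonal_test_funs_zero[OF t sqint_diff])
    show "sqint ?M (\<lambda>x. g x $ i)" "sqint ?M (\<lambda>x. g' x $ i)" using h by (auto simp: h1pair_def)
    fix \<phi> assume tf: "test_fun (cube c t) \<phi>"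
    have w: "integrable ?M (\<lambda>x. g x $ i * \<phi> x)" "integrable ?M (\<lambda>x. g' x $ i * \<phi> x)"
      "integrable ?M (\<lambda>x. f x * clgrad \<phi> x $ i)" "integrable ?M (\<lambda>x. f' x * clgrad \<phi> x $ i)"
      "(\<integral>x. f x * clgrad \<phi> x $ i \<partial>?M) = - (\<integral>x. g x $ i * \<phi> x \<partial>?M)"
      "(\<integral>x. f' x * clgrad \<phi> x $ i \<partial>?M) = - (\<integral>x. g' x $ i * \<phi> x \<partial>?M)"
      using h tf unfolding h1pair_def weak_grad_def by blast+
    have "(\<integral>x. f x * clgrad \<phi> x $ i \<partial>?M) = (\<integral>x. f' x * clgrad \<phi> x $ i \<partial>?M)"
    proof (rule integral_cong_AE)
      show "AE x in ?M. f x * clgrad \<phi> x $ i = f' x * clgrad \<phi> x $ i" using ff by eventually_elim simp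
    qed (use w(3,4) in \<open>auto dest: borel_measurable_integrable\<close>)
    then show "(\<integral>x. (g x $ i - g' x $ i) * \<phi> x \<partial>?M) = 0"
      using w by (simp add: left_diff_distrib)
  qed
  then have "AE x in ?M. \<forall>i. g x $ i - g' x $ i = 0"
    by (intro AE_all_countable[THEN iffD2] allI)
  then show ?thesis by eventually_elim (simp add: vec_eq_iff)
qed

text \<open>Removes the choice in \<open>grad\<close>: under an integral it may be replaced by any
  weak gradient at hand.\<close>

lemma grad_AE_eq:
  assumes "t > 0" "h1pair (cube c t) f g"
  shows "AE x in lebesgue_on (cube c t). grad (cube c t) f x = g x"
  by (rule weak_grad_unique[OF assms(1) h1pair_grad[OF h1pair_H1[OF assms(2)]] assms(2)]) simp

lemma h1pair_lincomb:
  assumes "h1pair S f g" "h1pair S f' g'"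
  shows "h1pair S (\<lambda>x. a * f x + b * f' x) (\<lambda>x. a *\<^sub>R g x + b *\<^sub>R g' x)"
  unfolding h1pair_def
proof (intro conjI allI)
  show "sqint (lebesgue_on S) (\<lambda>x. a * f x + b * f' x)"
    using assms unfolding h1pair_def by (intro sqint_add sqint_cmult) auto
  show "sqint (lebesgue_on S) (\<lambda>x. (a *\<^sub>R g x + b *\<^sub>R g' x) $ i)" for i
    using assms unfolding h1pair_def by (auto intro!: sqint_add sqint_cmult)
  show "weak_grad S (\<lambda>x. a * f x + b * f' x) (\<lambda>x. a *\<^sub>R g x + b *\<^sub>R g' x)"
    unfolding weak_grad_def
  proof (intro allI impI)
    fix \<phi> i assume t: "test_fun S \<phi>"
    have w: "integrable (lebesgue_on S) (\<lambda>x. g x $ i * \<phi> x)" "integrable (lebesgue_on S) (\<lambda>x. g' x $ i * \<phi> x)"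
      "integrable (lebesgue_on S) (\<lambda>x. f x * clgrad \<phi> x $ i)" "integrable (lebesgue_on S) (\<lambda>x. f' x * clgrad \<phi> x $ i)"
      "(\<integral>x. f x * clgrad \<phi> x $ i \<partial>lebesgue_on S) = - (\<integral>x. g x $ i * \<phi> x \<partial>lebesgue_on S)"
      "(\<integral>x. f' x * clgrad \<phi> x $ i \<partial>lebesgue_on S) = - (\<integral>x. g' x $ i * \<phi> x \<partial>lebesgue_on S)"
      using assms t unfolding h1pair_def weak_grad_def by blast+
    have e: "(\<lambda>x. (a * f x + b * f' x) * clgrad \<phi> x $ i) = (\<lambda>x. a * (f x * clgrad \<phi> x $ i) + b * (f' x * clgrad \<phi> x $ i))"
      "(\<lambda>x. (a *\<^sub>R g x + b *\<^sub>R g' x) $ i * \<phi> x) = (\<lambda>x. a * (g x $ i * \<phi> x) + b * (g' x $ i * \<phi> x))"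
      by (auto simp: algebra_simps)
    show "integrable (lebesgue_on S) (\<lambda>x. (a * f x + b * f' x) * clgrad \<phi> x $ i) \<and>
      integrable (lebesgue_on S) (\<lambda>x. (a *\<^sub>R g x + b *\<^sub>R g' x) $ i * \<phi> x) \<and>
      (\<integral>x. (a * f x + b * f' x) * clgrad \<phi> x $ i \<partial>lebesgue_on S) =
      - (\<integral>x. (a *\<^sub>R g x + b *\<^sub>R g' x) $ i * \<phi> x \<partial>lebesgue_on S)"
      unfolding e using w by simp
  qed
qed

lemma lebesgue_on_subset_integrable:
  fixes f :: "'a::euclidean_space \<Rightarrow> real"
  assumes T: "T \<in> sets borel" and S: "S \<in> sets borel" and TS: "T \<subseteq> S"
    and f: "integrable (lebesgue_on S) f"
  shows "integrable (lebesgue_on T) f"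
proof -
  have Sl: "S \<inter> space lebesgue \<in> sets lebesgue" "T \<inter> space lebesgue \<in> sets lebesgue" "T \<in> sets lebesgue" using S T by auto
  have "integrable lebesgue (\<lambda>x. indicator S x *\<^sub>R f x)" by (rule iffD1[OF integrable_restrict_space[OF Sl(1)] f])
  then have "integrable lebesgue (\<lambda>x. indicator T x *\<^sub>R (indicator S x *\<^sub>R f x))"
    by (rule integrable_mult_indicator[OF Sl(3)])
  moreover have "(\<lambda>x. indicator T x *\<^sub>R (indicator S x *\<^sub>R f x)) = (\<lambda>x. indicator T x *\<^sub>R f x)"
    using TS by (auto simp: indicator_def fun_eq_iff)
  ultimately show ?thesis by (simp add: integrable_restrict_space[OF Sl(2)])
qed

lemma lebesgue_on_subset_measurable:
  fixes f :: "'a::euclidean_space \<Rightarrow> 'b::topological_space"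
  assumes TS: "T \<subseteq> S" and f: "f \<in> borel_measurable (lebesgue_on S)"
  shows "f \<in> borel_measurable (lebesgue_on T)"
proof -
  have "f \<in> borel_measurable (restrict_space (lebesgue_on S) T)"
    using f by (rule measurable_restrict_space1)
  moreover have "sets (restrict_space (lebesgue_on S) T) = sets (lebesgue_on T)"
    using TS by (simp add: sets_restrict_restrict_space Int_absorb1)
  ultimately show ?thesis using measurable_cong_sets by blast
qed

lemma sqint_subset:
  fixes f :: "'a::euclidean_space \<Rightarrow> real"
  assumes "T \<in> sets borel" "S \<in> sets borel" "T \<subseteq> S" "sqint (lebesgue_on S) f"
  shows "sqint (lebesgue_on T) f"
  unfolding sqint_def
  using lebesgue_on_subset_measurable[OF assms(3) sqintD(1)[OF assms(4)]]
    lebesgue_on_subset_integrable[OF assms(1-3) sqintD(2)[OF assms(4)]] by blast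

lemma lebesgue_on_integral_vanish:
  fixes f :: "'a::euclidean_space \<Rightarrow> real"
  assumes T: "T \<in> sets borel" and S: "S \<in> sets borel" and TS: "T \<subseteq> S"
    and f: "\<And>x. x \<notin> T \<Longrightarrow> f x = 0"
  shows "(\<integral>x. f x \<partial>lebesgue_on T) = (\<integral>x. f x \<partial>lebesgue_on S)"
proof -
  have Sl: "S \<inter> space lebesgue \<in> sets lebesgue" "T \<inter> space lebesgue \<in> sets lebesgue" using S T by auto
  have "(\<lambda>x. indicator S x *\<^sub>R f x) = (\<lambda>x. indicator T x *\<^sub>R f x)" using f TS by (auto simp: indicator_def fun_eq_iff)
  then show ?thesis by (simp only: integral_restrict_space[OF Sl(1)] integral_restrict_space[OF Sl(2)])
qed

text \<open>A test function on the smaller set is one on the larger set, and the integrands vanish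
  outside the smaller set.\<close>

lemma h1pair_subset:
  assumes T: "open T" and S: "open S" and TS: "T \<subseteq> S" and h: "h1pair S f g"
  shows "h1pair T f g"
proof -
  have Tb: "T \<in> sets borel" "S \<in> sets borel" using T S by auto
  show ?thesis
    unfolding h1pair_def
  proof (intro conjI allI)
    show "sqint (lebesgue_on T) f" "sqint (lebesgue_on T) (\<lambda>x. g x $ i)" for i
      using h sqint_subset[OF Tb TS] unfolding h1pair_def by blast+
    show "weak_grad T f g"
      unfolding weak_grad_def
    proof (intro allI impI)
      fix \<phi> i assume t: "test_fun T \<phi>"
      have z: "x \<notin> T \<Longrightarrow> \<phi> x = 0 \<and> clgrad \<phi> x = 0" for x by (rule test_fun_zero_closure[OF t])
      have w: "integrable (lebesgue_on S) (\<lambda>x. g x $ i * \<phi> x)" "integrable (lebesgue_on S) (\<lambda>x. f x * clgrad \<phi> x $ i)"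
        "(\<integral>x. f x * clgrad \<phi> x $ i \<partial>lebesgue_on S) = - (\<integral>x. g x $ i * \<phi> x \<partial>lebesgue_on S)"
        using h test_fun_mono[OF t TS] unfolding h1pair_def weak_grad_def by blast+
      show "integrable (lebesgue_on T) (\<lambda>x. f x * clgrad \<phi> x $ i) \<and> integrable (lebesgue_on T) (\<lambda>x. g x $ i * \<phi> x) \<and>
        (\<integral>x. f x * clgrad \<phi> x $ i \<partial>lebesgue_on T) = - (\<integral>x. g x $ i * \<phi> x \<partial>lebesgue_on T)"
        using w lebesgue_on_subset_integrable[OF Tb TS]
          lebesgue_on_integral_vanish[OF Tb TS, of "\<lambda>x. f x * clgrad \<phi> x $ i"]
          lebesgue_on_integral_vanish[OF Tb TS, of "\<lambda>x. g x $ i * \<phi> x"] z by auto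
    qed
  qed
qed

lemma cube_lmeasurable [simp]: "cube c s \<in> lmeasurable"
  by (simp add: cube_def)

lemma finite_measure_cube: "finite_measure (lebesgue_on (cube c s))"
  by (rule finite_measure_lebesgue_on) simp

text \<open>Amounts to the vanishing of the integral of each partial derivative of a test
  function.\<close>

lemma h1pair_const:
  fixes c :: "real^'d"
  shows "h1pair (cube c s) (\<lambda>x. a) (\<lambda>x. 0)"
  unfolding h1pair_def weak_grad_def
proof (intro conjI allI impI)
  show "sqint (lebesgue_on (cube c s)) (\<lambda>x. a)"
    by (simp add: sqint_def finite_measure.integrable_const[OF finite_measure_cube])
  show "sqint (lebesgue_on (cube c s)) (\<lambda>x. (0 :: real^'d) $ i)" for i by (simp add: sqint_zero)
  fix \<phi> :: "real^'d \<Rightarrow> real" and i assume t: "test_fun (cube c s) \<phi>"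
  have b: "axis i 1 \<in> (Basis :: (real^'d) set)" by (auto simp: axis_in_Basis_iff)
  note t' = test_fun_clgrad[OF t, of i]
  have "sqint (lebesgue_on (cube c s)) (\<lambda>x. clgrad \<phi> x $ i)" by (rule test_fun_sqint[OF t']) auto
  then have "integrable (lebesgue_on (cube c s)) (\<lambda>x. clgrad \<phi> x $ i)"
    by (rule sqint_integrable[OF finite_measure_cube])
  then show "integrable (lebesgue_on (cube c s)) (\<lambda>x. a * clgrad \<phi> x $ i)" by simp
  show "integrable (lebesgue_on (cube c s)) (\<lambda>x. (0 :: real^'d) $ i * \<phi> x)" by simp
  have m: "(\<lambda>x. clgrad \<phi> x $ i) \<in> borel_measurable borel" by (rule smooth_fun_measurable[OF test_funD(1)[OF t']])
  have "(\<integral>x. clgrad \<phi> x $ i \<partial>lebesgue_on (cube c s)) = (\<integral>x. indicator (cube c s) x * clgrad \<phi> x $ i \<partial>lborel)"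
    by (rule lebesgue_on_integral_lborel(1)[OF cube_borel m])
  also have "\<dots> = (\<integral>x. clgrad \<phi> x $ i \<partial>lborel)"
    using test_fun_zero_closure[OF t] by (intro Bochner_Integration.integral_cong) (auto simp: indicator_def)
  also have "\<dots> = 0"
    using integral_frechet_derivative_zero[OF test_funD(1,2,5)[OF t] b] by (simp add: clgrad_def)
  finally show "(\<integral>x. a * clgrad \<phi> x $ i \<partial>lebesgue_on (cube c s)) = - (\<integral>x. (0 :: real^'d) $ i * \<phi> x \<partial>lebesgue_on (cube c s))"
    by simp
qed

section \<open>Exchanging coordinates of two points\<close>

lemma lborel_distr_reflect_Basis:
  fixes b :: "'a::euclidean_space"
  assumes b: "b \<in> Basis"
  shows "distr lborel borel (\<lambda>y. y - (2 * (y \<bullet> b)) *\<^sub>R b) = lborel"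
proof -
  let ?c = "\<lambda>j. if j = b then - 1 else 1 :: real"
  have T: "0 + (\<Sum>j\<in>Basis. (?c j * (x \<bullet> j)) *\<^sub>R j) = x - (2 * (x \<bullet> b)) *\<^sub>R b" for x :: 'a
  proof (rule euclidean_eqI)
    fix i :: 'a assume i: "i \<in> Basis"
    show "(0 + (\<Sum>j\<in>Basis. (?c j * (x \<bullet> j)) *\<^sub>R j)) \<bullet> i = (x - (2 * (x \<bullet> b)) *\<^sub>R b) \<bullet> i"
      using i b by (simp add: inner_diff_left inner_Basis)
  qed
  have "lborel = density (distr lborel borel (\<lambda>x. 0 + (\<Sum>j\<in>Basis. (?c j * (x \<bullet> j)) *\<^sub>R j))) (\<lambda>_. (\<Prod>j\<in>(Basis::'a set). \<bar>?c j\<bar>))"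
    by (rule lborel_affine_euclidean) auto
  also have "(\<Prod>j\<in>(Basis::'a set). \<bar>?c j\<bar>) = 1" by (intro prod.neutral) auto
  finally show ?thesis unfolding T by (simp add: density_1)
qed

lemma nn_integral_reflect_Basis:
  fixes f :: "'a::euclidean_space \<Rightarrow> ennreal"
  assumes "b \<in> Basis" "f \<in> borel_measurable borel"
  shows "(\<integral>\<^sup>+y. f (y - (2 * (y \<bullet> b)) *\<^sub>R b) \<partial>lborel) = (\<integral>\<^sup>+y. f y \<partial>lborel)"
proof -
  have "(\<integral>\<^sup>+y. f y \<partial>lborel) = (\<integral>\<^sup>+y. f y \<partial>distr lborel borel (\<lambda>y. y - (2 * (y \<bullet> b)) *\<^sub>R b))"
    by (simp add: lborel_distr_reflect_Basis[OF assms(1)])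
  also have "\<dots> = (\<integral>\<^sup>+y. f (y - (2 * (y \<bullet> b)) *\<^sub>R b) \<partial>lborel)"
    by (rule nn_integral_distr) (use assms in auto)
  finally show ?thesis by simp
qed

text \<open>Exchanging one coordinate of \<open>x\<close> with one of \<open>y\<close> is a composition of three shears and a reflection.\<close>

lemma nn_integral_swap_coordinate:
  fixes F :: "'a::euclidean_space \<Rightarrow> 'b::euclidean_space \<Rightarrow> ennreal"
  assumes b: "b \<in> Basis" and c: "c \<in> Basis"
    and F [measurable]: "(\<lambda>(x, y). F x y) \<in> borel_measurable (borel \<Otimes>\<^sub>M borel)"
  shows "(\<integral>\<^sup>+x. \<integral>\<^sup>+y. F (x + (y \<bullet> c - x \<bullet> b) *\<^sub>R b) (y + (x \<bullet> b - y \<bullet> c) *\<^sub>R c) \<partial>lborel \<partial>lborel)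
    = (\<integral>\<^sup>+x. \<integral>\<^sup>+y. F x y \<partial>lborel \<partial>lborel)"
proof -
  have F': "(\<lambda>(x, y). F x y) \<in> borel_measurable (lborel \<Otimes>\<^sub>M lborel)"
    using F by (simp cong: measurable_cong_sets)
  \<comment> \<open>The three shears turn the pair (x_b, y_c) into (y_c, -x_b), and the reflection
    in \<open>F0\<close> corrects the sign. As x and y may live in different spaces, the swap also
    applies with a single real variable in place of y.\<close>
  define F0 where "F0 x y = F x (y - (2 * (y \<bullet> c)) *\<^sub>R c)" for x y
  define F1 where "F1 x y = F0 (x + (y \<bullet> c) *\<^sub>R b) y" for x y
  define F2 where "F2 x y = F1 x (y + (- (x \<bullet> b)) *\<^sub>R c)" for x y
  define F3 where "F3 x y = F2 (x + (y \<bullet> c) *\<^sub>R b) y" for x y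
  have [measurable]: "(\<lambda>(x, y). F0 x y) \<in> borel_measurable (borel \<Otimes>\<^sub>M borel)" unfolding F0_def by measurable
  have [measurable]: "(\<lambda>(x, y). F1 x y) \<in> borel_measurable (borel \<Otimes>\<^sub>M borel)" unfolding F1_def by measurable
  have [measurable]: "(\<lambda>(x, y). F2 x y) \<in> borel_measurable (borel \<Otimes>\<^sub>M borel)" unfolding F2_def by measurable
  have [measurable]: "(\<lambda>(x, y). F3 x y) \<in> borel_measurable (borel \<Otimes>\<^sub>M borel)" unfolding F3_def by measurable
  have fub: "(\<integral>\<^sup>+y. \<integral>\<^sup>+x. G x y \<partial>lborel \<partial>lborel) = (\<integral>\<^sup>+x. \<integral>\<^sup>+y. G x y \<partial>lborel \<partial>lborel)"
    if "(\<lambda>(x, y). G x y) \<in> borel_measurable (borel \<Otimes>\<^sub>M borel)" for G :: "'a \<Rightarrow> 'b \<Rightarrow> ennreal"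
  proof -
    have "(\<lambda>(x, y). G x y) \<in> borel_measurable (lborel \<Otimes>\<^sub>M lborel)"
      using that by (simp cong: measurable_cong_sets)
    then show ?thesis by (rule lborel_pair.Fubini')
  qed
  have "(\<integral>\<^sup>+x. \<integral>\<^sup>+y. F3 x y \<partial>lborel \<partial>lborel) = (\<integral>\<^sup>+y. \<integral>\<^sup>+x. F2 (x + (y \<bullet> c) *\<^sub>R b) y \<partial>lborel \<partial>lborel)"
    unfolding F3_def[symmetric] by (rule fub[symmetric]) measurable
  also have "\<dots> = (\<integral>\<^sup>+y. \<integral>\<^sup>+x. F2 x y \<partial>lborel \<partial>lborel)"
    by (intro nn_integral_cong nn_integral_translate) measurable
  also have "\<dots> = (\<integral>\<^sup>+x. \<integral>\<^sup>+y. F1 x (y + (- (x \<bullet> b)) *\<^sub>R c) \<partial>lborel \<partial>lborel)"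
    unfolding F2_def[symmetric] by (rule fub) measurable
  also have "\<dots> = (\<integral>\<^sup>+x. \<integral>\<^sup>+y. F1 x y \<partial>lborel \<partial>lborel)"
    by (intro nn_integral_cong nn_integral_translate) measurable
  also have "\<dots> = (\<integral>\<^sup>+y. \<integral>\<^sup>+x. F0 (x + (y \<bullet> c) *\<^sub>R b) y \<partial>lborel \<partial>lborel)"
    unfolding F1_def[symmetric] by (rule fub[symmetric]) measurable
  also have "\<dots> = (\<integral>\<^sup>+y. \<integral>\<^sup>+x. F0 x y \<partial>lborel \<partial>lborel)"
    by (intro nn_integral_cong nn_integral_translate) measurable
  also have "\<dots> = (\<integral>\<^sup>+x. \<integral>\<^sup>+y. F x (y - (2 * (y \<bullet> c)) *\<^sub>R c) \<partial>lborel \<partial>lborel)"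
    unfolding F0_def[symmetric] by (rule fub) measurable
  also have "\<dots> = (\<integral>\<^sup>+x. \<integral>\<^sup>+y. F x y \<partial>lborel \<partial>lborel)"
    by (intro nn_integral_cong nn_integral_reflect_Basis c) measurable
  also have "F3 x y = F (x + (y \<bullet> c - x \<bullet> b) *\<^sub>R b) (y + (x \<bullet> b - y \<bullet> c) *\<^sub>R c)" for x y
    using b c by (simp add: F3_def F2_def F1_def F0_def inner_add_left inner_diff_left algebra_simps flip: scaleR_add_left scaleR_left_diff_distrib)
  ultimately show ?thesis by simp
qed

text \<open>A hybrid point: coordinates in B come from y, the others from x. It passes from x to y
  as B grows from the empty set to the whole basis.\<close>

definition mix :: "'a::euclidean_space set \<Rightarrow> 'a \<Rightarrow> 'a \<Rightarrow> 'a" where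
  "mix B x y = x + (\<Sum>b\<in>B. ((y - x) \<bullet> b) *\<^sub>R b)"

lemma mix_inner:
  assumes "B \<subseteq> Basis" "i \<in> Basis"
  shows "mix B x y \<bullet> i = (if i \<in> B then y \<bullet> i else x \<bullet> i)"
proof -
  have fin: "finite B" using assms(1) finite_Basis finite_subset by blast
  have "(\<Sum>b\<in>B. ((y - x) \<bullet> b) *\<^sub>R b) \<bullet> i = (\<Sum>b\<in>B. if b = i then (y - x) \<bullet> i else 0)"
    unfolding inner_sum_left using assms by (intro sum.cong) (auto simp: inner_Basis subset_iff)
  then show ?thesis using fin by (simp add: mix_def inner_add_left inner_diff_left)
qed

lemma measurable_mix [measurable]:
  "(\<lambda>x. mix B (f x) (g x)) \<in> borel_measurable M"
  if [measurable]: "f \<in> borel_measurable M" "g \<in> borel_measurable M"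
  unfolding mix_def by measurable

lemma swap_cube:
  assumes "b \<in> Basis"
  shows "x + (y \<bullet> b - x \<bullet> b) *\<^sub>R b \<in> cube c s \<and> y + (x \<bullet> b - y \<bullet> b) *\<^sub>R b \<in> cube c s
    \<longleftrightarrow> x \<in> cube c s \<and> y \<in> cube c s"
proof -
  have "(x + (y \<bullet> b - x \<bullet> b) *\<^sub>R b - c) \<bullet> i = (if i = b then (y - c) \<bullet> i else (x - c) \<bullet> i)" if "i \<in> Basis" for i x y
    using assms that by (simp add: inner_add_left inner_diff_left inner_Basis)
  then have "x + (y \<bullet> b - x \<bullet> b) *\<^sub>R b \<in> cube c s \<longleftrightarrow> (\<forall>i\<in>Basis. (i = b \<longrightarrow> \<bar>(y - c) \<bullet> i\<bar> < s / 2) \<and> (i \<noteq> b \<longrightarrow> \<bar>(x - c) \<bullet> i\<bar> < s / 2))" for x y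
    unfolding mem_cube by (intro ball_cong refl) presburger
  then show ?thesis unfolding mem_cube by blast
qed

text \<open>Swapping the coordinates in B between x and y, one after another, preserves measure and
  the product of the two cubes. As b is not in B, y_b is untouched, so (\<open>mix B x y\<close>,
  y_b) has the joint distribution of (x, y_b).\<close>

lemma mix_measure_preserving:
  fixes G :: "real^'d \<Rightarrow> real \<Rightarrow> ennreal"
  assumes B: "B \<subseteq> Basis" and b: "b \<in> Basis" "b \<notin> B"
    and G [measurable]: "(\<lambda>(x, t). G x t) \<in> borel_measurable (borel \<Otimes>\<^sub>M borel)"
  shows "(\<integral>\<^sup>+x. \<integral>\<^sup>+y. indicator (cube c s) x * indicator (cube c s) y * G (mix B x y) (y \<bullet> b) \<partial>lborel \<partial>lborel)
    = (\<integral>\<^sup>+x. \<integral>\<^sup>+y. indicator (cube c s) x * indicator (cube c s) y * G x (y \<bullet> b) \<partial>lborel \<partial>lborel)"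
proof -
  have "finite B" using B finite_Basis finite_subset by blast
  then show ?thesis using B b(2)
  proof (induction B rule: finite_induct)
    case empty
    then show ?case by (simp add: mix_def)
  next
    case (insert a B)
    let ?H = "\<lambda>x y. indicator (cube c s) x * indicator (cube c s) y * G (mix B x y) (y \<bullet> b)"
    have a: "a \<in> Basis" "a \<noteq> b" using insert by auto
    have m: "(\<lambda>(x, y). ?H x y) \<in> borel_measurable (borel \<Otimes>\<^sub>M borel)" by measurable
    have "?H (x + (y \<bullet> a - x \<bullet> a) *\<^sub>R a) (y + (x \<bullet> a - y \<bullet> a) *\<^sub>R a) =
       indicator (cube c s) x * indicator (cube c s) y * G (mix (insert a B) x y) (y \<bullet> b)" for x y
    proof -
      let ?x = "x + (y \<bullet> a - x \<bullet> a) *\<^sub>R a" and ?y = "y + (x \<bullet> a - y \<bullet> a) *\<^sub>R a"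
      have "?x \<bullet> i = (if i = a then y \<bullet> i else x \<bullet> i)" "?y \<bullet> i = (if i = a then x \<bullet> i else y \<bullet> i)" if "i \<in> Basis" for i
        using a that by (simp_all add: inner_add_left inner_Basis)
      note xy = this
      have "mix B ?x ?y = mix (insert a B) x y"
      proof (rule euclidean_eqI)
        fix i :: "real^'d" assume i: "i \<in> Basis"
        have "B \<subseteq> Basis" "insert a B \<subseteq> Basis" using insert.prems by auto
        note m = mix_inner[OF this(1) i, of ?x ?y] mix_inner[OF this(2) i, of x y]
        show "mix B ?x ?y \<bullet> i = mix (insert a B) x y \<bullet> i"
          unfolding m xy[OF i] using insert.hyps(2) by auto
      qed
      moreover have "?y \<bullet> b = y \<bullet> b" using a b by (simp add: inner_add_left inner_Basis)
      moreover have "(indicator (cube c s) ?x * indicator (cube c s) ?y :: ennreal) = indicator (cube c s) x * indicator (cube c s) y"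
        using swap_cube[OF a(1), of x y c s] by (auto simp: indicator_def split: if_splits)
      ultimately show ?thesis by simp
    qed
    then have "(\<integral>\<^sup>+x. \<integral>\<^sup>+y. indicator (cube c s) x * indicator (cube c s) y * G (mix (insert a B) x y) (y \<bullet> b) \<partial>lborel \<partial>lborel)
       = (\<integral>\<^sup>+x. \<integral>\<^sup>+y. ?H x y \<partial>lborel \<partial>lborel)"
      using nn_integral_swap_coordinate[OF a(1) a(1) m] by simp
    also have "\<dots> = (\<integral>\<^sup>+x. \<integral>\<^sup>+y. indicator (cube c s) x * indicator (cube c s) y * G x (y \<bullet> b) \<partial>lborel \<partial>lborel)"
      using insert by (intro insert.IH) auto
    finally show ?case .
  qed
qed

section \<open>Squared differences along coordinate lines\<close>

text \<open>The fundamental theorem of calculus with Cauchy-Schwarz; enlarging the segment to J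
  makes the second factor independent of the endpoints.\<close>

lemma nn_integral_segment_Cauchy_Schwarz:
  fixes h h' :: "real \<Rightarrow> real"
  assumes d: "\<And>t. (h has_real_derivative h' t) (at t)" and c: "continuous_on UNIV h'"
    and uv: "{u..v} \<subseteq> J" "u \<le> v"
  shows "ennreal ((h v - h u)\<^sup>2) \<le> ennreal (v - u) * (\<integral>\<^sup>+t. indicator J t * ennreal ((h' t)\<^sup>2) \<partial>lborel)"
proof -
  have [measurable]: "h' \<in> borel_measurable borel" by (rule borel_measurable_continuous_onI[OF c])
  have cu: "continuous_on {u..v} h'" using c continuous_on_subset by blast
  have i: "integrable lborel (\<lambda>x. indicator {u..v} x *\<^sub>R h' x)"
    by (rule borel_integrable_compact) (use cu in auto)
  have "h v - h u = (\<integral>x. indicator {u..v} x *\<^sub>R h' x \<partial>lborel)"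
    using integral_FTC_Icc[OF uv(2) _ cu, of h] d
    by (simp add: has_real_derivative_iff_has_vector_derivative has_vector_derivative_at_within)
  then have "ennreal \<bar>h v - h u\<bar> \<le> (\<integral>\<^sup>+t. ennreal (norm (indicator {u..v} t *\<^sub>R h' t)) \<partial>lborel)"
    using integral_norm_bound_ennreal[OF i] by simp
  also have "\<dots> = (\<integral>\<^sup>+t. indicator {u..v} t * (indicator {u..v} t * ennreal \<bar>h' t\<bar>) \<partial>lborel)"
    by (intro nn_integral_cong) (auto simp: indicator_def)
  finally have "(ennreal \<bar>h v - h u\<bar>)\<^sup>2 \<le> (\<integral>\<^sup>+t. indicator {u..v} t * (indicator {u..v} t * ennreal \<bar>h' t\<bar>) \<partial>lborel)\<^sup>2"
    by (rule power_mono) simp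
  also have "\<dots> \<le> (\<integral>\<^sup>+t. (indicator {u..v} t)\<^sup>2 \<partial>lborel) * (\<integral>\<^sup>+t. (indicator {u..v} t * ennreal \<bar>h' t\<bar>)\<^sup>2 \<partial>lborel)"
    by (rule Cauchy_Schwarz_nn_integral) measurable
  also have "(\<integral>\<^sup>+t. (indicator {u..v} t)\<^sup>2 \<partial>lborel) = (\<integral>\<^sup>+t. indicator {u..v} t \<partial>(lborel::real measure))"
    by (intro nn_integral_cong) (auto simp: indicator_def)
  also have "\<dots> = ennreal (v - u)" using uv by simp
  also have "(\<integral>\<^sup>+t. (indicator {u..v} t * ennreal \<bar>h' t\<bar>)\<^sup>2 \<partial>lborel) \<le> (\<integral>\<^sup>+t. indicator J t * ennreal ((h' t)\<^sup>2) \<partial>lborel)"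
    using uv(1) by (intro nn_integral_mono) (auto simp: indicator_def ennreal_power)
  finally show ?thesis by (simp add: ennreal_power mult_left_mono)
qed

lemma emeasure_cube:
  fixes c :: "real^'d"
  assumes "s \<ge> 0"
  shows "emeasure lborel (cube c s) = ennreal (s ^ CARD('d))"
proof -
  have "emeasure lborel (cube c s) = ennreal (\<Prod>b\<in>Basis. ((c + (s/2) *\<^sub>R One) - (c - (s/2) *\<^sub>R One)) \<bullet> b)"
    unfolding cube_def using assms by (intro emeasure_lborel_box) (auto simp: inner_diff_left inner_add_left)
  also have "(\<Prod>b\<in>Basis. ((c + (s/2) *\<^sub>R One) - (c - (s/2) *\<^sub>R One)) \<bullet> b) = (\<Prod>b\<in>(Basis :: (real^'d) set). s)"
  proof (intro prod.cong refl)
    fix b :: "real^'d" assume "b \<in> Basis"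
    then have "One \<bullet> b = 1" by simp
    then show "((c + (s/2) *\<^sub>R One) - (c - (s/2) *\<^sub>R One)) \<bullet> b = s"
      by (simp only: inner_diff_left inner_add_left inner_scaleR_left)
  qed
  finally show ?thesis by simp
qed

lemma measure_cube:
  fixes c :: "real^'d"
  assumes "s \<ge> 0"
  shows "measure lborel (cube c s) = s ^ CARD('d)" "measure lebesgue (cube c s) = s ^ CARD('d)"
proof -
  show "measure lborel (cube c s) = s ^ CARD('d)"
    using emeasure_cube[OF assms, of c] assms by (simp add: measure_def)
  then show "measure lebesgue (cube c s) = s ^ CARD('d)" by simp
qed

text \<open>Averaging y with its reflection 2c - y in the centre: the two distances to x_b add up to
  at most s. This gives s/2, where the pointwise bound would give s.\<close>

lemma nn_integral_cube_abs_le: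
  fixes c x :: "real^'d"
  assumes s: "s \<ge> 0" and b: "b \<in> Basis" and x: "x \<in> cube c s"
  shows "(\<integral>\<^sup>+y. indicator (cube c s) y * ennreal \<bar>y \<bullet> b - x \<bullet> b\<bar> \<partial>lborel) \<le> ennreal (s ^ CARD('d) * (s / 2))"
proof -
  let ?f = "\<lambda>y. indicator (cube c s) y * ennreal \<bar>y \<bullet> b - x \<bullet> b\<bar>"
  have r: "(\<integral>\<^sup>+y. ?f y \<partial>lborel) = (\<integral>\<^sup>+y. ?f (2 *\<^sub>R c - y) \<partial>lborel)"
  proof -
    have "(\<integral>\<^sup>+y. ?f y \<partial>lborel) = (\<integral>\<^sup>+y. ?f y \<partial>distr lborel borel (\<lambda>y. 2 *\<^sub>R c - y))"
      by (simp add: lborel_distr_reflect)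
    also have "\<dots> = (\<integral>\<^sup>+y. ?f (2 *\<^sub>R c - y) \<partial>lborel)" by (rule nn_integral_distr) auto
    finally show ?thesis .
  qed
  have "2 * (\<integral>\<^sup>+y. ?f y \<partial>lborel) = (\<integral>\<^sup>+y. ?f y \<partial>lborel) + (\<integral>\<^sup>+y. ?f (2 *\<^sub>R c - y) \<partial>lborel)"
    using r by (simp add: mult_2)
  also have "\<dots> = (\<integral>\<^sup>+y. ?f y + ?f (2 *\<^sub>R c - y) \<partial>lborel)"
    by (rule nn_integral_add[symmetric]) auto
  also have "\<dots> \<le> (\<integral>\<^sup>+y. ennreal s * indicator (cube c s) y \<partial>lborel)"
  proof (intro nn_integral_mono)
    fix y :: "real^'d"
    have m: "2 *\<^sub>R c - y \<in> cube c s \<longleftrightarrow> y \<in> cube c s"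
    proof -
      have "infnorm (2 *\<^sub>R c - y - c) = infnorm (y - c)"
        using infnorm_neg[of "y - c"] by (simp add: algebra_simps scaleR_2)
      then show ?thesis by (simp add: mem_cube_infnorm)
    qed
    show "?f y + ?f (2 *\<^sub>R c - y) \<le> ennreal s * indicator (cube c s) y"
    proof (cases "y \<in> cube c s")
      case True
      have "\<bar>(x - c) \<bullet> b\<bar> < s / 2" "\<bar>(y - c) \<bullet> b\<bar> < s / 2" using x True b by (auto simp: mem_cube)
      moreover have "\<bar>p - r\<bar> < s / 2 \<Longrightarrow> \<bar>q - r\<bar> < s / 2 \<Longrightarrow> \<bar>q - p\<bar> + \<bar>2 * r - q - p\<bar> \<le> s" for p q r :: real
        by (smt (verit) field_sum_of_halves)
      ultimately have "\<bar>y \<bullet> b - x \<bullet> b\<bar> + \<bar>(2 *\<^sub>R c - y) \<bullet> b - x \<bullet> b\<bar> \<le> s"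
        unfolding inner_diff_left inner_scaleR_left by blast
      then show ?thesis using True m by (simp add: ennreal_plus[symmetric] del: ennreal_plus)
    next
      case False
      then show ?thesis using m by simp
    qed
  qed
  also have "\<dots> = ennreal s * ennreal (s ^ CARD('d))"
    using emeasure_cube[OF s, of c] by (simp add: nn_integral_cmult)
  also have "\<dots> = 2 * ennreal (s ^ CARD('d) * (s / 2))"
  proof -
    have "2 * ennreal (s ^ CARD('d) * (s / 2)) = ennreal 2 * ennreal (s ^ CARD('d) * (s / 2))" by simp
    also have "\<dots> = ennreal (2 * (s ^ CARD('d) * (s / 2)))" using s by (intro ennreal_mult[symmetric]) auto
    also have "2 * (s ^ CARD('d) * (s / 2)) = s * s ^ CARD('d)" by simp
    also have "ennreal \<dots> = ennreal s * ennreal (s ^ CARD('d))" using s by (intro ennreal_mult) auto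
    finally show ?thesis by simp
  qed
  finally show ?thesis by (simp add: ennreal_mult_le_mult_iff)
qed

text \<open>Swapping x_b with the real variable t preserves the product of the cube with its side
  interval. The integrand then no longer depends on t, which contributes the length s.\<close>

lemma nn_integral_cube_line:
  fixes g :: "real^'d \<Rightarrow> ennreal"
  assumes s: "s \<ge> 0" and b: "b \<in> Basis" and g [measurable]: "g \<in> borel_measurable borel"
  shows "(\<integral>\<^sup>+x. indicator (cube c s) x * (\<integral>\<^sup>+t. indicator {t. \<bar>t - c \<bullet> b\<bar> < s / 2} t * g (x + (t - x \<bullet> b) *\<^sub>R b) \<partial>lborel) \<partial>lborel)
    = ennreal s * (\<integral>\<^sup>+x. indicator (cube c s) x * g x \<partial>lborel)"
proof -
  let ?J = "{t. \<bar>t - c \<bullet> b\<bar> < s / 2}"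
  let ?F = "\<lambda>x t. indicator (cube c s) x * (indicator ?J t * g x)"
  have J: "?J = {c \<bullet> b - s / 2 <..< c \<bullet> b + s / 2}"
    unfolding set_eq_iff mem_Collect_eq greaterThanLessThan_iff by linarith
  then have [measurable]: "?J \<in> sets borel" by simp
  have m: "(\<lambda>(x, t). ?F x t) \<in> borel_measurable (borel \<Otimes>\<^sub>M borel)" by measurable
  have "(\<integral>\<^sup>+x. indicator (cube c s) x * (\<integral>\<^sup>+t. indicator ?J t * g (x + (t - x \<bullet> b) *\<^sub>R b) \<partial>lborel) \<partial>lborel)
     = (\<integral>\<^sup>+x. \<integral>\<^sup>+t. indicator (cube c s) x * (indicator ?J t * g (x + (t - x \<bullet> b) *\<^sub>R b)) \<partial>lborel \<partial>lborel)"
    by (simp add: nn_integral_cmult)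
  also have "\<dots> = (\<integral>\<^sup>+x. \<integral>\<^sup>+t. ?F (x + (t \<bullet> 1 - x \<bullet> b) *\<^sub>R b) (t + (x \<bullet> b - t \<bullet> 1) *\<^sub>R 1) \<partial>lborel \<partial>lborel)"
  proof (intro nn_integral_cong)
    fix x t
    have "(x + (t - x \<bullet> b) *\<^sub>R b - c) \<bullet> i = (if i = b then t - c \<bullet> b else (x - c) \<bullet> i)" if "i \<in> Basis" for i
      using b that by (simp add: inner_add_left inner_diff_left inner_Basis)
    then have "x + (t - x \<bullet> b) *\<^sub>R b \<in> cube c s \<longleftrightarrow> (\<forall>i\<in>Basis. (i = b \<longrightarrow> \<bar>t - c \<bullet> b\<bar> < s / 2) \<and> (i \<noteq> b \<longrightarrow> \<bar>(x - c) \<bullet> i\<bar> < s / 2))"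
      unfolding mem_cube by (intro ball_cong refl) presburger
    then have "x + (t - x \<bullet> b) *\<^sub>R b \<in> cube c s \<and> \<bar>(x - c) \<bullet> b\<bar> < s / 2 \<longleftrightarrow> x \<in> cube c s \<and> \<bar>t - c \<bullet> b\<bar> < s / 2"
      unfolding mem_cube using b by blast
    then show "indicator (cube c s) x * (indicator ?J t * g (x + (t - x \<bullet> b) *\<^sub>R b)) =
       ?F (x + (t \<bullet> 1 - x \<bullet> b) *\<^sub>R b) (t + (x \<bullet> b - t \<bullet> 1) *\<^sub>R 1)"
      by (auto simp: indicator_def inner_diff_left)
  qed
  also have "\<dots> = (\<integral>\<^sup>+x. \<integral>\<^sup>+t. ?F x t \<partial>lborel \<partial>lborel)"
    by (rule nn_integral_swap_coordinate[OF b _ m]) simp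
  also have "\<dots> = (\<integral>\<^sup>+x. indicator (cube c s) x * g x * (\<integral>\<^sup>+t. indicator ?J t \<partial>lborel) \<partial>lborel)"
  proof (intro nn_integral_cong)
    fix x
    have "(\<integral>\<^sup>+t. ?F x t \<partial>lborel) = (\<integral>\<^sup>+t. (indicator (cube c s) x * g x) * indicator ?J t \<partial>lborel)"
      by (intro nn_integral_cong) (simp add: mult_ac)
    then show "(\<integral>\<^sup>+t. ?F x t \<partial>lborel) = indicator (cube c s) x * g x * (\<integral>\<^sup>+t. indicator ?J t \<partial>lborel)"
      by (simp add: nn_integral_cmult)
  qed
  also have "(\<integral>\<^sup>+t. indicator ?J t \<partial>lborel) = ennreal s" using s unfolding J by simp
  also have "(\<integral>\<^sup>+x. indicator (cube c s) x * g x * ennreal s \<partial>lborel) = ennreal s * (\<integral>\<^sup>+x. indicator (cube c s) x * g x \<partial>lborel)"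
    by (subst nn_integral_multc) (auto simp: mult.commute)
  finally show ?thesis .
qed

text \<open>The squared difference is at most |y_b - x_b| times the integral \<open>P x\<close> of
  the squared derivative over the whole chord through x. Since \<open>P x\<close> is free of y, the
  two integrations separate: the distance contributes s^d s/2 and the chord s.\<close>

lemma nn_integral_coordinate_difference:
  fixes \<phi> :: "real^'d \<Rightarrow> real"
  assumes s: "s \<ge> 0" and b: "b \<in> Basis" and \<phi>: "smooth_fun \<phi>"
  shows "(\<integral>\<^sup>+x. \<integral>\<^sup>+y. indicator (cube c s) x * indicator (cube c s) y * ennreal ((\<phi> x - \<phi> (x + (y \<bullet> b - x \<bullet> b) *\<^sub>R b))\<^sup>2) \<partial>lborel \<partial>lborel)
    \<le> ennreal (s ^ CARD('d) * s\<^sup>2 / 2) * (\<integral>\<^sup>+x. indicator (cube c s) x * ennreal ((frechet_derivative \<phi> (at x) b)\<^sup>2) \<partial>lborel)"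
proof -
  let ?Q = "cube c s" and ?J = "{t. \<bar>t - c \<bullet> b\<bar> < s / 2}"
  let ?g = "\<lambda>x. frechet_derivative \<phi> (at x) b"
  have g: "smooth_fun ?g" by (rule smooth_funD(2)[OF \<phi> b])
  have [measurable]: "?g \<in> borel_measurable borel" by (rule smooth_fun_measurable[OF g])
  have J: "?J = {c \<bullet> b - s / 2 <..< c \<bullet> b + s / 2}"
    unfolding set_eq_iff mem_Collect_eq greaterThanLessThan_iff by linarith
  then have [measurable]: "?J \<in> sets borel" by simp
  define P where "P x = (\<integral>\<^sup>+t. indicator ?J t * ennreal ((?g (x + (t - x \<bullet> b) *\<^sub>R b))\<^sup>2) \<partial>lborel)" for x
  have [measurable]: "P \<in> borel_measurable borel" unfolding P_def by measurable
  have pw: "ennreal ((\<phi> x - \<phi> (x + (y \<bullet> b - x \<bullet> b) *\<^sub>R b))\<^sup>2) \<le> ennreal \<bar>y \<bullet> b - x \<bullet> b\<bar> * P x" if "x \<in> ?Q" "y \<in> ?Q" for x y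
  proof -
    define h where "h t = \<phi> (x + (t - x \<bullet> b) *\<^sub>R b)" for t
    define h' where "h' t = ?g (x + (t - x \<bullet> b) *\<^sub>R b)" for t
    have d: "(h has_real_derivative h' t) (at t)" for t
    proof -
      let ?L = "\<lambda>t. x + (t - x \<bullet> b) *\<^sub>R b"
      have 1: "(?L has_derivative (\<lambda>u. u *\<^sub>R b)) (at t)" by (auto intro!: derivative_eq_intros)
      have 2: "(\<phi> has_derivative frechet_derivative \<phi> (at (?L t))) (at (?L t))"
        by (rule smooth_fun_has_derivative[OF \<phi>])
      have "((\<lambda>t. \<phi> (?L t)) has_derivative (\<lambda>u. frechet_derivative \<phi> (at (?L t)) (u *\<^sub>R b))) (at t)"
        by (rule has_derivative_compose[OF 1 2])
      moreover have "frechet_derivative \<phi> (at (?L t)) (u *\<^sub>R b) = h' t * u" for u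
        using linear_cmul[OF has_derivative_linear[OF 2], of u b] by (simp add: h'_def mult.commute)
      ultimately show ?thesis by (simp add: has_field_derivative_def h_def[abs_def])
    qed
    have c: "continuous_on UNIV h'" unfolding h'_def
      by (rule continuous_on_compose2[OF smooth_fun_continuous[OF g, of UNIV]]) (auto intro!: continuous_intros)
    have xy: "\<bar>x \<bullet> b - c \<bullet> b\<bar> < s / 2" "\<bar>y \<bullet> b - c \<bullet> b\<bar> < s / 2"
      using that b by (auto simp: mem_cube inner_diff_left)
    have Ph: "P x = (\<integral>\<^sup>+t. indicator ?J t * ennreal ((h' t)\<^sup>2) \<partial>lborel)" by (simp add: P_def h'_def)
    have hx: "h (x \<bullet> b) = \<phi> x" "h (y \<bullet> b) = \<phi> (x + (y \<bullet> b - x \<bullet> b) *\<^sub>R b)" by (auto simp: h_def)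
    show ?thesis
    proof (cases "x \<bullet> b \<le> y \<bullet> b")
      case True
      have "{x \<bullet> b..y \<bullet> b} \<subseteq> ?J"
        using xy by (intro subsetI) (unfold mem_Collect_eq atLeastAtMost_iff, linarith)
      from nn_integral_segment_Cauchy_Schwarz[OF d c this True] show ?thesis
        using True by (simp add: Ph hx power2_commute)
    next
      case False
      have "{y \<bullet> b..x \<bullet> b} \<subseteq> ?J"
        using xy by (intro subsetI) (unfold mem_Collect_eq atLeastAtMost_iff, linarith)
      from nn_integral_segment_Cauchy_Schwarz[OF d c this] False show ?thesis
        by (simp add: Ph hx power2_commute)
    qed
  qed
  have "(\<integral>\<^sup>+x. \<integral>\<^sup>+y. indicator ?Q x * indicator ?Q y * ennreal ((\<phi> x - \<phi> (x + (y \<bullet> b - x \<bullet> b) *\<^sub>R b))\<^sup>2) \<partial>lborel \<partial>lborel)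
    \<le> (\<integral>\<^sup>+x. \<integral>\<^sup>+y. (indicator ?Q x * P x) * (indicator ?Q y * ennreal \<bar>y \<bullet> b - x \<bullet> b\<bar>) \<partial>lborel \<partial>lborel)"
    using pw by (intro nn_integral_mono) (auto simp: indicator_def mult.commute)
  also have "\<dots> = (\<integral>\<^sup>+x. (indicator ?Q x * P x) * (\<integral>\<^sup>+y. indicator ?Q y * ennreal \<bar>y \<bullet> b - x \<bullet> b\<bar> \<partial>lborel) \<partial>lborel)"
    by (intro nn_integral_cong nn_integral_cmult) measurable
  also have "\<dots> \<le> (\<integral>\<^sup>+x. (indicator ?Q x * P x) * ennreal (s ^ CARD('d) * (s / 2)) \<partial>lborel)"
    using nn_integral_cube_abs_le[OF s b] by (intro nn_integral_mono) (auto simp: indicator_def intro: mult_left_mono)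
  also have "\<dots> = (\<integral>\<^sup>+x. indicator ?Q x * P x \<partial>lborel) * ennreal (s ^ CARD('d) * (s / 2))"
    by (rule nn_integral_multc) measurable
  also have "(\<integral>\<^sup>+x. indicator ?Q x * P x \<partial>lborel) = ennreal s * (\<integral>\<^sup>+x. indicator ?Q x * ennreal ((?g x)\<^sup>2) \<partial>lborel)"
    unfolding P_def by (rule nn_integral_cube_line[OF s b]) measurable
  also have "ennreal s * (\<integral>\<^sup>+x. indicator ?Q x * ennreal ((?g x)\<^sup>2) \<partial>lborel) * ennreal (s ^ CARD('d) * (s / 2))
     = ennreal (s ^ CARD('d) * s\<^sup>2 / 2) * (\<integral>\<^sup>+x. indicator ?Q x * ennreal ((?g x)\<^sup>2) \<partial>lborel)"
  proof -
    have "ennreal (s ^ CARD('d) * s\<^sup>2 / 2) = ennreal s * ennreal (s ^ CARD('d) * (s / 2))"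
      using s by (simp add: ennreal_mult[symmetric] power2_eq_square mult_ac)
    then show ?thesis by (simp add: mult_ac)
  qed
  finally show ?thesis .
qed

text \<open>Young's inequality. With constant k for the first k coordinates, the factor 1 + 1/k
  raises it to k + 1, matching the factor 1 + k of the new term. So the constant of the telescoping
  argument grows linearly in the number of coordinates.\<close>

lemma square_sum_weighted:
  fixes u v :: real assumes "k > 0"
  shows "(u + v)\<^sup>2 \<le> (1 + 1 / k) * u\<^sup>2 + (1 + k) * v\<^sup>2"
proof -
  have "0 \<le> (u / sqrt k - sqrt k * v)\<^sup>2" by simp
  also have "\<dots> = (u / sqrt k)\<^sup>2 + (sqrt k * v)\<^sup>2 - 2 * (u / sqrt k) * (sqrt k * v)" by (simp add: power2_diff)
  also have "\<dots> = u\<^sup>2 / k + k * v\<^sup>2 - 2 * u * v" using assms by (simp add: power_divide power_mult_distrib)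
  finally show ?thesis by (simp add: power2_sum distrib_right)
qed

text \<open>Telescoping over coordinates: each elementary replacement \<open>x \<mapsto> x[b := y\<^sub>b]\<close> starts from
  a point \<open>mix B x y\<close> which is again uniformly distributed on the cube.\<close>

lemma nn_integral_mix_difference:
  fixes \<phi> :: "real^'d \<Rightarrow> real"
  assumes s: "s \<ge> 0" and \<phi>: "smooth_fun \<phi>" and B: "B \<subseteq> Basis"
  shows "(\<integral>\<^sup>+x. \<integral>\<^sup>+y. indicator (cube c s) x * indicator (cube c s) y * ennreal ((\<phi> x - \<phi> (mix B x y))\<^sup>2) \<partial>lborel \<partial>lborel)
    \<le> ennreal (real (card B) * (s ^ CARD('d) * s\<^sup>2 / 2)) * (\<Sum>b\<in>B. \<integral>\<^sup>+x. indicator (cube c s) x * ennreal ((frechet_derivative \<phi> (at x) b)\<^sup>2) \<partial>lborel)"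
proof -
  have "finite B" using B finite_Basis finite_subset by blast
  then show ?thesis using B
  proof (induction B rule: finite_induct)
    case empty
    then show ?case by (simp add: mix_def)
  next
    case (insert b B)
    let ?Q = "cube c s"
    let ?C = "s ^ CARD('d) * s\<^sup>2 / 2"
    let ?S = "\<lambda>b. \<integral>\<^sup>+x. indicator ?Q x * ennreal ((frechet_derivative \<phi> (at x) b)\<^sup>2) \<partial>lborel"
    have [measurable]: "\<phi> \<in> borel_measurable borel" by (rule smooth_fun_measurable[OF \<phi>])
    have b: "b \<in> Basis" "b \<notin> B" "B \<subseteq> Basis" using insert by auto
    have C0: "?C \<ge> 0" using s by simp
    define z where "z = mix B"
    define G where "G x t = ennreal ((\<phi> x - \<phi> (x + (t - x \<bullet> b) *\<^sub>R b))\<^sup>2)" for x t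
    have [measurable]: "(\<lambda>(x, t). G x t) \<in> borel_measurable (borel \<Otimes>\<^sub>M borel)" unfolding G_def by measurable
    have [measurable]: "(\<lambda>x. z (f x) (g x)) \<in> borel_measurable M" if [measurable]: "f \<in> borel_measurable M" "g \<in> borel_measurable M" for f g M
      unfolding z_def by measurable
    have mixb: "mix (insert b B) x y = z x y + (y \<bullet> b - z x y \<bullet> b) *\<^sub>R b" for x y
      using insert.hyps b mix_inner[OF b(3,1), of x y] by (simp add: z_def) (simp add: mix_def inner_diff_left algebra_simps)
    have G1: "(\<integral>\<^sup>+x. \<integral>\<^sup>+y. indicator ?Q x * indicator ?Q y * G (z x y) (y \<bullet> b) \<partial>lborel \<partial>lborel) \<le> ennreal ?C * ?S b"
      unfolding z_def
      by (subst mix_measure_preserving[OF b(3,1,2)], measurable)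
         (use nn_integral_coordinate_difference[OF s b(1) \<phi>, of c] in \<open>simp add: G_def\<close>)
    have IH: "(\<integral>\<^sup>+x. \<integral>\<^sup>+y. indicator ?Q x * indicator ?Q y * ennreal ((\<phi> x - \<phi> (z x y))\<^sup>2) \<partial>lborel \<partial>lborel)
      \<le> ennreal (real (card B) * ?C) * (\<Sum>b\<in>B. ?S b)"
      unfolding z_def by (rule insert.IH[OF b(3)])
    show ?case
    proof (cases "B = {}")
      case True
      then have "z x y = x" for x y by (simp add: z_def mix_def)
      then show ?thesis using G1 True mixb by (simp add: G_def)
    next
      case False
      define k where "k = real (card B)"
      have k: "k > 0" using False insert.hyps by (simp add: k_def card_gt_0_iff)
      have pw: "ennreal ((\<phi> x - \<phi> (mix (insert b B) x y))\<^sup>2) \<le> ennreal (1 + 1 / k) * ennreal ((\<phi> x - \<phi> (z x y))\<^sup>2) + ennreal (1 + k) * G (z x y) (y \<bullet> b)" for x y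
      proof -
        have "(\<phi> x - \<phi> (mix (insert b B) x y))\<^sup>2 \<le> (1 + 1 / k) * (\<phi> x - \<phi> (z x y))\<^sup>2 + (1 + k) * (\<phi> (z x y) - \<phi> (mix (insert b B) x y))\<^sup>2"
          using square_sum_weighted[OF k, of "\<phi> x - \<phi> (z x y)" "\<phi> (z x y) - \<phi> (mix (insert b B) x y)"] by simp
        then have "ennreal ((\<phi> x - \<phi> (mix (insert b B) x y))\<^sup>2) \<le> ennreal ((1 + 1 / k) * (\<phi> x - \<phi> (z x y))\<^sup>2 + (1 + k) * (\<phi> (z x y) - \<phi> (mix (insert b B) x y))\<^sup>2)"
          by (rule ennreal_leI)
        also have "\<dots> = ennreal (1 + 1 / k) * ennreal ((\<phi> x - \<phi> (z x y))\<^sup>2) + ennreal (1 + k) * G (z x y) (y \<bullet> b)"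
          using k by (simp add: ennreal_plus[symmetric] ennreal_mult[symmetric] G_def mixb del: ennreal_plus)
        finally show ?thesis .
      qed
      have "(\<integral>\<^sup>+x. \<integral>\<^sup>+y. indicator ?Q x * indicator ?Q y * ennreal ((\<phi> x - \<phi> (mix (insert b B) x y))\<^sup>2) \<partial>lborel \<partial>lborel)
        \<le> (\<integral>\<^sup>+x. \<integral>\<^sup>+y. ennreal (1 + 1 / k) * (indicator ?Q x * indicator ?Q y * ennreal ((\<phi> x - \<phi> (z x y))\<^sup>2))
            + ennreal (1 + k) * (indicator ?Q x * indicator ?Q y * G (z x y) (y \<bullet> b)) \<partial>lborel \<partial>lborel)"
        using pw by (intro nn_integral_mono) (auto simp: indicator_def)
      also have "\<dots> = ennreal (1 + 1 / k) * (\<integral>\<^sup>+x. \<integral>\<^sup>+y. indicator ?Q x * indicator ?Q y * ennreal ((\<phi> x - \<phi> (z x y))\<^sup>2) \<partial>lborel \<partial>lborel)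
         + ennreal (1 + k) * (\<integral>\<^sup>+x. \<integral>\<^sup>+y. indicator ?Q x * indicator ?Q y * G (z x y) (y \<bullet> b) \<partial>lborel \<partial>lborel)"
        by (subst nn_integral_add nn_integral_cmult; measurable)+
      also have "\<dots> \<le> ennreal (1 + 1 / k) * (ennreal (k * ?C) * (\<Sum>b\<in>B. ?S b)) + ennreal (1 + k) * (ennreal ?C * ?S b)"
        using IH G1 unfolding k_def by (intro add_mono mult_left_mono) auto
      also have "\<dots> = ennreal ((1 + k) * ?C) * (\<Sum>b\<in>B. ?S b) + ennreal ((1 + k) * ?C) * ?S b"
      proof -
        have "ennreal (1 + 1 / k) * ennreal (k * ?C) = ennreal ((1 + k) * ?C)"
        proof -
          have "(1 + 1 / k) * (k * ?C) = (1 + k) * ?C" using k by (simp add: field_simps)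
          then show ?thesis using k C0 by (subst ennreal_mult[symmetric]) auto
        qed
        moreover have "ennreal (1 + k) * ennreal ?C = ennreal ((1 + k) * ?C)"
          using k C0 by (intro ennreal_mult[symmetric]) auto
        ultimately show ?thesis by (simp only: mult.assoc[symmetric])
      qed
      also have "\<dots> = ennreal (real (card (insert b B)) * ?C) * (\<Sum>b\<in>insert b B. ?S b)"
        using insert.hyps by (simp add: k_def distrib_left add.commute)
      finally show ?thesis .
    qed
  qed
qed

section \<open>The Poincare inequality on cubes\<close>

lemma sum_Basis_axis:
  fixes f :: "real^'d \<Rightarrow> 'b::comm_monoid_add"
  shows "(\<Sum>b\<in>Basis. f b) = (\<Sum>i\<in>UNIV. f (axis i 1))"
proof -
  have B: "(Basis :: (real^'d) set) = range (\<lambda>i::'d. axis i 1)" by (auto simp: Basis_vec_def)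
  have "inj (\<lambda>i::'d. axis i (1::real))" by (auto simp: inj_on_def axis_eq_axis)
  then show ?thesis unfolding B by (simp add: sum.reindex)
qed

text \<open>With I and J the integrals of phi and phi^2, the double integral of (phi x - phi y)^2
  over the cube is 2 (s^d J - I^2). Exchanging all d coordinates bounds it by d s^d s^2 / 2 times
  the squared gradient, and halving gives d/4.\<close>

lemma Poincare_test_fun:
  fixes \<phi> :: "real^'d \<Rightarrow> real" and c :: "real^'d"
  assumes s: "s \<ge> 0" and t: "test_fun S \<phi>"
  defines "M \<equiv> lebesgue_on (cube c s)"
  shows "s ^ CARD('d) * (\<integral>x. (\<phi> x)\<^sup>2 \<partial>M) \<le> (\<integral>x. \<phi> x \<partial>M)\<^sup>2
    + s ^ CARD('d) * (real CARD('d) / 4 * s\<^sup>2) * (\<Sum>i\<in>UNIV. \<integral>x. (clgrad \<phi> x $ i)\<^sup>2 \<partial>M)"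
proof -
  let ?Q = "cube c s" and ?n = "CARD('d)"
  have \<phi>: "smooth_fun \<phi>" by (rule test_funD(1)[OF t])
  have m [measurable]: "\<phi> \<in> borel_measurable borel" by (rule smooth_fun_measurable[OF \<phi>])
  have md [measurable]: "(\<lambda>x. clgrad \<phi> x $ i) \<in> borel_measurable borel" for i
    by (intro smooth_fun_measurable clgrad_smooth \<phi>)
  define I J where "I = (\<integral>x. indicator ?Q x * \<phi> x \<partial>lborel)" and "J = (\<integral>x. indicator ?Q x * (\<phi> x)\<^sup>2 \<partial>lborel)"
  define D where "D i = (\<integral>x. indicator ?Q x * (clgrad \<phi> x $ i)\<^sup>2 \<partial>lborel)" for i
  have iq: "integrable lborel (\<lambda>x. indicator ?Q x * f x)" if "integrable lborel f" for f :: "real^'d \<Rightarrow> real"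
    using integrable_mult_indicator[of ?Q lborel f] that by simp
  have i1: "integrable lborel (\<lambda>x. indicator ?Q x * \<phi> x)"
    by (rule iq[OF smooth_compact_integrable[OF test_funD(1,2,5)[OF t]]])
  have i2: "integrable lborel (\<lambda>x. indicator ?Q x * (\<phi> x)\<^sup>2)"
    by (rule iq[OF sqintD(2)[OF test_fun_sqint_lborel[OF t]]])
  have i3: "integrable lborel (\<lambda>x. indicator ?Q x * (clgrad \<phi> x $ i)\<^sup>2)" for i
    by (rule iq[OF sqintD(2)[OF test_fun_sqint_lborel[OF test_fun_clgrad[OF t]]]])
  have i0: "integrable lborel (indicat_real ?Q)" using emeasure_cube[OF s, of c] by (intro integrable_real_indicator) auto
  have m0: "(\<integral>x. indicat_real ?Q x \<partial>lborel) = s ^ ?n" using measure_cube(1)[OF s, of c] by simp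
  have inner: "(\<integral>\<^sup>+y. indicator ?Q y * ennreal ((a - \<phi> y)\<^sup>2) \<partial>lborel) = ennreal (s ^ ?n * a\<^sup>2 - 2 * a * I + J)" for a
  proof -
    have e: "indicator ?Q y * (a - \<phi> y)\<^sup>2 = a\<^sup>2 * indicator ?Q y - 2 * a * (indicator ?Q y * \<phi> y) + indicator ?Q y * (\<phi> y)\<^sup>2" for y
      by (simp add: power2_diff algebra_simps)
    have "(\<integral>\<^sup>+y. indicator ?Q y * ennreal ((a - \<phi> y)\<^sup>2) \<partial>lborel) = (\<integral>\<^sup>+y. ennreal (indicator ?Q y * (a - \<phi> y)\<^sup>2) \<partial>lborel)"
      by (intro nn_integral_cong) (auto simp: indicator_def)
    also have "\<dots> = ennreal (\<integral>y. indicator ?Q y * (a - \<phi> y)\<^sup>2 \<partial>lborel)"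
    proof (rule nn_integral_eq_integral)
      show "integrable lborel (\<lambda>y. indicator ?Q y * (a - \<phi> y)\<^sup>2)" unfolding e using i0 i1 i2 by auto
      show "AE y in lborel. 0 \<le> indicator ?Q y * (a - \<phi> y)\<^sup>2" by (intro AE_I2) simp
    qed
    also have "(\<integral>y. indicator ?Q y * (a - \<phi> y)\<^sup>2 \<partial>lborel) = s ^ ?n * a\<^sup>2 - 2 * a * I + J"
      unfolding e using i0 i1 i2 m0 by (simp add: I_def J_def mult.commute)
    finally show ?thesis .
  qed
  have pos: "s ^ ?n * a\<^sup>2 - 2 * a * I + J \<ge> 0" for a
  proof -
    have e: "indicator ?Q y * (a - \<phi> y)\<^sup>2 = a\<^sup>2 * indicator ?Q y - 2 * a * (indicator ?Q y * \<phi> y) + indicator ?Q y * (\<phi> y)\<^sup>2" for y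
      by (simp add: power2_diff algebra_simps)
    have "0 \<le> (\<integral>y. indicator ?Q y * (a - \<phi> y)\<^sup>2 \<partial>lborel)" by (intro integral_nonneg_AE AE_I2) simp
    also have "\<dots> = s ^ ?n * a\<^sup>2 - 2 * a * I + J"
      unfolding e using i0 i1 i2 m0 by (simp add: I_def J_def mult.commute)
    finally show ?thesis .
  qed
  have outer: "(\<integral>\<^sup>+x. \<integral>\<^sup>+y. indicator ?Q x * indicator ?Q y * ennreal ((\<phi> x - \<phi> (mix Basis x y))\<^sup>2) \<partial>lborel \<partial>lborel)
     = ennreal (2 * (s ^ ?n * J - I\<^sup>2))"
  proof -
    have mixy: "mix Basis x y = y" for x y :: "real^'d" by (rule euclidean_eqI) (simp add: mix_inner)
    have e: "indicator ?Q x * (s ^ ?n * (\<phi> x)\<^sup>2 - 2 * \<phi> x * I + J)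
        = s ^ ?n * (indicator ?Q x * (\<phi> x)\<^sup>2) - 2 * I * (indicator ?Q x * \<phi> x) + J * indicator ?Q x" for x
      by (simp add: algebra_simps)
    have "(\<integral>\<^sup>+x. \<integral>\<^sup>+y. indicator ?Q x * indicator ?Q y * ennreal ((\<phi> x - \<phi> (mix Basis x y))\<^sup>2) \<partial>lborel \<partial>lborel)
      = (\<integral>\<^sup>+x. indicator ?Q x * (\<integral>\<^sup>+y. indicator ?Q y * ennreal ((\<phi> x - \<phi> y)\<^sup>2) \<partial>lborel) \<partial>lborel)"
      by (simp add: mixy mult.assoc nn_integral_cmult)
    also have "\<dots> = (\<integral>\<^sup>+x. ennreal (indicator ?Q x * (s ^ ?n * (\<phi> x)\<^sup>2 - 2 * \<phi> x * I + J)) \<partial>lborel)"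
      unfolding inner by (intro nn_integral_cong) (auto simp: indicator_def)
    also have "\<dots> = ennreal (\<integral>x. indicator ?Q x * (s ^ ?n * (\<phi> x)\<^sup>2 - 2 * \<phi> x * I + J) \<partial>lborel)"
    proof (rule nn_integral_eq_integral)
      show "integrable lborel (\<lambda>x. indicator ?Q x * (s ^ ?n * (\<phi> x)\<^sup>2 - 2 * \<phi> x * I + J))"
        unfolding e using i0 i1 i2 by auto
      show "AE x in lborel. 0 \<le> indicator ?Q x * (s ^ ?n * (\<phi> x)\<^sup>2 - 2 * \<phi> x * I + J)"
        using pos by (intro AE_I2 mult_nonneg_nonneg) auto
    qed
    also have "(\<integral>x. indicator ?Q x * (s ^ ?n * (\<phi> x)\<^sup>2 - 2 * \<phi> x * I + J) \<partial>lborel) = 2 * (s ^ ?n * J - I\<^sup>2)"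
    proof -
      have "(\<integral>x. indicator ?Q x * (s ^ ?n * (\<phi> x)\<^sup>2 - 2 * \<phi> x * I + J) \<partial>lborel) = s ^ ?n * J - 2 * I * I + J * s ^ ?n"
        unfolding e using i0 i1 i2 m0 by (simp add: I_def J_def)
      then show ?thesis by (simp add: power2_eq_square)
    qed
    finally show ?thesis .
  qed
  have grad: "(\<integral>\<^sup>+x. indicator ?Q x * ennreal ((frechet_derivative \<phi> (at x) (axis i 1))\<^sup>2) \<partial>lborel) = ennreal (D i)" for i
  proof -
    have "(\<integral>\<^sup>+x. indicator ?Q x * ennreal ((frechet_derivative \<phi> (at x) (axis i 1))\<^sup>2) \<partial>lborel) = (\<integral>\<^sup>+x. ennreal (indicator ?Q x * (clgrad \<phi> x $ i)\<^sup>2) \<partial>lborel)"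
      by (intro nn_integral_cong) (auto simp: indicator_def clgrad_def)
    also have "\<dots> = ennreal (D i)" unfolding D_def by (rule nn_integral_eq_integral[OF i3]) auto
    finally show ?thesis .
  qed
  have D0: "D i \<ge> 0" for i unfolding D_def by (intro integral_nonneg_AE AE_I2) simp
  have "ennreal (2 * (s ^ ?n * J - I\<^sup>2)) \<le> ennreal (real ?n * (s ^ ?n * s\<^sup>2 / 2)) * (\<Sum>i\<in>UNIV. ennreal (D i))"
    using nn_integral_mix_difference[OF s \<phi> subset_refl[of Basis], of c]
    unfolding outer sum_Basis_axis[of "\<lambda>b. \<integral>\<^sup>+x. indicator ?Q x * ennreal ((frechet_derivative \<phi> (at x) b)\<^sup>2) \<partial>lborel"] grad
    by simp
  also have "\<dots> = ennreal (real ?n * (s ^ ?n * s\<^sup>2 / 2) * (\<Sum>i\<in>UNIV. D i))"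
  proof -
    have "(\<Sum>i\<in>UNIV. ennreal (D i)) = ennreal (\<Sum>i\<in>UNIV. D i)" using D0 by (intro sum_ennreal) auto
    then show ?thesis using D0 s by (simp only:) (intro ennreal_mult[symmetric] sum_nonneg; auto)
  qed
  finally have "2 * (s ^ ?n * J - I\<^sup>2) \<le> real ?n * (s ^ ?n * s\<^sup>2 / 2) * (\<Sum>i\<in>UNIV. D i)"
    using D0 s by (subst (asm) ennreal_le_iff) (auto intro!: mult_nonneg_nonneg sum_nonneg)
  then have "s ^ ?n * J \<le> I\<^sup>2 + s ^ ?n * (real ?n / 4 * s\<^sup>2) * (\<Sum>i\<in>UNIV. D i)"
    by (simp add: field_simps)
  moreover have "I = (\<integral>x. \<phi> x \<partial>M)" "J = (\<integral>x. (\<phi> x)\<^sup>2 \<partial>M)" "D i = (\<integral>x. (clgrad \<phi> x $ i)\<^sup>2 \<partial>M)" for i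
    unfolding I_def J_def D_def M_def by (intro lebesgue_on_integral_lborel(1)[symmetric]; measurable)+
  ultimately show ?thesis by simp
qed

lemma lebesgue_on_integral_indicator:
  fixes f :: "'a::euclidean_space \<Rightarrow> real"
  assumes T: "T \<in> sets borel" and S: "S \<in> sets borel" and TS: "T \<subseteq> S"
  shows "(\<integral>x. f x \<partial>lebesgue_on T) = (\<integral>x. indicator T x * f x \<partial>lebesgue_on S)"
proof -
  have Sl: "S \<inter> space lebesgue \<in> sets lebesgue" "T \<inter> space lebesgue \<in> sets lebesgue" using S T by auto
  have "(\<lambda>x. indicator S x *\<^sub>R (indicator T x * f x)) = (\<lambda>x. indicator T x *\<^sub>R f x)" using TS by (auto simp: indicator_def fun_eq_iff)
  then show ?thesis by (simp only: integral_restrict_space[OF Sl(1)] integral_restrict_space[OF Sl(2)])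
qed

lemma integral_subset_le:
  fixes f :: "'a::euclidean_space \<Rightarrow> real"
  assumes T: "T \<in> sets borel" and S: "S \<in> sets borel" and TS: "T \<subseteq> S"
    and f: "integrable (lebesgue_on S) f" "\<And>x. x \<in> S \<Longrightarrow> f x \<ge> 0"
  shows "(\<integral>x. f x \<partial>lebesgue_on T) \<le> (\<integral>x. f x \<partial>lebesgue_on S)"
  unfolding lebesgue_on_integral_indicator[OF T S TS]
proof (rule integral_mono[OF _ f(1)])
  show "integrable (lebesgue_on S) (\<lambda>x. indicat_real T x * f x)"
    using integrable_mult_indicator[of T "lebesgue_on S" f] T TS f(1) S
    by (simp add: sets_restrict_space_iff)
qed (use f(2) in \<open>auto simp: indicator_def\<close>)

lemma L2lim_subset:
  fixes f :: "nat \<Rightarrow> 'a::euclidean_space \<Rightarrow> real"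
  assumes TS: "T \<in> sets borel" "S \<in> sets borel" "T \<subseteq> S" and L: "L2lim (lebesgue_on S) f g"
  shows "L2lim (lebesgue_on T) f g"
  unfolding L2lim_def
proof (intro conjI allI)
  show "sqint (lebesgue_on T) (f k)" "sqint (lebesgue_on T) g" for k
    using L2limD(1,2)[OF L] sqint_subset[OF TS] by blast+
  show "(\<lambda>k. \<integral>x. (f k x - g x)\<^sup>2 \<partial>lebesgue_on T) \<longlonglongrightarrow> 0"
  proof (rule tendsto_sandwich[OF _ _ tendsto_const L2limD(3)[OF L]])
    show "\<forall>\<^sub>F k in sequentially. (\<integral>x. (f k x - g x)\<^sup>2 \<partial>lebesgue_on T) \<le> (\<integral>x. (f k x - g x)\<^sup>2 \<partial>lebesgue_on S)"
      using integral_subset_le[OF TS sqintD(2)[OF sqint_diff[OF L2limD(1,2)[OF L]]]] by (auto intro!: always_eventually)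
  qed (auto intro!: always_eventually)
qed

lemma integral_cube_exhaustion:
  fixes f :: "real^'d \<Rightarrow> real" and c :: "real^'d"
  assumes f: "integrable (lebesgue_on (cube c s)) f" and s: "s > 0"
  shows "(\<lambda>j::nat. \<integral>x. f x \<partial>lebesgue_on (cube c (s - s / (real j + 2)))) \<longlonglongrightarrow> (\<integral>x. f x \<partial>lebesgue_on (cube c s))"
proof -
  let ?r = "\<lambda>j::nat. s - s / (real j + 2)"
  have sub: "cube c (?r j) \<subseteq> cube c s" for j using s by (intro cube_mono) simp
  have mono: "?r i \<le> ?r j" if "i \<le> j" for i j :: nat using s that by (simp add: frac_le)
  have sm: "cube c (?r j) \<in> sets (lebesgue_on (cube c s))" for j
    using sub by (simp add: sets_restrict_space_iff)
  show ?thesis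
    unfolding lebesgue_on_integral_indicator[OF cube_borel cube_borel sub]
  proof (rule integral_dominated_convergence[where w="\<lambda>x. \<bar>f x\<bar>"])
    show "AE x in lebesgue_on (cube c s). (\<lambda>j. indicat_real (cube c (?r j)) x * f x) \<longlonglongrightarrow> f x"
    proof (intro AE_I2)
      fix x assume "x \<in> space (lebesgue_on (cube c s))"
      then obtain j where j: "x \<in> cube c (?r j)" using cube_exhaustion[of x c s] by auto
      have "\<forall>\<^sub>F i in sequentially. f x = indicat_real (cube c (?r i)) x * f x"
        unfolding eventually_sequentially
      proof (intro exI[of _ j] allI impI)
        fix i assume "j \<le> i"
        then have "x \<in> cube c (?r i)" using j cube_mono[OF mono] by blast
        then show "f x = indicat_real (cube c (?r i)) x * f x" by simp
      qed
      then show "(\<lambda>j. indicat_real (cube c (?r j)) x * f x) \<longlonglongrightarrow> f x"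
        by (rule Lim_transform_eventually[OF tendsto_const])
    qed
    show "(\<lambda>x. indicat_real (cube c (?r j)) x * f x) \<in> borel_measurable (lebesgue_on (cube c s))" for j
      using sm f by (intro borel_measurable_times borel_measurable_indicator) auto
  qed (use f in \<open>auto simp: indicator_def intro!: AE_I2\<close>)
qed

lemma L2lim_integral:
  assumes "finite_measure M" "L2lim M f g"
  shows "(\<lambda>k. \<integral>x. f k x \<partial>M) \<longlonglongrightarrow> (\<integral>x. g x \<partial>M)"
proof -
  have "sqint M (\<lambda>x. 1)" using assms(1) by (simp add: sqint_def finite_measure.integrable_const)
  from L2lim_integral_mult[OF assms(2) L2lim_const[OF this]] show ?thesis by simp
qed

lemma clgrad_locally_const:
  assumes T: "open T" and f: "\<And>x. x \<in> T \<Longrightarrow> f x = a" and x: "x \<in> T"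
  shows "clgrad f x = 0"
proof -
  have "((\<lambda>x. a) has_derivative (\<lambda>h. 0)) (at x)" by simp
  then have "(f has_derivative (\<lambda>h. 0)) (at x)"
    by (rule has_derivative_transform_within_open[where s=T]) (use assms in auto)
  then show ?thesis by (simp add: clgrad_def vec_eq_iff frechet_derivative_at[symmetric])
qed

text \<open>On a smaller concentric cube the cut-off is 1 with gradient 0, so f itself is there a
  limit of test functions with gradients. The inequality survives this limit and then the growth of
  the inner cubes, which avoids approximation up to the boundary.\<close>

lemma Poincare_cube:
  fixes f :: "real^'d \<Rightarrow> real" and c :: "real^'d"
  assumes s: "s > 0" and h: "h1pair (cube c s) f g"
  defines "M \<equiv> lebesgue_on (cube c s)"
  shows "s ^ CARD('d) * (\<integral>x. (f x)\<^sup>2 \<partial>M) \<le> (\<integral>x. f x \<partial>M)\<^sup>2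
    + s ^ CARD('d) * (real CARD('d) / 4 * s\<^sup>2) * (\<Sum>i\<in>UNIV. \<integral>x. (g x $ i)\<^sup>2 \<partial>M)"
proof -
  let ?n = "CARD('d)" and ?r = "\<lambda>j::nat. s - s / (real j + 2)"
  let ?M = "\<lambda>j. lebesgue_on (cube c (?r j))"
  have fg: "sqint M f" "\<And>i. sqint M (\<lambda>x. g x $ i)" using h by (auto simp: h1pair_def M_def)
  have sub: "cube c (?r j) \<subseteq> cube c s" for j using s by (intro cube_mono) simp
  have r0: "?r j \<ge> 0" for j using s by (simp add: field_simps)
  obtain \<eta> :: "nat \<Rightarrow> real^'d \<Rightarrow> real" where \<eta>: "\<And>j. test_fun (cube c s) (\<eta> j)"
    "\<And>j x. x \<in> cube c (?r j) \<Longrightarrow> \<eta> j x = 1"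
    using cube_cutoffs[OF s] by blast
  have step: "?r j ^ ?n * (\<integral>x. (f x)\<^sup>2 \<partial>?M j) \<le> (\<integral>x. f x \<partial>?M j)\<^sup>2
    + ?r j ^ ?n * (real ?n / 4 * (?r j)\<^sup>2) * (\<Sum>i\<in>UNIV. \<integral>x. (g x $ i)\<^sup>2 \<partial>?M j)" for j
  proof -
    obtain \<phi> where \<phi>: "\<forall>k. test_fun (cube c s) (\<phi> k)" "L2lim M \<phi> (\<lambda>x. \<eta> j x * f x)"
      "\<forall>i. L2lim M (\<lambda>k x. clgrad (\<phi> k) x $ i) (\<lambda>x. \<eta> j x * g x $ i + f x * clgrad (\<eta> j) x $ i)"
      using mollified_cutoff[OF open_cube h \<eta>(1)] unfolding M_def by blast
    have grad0: "clgrad (\<eta> j) x = 0" if "x \<in> cube c (?r j)" for x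
      by (rule clgrad_locally_const[OF open_cube \<eta>(2) that])
    have L1: "L2lim (?M j) \<phi> f"
    proof (rule L2lim_cong_AE[OF L2lim_subset[OF cube_borel cube_borel sub \<phi>(2)[unfolded M_def]]])
      show "f \<in> borel_measurable (?M j)" by (rule lebesgue_on_subset_measurable[OF sub sqintD(1)[OF fg(1)[unfolded M_def]]])
      show "AE x in ?M j. \<eta> j x * f x = f x" using \<eta>(2) by (intro AE_I2) simp
    qed
    have L2: "L2lim (?M j) (\<lambda>k x. clgrad (\<phi> k) x $ i) (\<lambda>x. g x $ i)" for i
    proof (rule L2lim_cong_AE[OF L2lim_subset[OF cube_borel cube_borel sub \<phi>(3)[unfolded M_def, rule_format]]])
      show "(\<lambda>x. g x $ i) \<in> borel_measurable (?M j)"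
        by (rule lebesgue_on_subset_measurable[OF sub sqintD(1)[OF fg(2)[unfolded M_def]]])
      show "AE x in ?M j. \<eta> j x * g x $ i + f x * clgrad (\<eta> j) x $ i = g x $ i"
        using \<eta>(2) grad0 by (intro AE_I2) simp
    qed
    show ?thesis
    proof (rule LIMSEQ_le)
      show "(\<lambda>k. ?r j ^ ?n * (\<integral>x. (\<phi> k x)\<^sup>2 \<partial>?M j)) \<longlonglongrightarrow> ?r j ^ ?n * (\<integral>x. (f x)\<^sup>2 \<partial>?M j)"
        by (intro tendsto_intros L2lim_square L1)
      show "(\<lambda>k. (\<integral>x. \<phi> k x \<partial>?M j)\<^sup>2 + ?r j ^ ?n * (real ?n / 4 * (?r j)\<^sup>2) * (\<Sum>i\<in>UNIV. \<integral>x. (clgrad (\<phi> k) x $ i)\<^sup>2 \<partial>?M j))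
        \<longlonglongrightarrow> (\<integral>x. f x \<partial>?M j)\<^sup>2 + ?r j ^ ?n * (real ?n / 4 * (?r j)\<^sup>2) * (\<Sum>i\<in>UNIV. \<integral>x. (g x $ i)\<^sup>2 \<partial>?M j)"
        by (intro tendsto_intros L2lim_square L2 L2lim_integral[OF finite_measure_cube L1])
      show "\<exists>N. \<forall>k\<ge>N. ?r j ^ ?n * (\<integral>x. (\<phi> k x)\<^sup>2 \<partial>?M j) \<le> (\<integral>x. \<phi> k x \<partial>?M j)\<^sup>2
         + ?r j ^ ?n * (real ?n / 4 * (?r j)\<^sup>2) * (\<Sum>i\<in>UNIV. \<integral>x. (clgrad (\<phi> k) x $ i)\<^sup>2 \<partial>?M j)"
        using Poincare_test_fun[OF r0 \<phi>(1)[rule_format]] by blast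
    qed
  qed
  have rl: "?r \<longlonglongrightarrow> s"
  proof -
    have "(\<lambda>j. s * (1 / real (j + 2))) \<longlonglongrightarrow> s * 0" by (rule tendsto_mult[OF tendsto_const LIMSEQ_ignore_initial_segment[OF lim_1_over_n]])
    then have "(\<lambda>j. s - s * (1 / real (j + 2))) \<longlonglongrightarrow> s - s * 0" by (rule tendsto_diff[OF tendsto_const])
    then show ?thesis by (simp add: add.commute)
  qed
  show ?thesis
    unfolding M_def
  proof (rule LIMSEQ_le[OF _ _ exI[of _ 0]])
    show "(\<lambda>j. ?r j ^ ?n * (\<integral>x. (f x)\<^sup>2 \<partial>?M j)) \<longlonglongrightarrow> s ^ ?n * (\<integral>x. (f x)\<^sup>2 \<partial>lebesgue_on (cube c s))"
      by (intro tendsto_intros rl integral_cube_exhaustion s sqintD(2)[OF fg(1)[unfolded M_def]])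
    show "(\<lambda>j. (\<integral>x. f x \<partial>?M j)\<^sup>2 + ?r j ^ ?n * (real ?n / 4 * (?r j)\<^sup>2) * (\<Sum>i\<in>UNIV. \<integral>x. (g x $ i)\<^sup>2 \<partial>?M j))
      \<longlonglongrightarrow> (\<integral>x. f x \<partial>lebesgue_on (cube c s))\<^sup>2 + s ^ ?n * (real ?n / 4 * s\<^sup>2) * (\<Sum>i\<in>UNIV. \<integral>x. (g x $ i)\<^sup>2 \<partial>lebesgue_on (cube c s))"
      by (intro tendsto_intros rl integral_cube_exhaustion s sqintD(2)[OF fg(2)[unfolded M_def]]
          sqint_integrable[OF finite_measure_cube fg(1)[unfolded M_def]])
  qed (use step in blast)
qed

section \<open>Partition into congruent subcubes\<close>

text \<open>Off the null set of the cutting hyperplanes every point lies in exactly one open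
  subcube, so the indicators of the subcubes add up to 1 almost everywhere.\<close>

lemma cube_partition:
  fixes c :: "real^'d"
  assumes L: "L > 0" and m: "m > 0"
  obtains C :: "(real^'d) set" where "finite C" "card C \<le> m ^ CARD('d)"
    "\<And>z. z \<in> C \<Longrightarrow> cube z (L / real m) \<subseteq> cube c L"
    "\<And>f. integrable (lebesgue_on (cube c L)) f \<Longrightarrow>
       (\<integral>x. f x \<partial>lebesgue_on (cube c L)) = (\<Sum>z\<in>C. \<integral>x. f x \<partial>lebesgue_on (cube z (L / real m)) :: real)"
proof -
  define ctr :: "(real^'d \<Rightarrow> nat) \<Rightarrow> real^'d" where
    "ctr k = (\<Sum>b\<in>Basis. (c \<bullet> b - L / 2 + (real (k b) + 1 / 2) * (L / real m)) *\<^sub>R b)" for k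
  define K where "K = (Basis :: (real^'d) set) \<rightarrow>\<^sub>E {..<m}"
  define C where "C = ctr ` K"
  let ?l = "L / real m"
  have l: "?l > 0" using L m by simp
  have ctr: "ctr k \<bullet> b = c \<bullet> b - L / 2 + (real (k b) + 1 / 2) * ?l" if "b \<in> Basis" for k b
    using that by (simp add: ctr_def)
  have fK: "finite K" unfolding K_def by (intro finite_PiE) auto
  have cK: "card K = m ^ CARD('d)" unfolding K_def by (subst card_PiE) (auto simp: prod_constant)
  have fC: "finite C" using fK by (simp add: C_def)
  have cC: "card C \<le> m ^ CARD('d)" using card_image_le[OF fK, of ctr] cK by (simp add: C_def)
  have sub: "cube z ?l \<subseteq> cube c L" if zC: "z \<in> C" for z
  proof
    fix x assume x: "x \<in> cube z ?l"
    obtain k where k: "k \<in> K" "z = ctr k" using zC by (auto simp: C_def)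
    show "x \<in> cube c L"
      unfolding mem_cube
    proof
      fix b :: "real^'d" assume b: "b \<in> Basis"
      have kb: "real (k b) + 1 \<le> real m" using k(1) b by (auto simp: K_def PiE_def Pi_def)
      have "(real (k b) + 1) * ?l \<le> real m * ?l" using kb l by (intro mult_right_mono) auto
      then have u: "(real (k b) + 1) * ?l \<le> L" using m by simp
      have lo: "0 \<le> real (k b) * ?l" using l by (intro mult_nonneg_nonneg) auto
      have "\<bar>x \<bullet> b - z \<bullet> b\<bar> < ?l / 2" using x b by (auto simp: mem_cube inner_diff_left)
      moreover have "\<bar>X - (a - L / 2 + (k + 1 / 2) * d)\<bar> < d / 2 \<Longrightarrow> (k + 1) * d \<le> L \<Longrightarrow> 0 \<le> k * d \<Longrightarrow> \<bar>X - a\<bar> < L / 2"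
        for X a k d :: real unfolding distrib_right by linarith
      ultimately show "\<bar>(x - c) \<bullet> b\<bar> < L / 2"
        using u lo unfolding k(2) ctr[OF b] inner_diff_left by blast
    qed
  qed
  have disj: "z = z'" if zC: "z \<in> C" "z' \<in> C" "x \<in> cube z ?l" "x \<in> cube z' ?l" for z z' x
  proof (rule euclidean_eqI)
    fix b :: "real^'d" assume b: "b \<in> Basis"
    obtain k k' where k: "z = ctr k" "z' = ctr k'" using zC by (auto simp: C_def)
    have "\<bar>x \<bullet> b - z \<bullet> b\<bar> < ?l / 2" "\<bar>x \<bullet> b - z' \<bullet> b\<bar> < ?l / 2"
      using zC(3,4) b by (simp_all add: mem_cube inner_diff_left)
    moreover have "\<bar>X - a\<bar> < d / 2 \<Longrightarrow> \<bar>X - a'\<bar> < d / 2 \<Longrightarrow> \<bar>a - a'\<bar> < d" for X a a' d :: real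
      by linarith
    ultimately have "\<bar>z \<bullet> b - z' \<bullet> b\<bar> < ?l" by blast
    moreover have "z \<bullet> b - z' \<bullet> b = (real (k b) - real (k' b)) * ?l"
      unfolding k ctr[OF b] by (simp add: algebra_simps)
    moreover have "\<bar>e * d\<bar> < d \<Longrightarrow> d > 0 \<Longrightarrow> \<bar>e\<bar> < 1" for e d :: real by (simp add: abs_mult)
    ultimately have "\<bar>real (k b) - real (k' b)\<bar> < 1" using l by metis
    then have "k b = k' b" by linarith
    then show "z \<bullet> b = z' \<bullet> b" unfolding k ctr[OF b] by simp
  qed
  define N where "N = (\<Union>b\<in>(Basis::(real^'d) set). \<Union>j\<in>{..m}. {x. x \<bullet> b = c \<bullet> b - L / 2 + real j * ?l})"
  have "negligible N" unfolding N_def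
    by (auto intro!: negligible_Union negligible_standard_hyperplane)
  then have N: "N \<in> null_sets lebesgue" by (simp add: negligible_iff_null_sets)
  have cover: "\<exists>z\<in>C. x \<in> cube z ?l" if x: "x \<in> cube c L" "x \<notin> N" for x
  proof -
    define t where "t b = (x \<bullet> b - (c \<bullet> b - L / 2)) / ?l" for b
    have tb: "x \<bullet> b = c \<bullet> b - L / 2 + t b * ?l" for b using L m by (simp add: t_def)
    have t0: "0 < t b" "t b < real m" if b: "b \<in> Basis" for b
    proof -
      have xb: "\<bar>x \<bullet> b - c \<bullet> b\<bar> < L / 2" using x(1) b by (auto simp: mem_cube inner_diff_left)
      have "0 < x \<bullet> b - (c \<bullet> b - L / 2)" using xb by linarith
      then show "0 < t b" unfolding t_def using l by (rule divide_pos_pos)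
      have "x \<bullet> b - (c \<bullet> b - L / 2) < L" using xb by linarith
      also have "L = real m * ?l" using m by simp
      finally show "t b < real m" unfolding t_def using l by (simp only: divide_less_eq) simp
    qed
    define k where "k b = (if b \<in> Basis then nat \<lfloor>t b\<rfloor> else undefined)" for b
    have kb: "real (k b) < t b" "t b < real (k b) + 1" "k b < m" if b: "b \<in> Basis" for b
    proof -
      have e: "real (k b) = of_int \<lfloor>t b\<rfloor>" using t0(1)[OF b] b by (simp add: k_def)
      show "t b < real (k b) + 1" unfolding e by linarith
      have le: "real (k b) \<le> t b" unfolding e by linarith
      then show km: "k b < m" using t0(2)[OF b] by linarith
      have "real (k b) \<noteq> t b"
      proof
        assume "real (k b) = t b"
        then have "x \<bullet> b = c \<bullet> b - L / 2 + real (k b) * ?l" using tb[of b] by simp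
        moreover have "k b \<in> {..m}" using km by simp
        ultimately have "x \<in> N" using b unfolding N_def by blast
        then show False using x(2) by simp
      qed
      then show "real (k b) < t b" using le by simp
    qed
    have "k \<in> K" unfolding K_def using kb(3) by (auto simp: PiE_def Pi_def extensional_def k_def)
    moreover have "x \<in> cube (ctr k) ?l"
      unfolding mem_cube
    proof
      fix b :: "real^'d" assume b: "b \<in> Basis"
      have "(x - ctr k) \<bullet> b = (t b - real (k b) - 1 / 2) * ?l"
        unfolding inner_diff_left ctr[OF b] tb by (simp add: algebra_simps)
      moreover have "\<bar>t b - real (k b) - 1 / 2\<bar> < 1 / 2" using kb(1,2)[OF b] by linarith
      moreover have "\<bar>e\<bar> < 1 / 2 \<Longrightarrow> d > 0 \<Longrightarrow> \<bar>e * d\<bar> < d / 2" for e d :: real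
        using mult_strict_right_mono[of "\<bar>e\<bar>" "1 / 2" d] by (simp add: abs_mult)
      ultimately show "\<bar>(x - ctr k) \<bullet> b\<bar> < ?l / 2" using l by metis
    qed
    ultimately show ?thesis by (auto simp: C_def)
  qed
  have sum1: "(\<Sum>z\<in>C. indicat_real (cube z ?l) x) = 1" if x: "x \<in> cube c L" "x \<notin> N" for x
  proof -
    obtain z where z: "z \<in> C" "x \<in> cube z ?l" using cover[OF x] by blast
    have "(\<Sum>z\<in>C. indicat_real (cube z ?l) x) = (\<Sum>z'\<in>C. if z' = z then 1 else 0)"
    proof (intro sum.cong refl)
      fix z' assume z': "z' \<in> C"
      have "x \<in> cube z' ?l \<longleftrightarrow> z' = z" using disj[OF z' z(1)] z(2) by blast
      then show "indicat_real (cube z' ?l) x = (if z' = z then 1 else 0)" by (simp add: indicator_def)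
    qed
    then show ?thesis using fC z by simp
  qed
  have "(\<integral>x. f x \<partial>lebesgue_on (cube c L)) = (\<Sum>z\<in>C. \<integral>x. f x \<partial>lebesgue_on (cube z ?l))"
    if f: "integrable (lebesgue_on (cube c L)) f" for f :: "real^'d \<Rightarrow> real"
  proof -
    have i: "integrable (lebesgue_on (cube c L)) (\<lambda>x. indicat_real (cube z ?l) x * f x)" if "z \<in> C" for z
      using integrable_mult_indicator[of "cube z ?l" "lebesgue_on (cube c L)" f] f sub[OF that]
      by (simp add: sets_restrict_space_iff)
    have "(\<integral>x. f x \<partial>lebesgue_on (cube c L)) = (\<integral>x. (\<Sum>z\<in>C. indicat_real (cube z ?l) x * f x) \<partial>lebesgue_on (cube c L))"
    proof (rule integral_cong_AE)
      have "AE x in lebesgue. x \<notin> N" by (rule AE_not_in[OF N])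
      then have "AE x in lebesgue. x \<in> cube c L \<longrightarrow> f x = (\<Sum>z\<in>C. indicat_real (cube z ?l) x * f x)"
        by eventually_elim (auto simp: sum1 sum_distrib_right[symmetric])
      then show "AE x in lebesgue_on (cube c L). f x = (\<Sum>z\<in>C. indicat_real (cube z ?l) x * f x)"
        by (subst AE_restrict_space_iff) auto
      show "(\<lambda>x. \<Sum>z\<in>C. indicat_real (cube z ?l) x * f x) \<in> borel_measurable (lebesgue_on (cube c L))"
        using i by (intro borel_measurable_sum) auto
    qed (use f in auto)
    also have "\<dots> = (\<Sum>z\<in>C. \<integral>x. indicat_real (cube z ?l) x * f x \<partial>lebesgue_on (cube c L))"
      using i by (intro Bochner_Integration.integral_sum) auto
    also have "\<dots> = (\<Sum>z\<in>C. \<integral>x. f x \<partial>lebesgue_on (cube z ?l))"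
      by (intro sum.cong refl lebesgue_on_integral_indicator[symmetric] cube_borel sub)
    finally show ?thesis .
  qed
  with fC cC sub show thesis by (rule that)
qed

text \<open>The cell integrals remain explicit because they are treated in two ways: in the
  dimension count they vanish, and in the Rellich theorem they converge along a subsequence.\<close>

lemma Poincare_subcubes:
  fixes c :: "real^'d"
  assumes L: "L > 0" and m: "m > 0"
  obtains C :: "(real^'d) set" where "finite C" "card C \<le> m ^ CARD('d)"
    "\<And>z. z \<in> C \<Longrightarrow> cube z (L / real m) \<subseteq> cube c L"
    "\<And>f g. h1pair (cube c L) f g \<Longrightarrow>
       (\<integral>x. (f x)\<^sup>2 \<partial>lebesgue_on (cube c L)) \<le>
         (\<Sum>z\<in>C. (\<integral>x. f x \<partial>lebesgue_on (cube z (L / real m)))\<^sup>2) / (L / real m) ^ CARD('d)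
         + real CARD('d) / 4 * (L / real m)\<^sup>2 * (\<Sum>i\<in>UNIV. \<integral>x. (g x $ i)\<^sup>2 \<partial>lebesgue_on (cube c L))"
proof -
  let ?l = "L / real m" and ?n = "CARD('d)"
  have l: "?l > 0" using L m by simp
  obtain C :: "(real^'d) set" where C: "finite C" "card C \<le> m ^ ?n"
    "\<And>z. z \<in> C \<Longrightarrow> cube z ?l \<subseteq> cube c L"
    "\<And>f. integrable (lebesgue_on (cube c L)) f \<Longrightarrow>
       (\<integral>x. f x \<partial>lebesgue_on (cube c L)) = (\<Sum>z\<in>C. \<integral>x. f x \<partial>lebesgue_on (cube z ?l) :: real)"
    using cube_partition[OF L m, of c] by blast
  have "(\<integral>x. (f x)\<^sup>2 \<partial>lebesgue_on (cube c L)) \<le> (\<Sum>z\<in>C. (\<integral>x. f x \<partial>lebesgue_on (cube z ?l))\<^sup>2) / ?l ^ ?n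
         + real ?n / 4 * ?l\<^sup>2 * (\<Sum>i\<in>UNIV. \<integral>x. (g x $ i)\<^sup>2 \<partial>lebesgue_on (cube c L))"
    if h: "h1pair (cube c L) f g" for f g
  proof -
    have fg: "sqint (lebesgue_on (cube c L)) f" "\<And>i. sqint (lebesgue_on (cube c L)) (\<lambda>x. g x $ i)" using h by (auto simp: h1pair_def)
    have cell: "(\<integral>x. (f x)\<^sup>2 \<partial>lebesgue_on (cube z ?l)) \<le> (\<integral>x. f x \<partial>lebesgue_on (cube z ?l))\<^sup>2 / ?l ^ ?n
       + real ?n / 4 * ?l\<^sup>2 * (\<Sum>i\<in>UNIV. \<integral>x. (g x $ i)\<^sup>2 \<partial>lebesgue_on (cube z ?l))" if "z \<in> C" for z
    proof -
      have hz: "h1pair (cube z ?l) f g" by (rule h1pair_subset[OF open_cube open_cube C(3)[OF that] h])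
      have p: "?l ^ ?n > 0" using l by simp
      have gen: "X \<le> Y / p + W" if "p * X \<le> Y + p * W" "p > 0" for X Y W p :: real
        using that by (simp add: field_simps)
      show ?thesis
        by (rule gen[OF _ p]) (use Poincare_cube[OF l hz] in \<open>simp only: mult.assoc\<close>)
    qed
    have "(\<integral>x. (f x)\<^sup>2 \<partial>lebesgue_on (cube c L)) = (\<Sum>z\<in>C. \<integral>x. (f x)\<^sup>2 \<partial>lebesgue_on (cube z ?l))"
      by (rule C(4)[OF sqintD(2)[OF fg(1)]])
    also have "\<dots> \<le> (\<Sum>z\<in>C. (\<integral>x. f x \<partial>lebesgue_on (cube z ?l))\<^sup>2 / ?l ^ ?n
       + real ?n / 4 * ?l\<^sup>2 * (\<Sum>i\<in>UNIV. \<integral>x. (g x $ i)\<^sup>2 \<partial>lebesgue_on (cube z ?l)))"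
      by (rule sum_mono[OF cell])
    also have "\<dots> = (\<Sum>z\<in>C. (\<integral>x. f x \<partial>lebesgue_on (cube z ?l))\<^sup>2) / ?l ^ ?n
       + real ?n / 4 * ?l\<^sup>2 * (\<Sum>i\<in>UNIV. \<Sum>z\<in>C. \<integral>x. (g x $ i)\<^sup>2 \<partial>lebesgue_on (cube z ?l))"
      unfolding sum.distrib sum_divide_distrib sum_distrib_left by (subst sum.swap) simp
    also have "(\<Sum>i\<in>UNIV. \<Sum>z\<in>C. \<integral>x. (g x $ i)\<^sup>2 \<partial>lebesgue_on (cube z ?l)) = (\<Sum>i\<in>UNIV. \<integral>x. (g x $ i)\<^sup>2 \<partial>lebesgue_on (cube c L))"
      by (intro sum.cong refl C(4)[symmetric] sqintD(2)[OF fg(2)])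
    finally show ?thesis .
  qed
  with C(1-3) show thesis by (rule that)
qed

text \<open>For a fixed test function both sides of the weak identity are continuous in L2. This
  closedness is behind the completeness of H1.\<close>

lemma weak_grad_closed:
  fixes f :: "real^'d \<Rightarrow> real"
  assumes S: "open S" and h: "\<And>k. h1pair S (F k) (G k)"
    and f: "L2lim (lebesgue_on S) F f" and g: "\<And>i. L2lim (lebesgue_on S) (\<lambda>k x. G k x $ i) (\<lambda>x. g x $ i)"
  shows "h1pair S f g"
  unfolding h1pair_def weak_grad_def
proof (intro conjI allI impI)
  let ?M = "lebesgue_on S"
  show sf: "sqint ?M f" by (rule L2limD(2)[OF f])
  show sg: "sqint ?M (\<lambda>x. g x $ i)" for i by (rule L2limD(2)[OF g])
  fix \<phi> i assume t: "test_fun S \<phi>"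
  have Sl: "S \<in> sets lebesgue" using S by auto
  have st: "sqint ?M \<phi>" "sqint ?M (\<lambda>x. clgrad \<phi> x $ i)"
    by (rule test_fun_sqint[OF t Sl], rule test_fun_sqint[OF test_fun_clgrad[OF t] Sl])
  show "integrable ?M (\<lambda>x. f x * clgrad \<phi> x $ i)" "integrable ?M (\<lambda>x. g x $ i * \<phi> x)"
    by (intro sqint_mult_integrable sf sg st)+
  have w: "(\<integral>x. F k x * clgrad \<phi> x $ i \<partial>?M) = - (\<integral>x. G k x $ i * \<phi> x \<partial>?M)" for k
    using h[of k] t unfolding h1pair_def weak_grad_def by blast
  have l1: "(\<lambda>k. \<integral>x. F k x * clgrad \<phi> x $ i \<partial>?M) \<longlonglongrightarrow> (\<integral>x. f x * clgrad \<phi> x $ i \<partial>?M)"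
    by (rule L2lim_integral_mult[OF f L2lim_const[OF st(2)]])
  have l2: "(\<lambda>k. \<integral>x. G k x $ i * \<phi> x \<partial>?M) \<longlonglongrightarrow> (\<integral>x. g x $ i * \<phi> x \<partial>?M)"
    by (rule L2lim_integral_mult[OF g L2lim_const[OF st(1)]])
  show "(\<integral>x. f x * clgrad \<phi> x $ i \<partial>?M) = - (\<integral>x. g x $ i * \<phi> x \<partial>?M)"
    using LIMSEQ_unique[OF l1[unfolded w] tendsto_minus[OF l2]] .
qed

section \<open>Linear systems and completeness of L2\<close>

text \<open>Elimination: an equation with a nonzero coefficient at p is solved for the unknown p and
  substituted into the others, which leaves one equation and one unknown fewer.\<close>

lemma homogeneous_system_nontrivial:
  fixes M :: "'k \<Rightarrow> 'i \<Rightarrow> real"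
  assumes "finite K" "finite I" "card K < card I"
  obtains c where "\<exists>i\<in>I. c i \<noteq> 0" "\<And>k. k \<in> K \<Longrightarrow> (\<Sum>i\<in>I. c i * M k i) = 0"
proof -
  have "\<exists>c. (\<exists>i\<in>I. c i \<noteq> 0) \<and> (\<forall>k\<in>K. (\<Sum>i\<in>I. c i * M k i) = 0)"
    using assms
  proof (induction K arbitrary: I M rule: finite_induct)
    case empty
    then have "I \<noteq> {}" by auto
    then show ?case by (intro exI[of _ "\<lambda>i. 1"]) auto
  next
    case (insert k K)
    show ?case
    proof (cases "\<exists>p\<in>I. M k p \<noteq> 0")
      case False
      have "card K < card I" using insert by simp
      from insert.IH[OF insert.prems(1) this, of M] False show ?thesis by auto
    next
      case True
      then obtain p where p: "p \<in> I" "M k p \<noteq> 0" by blast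
      have "finite (I - {p})" "card K < card (I - {p})" using insert p by auto
      from insert.IH[OF this, of "\<lambda>k' i. M k' i - M k' p * M k i / M k p"]
      obtain c where c: "\<exists>i\<in>I - {p}. c i \<noteq> 0"
        "\<And>k'. k' \<in> K \<Longrightarrow> (\<Sum>i\<in>I - {p}. c i * (M k' i - M k' p * M k i / M k p)) = 0" by blast
      define T where "T = (\<Sum>i\<in>I - {p}. c i * M k i)"
      define d where "d i = (if i = p then - T / M k p else c i)" for i
      have d: "(\<Sum>i\<in>I. d i * m i) = - T / M k p * m p + (\<Sum>i\<in>I - {p}. c i * m i)" for m
        using p insert.prems(1) by (subst sum.remove[of I p]) (auto simp: d_def intro!: sum.cong)
      have "(\<Sum>i\<in>I. d i * M k' i) = 0" if "k' \<in> insert k K" for k'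
      proof (cases "k' = k")
        case True
        then show ?thesis unfolding d using p by (simp add: T_def)
      next
        case False
        then have "0 = (\<Sum>i\<in>I - {p}. c i * M k' i - M k' p / M k p * (c i * M k i))"
          using c(2)[of k'] that by (simp add: algebra_simps)
        also have "\<dots> = (\<Sum>i\<in>I - {p}. c i * M k' i) - M k' p / M k p * T"
          by (simp add: sum_subtractf T_def sum_distrib_left)
        finally show ?thesis unfolding d by (simp add: mult.commute)
      qed
      moreover have "\<exists>i\<in>I. d i \<noteq> 0" using c(1) by (auto simp: d_def)
      ultimately show ?thesis by blast
    qed
  qed
  then show thesis using that by blast
qed

text \<open>On a finite measure an L2 Cauchy sequence is L1 Cauchy, so a subsequence converges
  almost everywhere; Fatou's lemma bounds the L2 distance to its limit.\<close>

lemma L2_complete: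
  fixes f :: "nat \<Rightarrow> 'a \<Rightarrow> real"
  assumes fin: "finite_measure M" and f: "\<And>k. sqint M (f k)"
    and cauchy: "\<And>e. e > 0 \<Longrightarrow> \<exists>N. \<forall>i\<ge>N. \<forall>j\<ge>N. (\<integral>x. (f i x - f j x)\<^sup>2 \<partial>M) < e"
  obtains g where "L2lim M f g"
proof -
  have m [measurable]: "f k \<in> borel_measurable M" for k using f by auto
  have d: "sqint M (\<lambda>x. f i x - f j x)" for i j by (intro sqint_diff f)
  have i1: "integrable M (f k)" for k by (rule sqint_integrable[OF fin f])
  define V where "V = (\<integral>x. (1::real)\<^sup>2 \<partial>M)"
  have V: "V \<ge> 0" by (simp add: V_def)
  have one: "sqint M (\<lambda>x. 1)" using fin by (simp add: sqint_def finite_measure.integrable_const)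
  have L1: "\<exists>N. \<forall>i\<ge>N. \<forall>j\<ge>N. (\<integral>x. norm (f i x - f j x) \<partial>M) < e" if e: "e > 0" for e
  proof -
    have "e\<^sup>2 / (V + 1) > 0" using e V by simp
    from cauchy[OF this] obtain N where N: "\<And>i j. i \<ge> N \<Longrightarrow> j \<ge> N \<Longrightarrow> (\<integral>x. (f i x - f j x)\<^sup>2 \<partial>M) < e\<^sup>2 / (V + 1)" by blast
    have "(\<integral>x. norm (f i x - f j x) \<partial>M) < e" if ij: "i \<ge> N" "j \<ge> N" for i j
    proof -
      have "sqint M (\<lambda>x. \<bar>f i x - f j x\<bar>)" using d[of i j] by (auto simp: sqint_def)
      from sqint_Cauchy_Schwarz[OF this one]
      have "(\<integral>x. \<bar>f i x - f j x\<bar> \<partial>M)\<^sup>2 \<le> (\<integral>x. (f i x - f j x)\<^sup>2 \<partial>M) * V" by (simp add: V_def)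
      also have "\<dots> \<le> e\<^sup>2 / (V + 1) * V" using N[OF ij] V by (intro mult_right_mono) auto
      also have "\<dots> < e\<^sup>2" using V e by (simp add: field_simps)
      finally show ?thesis using e by (simp add: power2_less_imp_less)
    qed
    then show ?thesis by blast
  qed
  obtain r where r: "strict_mono r" "AE x in M. Cauchy (\<lambda>i. f (r i) x)"
    using cauchy_L1_AE_cauchy_subseq[of M f] i1 L1 by blast
  define g where "g x = lim (\<lambda>i. f (r i) x)" for x
  have mg [measurable]: "g \<in> borel_measurable M" unfolding g_def by measurable
  have lim: "AE x in M. (\<lambda>i. f (r i) x) \<longlonglongrightarrow> g x"
    using r(2) by eventually_elim (simp add: g_def Cauchy_convergent_iff convergent_LIMSEQ_iff)
  have est: "integrable M (\<lambda>x. (f k x - g x)\<^sup>2) \<and> (\<integral>x. (f k x - g x)\<^sup>2 \<partial>M) \<le> e"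
    if e: "e \<ge> 0" and N: "\<And>j. j \<ge> N \<Longrightarrow> (\<integral>x. (f k x - f j x)\<^sup>2 \<partial>M) \<le> e" for k e N
  proof -
    have "(\<integral>\<^sup>+x. ennreal ((f k x - g x)\<^sup>2) \<partial>M) = (\<integral>\<^sup>+x. liminf (\<lambda>j. ennreal ((f k x - f (r j) x)\<^sup>2)) \<partial>M)"
    proof (rule nn_integral_cong_AE)
      show "AE x in M. ennreal ((f k x - g x)\<^sup>2) = liminf (\<lambda>j. ennreal ((f k x - f (r j) x)\<^sup>2))"
        using lim
      proof eventually_elim
        case (elim x)
        then have "(\<lambda>j. ennreal ((f k x - f (r j) x)\<^sup>2)) \<longlonglongrightarrow> ennreal ((f k x - g x)\<^sup>2)"
          by (intro tendsto_ennrealI tendsto_intros)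
        then show ?case using lim_imp_Liminf[OF sequentially_bot] by metis
      qed
    qed
    also have "\<dots> \<le> liminf (\<lambda>j. \<integral>\<^sup>+x. ennreal ((f k x - f (r j) x)\<^sup>2) \<partial>M)"
      by (rule nn_integral_liminf) measurable
    also have "\<dots> \<le> liminf (\<lambda>j. ennreal e)"
    proof (rule Liminf_mono)
      show "\<forall>\<^sub>F j in sequentially. (\<integral>\<^sup>+x. ennreal ((f k x - f (r j) x)\<^sup>2) \<partial>M) \<le> ennreal e"
        unfolding eventually_sequentially
      proof (intro exI allI impI)
        fix j assume "N \<le> j"
        then have "N \<le> r j" using seq_suble[OF r(1), of j] by simp
        then show "(\<integral>\<^sup>+x. ennreal ((f k x - f (r j) x)\<^sup>2) \<partial>M) \<le> ennreal e"
          using N[of "r j"] nn_integral_eq_integral[OF sqintD(2)[OF d[of k "r j"]]] by (simp add: ennreal_leI)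
      qed
    qed
    also have "\<dots> = ennreal e" by (simp add: Liminf_const)
    finally have fin: "(\<integral>\<^sup>+x. ennreal ((f k x - g x)\<^sup>2) \<partial>M) \<le> ennreal e" .
    then have i: "integrable M (\<lambda>x. (f k x - g x)\<^sup>2)"
      by (intro integrableI_bounded) (auto simp: less_top[symmetric] top_unique elim: le_less_trans)
    then show ?thesis using fin e nn_integral_eq_integral[OF i] by simp
  qed
  have "sqint M g"
  proof -
    obtain N where N: "\<forall>i\<ge>N. \<forall>j\<ge>N. (\<integral>x. (f i x - f j x)\<^sup>2 \<partial>M) < 1" using cauchy[of 1] by auto
    have "integrable M (\<lambda>x. (f N x - g x)\<^sup>2)" using est[of 1 N N] N by (auto intro: less_imp_le)
    then have "sqint M (\<lambda>x. f N x - g x)" by (simp add: sqint_def)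
    from sqint_diff[OF f[of N] this] show ?thesis by simp
  qed
  moreover have "(\<lambda>k. \<integral>x. (f k x - g x)\<^sup>2 \<partial>M) \<longlonglongrightarrow> 0"
  proof (rule LIMSEQ_I)
    fix e :: real assume e: "e > 0"
    obtain N where N: "\<forall>i\<ge>N. \<forall>j\<ge>N. (\<integral>x. (f i x - f j x)\<^sup>2 \<partial>M) < e / 2" using cauchy[of "e/2"] e by auto
    have "norm ((\<integral>x. (f k x - g x)\<^sup>2 \<partial>M) - 0) < e" if "k \<ge> N" for k
    proof -
      have "(\<integral>x. (f k x - g x)\<^sup>2 \<partial>M) \<le> e / 2" using est[of "e/2" N k] e N that by (auto intro: less_imp_le)
      then show ?thesis using e by simp
    qed
    then show "\<exists>N. \<forall>k\<ge>N. norm ((\<integral>x. (f k x - g x)\<^sup>2 \<partial>M) - 0) < e" by blast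
  qed
  ultimately have "L2lim M f g" using f by (simp add: L2lim_def)
  then show thesis by (rule that)
qed

section \<open>Positive semidefinite forms\<close>

text \<open>Forms are merely semidefinite: functions are not identified up to null sets, and the
  energy vanishes on constants. The domain is a predicate on functions, so that the L2 product and
  the energy can share it.\<close>

locale psd_form =
  fixes H :: "('a \<Rightarrow> real) \<Rightarrow> bool" and B :: "('a \<Rightarrow> real) \<Rightarrow> ('a \<Rightarrow> real) \<Rightarrow> real"
  assumes H_zero: "H (\<lambda>x. 0)"
    and H_lin: "H f \<Longrightarrow> H g \<Longrightarrow> H (\<lambda>x. a * f x + b * g x)"
    and sym: "H f \<Longrightarrow> H g \<Longrightarrow> B f g = B g f"
    and lin: "H f \<Longrightarrow> H g \<Longrightarrow> H h \<Longrightarrow> B (\<lambda>x. a * f x + b * g x) h = a * B f h + b * B g h"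
    and pos: "H f \<Longrightarrow> B f f \<ge> 0"
begin

lemma lin_right: "H f \<Longrightarrow> H g \<Longrightarrow> H h \<Longrightarrow> B h (\<lambda>x. a * f x + b * g x) = a * B h f + b * B h g"
  using lin[of f g h a b] sym[of h "\<lambda>x. a * f x + b * g x"] sym[of h f] sym[of h g] H_lin by simp

lemma H_diff: "H f \<Longrightarrow> H g \<Longrightarrow> H (\<lambda>x. f x - g x)"
  using H_lin[of f g 1 "-1"] by simp

lemma H_add: "H f \<Longrightarrow> H g \<Longrightarrow> H (\<lambda>x. f x + g x)"
  using H_lin[of f g 1 1] by simp

lemma B_diff: "H f \<Longrightarrow> H g \<Longrightarrow> H h \<Longrightarrow> B (\<lambda>x. f x - g x) h = B f h - B g h"
  using lin[of f g h 1 "-1"] by simp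

lemma square_lin:
  assumes "H f" "H g"
  shows "B (\<lambda>x. a * f x + b * g x) (\<lambda>x. a * f x + b * g x) = a\<^sup>2 * B f f + 2 * a * b * B f g + b\<^sup>2 * B g g"
  using assms H_lin[OF assms, of a b] sym[OF assms]
  by (simp add: lin lin_right power2_eq_square algebra_simps)

lemma Cauchy_Schwarz:
  assumes "H f" "H g"
  shows "(B f g)\<^sup>2 \<le> B f f * B g g"
proof (rule quadratic_nonneg_discriminant)
  fix t :: real
  show "0 \<le> B f f + 2 * t * B f g + t\<^sup>2 * B g g"
    using square_lin[OF assms, of 1 t] pos[OF H_lin[OF assms, of 1 t]] by simp
qed (rule pos[OF assms(2)])

lemma zero_orthogonal: "H f \<Longrightarrow> H g \<Longrightarrow> B g g = 0 \<Longrightarrow> B f g = 0"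
  using Cauchy_Schwarz[of f g] by simp

lemma H_sum: "(\<And>i. i \<in> I \<Longrightarrow> H (w i)) \<Longrightarrow> H (\<lambda>x. \<Sum>i\<in>I. c i * w i x)"
proof (induction I rule: infinite_finite_induct)
  case (insert i I)
  then show ?case using H_lin[of "w i" "\<lambda>x. \<Sum>i\<in>I. c i * w i x" "c i" 1] by simp
qed (auto simp: H_zero)

lemma B_sum:
  assumes "finite I" "\<And>i. i \<in> I \<Longrightarrow> H (w i)" "H h"
  shows "B (\<lambda>x. \<Sum>i\<in>I. c i * w i x) h = (\<Sum>i\<in>I. c i * B (w i) h)"
  using assms
proof (induction I rule: finite_induct)
  case empty
  then show ?case using lin[of h h h 0 0] by simp
next
  case (insert i I)
  then show ?case using lin[of "w i" "\<lambda>x. \<Sum>i\<in>I. c i * w i x" h "c i" 1] H_sum[of I w c] by simp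
qed

lemma square_orthogonal_sum:
  assumes I: "finite I" and H: "\<And>i. i \<in> I \<Longrightarrow> H (w i)"
    and orth: "\<And>i j. i \<in> I \<Longrightarrow> j \<in> I \<Longrightarrow> i \<noteq> j \<Longrightarrow> B (w i) (w j) = 0"
  shows "B (\<lambda>x. \<Sum>i\<in>I. c i * w i x) (\<lambda>x. \<Sum>i\<in>I. c i * w i x) = (\<Sum>i\<in>I. (c i)\<^sup>2 * B (w i) (w i))"
proof -
  let ?z = "\<lambda>x. \<Sum>i\<in>I. c i * w i x"
  have z: "H ?z" by (rule H_sum[OF H])
  have "B (w i) ?z = c i * B (w i) (w i)" if "i \<in> I" for i
  proof -
    have "B (w i) ?z = B ?z (w i)" by (rule sym[OF H[OF that] z])
    also have "\<dots> = (\<Sum>j\<in>I. c j * B (w j) (w i))" by (rule B_sum[OF I H H[OF that]])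
    also have "\<dots> = (\<Sum>j\<in>I. if j = i then c i * B (w i) (w i) else 0)"
      using orth that by (intro sum.cong) auto
    finally show ?thesis using I that by simp
  qed
  moreover have "B ?z ?z = (\<Sum>i\<in>I. c i * B (w i) ?z)" by (rule B_sum[OF I H z])
  ultimately show ?thesis by (simp add: power2_eq_square mult.assoc)
qed

text \<open>Gram-Schmidt by induction: the new vector is made orthogonal to the earlier ones, and
  the component along it is subtracted. Degenerate directions do no harm, as a null vector of a
  semidefinite form is orthogonal to everything.\<close>

lemma projection_exists:
  fixes w :: "nat \<Rightarrow> 'a \<Rightarrow> real"
  assumes "\<And>i. i < n \<Longrightarrow> H (w i)" "H u"
  shows "\<exists>c. \<forall>j<n. B (\<lambda>x. u x - (\<Sum>i<n. c i * w i x)) (w j) = 0"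
  using assms
proof (induction n arbitrary: u)
  case 0
  then show ?case by simp
next
  case (Suc n)
  have wn: "H (w n)" and wi: "\<And>i. i < n \<Longrightarrow> H (w i)" using Suc.prems by auto
  obtain p where p: "\<forall>j<n. B (\<lambda>x. w n x - (\<Sum>i<n. p i * w i x)) (w j) = 0"
    using Suc.IH[OF wi wn] by blast
  obtain q where q: "\<forall>j<n. B (\<lambda>x. u x - (\<Sum>i<n. q i * w i x)) (w j) = 0"
    using Suc.IH[OF wi Suc.prems(2)] by blast
  define w' where "w' x = w n x - (\<Sum>i<n. p i * w i x)" for x
  define u' where "u' x = u x - (\<Sum>i<n. q i * w i x)" for x
  have Hs: "H (\<lambda>x. \<Sum>i<n. c i * w i x)" for c using wi by (intro H_sum) auto
  have Hw': "H w'" unfolding w'_def by (intro H_diff wn Hs)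
  have Hu': "H u'" unfolding u'_def by (intro H_diff Suc.prems(2) Hs)
  \<comment> \<open>If \<open>B w' w' = 0\<close>, division by zero gives t = 0, which is the right
    value because \<open>B u' w'\<close> vanishes as well.\<close>
  define t where "t = B u' w' / B w' w'"
  have t: "B u' w' = t * B w' w'" using zero_orthogonal[OF Hu' Hw'] by (cases "B w' w' = 0") (auto simp: t_def)
  define c where "c i = (if i = n then t else q i - t * p i)" for i
  have e: "(\<lambda>x. u x - (\<Sum>i<Suc n. c i * w i x)) = (\<lambda>x. 1 * u' x + (- t) * w' x)"
  proof
    fix x
    have "(\<Sum>i<n. c i * w i x) = (\<Sum>i<n. q i * w i x) - t * (\<Sum>i<n. p i * w i x)"
      by (simp add: c_def sum_distrib_left sum_subtractf[symmetric] algebra_simps)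
    then show "u x - (\<Sum>i<Suc n. c i * w i x) = 1 * u' x + (- t) * w' x"
      by (simp add: u'_def w'_def c_def algebra_simps)
  qed
  have lo: "B (\<lambda>x. 1 * u' x + (- t) * w' x) (w j) = 0" if "j < n" for j
    using p q that wi[OF that] lin[OF Hu' Hw' wi[OF that], of 1 "- t"]
    unfolding w'_def[abs_def] u'_def[abs_def] by simp
  have "B (\<lambda>x. 1 * u' x + (- t) * w' x) (w n) = 0"
  proof -
    let ?y = "\<lambda>x. 1 * u' x + (- t) * w' x"
    have y: "H ?y" by (rule H_lin[OF Hu' Hw'])
    have "w n = (\<lambda>x. 1 * w' x + 1 * (\<Sum>i<n. p i * w i x))" by (auto simp: w'_def)
    then have "B ?y (w n) = 1 * B ?y w' + 1 * B ?y (\<lambda>x. \<Sum>i<n. p i * w i x)"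
      using lin_right[OF Hw' Hs y, of 1 1] by metis
    also have "B ?y (\<lambda>x. \<Sum>i<n. p i * w i x) = (\<Sum>i<n. p i * B (w i) ?y)"
      using sym[OF y Hs[of p]] B_sum[of "{..<n}" w ?y p] wi y by simp
    also have "\<dots> = 0" using lo sym[OF y wi] by (intro sum.neutral) auto
    also have "B ?y w' = 0" using lin[OF Hu' Hw' Hw', of 1 "- t"] t by simp
    finally show ?thesis by simp
  qed
  then show ?case using lo e by (intro exI[of _ c]) (auto simp: less_Suc_eq)
qed

lemma tendsto_left:
  assumes "\<And>k. H (f k)" "H g" "H h" "(\<lambda>k. B (\<lambda>x. f k x - g x) (\<lambda>x. f k x - g x)) \<longlonglongrightarrow> 0"
  shows "(\<lambda>k. B (f k) h) \<longlonglongrightarrow> B g h"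
proof -
  have "(\<lambda>k. sqrt (B (\<lambda>x. f k x - g x) (\<lambda>x. f k x - g x) * B h h)) \<longlonglongrightarrow> sqrt (0 * B h h)"
    by (intro tendsto_intros assms(4))
  then have l: "(\<lambda>k. sqrt (B (\<lambda>x. f k x - g x) (\<lambda>x. f k x - g x) * B h h)) \<longlonglongrightarrow> 0" by simp
  have "norm (B (f k) h - B g h) \<le> sqrt (B (\<lambda>x. f k x - g x) (\<lambda>x. f k x - g x) * B h h)" for k
    using real_sqrt_le_mono[OF Cauchy_Schwarz[OF H_diff[OF assms(1,2)] assms(3)], of k]
    by (simp add: B_diff[OF assms(1,2,3)])
  then have "(\<lambda>k. B (f k) h - B g h) \<longlonglongrightarrow> 0"
    using l by (intro Lim_null_comparison[OF _ l] always_eventually) auto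
  then show ?thesis by (simp add: LIM_zero_iff)
qed

lemma tendsto_square:
  assumes "\<And>k. H (f k)" "H g" "(\<lambda>k. B (\<lambda>x. f k x - g x) (\<lambda>x. f k x - g x)) \<longlonglongrightarrow> 0"
  shows "(\<lambda>k. B (f k) (f k)) \<longlonglongrightarrow> B g g"
proof -
  have "B (f k) (f k) = B (\<lambda>x. f k x - g x) (\<lambda>x. f k x - g x) + 2 * B (f k) g - B g g" for k
    using square_lin[OF assms(1)[of k] assms(2), of 1 "-1"] by simp
  moreover have "(\<lambda>k. B (\<lambda>x. f k x - g x) (\<lambda>x. f k x - g x) + 2 * B (f k) g - B g g) \<longlonglongrightarrow> 0 + 2 * B g g - B g g"
    by (intro tendsto_intros assms(3) tendsto_left[OF assms(1,2,2,3)])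
  ultimately show ?thesis by simp
qed

end

section \<open>Rayleigh quotients\<close>

text \<open>The two analytic inputs of the eigenvalue argument. Compactness yields merely a sequence
  that is Cauchy for \<open>ip\<close>: its limit is known to lie in the domain only once the
  sequence is Cauchy for the energy too.\<close>

locale spectral_form = ip: psd_form H ip + E: psd_form H E
  for H :: "('a \<Rightarrow> real) \<Rightarrow> bool" and ip E :: "('a \<Rightarrow> real) \<Rightarrow> ('a \<Rightarrow> real) \<Rightarrow> real" +
  assumes compact: "(\<And>k. H (f k)) \<Longrightarrow> (\<And>k. ip (f k) (f k) \<le> M) \<Longrightarrow> (\<And>k. E (f k) (f k) \<le> M) \<Longrightarrow>
      \<exists>r. strict_mono (r :: nat \<Rightarrow> nat) \<and> (\<forall>e>0. \<exists>N. \<forall>i\<ge>N. \<forall>j\<ge>N.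
        ip (\<lambda>x. f (r i) x - f (r j) x) (\<lambda>x. f (r i) x - f (r j) x) < e)"
    and complete: "(\<And>k. H (f k)) \<Longrightarrow>
      (\<And>e. e > 0 \<Longrightarrow> \<exists>N. \<forall>i\<ge>N. \<forall>j\<ge>N. ip (\<lambda>x. f i x - f j x) (\<lambda>x. f i x - f j x) < e) \<Longrightarrow>
      (\<And>e. e > 0 \<Longrightarrow> \<exists>N. \<forall>i\<ge>N. \<forall>j\<ge>N. E (\<lambda>x. f i x - f j x) (\<lambda>x. f i x - f j x) < e) \<Longrightarrow>
      \<exists>g. H g \<and> (\<lambda>k. ip (\<lambda>x. f k x - g x) (\<lambda>x. f k x - g x)) \<longlonglongrightarrow> 0 \<and>
          (\<lambda>k. E (\<lambda>x. f k x - g x) (\<lambda>x. f k x - g x)) \<longlonglongrightarrow> 0"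
begin

text \<open>By the parallelogram law a minimizing sequence which is Cauchy for \<open>ip\<close> is also Cauchy for \<open>E\<close>.\<close>

lemma minimizer_exists:
  fixes p :: "'i \<Rightarrow> 'a \<Rightarrow> real"
  assumes p: "\<And>i. i \<in> I \<Longrightarrow> H (p i)"
    and f0: "H f0" "\<And>i. i \<in> I \<Longrightarrow> ip f0 (p i) = 0" "ip f0 f0 > 0"
  obtains w where "H w" "\<And>i. i \<in> I \<Longrightarrow> ip w (p i) = 0" "ip w w = 1"
    "\<And>f. H f \<Longrightarrow> (\<And>i. i \<in> I \<Longrightarrow> ip f (p i) = 0) \<Longrightarrow> E w w * ip f f \<le> E f f"
proof -
  define V where "V f \<longleftrightarrow> H f \<and> (\<forall>i\<in>I. ip f (p i) = 0)" for f
  have VH: "V f \<Longrightarrow> H f" for f by (simp add: V_def)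
  have V_lin: "V (\<lambda>x. a * f x + b * g x)" if "V f" "V g" for f g a b
    using that p by (auto simp: V_def ip.lin intro: ip.H_lin)
  have V_cmult: "V (\<lambda>x. a * f x)" if "V f" for f a
    using V_lin[OF that that, of a 0] by simp
  define S where "S = (\<lambda>f. E f f) ` {f. V f \<and> ip f f = 1}"
  have scale: "ip (\<lambda>x. a * f x) (\<lambda>x. a * f x) = a\<^sup>2 * ip f f" "E (\<lambda>x. a * f x) (\<lambda>x. a * f x) = a\<^sup>2 * E f f" if "H f" for f a
    using ip.square_lin[OF that that, of a 0] E.square_lin[OF that that, of a 0] by auto
  have norm1: "ip (\<lambda>x. (1 / sqrt (ip f f)) * f x) (\<lambda>x. (1 / sqrt (ip f f)) * f x) = 1"
    "E (\<lambda>x. (1 / sqrt (ip f f)) * f x) (\<lambda>x. (1 / sqrt (ip f f)) * f x) = E f f / ip f f"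
    if "H f" "ip f f > 0" for f
    using that unfolding scale[OF that(1)] by (simp_all add: power_divide)
  have Vf0: "V f0" using f0 by (simp add: V_def)
  have Sne: "S \<noteq> {}" using V_cmult[OF Vf0, of "1 / sqrt (ip f0 f0)"] norm1(1)[OF f0(1,3)] unfolding S_def by blast
  have Sbd: "bdd_below S" unfolding S_def by (rule bdd_belowI[of _ 0]) (auto dest: VH intro: E.pos)
  define \<Lambda> where "\<Lambda> = Inf S"
  have \<Lambda>0: "\<Lambda> \<ge> 0" unfolding \<Lambda>_def using Sne by (rule cInf_greatest) (auto simp: S_def dest: VH intro: E.pos)
  have low: "\<Lambda> * ip f f \<le> E f f" if "V f" for f
  proof (cases "ip f f = 0")
    case True
    then show ?thesis using E.pos[OF VH[OF that]] by simp
  next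
    case False
    then have pos: "ip f f > 0" using ip.pos[OF VH[OF that]] by simp
    have "E f f / ip f f \<in> S"
      unfolding S_def norm1(2)[OF VH[OF that] pos, symmetric]
      using V_cmult[OF that, of "1 / sqrt (ip f f)"] norm1(1)[OF VH[OF that] pos] by blast
    then have "\<Lambda> \<le> E f f / ip f f" unfolding \<Lambda>_def by (rule cInf_lower[OF _ Sbd])
    then show ?thesis using pos by (simp add: field_simps)
  qed
  have "\<forall>k::nat. \<exists>f. V f \<and> ip f f = 1 \<and> E f f < \<Lambda> + 1 / real (Suc k)"
  proof
    fix k :: nat
    have "Inf S < \<Lambda> + 1 / real (Suc k)" by (simp add: \<Lambda>_def)
    then obtain y where "y \<in> S" "y < \<Lambda> + 1 / real (Suc k)" using cInf_lessD[OF Sne] by blast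
    then show "\<exists>f. V f \<and> ip f f = 1 \<and> E f f < \<Lambda> + 1 / real (Suc k)" by (auto simp: S_def)
  qed
  from choice[OF this] obtain f where f: "\<And>k. V (f k)" "\<And>k. ip (f k) (f k) = 1"
    "\<And>k::nat. E (f k) (f k) < \<Lambda> + 1 / real (Suc k)" by blast
  have Hf: "H (f k)" for k by (rule VH[OF f(1)])
  have Elim: "(\<lambda>k. E (f k) (f k)) \<longlonglongrightarrow> \<Lambda>"
  proof (rule tendsto_sandwich[where f="\<lambda>_. \<Lambda>"])
    show "\<forall>\<^sub>F k in sequentially. \<Lambda> \<le> E (f k) (f k)" using low[OF f(1)] f(2) by (auto intro!: always_eventually)
    show "\<forall>\<^sub>F k in sequentially. E (f k) (f k) \<le> \<Lambda> + 1 / real (Suc k)" using f(3) by (auto intro!: always_eventually less_imp_le)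
    show "(\<lambda>k. \<Lambda> + 1 / real (Suc k)) \<longlonglongrightarrow> \<Lambda>"
      using tendsto_add[OF tendsto_const LIMSEQ_Suc[OF lim_1_over_n], of \<Lambda>] by simp
  qed auto
  have "E (f k) (f k) \<le> \<Lambda> + 1" for k
  proof -
    have "1 / real (Suc k) \<le> 1" by simp
    then show ?thesis using f(3)[of k] by linarith
  qed
  then obtain r where r: "strict_mono (r :: nat \<Rightarrow> nat)"
    "\<forall>e>0. \<exists>N. \<forall>i\<ge>N. \<forall>j\<ge>N. ip (\<lambda>x. f (r i) x - f (r j) x) (\<lambda>x. f (r i) x - f (r j) x) < e"
    using compact[of f "\<Lambda> + 1"] Hf f(2) \<Lambda>0 by auto
  have Elim_r: "(\<lambda>k. E (f (r k)) (f (r k))) \<longlonglongrightarrow> \<Lambda>"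
    using LIMSEQ_subseq_LIMSEQ[OF Elim r(1)] by (simp add: o_def)
  have par: "E (\<lambda>x. f (r i) x - f (r j) x) (\<lambda>x. f (r i) x - f (r j) x)
      \<le> 2 * (E (f (r i)) (f (r i)) - \<Lambda>) + 2 * (E (f (r j)) (f (r j)) - \<Lambda>)
        + \<Lambda> * ip (\<lambda>x. f (r i) x - f (r j) x) (\<lambda>x. f (r i) x - f (r j) x)" for i j
  proof -
    have "\<Lambda> * ip (\<lambda>x. 1 * f (r i) x + 1 * f (r j) x) (\<lambda>x. 1 * f (r i) x + 1 * f (r j) x)
       \<le> E (\<lambda>x. 1 * f (r i) x + 1 * f (r j) x) (\<lambda>x. 1 * f (r i) x + 1 * f (r j) x)"
      by (rule low[OF V_lin[OF f(1) f(1)]])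
    then have "\<Lambda> * (2 + 2 * ip (f (r i)) (f (r j))) \<le> E (f (r i)) (f (r i)) + 2 * E (f (r i)) (f (r j)) + E (f (r j)) (f (r j))"
      using ip.square_lin[OF Hf Hf, of 1 "r i" 1 "r j"] E.square_lin[OF Hf Hf, of 1 "r i" 1 "r j"] f(2) by simp
    moreover have "\<Lambda> * ip (\<lambda>x. f (r i) x - f (r j) x) (\<lambda>x. f (r i) x - f (r j) x) = \<Lambda> * (2 - 2 * ip (f (r i)) (f (r j)))"
      using ip.square_lin[OF Hf Hf, of 1 "r i" "-1" "r j"] f(2) by simp
    moreover have "E (\<lambda>x. f (r i) x - f (r j) x) (\<lambda>x. f (r i) x - f (r j) x)
        = E (f (r i)) (f (r i)) - 2 * E (f (r i)) (f (r j)) + E (f (r j)) (f (r j))"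
      using E.square_lin[OF Hf Hf, of 1 "r i" "-1" "r j"] by simp
    ultimately show ?thesis by (simp add: algebra_simps)
  qed
  have cauchyE: "\<exists>N. \<forall>i\<ge>N. \<forall>j\<ge>N. E (\<lambda>x. f (r i) x - f (r j) x) (\<lambda>x. f (r i) x - f (r j) x) < e" if e: "e > 0" for e
  proof -
    have e2: "e / (2 * (\<Lambda> + 1)) > 0" using e \<Lambda>0 by simp
    obtain N1 where N1: "\<And>i j. i \<ge> N1 \<Longrightarrow> j \<ge> N1 \<Longrightarrow> ip (\<lambda>x. f (r i) x - f (r j) x) (\<lambda>x. f (r i) x - f (r j) x) < e / (2 * (\<Lambda> + 1))"
      using r(2)[rule_format, OF e2] by blast
    obtain N2 where N2: "\<And>i. i \<ge> N2 \<Longrightarrow> norm (E (f (r i)) (f (r i)) - \<Lambda>) < e / 8"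
      using LIMSEQ_D[OF Elim_r, of "e / 8"] e by auto
    have "E (\<lambda>x. f (r i) x - f (r j) x) (\<lambda>x. f (r i) x - f (r j) x) < e" if ij: "i \<ge> max N1 N2" "j \<ge> max N1 N2" for i j
    proof -
      have "\<Lambda> * ip (\<lambda>x. f (r i) x - f (r j) x) (\<lambda>x. f (r i) x - f (r j) x) \<le> \<Lambda> * (e / (2 * (\<Lambda> + 1)))"
        using N1[of i j] ij \<Lambda>0 by (intro mult_left_mono) auto
      also have "\<dots> \<le> e / 2" using \<Lambda>0 e by (simp add: field_simps)
      finally have "\<Lambda> * ip (\<lambda>x. f (r i) x - f (r j) x) (\<lambda>x. f (r i) x - f (r j) x) \<le> e / 2" .
      moreover have "E (f (r i)) (f (r i)) - \<Lambda> < e / 8" "E (f (r j)) (f (r j)) - \<Lambda> < e / 8"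
        using N2[of i] N2[of j] ij unfolding real_norm_def abs_less_iff by auto
      moreover have "Y \<le> e / 2 \<Longrightarrow> a < e / 8 \<Longrightarrow> b < e / 8 \<Longrightarrow> X \<le> 2 * a + 2 * b + Y \<Longrightarrow> X < e" for X Y a b :: real
        by linarith
      ultimately show ?thesis using par[of i j] by blast
    qed
    then show ?thesis by blast
  qed
  obtain g where g: "H g" "(\<lambda>k. ip (\<lambda>x. f (r k) x - g x) (\<lambda>x. f (r k) x - g x)) \<longlonglongrightarrow> 0"
     "(\<lambda>k. E (\<lambda>x. f (r k) x - g x) (\<lambda>x. f (r k) x - g x)) \<longlonglongrightarrow> 0"
    using complete[of "\<lambda>k. f (r k)"] Hf r(2) cauchyE by blast
  have "ip g (p i) = 0" if "i \<in> I" for i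
    using ip.tendsto_left[OF Hf g(1) p[OF that] g(2)] f(1) that
    by (simp add: V_def LIMSEQ_const_iff)
  moreover have "ip g g = 1" using ip.tendsto_square[OF Hf g(1,2)] f(2) by (simp add: LIMSEQ_const_iff)
  moreover have "E g g = \<Lambda>" using LIMSEQ_unique[OF E.tendsto_square[OF Hf g(1,3)] Elim_r] .
  ultimately show thesis using that[of g] g(1) low by (auto simp: V_def)
qed

text \<open>A minimizer of the quotient on the complement of the \<open>q i\<close> satisfies the
  eigenvalue equation, so that \<open>minimal\<close> applies to it; its quotient is in turn at most
  that of \<open>e\<close>.\<close>

lemma Rayleigh_lower_bound:
  fixes q :: "nat \<Rightarrow> 'a \<Rightarrow> real"
  assumes q: "\<And>i. i < N \<Longrightarrow> H (q i)"
    and eig: "\<And>i w. i < N \<Longrightarrow> H w \<Longrightarrow> E (q i) w = mu i * ip (q i) w"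
    and minimal: "\<And>w \<mu>. H w \<Longrightarrow> (\<And>z. H z \<Longrightarrow> E w z = \<mu> * ip w z) \<Longrightarrow> ip w w = 1 \<Longrightarrow>
        (\<And>i. i < N \<Longrightarrow> ip w (q i) = 0) \<Longrightarrow> l \<le> \<mu>"
    and e: "H e" "\<And>i. i < N \<Longrightarrow> ip e (q i) = 0"
  shows "l * ip e e \<le> E e e"
proof (cases "ip e e = 0")
  case True
  then show ?thesis using E.pos[OF e(1)] by simp
next
  case False
  then have pos: "ip e e > 0" using ip.pos[OF e(1)] by simp
  obtain w where w: "H w" "\<And>i. i \<in> {..<N} \<Longrightarrow> ip w (q i) = 0" "ip w w = 1"
    "\<And>f. H f \<Longrightarrow> (\<And>i. i \<in> {..<N} \<Longrightarrow> ip f (q i) = 0) \<Longrightarrow> E w w * ip f f \<le> E f f"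
    using minimizer_exists[of "{..<N}" q e] q e pos by auto
  have var: "E w z = E w w * ip w z" if z: "H z" "\<And>i. i < N \<Longrightarrow> ip z (q i) = 0" for z
  proof -
    \<comment> \<open>The form E - \<open>E w w\<close> ip is nonnegative on the complement and zero
      at w, so its discriminant annihilates the first variation.\<close>
    have "(E w z - E w w * ip w z)\<^sup>2 \<le> 0 * (E z z - E w w * ip z z)"
    proof (rule quadratic_nonneg_discriminant)
      show "E z z - E w w * ip z z \<ge> 0" using w(4)[OF z(1)] z(2) by auto
      fix t :: real
      have "ip (\<lambda>x. 1 * w x + t * z x) (q i) = 0" if "i < N" for i
        using w(2) z(2) that by (subst ip.lin[OF w(1) z(1) q[OF that]]) auto
      then have "E w w * ip (\<lambda>x. 1 * w x + t * z x) (\<lambda>x. 1 * w x + t * z x) \<le> E (\<lambda>x. 1 * w x + t * z x) (\<lambda>x. 1 * w x + t * z x)"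
        by (intro w(4) ip.H_lin w(1) z(1)) auto
      then show "0 \<le> 0 + 2 * t * (E w z - E w w * ip w z) + t\<^sup>2 * (E z z - E w w * ip z z)"
        unfolding ip.square_lin[OF w(1) z(1)] E.square_lin[OF w(1) z(1)] w(3) by (simp add: algebra_simps)
    qed
    then show ?thesis by simp
  qed
  have "E w z = E w w * ip w z" if z: "H z" for z
  proof -
    \<comment> \<open>The equation is known for z in the complement. The part of z in the span of
      the \<open>q i\<close> contributes 0 to both sides, because the \<open>q i\<close> are
      eigenfunctions orthogonal to w.\<close>
    obtain c where c: "\<forall>j<N. ip (\<lambda>x. z x - (\<Sum>i<N. c i * q i x)) (q j) = 0"
      using ip.projection_exists[of N q z] q z by blast
    let ?s = "\<lambda>x. \<Sum>i<N. c i * q i x"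
    have s: "H ?s" using q by (intro ip.H_sum) auto
    have z': "H (\<lambda>x. z x - ?s x)" by (rule ip.H_diff[OF z s])
    have "ip ?s w = 0" using ip.B_sum[of "{..<N}" q w c] q w(1,2) ip.sym[OF q w(1)] by simp
    moreover have "E ?s w = 0"
      using E.B_sum[of "{..<N}" q w c] q w(1,2) ip.sym[OF q w(1)] eig[OF _ w(1)] by simp
    ultimately have zero: "ip w ?s = 0" "E w ?s = 0" using ip.sym[OF s w(1)] E.sym[OF s w(1)] by auto
    have "E w (\<lambda>x. z x - ?s x) = E w w * ip w (\<lambda>x. z x - ?s x)"
      by (rule var[OF z']) (use c in auto)
    then show ?thesis
      using zero E.lin_right[OF z s w(1), of 1 "-1"] ip.lin_right[OF z s w(1), of 1 "-1"] by simp
  qed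
  then have "l \<le> E w w" by (intro minimal[OF w(1) _ w(3)] w(2)) auto
  then have "l * ip e e \<le> E w w * ip e e" using pos by simp
  also have "\<dots> \<le> E e e" by (rule w(4)[OF e(1)]) (use e(2) in auto)
  finally show ?thesis .
qed

text \<open>Dimension count: the span of \<open>q 0, \<dots>, q (N-1)\<close> and \<open>e\<close> contains a nonzero \<open>z\<close> which is annihilated
  by all the functionals \<open>\<Phi>\<close>, and the Rayleigh quotient of \<open>z\<close> is at most that of \<open>e\<close>.\<close>

lemma Rayleigh_dimension_count:
  fixes q :: "nat \<Rightarrow> 'a \<Rightarrow> real"
  assumes q: "\<And>i. i < N \<Longrightarrow> H (q i)"
    and eig: "\<And>i w. i < N \<Longrightarrow> H w \<Longrightarrow> E (q i) w = mu i * ip (q i) w"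
    and q_pos: "\<And>i. i < N \<Longrightarrow> ip (q i) (q i) > 0"
    and orth: "\<And>i j. i < N \<Longrightarrow> j < N \<Longrightarrow> i \<noteq> j \<Longrightarrow> ip (q i) (q j) = 0"
    and e: "H e" "\<And>i. i < N \<Longrightarrow> ip e (q i) = 0" "\<And>i. i < N \<Longrightarrow> mu i * ip e e \<le> E e e"
    and K: "finite K" "card K \<le> N"
    and \<Phi>: "\<And>k f g a b. k \<in> K \<Longrightarrow> H f \<Longrightarrow> H g \<Longrightarrow> \<Phi> k (\<lambda>x. a * f x + b * g x) = a * \<Phi> k f + b * \<Phi> k g"
    and \<kappa>: "\<kappa> \<ge> 0" "\<And>z. H z \<Longrightarrow> (\<And>k. k \<in> K \<Longrightarrow> \<Phi> k z = 0) \<Longrightarrow> ip z z \<le> \<kappa> * E z z"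
  shows "ip e e \<le> \<kappa> * E e e"
proof (cases "ip e e = 0")
  case True
  then show ?thesis using E.pos[OF e(1)] \<kappa>(1) by simp
next
  case False
  then have pos: "ip e e > 0" using ip.pos[OF e(1)] by simp
  \<comment> \<open>With e in the last place these are N + 1 orthogonal vectors, facing at most N
    linear conditions.\<close>
  define w where "w i = (if i < N then q i else e)" for i
  define R where "R = E e e / ip e e"
  have Hw: "H (w i)" for i using q e by (simp add: w_def)
  have wpos: "ip (w i) (w i) > 0" for i using q_pos pos by (simp add: w_def)
  have o: "ip (w i) (w j) = 0 \<and> E (w i) (w j) = 0" if "i < Suc N" "j < Suc N" "i \<noteq> j" for i j
    using that orth e(1,2) q ip.sym[OF e(1) q] E.sym[OF e(1) q] eig by (auto simp: w_def)
  have Rw: "E (w i) (w i) \<le> R * ip (w i) (w i)" if i: "i < Suc N" for i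
  proof (cases "i < N")
    case True
    have "mu i \<le> R" using e(3)[OF True] pos by (simp add: R_def field_simps)
    then show ?thesis using True q_pos[OF True] eig[OF True q[OF True]] by (simp add: w_def)
  next
    case False
    then show ?thesis using pos by (simp add: w_def R_def)
  qed
  obtain c where c: "\<exists>i\<in>{..<Suc N}. c i \<noteq> 0" "\<And>k. k \<in> K \<Longrightarrow> (\<Sum>i<Suc N. c i * \<Phi> k (w i)) = 0"
    using homogeneous_system_nontrivial[of K "{..<Suc N}" "\<lambda>k i. \<Phi> k (w i)"] K by auto
  let ?z = "\<lambda>x. \<Sum>i<Suc N. c i * w i x"
  have z: "H ?z" using Hw by (intro ip.H_sum) auto
  have \<Phi>_sum: "\<Phi> k (\<lambda>x. \<Sum>i<n. c i * w i x) = (\<Sum>i<n. c i * \<Phi> k (w i))" if k: "k \<in> K" for k n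
  proof (induction n)
    case 0
    then show ?case using \<Phi>[OF k e(1) e(1), of 0 0] by simp
  next
    case (Suc n)
    have "H (\<lambda>x. \<Sum>i<n. c i * w i x)" using Hw by (intro ip.H_sum) auto
    from \<Phi>[OF k this Hw[of n], of 1 "c n"] show ?case using Suc by simp
  qed
  have zi: "ip ?z ?z = (\<Sum>i<Suc N. (c i)\<^sup>2 * ip (w i) (w i))"
    by (rule ip.square_orthogonal_sum) (use Hw o in auto)
  have zE: "E ?z ?z = (\<Sum>i<Suc N. (c i)\<^sup>2 * E (w i) (w i))"
    by (rule E.square_orthogonal_sum) (use Hw o in auto)
  obtain i where i: "i < Suc N" "c i \<noteq> 0" using c(1) by auto
  have "0 < (\<Sum>i<Suc N. (c i)\<^sup>2 * ip (w i) (w i))"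
    by (rule sum_pos2[of _ i]) (use i wpos less_imp_le[OF wpos] in auto)
  then have zpos: "ip ?z ?z > 0" using zi by simp
  have "E ?z ?z \<le> (\<Sum>i<Suc N. (c i)\<^sup>2 * (R * ip (w i) (w i)))"
    unfolding zE using Rw by (intro sum_mono mult_left_mono) auto
  also have "\<dots> = R * ip ?z ?z" unfolding zi by (simp add: sum_distrib_left mult_ac del: sum.lessThan_Suc)
  finally have ER: "E ?z ?z \<le> R * ip ?z ?z" .
  have "ip ?z ?z \<le> \<kappa> * E ?z ?z" by (rule \<kappa>(2)[OF z]) (simp only: \<Phi>_sum c(2))
  also have "\<dots> \<le> \<kappa> * (R * ip ?z ?z)" by (rule mult_left_mono[OF ER \<kappa>(1)])
  finally have "1 * ip ?z ?z \<le> \<kappa> * R * ip ?z ?z" by (simp add: mult.assoc)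
  then have "1 \<le> \<kappa> * R" using zpos by (simp only: mult_le_cancel_right_pos)
  then show ?thesis using pos by (simp add: R_def field_simps)
qed

end

section \<open>The energy form on a cube\<close>

lemma symmetric_form_Cauchy_Schwarz:
  fixes A :: "real^'d^'d"
  assumes sym: "transpose A = A" and pos: "\<And>\<xi>. 0 \<le> \<xi> \<bullet> (A *v \<xi>)" and up: "\<And>\<xi>. \<xi> \<bullet> (A *v \<xi>) \<le> \<beta> * (norm \<xi>)\<^sup>2"
    and "\<beta> \<ge> 0"
  shows "\<bar>\<xi> \<bullet> (A *v \<eta>)\<bar> \<le> \<beta> * norm \<xi> * norm \<eta>"
proof -
  have s: "\<eta> \<bullet> (A *v \<xi>) = \<xi> \<bullet> (A *v \<eta>)"
    using dot_lmul_matrix[of \<eta> A \<xi>] sym by (metis inner_commute transpose_matrix_vector)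
  have "(\<xi> \<bullet> (A *v \<eta>))\<^sup>2 \<le> (\<xi> \<bullet> (A *v \<xi>)) * (\<eta> \<bullet> (A *v \<eta>))"
  proof (rule quadratic_nonneg_discriminant)
    fix t :: real
    have "0 \<le> (\<xi> + t *\<^sub>R \<eta>) \<bullet> (A *v (\<xi> + t *\<^sub>R \<eta>))" by (rule pos)
    also have "\<dots> = \<xi> \<bullet> (A *v \<xi>) + 2 * t * (\<xi> \<bullet> (A *v \<eta>)) + t\<^sup>2 * (\<eta> \<bullet> (A *v \<eta>))"
      using s by (simp add: matrix_vector_right_distrib matrix_vector_mult_scaleR inner_add_left inner_add_right
          power2_eq_square algebra_simps)
    finally show "0 \<le> \<xi> \<bullet> (A *v \<xi>) + 2 * t * (\<xi> \<bullet> (A *v \<eta>)) + t\<^sup>2 * (\<eta> \<bullet> (A *v \<eta>))" .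
  qed (rule pos)
  also have "\<dots> \<le> (\<beta> * (norm \<xi>)\<^sup>2) * (\<beta> * (norm \<eta>)\<^sup>2)"
    using assms by (intro mult_mono) auto
  also have "\<dots> = (\<beta> * norm \<xi> * norm \<eta>)\<^sup>2" by (simp add: power2_eq_square algebra_simps)
  finally have "\<bar>\<xi> \<bullet> (A *v \<eta>)\<bar>\<^sup>2 \<le> (\<beta> * norm \<xi> * norm \<eta>)\<^sup>2" by simp
  then show ?thesis by (rule power2_le_imp_le) (use assms(4) in simp)
qed

locale coeff_cube =
  fixes c :: "real^'d" and L :: real and A :: "real^'d \<Rightarrow> real^'d^'d" and \<alpha> \<beta> :: real
  assumes L: "L > 0" and coeff: "coeff_matrix (cube c L) A \<alpha> \<beta>"
begin

definition Q :: "(real^'d) set" where "Q = cube c L"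
definition M :: "(real^'d) measure" where "M = lebesgue_on Q"
text \<open>The energy form on vector fields: computations use explicit weak gradients, and
  uniqueness almost everywhere links the result to \<open>energy_ip\<close>.\<close>

definition ef :: "(real^'d \<Rightarrow> real^'d) \<Rightarrow> (real^'d \<Rightarrow> real^'d) \<Rightarrow> real" where
  "ef g h = (\<integral>x. (A x *v g x) \<bullet> h x \<partial>M)"
definition ip :: "(real^'d \<Rightarrow> real) \<Rightarrow> (real^'d \<Rightarrow> real) \<Rightarrow> real" where
  "ip f g = (\<integral>x. f x * g x \<partial>M)"
definition sqvec :: "(real^'d \<Rightarrow> real^'d) \<Rightarrow> bool" where
  "sqvec g \<longleftrightarrow> (\<forall>i. sqint M (\<lambda>x. g x $ i))"

lemma space_M [simp]: "space M = Q" by (simp add: M_def)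

lemma bounds: "0 < \<alpha>" "\<alpha> \<le> \<beta>" "0 < \<beta>" using coeff by (auto simp: coeff_matrix_def)

lemma A_sym: "x \<in> Q \<Longrightarrow> transpose (A x) = A x"
  and A_low: "x \<in> Q \<Longrightarrow> \<alpha> * (norm \<xi>)\<^sup>2 \<le> \<xi> \<bullet> (A x *v \<xi>)"
  and A_up: "x \<in> Q \<Longrightarrow> \<xi> \<bullet> (A x *v \<xi>) \<le> \<beta> * (norm \<xi>)\<^sup>2"
  and A_meas: "A \<in> borel_measurable M"
  using coeff by (auto simp: coeff_matrix_def Q_def M_def)

text \<open>Cauchy-Schwarz for the matrix form on two unit vectors. Bounded entries keep
  \<open>A x *v g x\<close> square integrable.\<close>

lemma A_entry_bound: "x \<in> Q \<Longrightarrow> \<bar>A x $ i $ j\<bar> \<le> \<beta>"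
proof -
  assume x: "x \<in> Q"
  have "0 \<le> \<xi> \<bullet> (A x *v \<xi>)" for \<xi>
    using A_low[OF x, of \<xi>] bounds by (smt (verit) mult_nonneg_nonneg zero_le_power2)
  from symmetric_form_Cauchy_Schwarz[OF A_sym[OF x] this A_up[OF x], of "axis i 1" "axis j 1"]
  show ?thesis using bounds by (simp add: inner_axis' matrix_vector_mult_basis column_def)
qed

lemma A_entry_meas: "(\<lambda>x. A x $ i $ j) \<in> borel_measurable M"
proof (rule measurable_compose[OF A_meas])
  show "(\<lambda>B :: real^'d^'d. B $ i $ j) \<in> borel_measurable borel"
    by (intro borel_measurable_continuous_onI continuous_intros)
qed

lemma form_expand: "(B *v g) \<bullet> h = (\<Sum>i\<in>UNIV. \<Sum>j\<in>UNIV. B $ i $ j * g $ j * h $ i)" for B :: "real^'d^'d"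
  by (simp add: inner_vec_def matrix_vector_mult_def sum_distrib_right)

lemma integrable_form:
  assumes "sqvec g" "sqvec h"
  shows "integrable M (\<lambda>x. (A x *v g x) \<bullet> h x)"
  unfolding form_expand
proof (intro Bochner_Integration.integrable_sum)
  fix i j
  have "sqint M (\<lambda>x. A x $ i $ j * g x $ j)"
    by (rule sqint_mult_bounded[of _ _ _ \<beta>]) (use assms A_entry_meas A_entry_bound in \<open>auto simp: sqvec_def\<close>)
  then show "integrable M (\<lambda>x. A x $ i $ j * g x $ j * h x $ i)"
    by (rule sqint_mult_integrable) (use assms in \<open>auto simp: sqvec_def\<close>)
qed

lemma sqvec_lin: "sqvec g \<Longrightarrow> sqvec h \<Longrightarrow> sqvec (\<lambda>x. a *\<^sub>R g x + b *\<^sub>R h x)"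
  by (auto simp: sqvec_def intro!: sqint_add sqint_cmult)

lemma sqvec_diff: "sqvec g \<Longrightarrow> sqvec h \<Longrightarrow> sqvec (\<lambda>x. g x - h x)"
  using sqvec_lin[of g h 1 "-1"] by simp

lemma sqvec_scale:
  assumes "sqvec g" "f \<in> borel_measurable M" "\<And>x. x \<in> Q \<Longrightarrow> \<bar>f x\<bar> \<le> B"
  shows "sqvec (\<lambda>x. f x *\<^sub>R g x)"
  unfolding sqvec_def
proof
  fix i
  have "sqint M (\<lambda>x. f x * g x $ i)"
    by (rule sqint_mult_bounded[of _ _ _ B]) (use assms in \<open>auto simp: sqvec_def\<close>)
  then show "sqint M (\<lambda>x. (f x *\<^sub>R g x) $ i)" by simp
qed

lemma form_sym: "x \<in> Q \<Longrightarrow> (A x *v g) \<bullet> h = (A x *v h) \<bullet> g"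
  using dot_lmul_matrix[of g "A x" h] A_sym[of x] by (metis inner_commute transpose_matrix_vector)

lemma ef_sym: "ef g h = ef h g"
  unfolding ef_def by (intro Bochner_Integration.integral_cong refl form_sym) simp

lemma ef_lin:
  assumes "sqvec f" "sqvec g" "sqvec h"
  shows "ef (\<lambda>x. a *\<^sub>R f x + b *\<^sub>R g x) h = a * ef f h + b * ef g h"
proof -
  have "(A x *v (a *\<^sub>R f x + b *\<^sub>R g x)) \<bullet> h x = a * ((A x *v f x) \<bullet> h x) + b * ((A x *v g x) \<bullet> h x)" for x
    by (simp add: matrix_vector_right_distrib matrix_vector_mult_scaleR inner_add_left)
  then show ?thesis unfolding ef_def using integrable_form assms by simp
qed

lemma ef_cong_AE:
  assumes "sqvec g" "sqvec h" "sqvec g'" "sqvec h'" "AE x in M. g x = g' x" "AE x in M. h x = h' x"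
  shows "ef g h = ef g' h'"
  unfolding ef_def
proof (rule integral_cong_AE)
  show "AE x in M. (A x *v g x) \<bullet> h x = (A x *v g' x) \<bullet> h' x"
    using assms(5,6) by eventually_elim simp
qed (use integrable_form assms in auto)

lemma sqvec_norm2: "sqvec g \<Longrightarrow> integrable M (\<lambda>x. (norm (g x))\<^sup>2) \<and> (\<integral>x. (norm (g x))\<^sup>2 \<partial>M) = (\<Sum>i\<in>UNIV. \<integral>x. (g x $ i)\<^sup>2 \<partial>M)"
proof -
  assume "sqvec g"
  then have i: "integrable M (\<lambda>x. (g x $ i)\<^sup>2)" for i by (auto simp: sqvec_def)
  have "(norm (g x))\<^sup>2 = (\<Sum>i\<in>UNIV. (g x $ i)\<^sup>2)" for x
    unfolding power2_norm_eq_inner inner_vec_def by (simp add: power2_eq_square)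
  then show ?thesis using i by simp
qed

lemma ef_low: "sqvec g \<Longrightarrow> \<alpha> * (\<Sum>i\<in>UNIV. \<integral>x. (g x $ i)\<^sup>2 \<partial>M) \<le> ef g g"
  and ef_up: "sqvec g \<Longrightarrow> ef g g \<le> \<beta> * (\<Sum>i\<in>UNIV. \<integral>x. (g x $ i)\<^sup>2 \<partial>M)"
proof -
  assume g: "sqvec g"
  note n = sqvec_norm2[OF g]
  show "\<alpha> * (\<Sum>i\<in>UNIV. \<integral>x. (g x $ i)\<^sup>2 \<partial>M) \<le> ef g g"
  proof -
    have "(\<integral>x. \<alpha> * (norm (g x))\<^sup>2 \<partial>M) \<le> ef g g"
      unfolding ef_def by (rule integral_mono) (use n integrable_form[OF g g] A_low in \<open>auto simp: inner_commute\<close>)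
    then show ?thesis using n by simp
  qed
  show "ef g g \<le> \<beta> * (\<Sum>i\<in>UNIV. \<integral>x. (g x $ i)\<^sup>2 \<partial>M)"
  proof -
    have "ef g g \<le> (\<integral>x. \<beta> * (norm (g x))\<^sup>2 \<partial>M)"
      unfolding ef_def by (rule integral_mono) (use n integrable_form[OF g g] A_up in \<open>auto simp: inner_commute\<close>)
    then show ?thesis using n by simp
  qed
qed

lemma ef_nonneg: "sqvec g \<Longrightarrow> 0 \<le> ef g g"
proof -
  assume g: "sqvec g"
  have "0 \<le> \<alpha> * (\<Sum>i\<in>UNIV. \<integral>x. (g x $ i)\<^sup>2 \<partial>M)" using bounds by (intro mult_nonneg_nonneg sum_nonneg) auto
  then show ?thesis using ef_low[OF g] by linarith
qed

lemma h1D: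
  assumes "h1pair Q f g"
  shows "sqint M f" "sqvec g"
  using assms by (auto simp: h1pair_def M_def sqvec_def)

lemma energy_ip_pair:
  assumes "h1pair Q f g" "h1pair Q f' g'"
  shows "energy_ip A Q f f' = ef g g'"
proof -
  have "energy_ip A Q f f' = ef (grad Q f) (grad Q f')" by (simp add: energy_ip_def ef_def M_def)
  also have "\<dots> = ef g g'"
  proof (rule ef_cong_AE)
    show "AE x in M. grad Q f x = g x" "AE x in M. grad Q f' x = g' x"
      using grad_AE_eq[OF L] assms unfolding M_def Q_def by blast+
  qed (use assms h1D(2) h1pair_grad h1pair_H1 in blast)+
  finally show ?thesis .
qed

lemma psd_ip: "psd_form (H1 Q) ip"
proof
  show "H1 Q (\<lambda>x. 0)" using h1pair_H1[OF h1pair_const[of c L 0]] by (simp add: Q_def)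
  show "H1 Q (\<lambda>x. a * f x + b * g x)" if "H1 Q f" "H1 Q g" for f g a b
    by (rule h1pair_H1[OF h1pair_lincomb[OF h1pair_grad[OF that(1)] h1pair_grad[OF that(2)]]])
  show "ip f g = ip g f" for f g by (simp add: ip_def mult.commute)
  show "ip (\<lambda>x. a * f x + b * g x) h = a * ip f h + b * ip g h" if "H1 Q f" "H1 Q g" "H1 Q h" for f g h a b
  proof -
    have "integrable M (\<lambda>x. f x * h x)" "integrable M (\<lambda>x. g x * h x)"
      using that by (auto intro!: sqint_mult_integrable dest!: h1pair_grad h1D(1))
    moreover have "(\<lambda>x. (a * f x + b * g x) * h x) = (\<lambda>x. a * (f x * h x) + b * (g x * h x))" by (auto simp: algebra_simps)
    ultimately show ?thesis by (simp add: ip_def)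
  qed
  show "0 \<le> ip f f" for f unfolding ip_def by (intro integral_nonneg_AE AE_I2) simp
qed

interpretation ipf: psd_form "H1 Q" ip by (rule psd_ip)

lemma psd_energy: "psd_form (H1 Q) (energy_ip A Q)"
proof
  show "H1 Q (\<lambda>x. 0)" by (rule ipf.H_zero)
  show "H1 Q (\<lambda>x. a * f x + b * g x)" if "H1 Q f" "H1 Q g" for f g a b
    by (rule ipf.H_lin[OF that])
  show "energy_ip A Q f g = energy_ip A Q g f" for f g
    using ef_sym[of "grad Q f" "grad Q g"] by (simp add: energy_ip_def ef_def M_def)
  show "energy_ip A Q (\<lambda>x. a * f x + b * g x) h = a * energy_ip A Q f h + b * energy_ip A Q g h"
    if "H1 Q f" "H1 Q g" "H1 Q h" for f g h a b
    using that[THEN h1pair_grad]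
    by (simp add: energy_ip_pair[OF h1pair_lincomb] energy_ip_pair ef_lin h1D(2))
  show "0 \<le> energy_ip A Q f f" if "H1 Q f" for f
    using energy_ip_pair[OF h1pair_grad[OF that] h1pair_grad[OF that]] ef_nonneg[OF h1D(2)[OF h1pair_grad[OF that]]] by simp
qed

interpretation enf: psd_form "H1 Q" "energy_ip A Q" by (rule psd_energy)

lemma h1pair_diff: "h1pair Q f g \<Longrightarrow> h1pair Q f' g' \<Longrightarrow> h1pair Q (\<lambda>x. f x - f' x) (\<lambda>x. g x - g' x)"
  using h1pair_lincomb[of Q f g f' g' 1 "-1"] by simp

lemma grad_le_energy:
  assumes "h1pair Q f g"
  shows "(\<Sum>i\<in>UNIV. \<integral>x. (g x $ i)\<^sup>2 \<partial>M) \<le> energy_ip A Q f f / \<alpha>"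
  using ef_low[OF h1D(2)[OF assms]] bounds energy_ip_pair[OF assms assms] by (simp add: field_simps)

lemma ip_square: "ip f f = (\<integral>x. (f x)\<^sup>2 \<partial>M)"
  by (simp add: ip_def power2_eq_square)

lemma finite_M: "finite_measure M"
  unfolding M_def Q_def by (rule finite_measure_cube)

section \<open>Completeness of H1 and the Rellich theorem\<close>

text \<open>The lower bound \<alpha> makes the gradients Cauchy componentwise, their limits form a
  weak gradient by closedness, and the upper bound \<beta> leads back to the energy.\<close>

lemma H1_complete:
  assumes H: "\<And>k. H1 Q (f k)"
    and ci: "\<And>e. e > 0 \<Longrightarrow> \<exists>N. \<forall>i\<ge>N. \<forall>j\<ge>N. ip (\<lambda>x. f i x - f j x) (\<lambda>x. f i x - f j x) < e"
    and cE: "\<And>e. e > 0 \<Longrightarrow> \<exists>N. \<forall>i\<ge>N. \<forall>j\<ge>N. energy_ip A Q (\<lambda>x. f i x - f j x) (\<lambda>x. f i x - f j x) < e"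
  shows "\<exists>g. H1 Q g \<and> (\<lambda>k. ip (\<lambda>x. f k x - g x) (\<lambda>x. f k x - g x)) \<longlonglongrightarrow> 0 \<and>
     (\<lambda>k. energy_ip A Q (\<lambda>x. f k x - g x) (\<lambda>x. f k x - g x)) \<longlonglongrightarrow> 0"
proof -
  define g where "g k = grad Q (f k)" for k
  have h: "h1pair Q (f k) (g k)" for k unfolding g_def by (rule h1pair_grad[OF H])
  obtain F where F: "L2lim M f F"
    by (rule L2_complete[of M f, OF finite_M h1D(1)[OF h] ci[unfolded ip_square]])
  have "\<forall>i. \<exists>G. L2lim M (\<lambda>k x. g k x $ i) G"
  proof
    fix i
    have cg: "\<exists>N. \<forall>k\<ge>N. \<forall>l\<ge>N. (\<integral>x. (g k x $ i - g l x $ i)\<^sup>2 \<partial>M) < e" if e: "e > 0" for e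
    proof -
      have "e * \<alpha> > 0" using e bounds by simp
      from cE[OF this] obtain N where N: "\<And>k l. k \<ge> N \<Longrightarrow> l \<ge> N \<Longrightarrow> energy_ip A Q (\<lambda>x. f k x - f l x) (\<lambda>x. f k x - f l x) < e * \<alpha>" by blast
      have "(\<integral>x. (g k x $ i - g l x $ i)\<^sup>2 \<partial>M) < e" if kl: "k \<ge> N" "l \<ge> N" for k l
      proof -
        have "(\<integral>x. (g k x $ i - g l x $ i)\<^sup>2 \<partial>M) \<le> (\<Sum>i\<in>UNIV. \<integral>x. ((g k x - g l x) $ i)\<^sup>2 \<partial>M)"
          using member_le_sum[of i UNIV "\<lambda>i. \<integral>x. ((g k x - g l x) $ i)\<^sup>2 \<partial>M"] by simp
        also have "\<dots> \<le> energy_ip A Q (\<lambda>x. f k x - f l x) (\<lambda>x. f k x - f l x) / \<alpha>"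
          by (rule grad_le_energy[OF h1pair_diff[OF h h]])
        also have "\<dots> < e" using N[OF kl] bounds by (simp add: field_simps)
        finally show ?thesis .
      qed
      then show ?thesis by blast
    qed
    have sq: "sqint M (\<lambda>x. g k x $ i)" for k using h1D(2)[OF h[of k]] by (simp add: sqvec_def)
    show "\<exists>G. L2lim M (\<lambda>k x. g k x $ i) G"
      by (rule L2_complete[of M "\<lambda>k x. g k x $ i", OF finite_M sq cg]) (assumption, rule exI)
  qed
  from choice[OF this] obtain G where G: "\<And>i. L2lim M (\<lambda>k x. g k x $ i) (G i)" by blast
  define G' where "G' x = (\<chi> i. G i x)" for x
  have G': "L2lim M (\<lambda>k x. g k x $ i) (\<lambda>x. G' x $ i)" for i using G by (simp add: G'_def)
  have hF: "h1pair Q F G'"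
    by (rule weak_grad_closed[OF _ h F[unfolded M_def] G'[unfolded M_def]]) (simp add: Q_def)
  have "(\<lambda>k. energy_ip A Q (\<lambda>x. f k x - F x) (\<lambda>x. f k x - F x)) \<longlonglongrightarrow> 0"
  proof (rule tendsto_sandwich[where f="\<lambda>_. 0"])
    have "(\<lambda>k. \<beta> * (\<Sum>i\<in>UNIV. \<integral>x. (g k x $ i - G' x $ i)\<^sup>2 \<partial>M)) \<longlonglongrightarrow> \<beta> * (\<Sum>i\<in>(UNIV::'d set). 0)"
      by (intro tendsto_intros L2limD(3)[OF G'])
    then show "(\<lambda>k. \<beta> * (\<Sum>i\<in>UNIV. \<integral>x. (g k x $ i - G' x $ i)\<^sup>2 \<partial>M)) \<longlonglongrightarrow> 0" by simp
    have hd: "h1pair Q (\<lambda>x. f k x - F x) (\<lambda>x. g k x - G' x)" for k by (rule h1pair_diff[OF h hF])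
    show "\<forall>\<^sub>F k in sequentially. energy_ip A Q (\<lambda>x. f k x - F x) (\<lambda>x. f k x - F x) \<le> \<beta> * (\<Sum>i\<in>UNIV. \<integral>x. (g k x $ i - G' x $ i)\<^sup>2 \<partial>M)"
      using ef_up[OF h1D(2)[OF hd]] by (intro always_eventually) (simp add: energy_ip_pair[OF hd hd])
    show "\<forall>\<^sub>F k in sequentially. 0 \<le> energy_ip A Q (\<lambda>x. f k x - F x) (\<lambda>x. f k x - F x)"
      using ef_nonneg[OF h1D(2)[OF hd]] by (intro always_eventually) (simp add: energy_ip_pair[OF hd hd])
  qed auto
  then show ?thesis using h1pair_H1[OF hF] L2limD(3)[OF F] unfolding ip_square by blast
qed

lemma integral_subcube_square_le:
  assumes f: "sqint M f" and z: "cube z s \<subseteq> Q" and s: "s \<ge> 0"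
  shows "(\<integral>x. f x \<partial>lebesgue_on (cube z s))\<^sup>2 \<le> s ^ CARD('d) * (\<integral>x. (f x)\<^sup>2 \<partial>M)"
proof -
  let ?N = "lebesgue_on (cube z s)"
  have Qb: "Q \<in> sets borel" by (simp add: Q_def)
  have fz: "sqint ?N f" by (rule sqint_subset[OF cube_borel Qb z f[unfolded M_def]])
  have one: "sqint ?N (\<lambda>x. 1)" by (simp add: sqint_def finite_measure.integrable_const[OF finite_measure_cube])
  have "(\<integral>x. f x \<partial>?N)\<^sup>2 \<le> (\<integral>x. (f x)\<^sup>2 \<partial>?N) * (\<integral>x. (1::real)\<^sup>2 \<partial>?N)"
    using sqint_Cauchy_Schwarz[OF fz one] by simp
  also have "(\<integral>x. (1::real)\<^sup>2 \<partial>?N) = s ^ CARD('d)"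
    using measure_cube(2)[OF s, of z] by (simp add: measure_restrict_space)
  also have "(\<integral>x. (f x)\<^sup>2 \<partial>?N) * s ^ CARD('d) \<le> (\<integral>x. (f x)\<^sup>2 \<partial>M) * s ^ CARD('d)"
    using integral_subset_le[OF cube_borel Qb z sqintD(2)[OF f[unfolded M_def]]] s
    by (intro mult_right_mono) (auto simp: M_def)
  finally show ?thesis by (simp add: mult.commute)
qed

text \<open>The integrals over all cells of all meshes are countably many bounded scalar sequences,
  so a diagonal subsequence makes them all converge. On a fine mesh the Poincare inequality bounds
  the rest of the L2 distance by the bounded gradients.\<close>

lemma Rellich:
  assumes H: "\<And>k. H1 Q (f k)" and bi: "\<And>k. ip (f k) (f k) \<le> B" and bE: "\<And>k. energy_ip A Q (f k) (f k) \<le> B"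
  shows "\<exists>r. strict_mono (r :: nat \<Rightarrow> nat) \<and> (\<forall>e>0. \<exists>N. \<forall>i\<ge>N. \<forall>j\<ge>N.
        ip (\<lambda>x. f (r i) x - f (r j) x) (\<lambda>x. f (r i) x - f (r j) x) < e)"
proof -
  let ?n = "CARD('d)"
  define g where "g k = grad Q (f k)" for k
  have h: "h1pair Q (f k) (g k)" for k unfolding g_def by (rule h1pair_grad[OF H])
  have B0: "B \<ge> 0" using bi[of 0] ipf.pos[OF H, of 0] by linarith
  define P where "P m C \<longleftrightarrow> finite C \<and> (\<forall>z\<in>C. cube z (L / real (Suc m)) \<subseteq> Q) \<and>
     (\<forall>f g. h1pair Q f g \<longrightarrow> (\<integral>x. (f x)\<^sup>2 \<partial>M) \<le>
         (\<Sum>z\<in>C. (\<integral>x. f x \<partial>lebesgue_on (cube z (L / real (Suc m))))\<^sup>2) / (L / real (Suc m)) ^ ?n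
         + real ?n / 4 * (L / real (Suc m))\<^sup>2 * (\<Sum>i\<in>UNIV. \<integral>x. (g x $ i)\<^sup>2 \<partial>M))" for m C
  have "\<forall>m. \<exists>C. P m C"
  proof
    fix m
    show "\<exists>C. P m C"
      unfolding P_def M_def Q_def by (rule Poincare_subcubes[OF L zero_less_Suc[of m], of c]) blast
  qed
  from choice[OF this] obtain C where C: "\<And>m. P m (C m)" by blast
  define S where "S = (SIGMA m:UNIV. C m)"
  define F where "F k mz = (\<integral>x. f k x \<partial>lebesgue_on (cube (snd mz) (L / real (Suc (fst mz)))))" for k and mz :: "nat \<times> (real^'d)"
  have cS: "countable S" unfolding S_def using C by (intro countable_SIGMA) (auto simp: P_def intro: countable_finite)
  have bd: "norm (F k mz) \<le> sqrt (L ^ ?n * B)" if "mz \<in> S" for k mz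
  proof -
    let ?s = "L / real (Suc (fst mz))"
    have s: "?s \<ge> 0" "?s \<le> L" using L by (auto simp: field_simps)
    have "cube (snd mz) ?s \<subseteq> Q" using that C[of "fst mz"] by (auto simp: S_def P_def)
    from integral_subcube_square_le[OF h1D(1)[OF h] this s(1)]
    have "(F k mz)\<^sup>2 \<le> ?s ^ ?n * (\<integral>x. (f k x)\<^sup>2 \<partial>M)" by (simp add: F_def)
    also have "\<dots> \<le> L ^ ?n * B" using s bi[of k] L by (intro mult_mono power_mono) (auto simp: ip_square)
    finally show ?thesis using real_sqrt_le_mono by fastforce
  qed
  obtain r where r: "strict_mono (r :: nat \<Rightarrow> nat)" "\<And>mz. mz \<in> S \<Longrightarrow> \<exists>l. (\<lambda>k. F (r k) mz) \<longlonglongrightarrow> l"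
    using function_convergent_subsequence[OF cS, of F "sqrt (L ^ ?n * B)"] bd by blast
  have grad_bd: "(\<Sum>a\<in>UNIV. \<integral>x. ((g i x - g j x) $ a)\<^sup>2 \<partial>M) \<le> 4 * B / \<alpha>" for i j
  proof -
    have "(\<Sum>a\<in>UNIV. \<integral>x. ((g i x - g j x) $ a)\<^sup>2 \<partial>M) \<le> energy_ip A Q (\<lambda>x. f i x - f j x) (\<lambda>x. f i x - f j x) / \<alpha>"
      by (rule grad_le_energy[OF h1pair_diff[OF h h]])
    also have "\<dots> \<le> 4 * B / \<alpha>"
    proof (rule divide_right_mono)
      have "energy_ip A Q (\<lambda>x. f i x - f j x) (\<lambda>x. f i x - f j x) + energy_ip A Q (\<lambda>x. f i x + f j x) (\<lambda>x. f i x + f j x)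
        = 2 * energy_ip A Q (f i) (f i) + 2 * energy_ip A Q (f j) (f j)"
        using enf.square_lin[OF H H, of 1 i "-1" j] enf.square_lin[OF H H, of 1 i 1 j] by simp
      moreover have "0 \<le> energy_ip A Q (\<lambda>x. f i x + f j x) (\<lambda>x. f i x + f j x)"
        by (rule enf.pos[OF enf.H_add[OF H H]])
      ultimately show "energy_ip A Q (\<lambda>x. f i x - f j x) (\<lambda>x. f i x - f j x) \<le> 4 * B"
        using bE[of i] bE[of j] by linarith
    qed (use bounds in simp)
    finally show ?thesis .
  qed
  have "\<exists>N. \<forall>i\<ge>N. \<forall>j\<ge>N. ip (\<lambda>x. f (r i) x - f (r j) x) (\<lambda>x. f (r i) x - f (r j) x) < e" if e: "e > 0" for e
  proof -
    define K where "K = real ?n / 4 * L\<^sup>2 * (4 * B / \<alpha>)"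
    have K0: "K \<ge> 0" using B0 bounds by (simp add: K_def)
    \<comment> \<open>The mesh is chosen so fine that the gradient term takes less than half of e;
      the cell integrals must account for the other half.\<close>
    have small: "\<exists>m. real ?n / 4 * (L / real (Suc m))\<^sup>2 * (4 * B / \<alpha>) < e / 2"
    proof -
      obtain m :: nat where m: "2 * K / e < real m" using reals_Archimedean2 by blast
      have "real m \<le> (real (Suc m))\<^sup>2" by (simp add: power2_eq_square algebra_simps)
      then have "2 * K / e < (real (Suc m))\<^sup>2" using m by linarith
      then have "K / (real (Suc m))\<^sup>2 < e / 2" using e by (simp add: field_simps)
      then show ?thesis by (intro exI[of _ m]) (simp add: K_def power_divide mult.commute)
    qed
    then obtain m where m: "real ?n / 4 * (L / real (Suc m))\<^sup>2 * (4 * B / \<alpha>) < e / 2" by blast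
    let ?s = "L / real (Suc m)"
    have s: "?s > 0" using L by simp
    have lim: "\<exists>l. (\<lambda>k. F (r k) (m, z)) \<longlonglongrightarrow> l" if "z \<in> C m" for z
      using r(2)[of "(m, z)"] that by (simp add: S_def)
    then obtain l where l: "\<And>z. z \<in> C m \<Longrightarrow> (\<lambda>k. F (r k) (m, z)) \<longlonglongrightarrow> l z" by metis
    have "(\<lambda>k. (\<Sum>z\<in>C m. (F (r k) (m, z) - l z)\<^sup>2) / ?s ^ ?n) \<longlonglongrightarrow> (\<Sum>z\<in>C m. (l z - l z)\<^sup>2) / ?s ^ ?n"
      by (rule tendsto_divide[OF tendsto_sum[OF tendsto_power[OF tendsto_diff[OF l tendsto_const]]] tendsto_const])
         (use s in auto)
    then have "\<forall>\<^sub>F k in sequentially. (\<Sum>z\<in>C m. (F (r k) (m, z) - l z)\<^sup>2) / ?s ^ ?n < e / 8"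
      using e by (intro order_tendstoD) auto
    then obtain N where N: "\<And>k. k \<ge> N \<Longrightarrow> (\<Sum>z\<in>C m. (F (r k) (m, z) - l z)\<^sup>2) / ?s ^ ?n < e / 8"
      by (auto simp: eventually_sequentially)
    have "ip (\<lambda>x. f (r i) x - f (r j) x) (\<lambda>x. f (r i) x - f (r j) x) < e" if ij: "i \<ge> N" "j \<ge> N" for i j
    proof -
      have sub: "cube z ?s \<subseteq> Q" if "z \<in> C m" for z using C[of m] that by (simp add: P_def)
      have Fd: "(\<integral>x. f (r i) x - f (r j) x \<partial>lebesgue_on (cube z ?s)) = F (r i) (m, z) - F (r j) (m, z)" if "z \<in> C m" for z
      proof -
        have "integrable (lebesgue_on (cube z ?s)) (f k)" for k
          by (rule sqint_integrable[OF finite_measure_cube sqint_subset[OF cube_borel _ sub[OF that] h1D(1)[OF h, unfolded M_def]]])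
             (simp add: Q_def)
        then show ?thesis by (simp add: F_def)
      qed
      have "ip (\<lambda>x. f (r i) x - f (r j) x) (\<lambda>x. f (r i) x - f (r j) x)
        \<le> (\<Sum>z\<in>C m. (\<integral>x. f (r i) x - f (r j) x \<partial>lebesgue_on (cube z ?s))\<^sup>2) / ?s ^ ?n
         + real ?n / 4 * ?s\<^sup>2 * (\<Sum>a\<in>UNIV. \<integral>x. ((g (r i) x - g (r j) x) $ a)\<^sup>2 \<partial>M)"
        using C[of m] h1pair_diff[OF h h, of "r i" "r j"] unfolding ip_square P_def by blast
      also have "real ?n / 4 * ?s\<^sup>2 * (\<Sum>a\<in>UNIV. \<integral>x. ((g (r i) x - g (r j) x) $ a)\<^sup>2 \<partial>M)
         \<le> real ?n / 4 * ?s\<^sup>2 * (4 * B / \<alpha>)"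
        by (rule mult_left_mono[OF grad_bd]) simp
      also have "\<dots> < e / 2" by (rule m)
      also have "(\<Sum>z\<in>C m. (\<integral>x. f (r i) x - f (r j) x \<partial>lebesgue_on (cube z ?s))\<^sup>2) / ?s ^ ?n
         \<le> (\<Sum>z\<in>C m. 2 * (F (r i) (m, z) - l z)\<^sup>2 + 2 * (F (r j) (m, z) - l z)\<^sup>2) / ?s ^ ?n"
      proof (intro divide_right_mono sum_mono)
        fix z assume z: "z \<in> C m"
        show "(\<integral>x. f (r i) x - f (r j) x \<partial>lebesgue_on (cube z ?s))\<^sup>2 \<le> 2 * (F (r i) (m, z) - l z)\<^sup>2 + 2 * (F (r j) (m, z) - l z)\<^sup>2"
          unfolding Fd[OF z] using diff_square_le[of "F (r i) (m, z) - l z" "F (r j) (m, z) - l z"] by simp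
      qed (use s in simp)
      also have "\<dots> = 2 * ((\<Sum>z\<in>C m. (F (r i) (m, z) - l z)\<^sup>2) / ?s ^ ?n) + 2 * ((\<Sum>z\<in>C m. (F (r j) (m, z) - l z)\<^sup>2) / ?s ^ ?n)"
        by (simp only: sum.distrib sum_distrib_left[symmetric] add_divide_distrib times_divide_eq_right)
      also have "\<dots> < e / 2"
      proof -
        have "X < e / 8 \<Longrightarrow> Y < e / 8 \<Longrightarrow> 2 * X + 2 * Y < e / 2" for X Y :: real by linarith
        then show ?thesis using N[OF ij(1)] N[OF ij(2)] by blast
      qed
      finally show ?thesis by simp
    qed
    then show ?thesis by blast
  qed
  then show ?thesis using r(1) by blast
qed

lemma spectral: "spectral_form (H1 Q) ip (energy_ip A Q)"
  by (intro spectral_form.intro spectral_form_axioms.intro psd_ip psd_energy Rellich H1_complete)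

end

section \<open>The Caccioppoli inequality\<close>

lemma coeff_matrix_subset:
  assumes "coeff_matrix S A \<alpha> \<beta>" "T \<subseteq> S"
  shows "coeff_matrix T A \<alpha> \<beta>"
  using assms lebesgue_on_subset_measurable[OF assms(2), of A] unfolding coeff_matrix_def by blast

context coeff_cube
begin

lemma coeff_cube_subset: "0 < s \<Longrightarrow> s \<le> L \<Longrightarrow> coeff_cube c s A \<alpha> \<beta>"
  using coeff_matrix_subset[OF coeff cube_mono] by unfold_locales auto

lemma form_component: "sqvec g \<Longrightarrow> sqint M (\<lambda>x. (A x *v g x) $ i)"
  unfolding matrix_vector_mult_def vec_lambda_beta
  by (intro sqint_sum sqint_mult_bounded[of _ _ _ \<beta>] A_entry_meas)
     (auto simp: sqvec_def A_entry_bound)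

lemma ef_tendsto_right:
  assumes g: "sqvec g" and h: "\<And>i. L2lim M (\<lambda>k x. h k x $ i) (\<lambda>x. h' x $ i)"
  shows "(\<lambda>k. ef g (h k)) \<longlonglongrightarrow> ef g h'"
proof -
  have e: "ef g f = (\<Sum>i\<in>UNIV. \<integral>x. (A x *v g x) $ i * f x $ i \<partial>M)" if "sqvec f" for f
    unfolding ef_def inner_vec_def inner_real_def
    by (rule Bochner_Integration.integral_sum)
       (use that form_component[OF g] in \<open>auto simp: sqvec_def intro: sqint_mult_integrable\<close>)
  have "sqvec (h k)" "sqvec h'" for k using L2limD(1,2)[OF h] by (auto simp: sqvec_def)
  then show ?thesis
    by (simp only: e) (intro tendsto_sum L2lim_integral_mult L2lim_const form_component g h)
qed

lemma open_Q: "open Q" and Q_borel: "Q \<in> sets borel" and Q_lebesgue: "Q \<in> sets lebesgue"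
  by (auto simp: Q_def)

lemma A_harmonic_iff:
  assumes "h1pair Q f g"
  shows "A_harmonic A Q f \<longleftrightarrow> (\<forall>\<phi>. test_fun Q \<phi> \<longrightarrow> ef g (clgrad \<phi>) = 0)"
proof -
  have "(\<integral>x. (A x *v grad Q f x) \<bullet> clgrad \<phi> x \<partial>lebesgue_on Q) = ef g (clgrad \<phi>)" if t: "test_fun Q \<phi>" for \<phi>
  proof -
    have v: "sqvec (clgrad \<phi>)" using test_fun_sqint[OF test_fun_clgrad[OF t] Q_lebesgue] by (simp add: sqvec_def M_def)
    have "ef (grad Q f) (clgrad \<phi>) = ef g (clgrad \<phi>)"
    proof (rule ef_cong_AE[OF h1D(2)[OF h1pair_grad[OF h1pair_H1[OF assms]]] v h1D(2)[OF assms] v])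
      show "AE x in M. grad Q f x = g x" using grad_AE_eq[OF L] assms unfolding M_def Q_def by blast
    qed simp
    then show ?thesis by (simp add: ef_def M_def)
  qed
  then show ?thesis using h1pair_H1[OF assms] by (auto simp: A_harmonic_def)
qed

lemma A_harmonic_lincomb:
  assumes "A_harmonic A Q f" "A_harmonic A Q f'"
  shows "A_harmonic A Q (\<lambda>x. a * f x + b * f' x)"
proof -
  have h: "h1pair Q f (grad Q f)" "h1pair Q f' (grad Q f')" using assms by (auto simp: A_harmonic_def intro: h1pair_grad)
  have z: "ef (grad Q f) (clgrad \<phi>) = 0" "ef (grad Q f') (clgrad \<phi>) = 0" if "test_fun Q \<phi>" for \<phi>
    using assms that A_harmonic_iff[OF h(1)] A_harmonic_iff[OF h(2)] by auto
  have "ef (\<lambda>x. a *\<^sub>R grad Q f x + b *\<^sub>R grad Q f' x) (clgrad \<phi>) = 0" if t: "test_fun Q \<phi>" for \<phi>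
  proof -
    have v: "sqvec (clgrad \<phi>)" using test_fun_sqint[OF test_fun_clgrad[OF t] Q_lebesgue] by (simp add: sqvec_def M_def)
    show ?thesis using ef_lin[OF h1D(2)[OF h(1)] h1D(2)[OF h(2)] v] z[OF t] by simp
  qed
  then show ?thesis using A_harmonic_iff[OF h1pair_lincomb[OF h]] by blast
qed

lemma h1pair_const_Q: "h1pair Q (\<lambda>x. a) (\<lambda>x. 0)"
  using h1pair_const[of c L a] by (simp add: Q_def)

lemma ef_zero: "ef (\<lambda>x. 0) h = 0"
  by (simp add: ef_def)

lemma A_harmonic_const: "A_harmonic A Q (\<lambda>x. a)"
  using A_harmonic_iff[OF h1pair_const_Q] by (simp add: ef_zero)

lemma A_harmonic_sum:
  fixes w :: "nat \<Rightarrow> real^'d \<Rightarrow> real"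
  assumes "\<And>i. i < n \<Longrightarrow> A_harmonic A Q (w i)"
  shows "A_harmonic A Q (\<lambda>x. \<Sum>i<n. k i * w i x)"
  using assms
proof (induction n)
  case 0
  then show ?case using A_harmonic_const[of 0] by simp
next
  case (Suc n)
  have "A_harmonic A Q (\<lambda>x. 1 * (\<Sum>i<n. k i * w i x) + k n * w n x)"
    by (intro A_harmonic_lincomb Suc) auto
  then show ?case by simp
qed

text \<open>The equation extends from test functions to their limits because it only involves
  gradients, which converge in L2. This is how the common boundary values of an eigenfunction and
  its harmonic extension are exploited.\<close>

lemma energy_harmonic_H01:
  assumes f: "A_harmonic A Q f" and z: "H01 Q z"
  shows "energy_ip A Q f z = 0"
proof -
  have hf: "h1pair Q f (grad Q f)" using f by (auto simp: A_harmonic_def intro: h1pair_grad)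
  have hz: "h1pair Q z (grad Q z)" using z by (auto simp: H01_def intro: h1pair_grad)
  obtain \<phi> where \<phi>: "\<And>k. test_fun Q (\<phi> k)"
    "(\<lambda>k. \<integral>x. (\<phi> k x - z x)\<^sup>2 + (norm (clgrad (\<phi> k) x - grad Q z x))\<^sup>2 \<partial>M) \<longlonglongrightarrow> 0"
    using z unfolding H01_def M_def by blast
  have vz: "sqvec (grad Q z)" by (rule h1D(2)[OF hz])
  have v: "sqvec (clgrad (\<phi> k))" for k
    using test_fun_sqint[OF test_fun_clgrad[OF \<phi>(1)] Q_lebesgue] by (simp add: sqvec_def M_def)
  have sd: "sqint M (\<lambda>x. \<phi> k x - z x)" for k
    using test_fun_sqint[OF \<phi>(1) Q_lebesgue] h1D(1)[OF hz] by (auto simp: M_def intro: sqint_diff)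
  have lim: "L2lim M (\<lambda>k x. clgrad (\<phi> k) x $ i) (\<lambda>x. grad Q z x $ i)" for i
    unfolding L2lim_def
  proof (intro conjI allI)
    show "sqint M (\<lambda>x. clgrad (\<phi> k) x $ i)" "sqint M (\<lambda>x. grad Q z x $ i)" for k
      using v vz by (auto simp: sqvec_def)
    show "(\<lambda>k. \<integral>x. (clgrad (\<phi> k) x $ i - grad Q z x $ i)\<^sup>2 \<partial>M) \<longlonglongrightarrow> 0"
    proof (rule tendsto_sandwich[OF _ _ tendsto_const \<phi>(2)])
      show "\<forall>\<^sub>F k in sequentially. (\<integral>x. (clgrad (\<phi> k) x $ i - grad Q z x $ i)\<^sup>2 \<partial>M)
         \<le> (\<integral>x. (\<phi> k x - z x)\<^sup>2 + (norm (clgrad (\<phi> k) x - grad Q z x))\<^sup>2 \<partial>M)"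
      proof (intro always_eventually allI integral_mono)
        fix k
        note d = sqvec_diff[OF v[of k] vz]
        show "integrable M (\<lambda>x. (clgrad (\<phi> k) x $ i - grad Q z x $ i)\<^sup>2)"
          using d by (auto simp: sqvec_def sqint_def)
        show "integrable M (\<lambda>x. (\<phi> k x - z x)\<^sup>2 + (norm (clgrad (\<phi> k) x - grad Q z x))\<^sup>2)"
          using sqvec_norm2[OF d] sqintD(2)[OF sd] by auto
        fix x
        have "\<bar>(clgrad (\<phi> k) x - grad Q z x) $ i\<bar>\<^sup>2 \<le> (norm (clgrad (\<phi> k) x - grad Q z x))\<^sup>2"
          by (intro power_mono component_le_norm_cart) simp
        moreover have "0 \<le> (\<phi> k x - z x)\<^sup>2" by simp
        ultimately show "(clgrad (\<phi> k) x $ i - grad Q z x $ i)\<^sup>2 \<le> (\<phi> k x - z x)\<^sup>2 + (norm (clgrad (\<phi> k) x - grad Q z x))\<^sup>2"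
          by (simp only: power2_abs vector_minus_component)
      qed
    qed (auto intro!: always_eventually)
  qed
  have "ef (grad Q f) (clgrad (\<phi> k)) = 0" for k
    using f A_harmonic_iff[OF hf] \<phi>(1) by blast
  then have "ef (grad Q f) (grad Q z) = 0"
    using ef_tendsto_right[OF h1D(2)[OF hf] lim] by (simp add: LIMSEQ_const_iff)
  then show ?thesis by (simp add: energy_ip_pair[OF hf hz])
qed

text \<open>For \<open>A\<close>-harmonic \<open>f\<close> the mixed terms cancel and
  \<open>\<parallel>\<eta> f\<parallel>\<^sup>2 = \<integral> f\<^sup>2 A \<nabla>\<eta> \<cdot> \<nabla>\<eta>\<close> in the energy norm, which makes the constant of the Caccioppoli inequality 1.\<close>

lemma Caccioppoli_cutoff:
  assumes f: "A_harmonic A Q f" and \<eta>: "test_fun Q \<eta>" and B: "\<And>x. norm (clgrad \<eta> x) \<le> B"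
    and s: "0 < s" "s \<le> L" and one: "\<And>x. x \<in> cube c s \<Longrightarrow> \<eta> x = 1"
  shows "energy_ip A (cube c s) f f \<le> B\<^sup>2 * \<beta> * (\<integral>x. (f x)\<^sup>2 \<partial>M)"
proof -
  define g where "g = grad Q f"
  have hf: "h1pair Q f g" using f by (auto simp: A_harmonic_def g_def intro: h1pair_grad)
  have sm: "smooth_fun \<eta>" by (rule test_funD(1)[OF \<eta>])
  have B0: "B \<ge> 0" using B[of undefined] norm_ge_zero order_trans by blast
  \<comment> \<open>The function to test with is eta^2 f; the square lets its gradient be expressed
    through the two fields \<open>p\<close> and \<open>q\<close> below.\<close>
  define \<eta>2 where "\<eta>2 x = \<eta> x * \<eta> x" for x
  have t2: "test_fun Q \<eta>2" unfolding \<eta>2_def by (rule test_fun_mult_smooth[OF \<eta> sm])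
  have g2: "clgrad \<eta>2 x = (2 * \<eta> x) *\<^sub>R clgrad \<eta> x" for x
    unfolding \<eta>2_def clgrad_mult[OF sm sm] by (simp add: scaleR_2[symmetric])
  define p q where "p x = \<eta> x *\<^sub>R g x" and "q x = f x *\<^sub>R clgrad \<eta> x" for x
  obtain E where E: "\<And>x. \<bar>\<eta> x\<bar> \<le> E" using test_fun_bounded[OF \<eta>] by metis
  have vg: "sqvec g" by (rule h1D(2)[OF hf])
  have vp: "sqvec p" unfolding p_def
    by (rule sqvec_scale[OF vg _ E]) (simp add: M_def borel_measurable_lebesgue_on smooth_fun_measurable[OF sm])
  have vq: "sqvec q" unfolding q_def sqvec_def
  proof
    fix i
    have "sqint M (\<lambda>x. clgrad \<eta> x $ i * f x)"
    proof (rule sqint_mult_bounded[OF h1D(1)[OF hf]])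
      show "(\<lambda>x. clgrad \<eta> x $ i) \<in> borel_measurable M"
        unfolding M_def by (intro borel_measurable_lebesgue_on smooth_fun_measurable clgrad_smooth sm)
      show "\<bar>clgrad \<eta> x $ i\<bar> \<le> B" for x using component_le_norm_cart B order_trans by blast
    qed
    then show "sqint M (\<lambda>x. (f x *\<^sub>R clgrad \<eta> x) $ i)" by (simp add: mult.commute)
  qed
  \<comment> \<open>Since f need not be smooth, eta^2 f is replaced by test functions whose
    gradients converge to its gradient \<open>G\<close>.\<close>
  obtain \<phi> where \<phi>: "\<forall>k. test_fun Q (\<phi> k)" "\<forall>i. L2lim M (\<lambda>k x. clgrad (\<phi> k) x $ i) (\<lambda>x. \<eta>2 x * g x $ i + f x * clgrad \<eta>2 x $ i)"
    using mollified_cutoff[OF open_Q hf t2] unfolding M_def by blast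
  define G where "G x = \<eta>2 x *\<^sub>R g x + f x *\<^sub>R clgrad \<eta>2 x" for x
  have "ef g (clgrad (\<phi> k)) = 0" for k using f A_harmonic_iff[OF hf] \<phi>(1) by blast
  moreover have "(\<lambda>k. ef g (clgrad (\<phi> k))) \<longlonglongrightarrow> ef g G"
    by (rule ef_tendsto_right[OF vg]) (use \<phi>(2) in \<open>simp add: G_def\<close>)
  ultimately have gG: "ef g G = 0" by (simp add: LIMSEQ_const_iff)
  \<comment> \<open>Testing yields \<open>ef p p + 2 * ef p q = 0\<close>. Completing the square,
    the energy of p + q, the gradient of eta f, equals that of q alone.\<close>
  have "(A x *v g x) \<bullet> G x = (A x *v p x) \<bullet> p x + 2 * ((A x *v p x) \<bullet> q x)" for x
    by (simp add: G_def p_def q_def g2 \<eta>2_def matrix_vector_mult_scaleR inner_add_right mult_ac)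
  then have pq: "ef p p + 2 * ef p q = 0"
    using gG integrable_form[OF vp vp] integrable_form[OF vp vq] by (simp add: ef_def)
  have vpq: "sqvec (\<lambda>x. p x + q x)" using sqvec_lin[OF vp vq, of 1 1] by simp
  have "ef (\<lambda>x. p x + q x) (\<lambda>x. p x + q x) = ef p p + 2 * ef p q + ef q q"
    using ef_lin[OF vp vq vpq, of 1 1] ef_lin[OF vp vq vp, of 1 1] ef_lin[OF vp vq vq, of 1 1]
      ef_sym[of p "\<lambda>x. p x + q x"] ef_sym[of q "\<lambda>x. p x + q x"] ef_sym[of q p] by simp
  then have epq: "ef (\<lambda>x. p x + q x) (\<lambda>x. p x + q x) = ef q q" using pq by simp
  have sub: "cube c s \<subseteq> Q" unfolding Q_def by (rule cube_mono[OF s(2)])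
  have hs: "h1pair (cube c s) f g" by (rule h1pair_subset[OF open_cube open_Q sub hf])
  interpret small: coeff_cube c s A \<alpha> \<beta> by (rule coeff_cube_subset[OF s])
  have "small.Q = cube c s" by (simp add: small.Q_def)
  then have "energy_ip A (cube c s) f f = (\<integral>x. (A x *v g x) \<bullet> g x \<partial>lebesgue_on (cube c s))"
    using small.energy_ip_pair[of f g f g] hs by (simp add: small.ef_def small.M_def)
  also have "\<dots> = (\<integral>x. (A x *v (p x + q x)) \<bullet> (p x + q x) \<partial>lebesgue_on (cube c s))"
  proof (intro Bochner_Integration.integral_cong refl)
    fix x assume "x \<in> space (lebesgue_on (cube c s))"
    then have x: "x \<in> cube c s" by simp
    have "clgrad \<eta> x = 0" by (rule clgrad_locally_const[of "cube c s" \<eta> 1, OF open_cube one x])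
    then show "(A x *v g x) \<bullet> g x = (A x *v (p x + q x)) \<bullet> (p x + q x)"
      using one[OF x] by (simp add: p_def q_def)
  qed
  also have "\<dots> \<le> ef (\<lambda>x. p x + q x) (\<lambda>x. p x + q x)"
    unfolding ef_def M_def
  proof (rule integral_subset_le[OF cube_borel Q_borel sub integrable_form[OF vpq vpq, unfolded M_def]])
    fix x assume "x \<in> Q"
    then have "\<alpha> * (norm (p x + q x))\<^sup>2 \<le> (A x *v (p x + q x)) \<bullet> (p x + q x)" using A_low by (simp add: inner_commute)
    moreover have "0 \<le> \<alpha> * (norm (p x + q x))\<^sup>2" using bounds by simp
    ultimately show "0 \<le> (A x *v (p x + q x)) \<bullet> (p x + q x)" by linarith
  qed
  also have "\<dots> = ef q q" by (rule epq)
  also have "\<dots> \<le> \<beta> * (\<integral>x. (norm (q x))\<^sup>2 \<partial>M)" using ef_up[OF vq] sqvec_norm2[OF vq] by simp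
  also have "\<dots> \<le> \<beta> * (\<integral>x. B\<^sup>2 * (f x)\<^sup>2 \<partial>M)"
  proof (rule mult_left_mono[OF integral_mono])
    show "integrable M (\<lambda>x. (norm (q x))\<^sup>2)" using sqvec_norm2[OF vq] by simp
    show "integrable M (\<lambda>x. B\<^sup>2 * (f x)\<^sup>2)" using sqintD(2)[OF h1D(1)[OF hf]] by simp
    fix x
    have "(norm (q x))\<^sup>2 = (norm (clgrad \<eta> x))\<^sup>2 * (f x)\<^sup>2" by (simp add: q_def power_mult_distrib)
    also have "\<dots> \<le> B\<^sup>2 * (f x)\<^sup>2" using B by (intro mult_right_mono power_mono) auto
    finally show "(norm (q x))\<^sup>2 \<le> B\<^sup>2 * (f x)\<^sup>2" .
  qed (use bounds in simp)
  finally show ?thesis using bounds by (simp add: mult_ac)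
qed

text \<open>Cut-offs are constructed for slopes strictly above 2 / (L - s); the inequality is passed
  to the limit as the slope decreases to this value.\<close>

lemma Caccioppoli:
  assumes f: "A_harmonic A Q f" and s: "0 < s" "s < L"
  shows "energy_ip A (cube c s) f f \<le> (2 / (L - s))\<^sup>2 * \<beta> * (\<integral>x. (f x)\<^sup>2 \<partial>M)"
proof -
  have "energy_ip A (cube c s) f f \<le> B\<^sup>2 * \<beta> * (\<integral>x. (f x)\<^sup>2 \<partial>M)" if B: "B > 2 / (L - s)" for B
  proof -
    have BL: "B * (L - s) > 2" using B s by (simp add: field_simps)
    obtain \<eta> where \<eta>: "test_fun (cube c L) \<eta>" "\<And>x. x \<in> cube c s \<Longrightarrow> \<eta> x = 1"
        "\<And>x. 0 \<le> \<eta> x" "\<And>x. \<eta> x \<le> 1" "\<And>x. norm (clgrad \<eta> x) \<le> B"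
      by (rule cutoff_exists[of s L B c, OF less_imp_le[OF s(1)] s(2) BL], rule that)
    show ?thesis
      by (rule Caccioppoli_cutoff[OF f \<eta>(1)[folded Q_def] \<eta>(5) s(1) less_imp_le[OF s(2)] \<eta>(2)])
  qed
  then have ev: "\<forall>\<^sub>F B in at_right (2 / (L - s)). energy_ip A (cube c s) f f \<le> B\<^sup>2 * \<beta> * (\<integral>x. (f x)\<^sup>2 \<partial>M)"
    by (auto simp: eventually_at_filter)
  have "((\<lambda>B. B\<^sup>2 * \<beta> * (\<integral>x. (f x)\<^sup>2 \<partial>M)) \<longlongrightarrow> (2 / (L - s))\<^sup>2 * \<beta> * (\<integral>x. (f x)\<^sup>2 \<partial>M)) (at_right (2 / (L - s)))"
    by (intro tendsto_intros)
  then show ?thesis by (rule tendsto_lowerbound[OF _ ev]) simp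
qed

end

section \<open>The approximation theorem\<close>

context coeff_cube
begin

interpretation ipf: psd_form "H1 Q" ip by (rule psd_ip)
interpretation enf: psd_form "H1 Q" "energy_ip A Q" by (rule psd_energy)
interpretation spf: spectral_form "H1 Q" ip "energy_ip A Q" by (rule spectral)

lemma H1_const: "H1 Q (\<lambda>x. a)"
  by (rule h1pair_H1[OF h1pair_const_Q])

lemma energy_const: "H1 Q f \<Longrightarrow> energy_ip A Q (\<lambda>x. a) f = 0"
  using energy_ip_pair[OF h1pair_const_Q h1pair_grad] by (simp add: ef_zero)

lemma energy_nonneg: "H1 Q f \<Longrightarrow> 0 \<le> energy_ip A Q f f"
  by (rule enf.pos)

lemma energy_diff_const: "H1 Q f \<Longrightarrow> H1 Q g \<Longrightarrow> energy_ip A Q (\<lambda>x. f x - a) g = energy_ip A Q f g"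
  using enf.B_diff[OF _ H1_const] energy_const by simp

lemma measure_Q: "measure M Q = L ^ CARD('d)" "L ^ CARD('d) > 0"
  using measure_cube(2)[of L c] L by (simp_all add: M_def Q_def measure_restrict_space)

lemma ip_const: "ip f (\<lambda>x. 1) = (\<integral>x. f x \<partial>M)" "ip (\<lambda>x. 1) (\<lambda>x. 1) = L ^ CARD('d)"
  using measure_Q by (simp_all add: ip_def)

lemma neumann_eig_iff:
  "neumann_eig A Q v lam \<longleftrightarrow> H1 Q v \<and> (\<forall>w. H1 Q w \<longrightarrow> energy_ip A Q v w = lam * ip v w)"
  by (simp add: neumann_eig_def ip_def M_def)

text \<open>The Poincare inequality for v minus its average. It makes the eigenvalue of a
  nonconstant eigenfunction nonzero.\<close>

lemma zero_energy_constant: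
  assumes v: "H1 Q v" and E0: "energy_ip A Q v v = 0"
  shows "\<not> nonconstant Q v"
proof -
  define a where "a = (\<integral>x. v x \<partial>M) / L ^ CARD('d)"
  have hv: "H1 Q (\<lambda>x. v x - a)" by (rule ipf.H_diff[OF v H1_const])
  have "energy_ip A Q (\<lambda>x. v x - a) (\<lambda>x. v x - a) = energy_ip A Q v (\<lambda>x. v x - a)"
    by (rule energy_diff_const[OF v hv])
  also have "\<dots> = energy_ip A Q (\<lambda>x. v x - a) v" by (rule enf.sym[OF v hv])
  also have "\<dots> = 0" using energy_diff_const[OF v v] E0 by simp
  finally have E: "energy_ip A Q (\<lambda>x. v x - a) (\<lambda>x. v x - a) = 0" .
  let ?g = "grad Q (\<lambda>x. v x - a)"
  have h: "h1pair Q (\<lambda>x. v x - a) ?g" by (rule h1pair_grad[OF hv])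
  have iv: "integrable M v" by (rule sqint_integrable[OF finite_M h1D(1)[OF h1pair_grad[OF v]]])
  have ia: "integrable M (\<lambda>x. a)" by (rule finite_measure.integrable_const[OF finite_M])
  have "(\<integral>x. v x - a \<partial>M) = 0" using iv ia measure_Q L by (simp add: a_def)
  moreover have "(\<Sum>i\<in>UNIV. \<integral>x. (?g x $ i)\<^sup>2 \<partial>M) \<le> 0" using grad_le_energy[OF h] E by simp
  moreover have "0 \<le> (\<Sum>i\<in>UNIV. \<integral>x. (?g x $ i)\<^sup>2 \<partial>M)" by (intro sum_nonneg) simp
  ultimately have "L ^ CARD('d) * (\<integral>x. (v x - a)\<^sup>2 \<partial>M) \<le> 0"
    using Poincare_cube[OF L h[unfolded Q_def]] unfolding M_def Q_def by (simp add: power2_eq_square)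
  then have "(\<integral>x. (v x - a)\<^sup>2 \<partial>M) = 0"
    using measure_Q(2) by (simp add: mult_le_0_iff order_antisym)
  then have "AE x in M. (v x - a)\<^sup>2 = 0"
    using integral_nonneg_eq_0_iff_AE[OF sqintD(2)[OF h1D(1)[OF h]]] by simp
  then have "AE x in M. v x = a" by eventually_elim simp
  then show ?thesis unfolding nonconstant_def M_def by blast
qed

text \<open>The coefficients come from the projection in the energy of the large cube, where all
  orthogonality relations hold; the small cube enters only through the final Caccioppoli
  estimate.\<close>

lemma approximation_error:
  assumes u: "A_harmonic0 A Q u" and eigs: "first_nonconst_eigs A Q n v lam"
    and ext: "\<And>i. i < n \<Longrightarrow> harmonic_ext A Q (v i) (h i)"
    and m: "m > 0" "m ^ CARD('d) \<le> n + 1" and s: "0 < s" "s < L"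
  shows "\<exists>k. energy_ip A (cube c s) (\<lambda>x. u x - (\<Sum>i<n. k i * (h i x - avg Q (h i)))) (\<lambda>x. u x - (\<Sum>i<n. k i * (h i x - avg Q (h i))))
    \<le> (2 / (L - s))\<^sup>2 * \<beta> * (real CARD('d) / 4 * (L / real m)\<^sup>2 / \<alpha>) * energy_ip A Q u u"
proof -
  let ?en = "energy_ip A Q"
  define w where "w i x = h i x - avg Q (h i)" for i x
  have hH: "A_harmonic A Q (h i)" "H01 Q (\<lambda>x. h i x - v i x)" if "i < n" for i
    using ext[OF that] by (auto simp: harmonic_ext_def)
  have Hh: "H1 Q (h i)" if "i < n" for i using hH(1)[OF that] by (simp add: A_harmonic_def)
  have wA: "A_harmonic A Q (w i)" if "i < n" for i
    using A_harmonic_lincomb[OF hH(1)[OF that] A_harmonic_const[of "avg Q (h i)"], of 1 "-1"] by (simp add: w_def[abs_def])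
  have Hw: "H1 Q (w i)" if "i < n" for i using wA[OF that] by (simp add: A_harmonic_def)
  have uA: "A_harmonic A Q u" and u0: "(\<integral>x. u x \<partial>M) = 0" using u by (auto simp: A_harmonic0_def M_def)
  have Hu: "H1 Q u" using uA by (simp add: A_harmonic_def)
  have int: "integrable M f" if "H1 Q f" for f by (rule sqint_integrable[OF finite_M h1D(1)[OF h1pair_grad[OF that]]])
  have w0: "(\<integral>x. w i x \<partial>M) = 0" if "i < n" for i
  proof -
    have "avg Q (h i) = (\<integral>x. h i x \<partial>M) / L ^ CARD('d)"
      using measure_cube(2)[of L c] L by (simp add: avg_def M_def Q_def)
    moreover have "(\<integral>x. h i x - a \<partial>M) = (\<integral>x. h i x \<partial>M) - a * L ^ CARD('d)" for a
      using int[OF Hh[OF that]] finite_measure.integrable_const[OF finite_M, of a] measure_Q(1) by simp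
    ultimately show ?thesis using L by (simp add: w_def)
  qed
  obtain k where k: "\<forall>j<n. ?en (\<lambda>x. u x - (\<Sum>i<n. k i * w i x)) (w j) = 0"
    using enf.projection_exists[of n w u] Hw Hu by blast
  define e where "e x = u x - (\<Sum>i<n. k i * w i x)" for x
  let ?s = "\<lambda>x. \<Sum>i<n. k i * w i x"
  have Hs: "H1 Q ?s" using Hw by (intro ipf.H_sum) auto
  have He: "H1 Q e" unfolding e_def[abs_def] by (rule ipf.H_diff[OF Hu Hs])
  have eA: "A_harmonic A Q e"
    using A_harmonic_lincomb[OF uA A_harmonic_sum[where w=w and n=n and k=k, OF wA], of 1 "-1"] by (simp add: e_def[abs_def])
  have ew: "?en e (w j) = 0" if "j < n" for j using k that by (simp add: e_def[abs_def])
  have e0: "ip e (\<lambda>x. 1) = 0"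
    unfolding ip_const e_def using int[OF Hu] int[OF Hs] int[OF Hw] u0 w0 by (simp add: Bochner_Integration.integral_sum)
  have eu: "?en e e \<le> ?en u u"
  proof -
    have "?en e ?s = (\<Sum>i<n. k i * ?en (w i) e)"
      using enf.sym[OF He Hs] enf.B_sum[of "{..<n}" w e k] Hw He by simp
    also have "\<dots> = 0" using ew enf.sym[OF He Hw] by (intro sum.neutral) auto
    finally have es: "?en e ?s = 0" .
    have "u = (\<lambda>x. 1 * e x + 1 * ?s x)" by (auto simp: e_def)
    then have "?en u u = ?en e e + ?en ?s ?s"
      using enf.square_lin[OF He Hs, of 1 1] es by simp
    then show ?thesis using enf.pos[OF Hs] by simp
  qed
  have eig: "H1 Q (v i)" "\<And>f. H1 Q f \<Longrightarrow> ?en (v i) f = lam i * ip (v i) f" "nonconstant Q (v i)" if "i < n" for i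
    using eigs that by (auto simp: first_nonconst_eigs_def neumann_eig_iff)
  have orth: "ip (v i) (v j) = (if i = j then 1 else 0)" if "i < n" "j < n" for i j
    using eigs that by (simp add: first_nonconst_eigs_def ip_def M_def)
  \<comment> \<open>Division by the eigenvalue is used twice: it shows that \<open>v i\<close> has
    zero average, and it turns energy orthogonality of e to \<open>v i\<close> into L2
    orthogonality.\<close>
  have lam0: "lam i \<noteq> 0" if "i < n" for i
    using zero_energy_constant[OF eig(1)[OF that]] eig(2)[OF that eig(1)[OF that]] eig(3)[OF that] by auto
  have v1: "ip (v i) (\<lambda>x. 1) = 0" if "i < n" for i
    using eig(2)[OF that H1_const] enf.sym[OF eig(1)[OF that] H1_const] energy_const[OF eig(1)[OF that]] lam0[OF that] by simp
  have ev: "ip e (v i) = 0" if i: "i < n" for i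
  proof -
    have d: "H1 Q (\<lambda>x. h i x - v i x)" by (rule ipf.H_diff[OF Hh[OF i] eig(1)[OF i]])
    have "?en e (h i) = ?en (h i) e" by (rule enf.sym[OF He Hh[OF i]])
    also have "\<dots> = ?en (w i) e" using energy_diff_const[OF Hh[OF i] He] by (simp add: w_def[abs_def])
    also have "\<dots> = 0" using enf.sym[OF He Hw[OF i]] ew[OF i] by simp
    finally have "?en e (h i) = 0" .
    moreover have "?en e (\<lambda>x. h i x - v i x) = ?en e (h i) - ?en e (v i)"
      using enf.lin_right[OF Hh[OF i] eig(1)[OF i] He, of 1 "-1"] by simp
    moreover have "?en e (\<lambda>x. h i x - v i x) = 0" by (rule energy_harmonic_H01[OF eA hH(2)[OF i]])
    ultimately have "?en e (v i) = 0" by simp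
    then have "lam i * ip (v i) e = 0" using eig(2)[OF i He] enf.sym[OF He eig(1)[OF i]] by simp
    then show ?thesis using lam0[OF i] ipf.sym[OF He eig(1)[OF i]] by simp
  qed
  \<comment> \<open>The constant 1 is adjoined as the eigenfunction with eigenvalue 0, which raises
    the count from n to n + 1.\<close>
  define q where "q i = (case i of 0 \<Rightarrow> (\<lambda>x. 1) | Suc j \<Rightarrow> v j)" for i
  define mu where "mu i = (case i of 0 \<Rightarrow> 0 | Suc j \<Rightarrow> lam j)" for i
  have q: "H1 Q (q i)" if "i < n + 1" for i using that eig(1) H1_const by (cases i) (auto simp: q_def)
  have qeig: "?en (q i) f = mu i * ip (q i) f" if "i < n + 1" "H1 Q f" for i f
    using that eig(2) energy_const by (cases i) (auto simp: q_def mu_def)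
  have qpos: "ip (q i) (q i) > 0" if "i < n + 1" for i
    using that orth ip_const(2) measure_Q(2) by (cases i) (auto simp: q_def)
  have qorth: "ip (q i) (q j) = 0" if ij: "i < n + 1" "j < n + 1" "i \<noteq> j" for i j
    using ij orth v1 ipf.sym[OF H1_const eig(1)] by (cases i; cases j) (auto simp: q_def)
  have eq0: "ip e (q i) = 0" if "i < n + 1" for i using that e0 ev by (cases i) (auto simp: q_def)
  have Ray: "lam i * ip e e \<le> ?en e e" if i: "i < n" for i
  proof (rule spf.Rayleigh_lower_bound[where N="n + 1", OF q qeig _ He eq0])
    fix f \<mu>
    assume f: "H1 Q f" "\<And>z. H1 Q z \<Longrightarrow> ?en f z = \<mu> * ip f z" "ip f f = 1"
      "\<And>i. i < n + 1 \<Longrightarrow> ip f (q i) = 0"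
    have f1: "ip f (\<lambda>x. 1) = 0" using f(4)[of 0] by (simp add: q_def)
    have fv: "ip f (v j) = 0" if "j < n" for j using f(4)[of "Suc j"] that by (simp add: q_def)
    \<comment> \<open>The minimality in \<open>first_nonconst_eigs\<close> concerns nonconstant
      competitors. Orthogonality to \<open>q 0\<close> gives f zero average, and a constant with
      zero average contradicts norm 1.\<close>
    have "nonconstant Q f"
      unfolding nonconstant_def
    proof
      assume "\<exists>a. AE x in lebesgue_on Q. f x = a"
      then obtain a where a: "AE x in M. f x = a" unfolding M_def by blast
      have mf: "f \<in> borel_measurable M" using h1D(1)[OF h1pair_grad[OF f(1)]] by auto
      have "(\<integral>x. f x \<partial>M) = (\<integral>x. a \<partial>M)" by (rule integral_cong_AE) (use a mf in auto)
      then have "a = 0" using f1 measure_Q L by (simp add: ip_const)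
      then have "AE x in M. f x * f x = 0" using a by auto
      then have "ip f f = (\<integral>x. 0 \<partial>M)" unfolding ip_def by (intro integral_cong_AE) (use mf in auto)
      then show False using f(3) by simp
    qed
    moreover have "neumann_eig A Q f \<mu>" using f(1,2) by (simp add: neumann_eig_iff)
    moreover have "\<forall>j<n. (\<integral>x. f x * v j x \<partial>lebesgue_on Q) = 0" using fv by (simp add: ip_def M_def)
    ultimately show "lam i \<le> \<mu>" using eigs i unfolding first_nonconst_eigs_def by blast
  qed
  obtain C where C: "finite C" "card C \<le> m ^ CARD('d)"
    "\<And>z. z \<in> C \<Longrightarrow> cube z (L / real m) \<subseteq> Q"
    "\<And>f g. h1pair Q f g \<Longrightarrow>
       (\<integral>x. (f x)\<^sup>2 \<partial>M) \<le> (\<Sum>z\<in>C. (\<integral>x. f x \<partial>lebesgue_on (cube z (L / real m)))\<^sup>2) / (L / real m) ^ CARD('d)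
         + real CARD('d) / 4 * (L / real m)\<^sup>2 * (\<Sum>i\<in>UNIV. \<integral>x. (g x $ i)\<^sup>2 \<partial>M)"
    using Poincare_subcubes[OF L m(1), of c] unfolding M_def Q_def by blast
  define \<kappa> where "\<kappa> = real CARD('d) / 4 * (L / real m)\<^sup>2 / \<alpha>"
  have \<kappa>0: "\<kappa> \<ge> 0" using bounds by (simp add: \<kappa>_def)
  have "ip e e \<le> \<kappa> * ?en e e"
  \<comment> \<open>The functionals are the integrals over the cells, and \<open>\<kappa>\<close> is
    the Poincare constant of a cell divided by the ellipticity bound \<alpha>.\<close>
  proof (rule spf.Rayleigh_dimension_count[where N="n + 1", OF q qeig qpos qorth He eq0 _ C(1) _ _ \<kappa>0])
    show "mu i * ip e e \<le> ?en e e" if "i < n + 1" for i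
      using that Ray enf.pos[OF He] by (cases i) (auto simp: mu_def)
    show "card C \<le> n + 1" using C(2) m(2) by simp
    show "(\<integral>x. a * f x + b * g x \<partial>lebesgue_on (cube z (L / real m)))
       = a * (\<integral>x. f x \<partial>lebesgue_on (cube z (L / real m))) + b * (\<integral>x. g x \<partial>lebesgue_on (cube z (L / real m)))"
      if z: "z \<in> C" and fg: "H1 Q f" "H1 Q g" for z f g a b
    proof -
      have "integrable (lebesgue_on (cube z (L / real m))) f" if "H1 Q f" for f
        by (rule lebesgue_on_subset_integrable[OF cube_borel Q_borel C(3)[OF z] int[OF that, unfolded M_def]])
      then show ?thesis using fg by simp
    qed
    fix z assume z: "H1 Q z" "\<And>x. x \<in> C \<Longrightarrow> (\<integral>y. z y \<partial>lebesgue_on (cube x (L / real m))) = 0"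
    have "ip z z \<le> real CARD('d) / 4 * (L / real m)\<^sup>2 * (\<Sum>i\<in>UNIV. \<integral>x. (grad Q z x $ i)\<^sup>2 \<partial>M)"
      using C(4)[OF h1pair_grad[OF z(1)]] z(2) by (simp add: ip_square)
    also have "\<dots> \<le> real CARD('d) / 4 * (L / real m)\<^sup>2 * (?en z z / \<alpha>)"
      by (rule mult_left_mono[OF grad_le_energy[OF h1pair_grad[OF z(1)]]]) simp
    finally show "ip z z \<le> \<kappa> * ?en z z" by (simp add: \<kappa>_def)
  qed
  also have "\<dots> \<le> \<kappa> * ?en u u" by (rule mult_left_mono[OF eu \<kappa>0])
  finally have ipe: "ip e e \<le> \<kappa> * ?en u u" .
  have "energy_ip A (cube c s) e e \<le> (2 / (L - s))\<^sup>2 * \<beta> * ip e e"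
    using Caccioppoli[OF eA s] by (simp add: ip_square)
  also have "\<dots> \<le> (2 / (L - s))\<^sup>2 * \<beta> * (\<kappa> * ?en u u)"
    using bounds by (intro mult_left_mono[OF ipe]) simp
  finally have "energy_ip A (cube c s) e e \<le> (2 / (L - s))\<^sup>2 * \<beta> * \<kappa> * ?en u u" by (simp add: mult.assoc)
  then show ?thesis unfolding e_def[abs_def] w_def[abs_def] \<kappa>_def by blast
qed

end

text \<open>The error of the projection is orthogonal to the span, so changing the coefficients adds
  a nonnegative square. The minimum is thus attained even when the vectors are dependent or the form
  degenerates on them.\<close>

lemma (in psd_form) best_approximation:
  fixes w :: "nat \<Rightarrow> 'a \<Rightarrow> real"
  assumes w: "\<And>i. i < n \<Longrightarrow> H (w i)" and u: "H u"
  obtains k where "\<And>k'. B (\<lambda>x. u x - (\<Sum>i<n. k i * w i x)) (\<lambda>x. u x - (\<Sum>i<n. k i * w i x))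
    \<le> B (\<lambda>x. u x - (\<Sum>i<n. k' i * w i x)) (\<lambda>x. u x - (\<Sum>i<n. k' i * w i x))"
proof -
  obtain k where k: "\<forall>j<n. B (\<lambda>x. u x - (\<Sum>i<n. k i * w i x)) (w j) = 0"
    using projection_exists[of n w u] w u by blast
  define e where "e x = u x - (\<Sum>i<n. k i * w i x)" for x
  have Hs: "H (\<lambda>x. \<Sum>i<n. k' i * w i x)" for k' using w by (intro H_sum) auto
  have He: "H e" unfolding e_def[abs_def] by (rule H_diff[OF u Hs])
  show thesis
  proof (rule that[of k])
    fix k'
    let ?d = "\<lambda>x. \<Sum>i<n. (k i - k' i) * w i x"
    have "B e ?d = (\<Sum>i<n. (k i - k' i) * B (w i) e)"
      using sym[OF He Hs] B_sum[of "{..<n}" w e "\<lambda>i. k i - k' i"] w He by simp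
    also have "\<dots> = 0" using k sym[OF He w] by (intro sum.neutral) (auto simp: e_def[abs_def])
    finally have "B e ?d = 0" .
    moreover have "(\<lambda>x. u x - (\<Sum>i<n. k' i * w i x)) = (\<lambda>x. 1 * e x + 1 * ?d x)"
      by (auto simp: e_def left_diff_distrib sum_subtractf)
    ultimately have "B (\<lambda>x. u x - (\<Sum>i<n. k' i * w i x)) (\<lambda>x. u x - (\<Sum>i<n. k' i * w i x)) = B e e + B ?d ?d"
      using square_lin[OF He Hs, of 1 1] by simp
    then show "B (\<lambda>x. u x - (\<Sum>i<n. k i * w i x)) (\<lambda>x. u x - (\<Sum>i<n. k i * w i x))
      \<le> B (\<lambda>x. u x - (\<Sum>i<n. k' i * w i x)) (\<lambda>x. u x - (\<Sum>i<n. k' i * w i x))"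
      using pos[OF Hs] by (simp add: e_def[abs_def])
  qed
qed

section \<open>The constants\<close>

text \<open>\<open>m n\<close> falls short of (n + 1)^(1/d) by less than 1. Since \<kappa> < 1, this
  loss is absorbed once x = n^(1/d) satisfies x (1 - \<kappa>) >= 1; from then on \<open>C n\<close>
  is exactly n^(-1/d), and the maximum takes care of the finitely many earlier n.\<close>

lemma powr_sequence_constant:
  fixes \<kappa> :: real and d :: nat
  assumes d: "d > 0" and \<kappa>: "0 \<le> \<kappa>" "\<kappa> < 1"
  defines "m n \<equiv> nat \<lfloor>real (n + 1) powr (1 / real d)\<rfloor>"
  defines "C n \<equiv> max (real n powr (- 1 / real d)) (\<kappa> / real (m n))"
  shows "m n > 0" "m n ^ d \<le> n + 1" "(\<lambda>n. C n / (real n powr (- 1 / real d))) \<longlonglongrightarrow> 1"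
proof -
  have p1: "real (n + 1) powr (1 / real d) \<ge> 1" for n by (rule ge_one_powr_ge_zero) auto
  have mr: "real (m n) = of_int \<lfloor>real (n + 1) powr (1 / real d)\<rfloor>" for n using p1[of n] by (simp add: m_def)
  have mle: "real (m n) \<le> real (n + 1) powr (1 / real d)" "real (m n) > real (n + 1) powr (1 / real d) - 1" for n
    unfolding mr by linarith+
  show m0: "m n > 0" for n using mle(2)[of n] p1[of n] by linarith
  have "real (m n) ^ d \<le> (real (n + 1) powr (1 / real d)) ^ d" by (rule power_mono[OF mle(1)]) simp
  also have "\<dots> = real (n + 1)" using d by (simp add: powr_realpow[symmetric] powr_powr)
  finally show "m n ^ d \<le> n + 1" by (metis of_nat_le_iff of_nat_power)
  have "\<forall>\<^sub>F n in sequentially. C n / (real n powr (- 1 / real d)) = 1"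
  proof -
    have "filterlim (\<lambda>n. real n powr (1 / real d)) at_top sequentially"
      using d by (intro filterlim_compose[OF real_powr_at_top filterlim_real_sequentially]) auto
    then have "\<forall>\<^sub>F n in sequentially. real n powr (1 / real d) \<ge> 1 / (1 - \<kappa>)"
      by (simp add: filterlim_at_top)
    then show ?thesis
      using eventually_gt_at_top[of 0]
    proof eventually_elim
      case (elim n)
      define x where "x = real n powr (1 / real d)"
      have x: "x > 0" using elim by (simp add: x_def)
      have xi: "real n powr (- 1 / real d) = 1 / x" using elim by (simp add: x_def powr_minus_divide)
      have "1 \<le> x * (1 - \<kappa>)" using elim \<kappa> by (simp add: x_def field_simps)
      moreover have "x \<le> real (n + 1) powr (1 / real d)" unfolding x_def by (rule powr_mono2) auto
      ultimately have "\<kappa> * x \<le> real (m n)" using mle(2)[of n] by (simp add: algebra_simps)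
      then have "\<kappa> / real (m n) \<le> 1 / x" using x m0[of n] by (simp add: field_simps)
      then have "C n = 1 / x" by (simp only: C_def xi max_absorb1)
      then show ?case using x by (simp only: xi) simp
    qed
  qed
  then show "(\<lambda>n. C n / (real n powr (- 1 / real d))) \<longlonglongrightarrow> 1"
    by (rule tendsto_eventually)
qed

text \<open>For d = 2 the ratio is sqrt 2 / 2. For d = 3 sixth powers clear all roots: (3 pi / 4)^3
  < (4 pi / 3)^2 means pi < 1024/243, which follows from pi < 4.\<close>

lemma unit_ball_constant:
  assumes "CARD('d::finite) \<in> {2, 3}"
  defines "\<gamma> \<equiv> measure lebesgue (ball (0 :: real^'d) 1) powr (1 / real CARD('d))"
  shows "\<gamma> > 0" "sqrt (real CARD('d)) / 2 * sqrt pi / \<gamma> < 1"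
proof -
  have g: "\<gamma> = unit_ball_vol (real CARD('d)) powr (1 / real CARD('d))"
    by (simp add: \<gamma>_def content_ball)
  consider "CARD('d) = 2" | "CARD('d) = 3" using assms(1) by auto
  then have "\<gamma> > 0 \<and> sqrt (real CARD('d)) / 2 * sqrt pi / \<gamma> < 1"
  proof cases
    case 1
    then have e: "\<gamma> = sqrt pi" by (simp add: g unit_ball_vol_2 powr_half_sqrt)
    have "sqrt 2 < (2::real)" by (rule real_less_lsqrt) auto
    then show ?thesis unfolding e 1 by simp
  next
    case 2
    then have e: "\<gamma> = (4 / 3 * pi) powr (1 / 3)" by (simp add: g unit_ball_vol_3)
    then have pos: "\<gamma> > 0" using pi_gt_zero by simp
    have e3: "\<gamma> ^ 3 = 4 / 3 * pi"
      unfolding e using powr_realpow[of "(4 / 3 * pi) powr (1 / 3)" 3] by (simp add: powr_powr)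
    have "(sqrt 3 / 2 * sqrt pi)\<^sup>2 = 3 / 4 * pi" by (simp add: power_mult_distrib power_divide)
    then have "((sqrt 3 / 2 * sqrt pi)\<^sup>2) ^ 3 = 27 / 64 * pi ^ 3" by (simp add: power_mult_distrib power_divide)
    then have "(sqrt 3 / 2 * sqrt pi) ^ 6 = 27 / 64 * pi ^ 3" by (simp only: power_mult[symmetric]) simp
    also have "\<dots> < (4 / 3 * pi) ^ 2"
    proof -
      have "27 / 64 * pi < 16 / 9" using pi_less_4 by simp
      then have "27 / 64 * pi * pi\<^sup>2 < 16 / 9 * pi\<^sup>2" by (intro mult_strict_right_mono) auto
      then show ?thesis by (simp add: power2_eq_square power3_eq_cube)
    qed
    also have "\<dots> = \<gamma> ^ 6" unfolding e3[symmetric] by (simp flip: power_mult)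
    finally have "sqrt 3 / 2 * sqrt pi < \<gamma>" by (rule power_less_imp_less_base) (use pos in simp)
    then show ?thesis using pos 2 by simp
  qed
  then show "\<gamma> > 0" "sqrt (real CARD('d)) / 2 * sqrt pi / \<gamma> < 1" by auto
qed

text \<open>The projection in the energy of the small cube attains the infimum. For the estimate it
  is compared with the projection in the energy of the large cube, whose error on the small cube is
  controlled.\<close>

theorem theorem3p4:
  assumes "CARD('d::finite) \<in> {2, 3}"
  shows "\<exists>C :: nat \<Rightarrow> real.
    (\<lambda>n. C n / (real n powr (- 1 / real CARD('d)))) \<longlonglongrightarrow> 1 \<and>
    (\<forall>(c :: real^'d) \<sigma> \<rho> A \<alpha> \<beta> u n v lam h.
       \<sigma> > 0 \<and> \<rho> > 0 \<and>
       coeff_matrix (cube c ((1 + \<rho>) * \<sigma>)) A \<alpha> \<beta> \<and>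
       A_harmonic0 A (cube c ((1 + \<rho>) * \<sigma>)) u \<and>
       first_nonconst_eigs A (cube c ((1 + \<rho>) * \<sigma>)) n v lam \<and>
       (\<forall>i<n. harmonic_ext A (cube c ((1 + \<rho>) * \<sigma>)) (v i) (h i))
       \<longrightarrow>
       (\<exists>vu \<in> Fn (cube c ((1 + \<rho>) * \<sigma>)) n h.
          energy_norm A (cube c \<sigma>) (\<lambda>x. u x - vu x)
            = (INF w \<in> Fn (cube c ((1 + \<rho>) * \<sigma>)) n h. energy_norm A (cube c \<sigma>) (\<lambda>x. u x - w x)) \<and>
          energy_norm A (cube c \<sigma>) (\<lambda>x. u x - vu x)
            \<le> 2 * (measure lebesgue (ball (0 :: real^'d) 1)) powr (1 / real CARD('d)) / sqrt pi
                * ((1 + \<rho>) / \<rho>) * sqrt (\<beta> / \<alpha>) * C n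
                * energy_norm A (cube c ((1 + \<rho>) * \<sigma>)) u))"
proof -
  define \<gamma> where "\<gamma> = measure lebesgue (ball (0 :: real^'d) 1) powr (1 / real CARD('d))"
  have \<gamma>: "\<gamma> > 0" "sqrt (real CARD('d)) / 2 * sqrt pi / \<gamma> < 1"
    using unit_ball_constant[OF assms] by (simp_all add: \<gamma>_def)
  \<comment> \<open>The ratio of the Poincare constant that is available, sqrt d / 2, to the
    constant \<gamma> / sqrt pi of the claim.\<close>
  define \<kappa> where "\<kappa> = sqrt (real CARD('d)) / 2 * sqrt pi / \<gamma>"
  have \<kappa>: "0 \<le> \<kappa>" "\<kappa> < 1" using \<gamma> by (simp_all add: \<kappa>_def)
  define m where "m n = nat \<lfloor>real (n + 1) powr (1 / real CARD('d))\<rfloor>" for n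
  define C where "C n = max (real n powr (- 1 / real CARD('d))) (\<kappa> / real (m n))" for n
  note seq = powr_sequence_constant[of "CARD('d)" \<kappa>, OF _ \<kappa>, folded m_def, folded C_def]
  have m: "m n > 0" "m n ^ CARD('d) \<le> n + 1" for n using seq by auto
  have lim: "(\<lambda>n. C n / (real n powr (- 1 / real CARD('d)))) \<longlonglongrightarrow> 1" using seq by auto
  show ?thesis
  proof (intro exI[of _ C] conjI lim allI impI)
    fix c :: "real^'d" and \<sigma> \<rho> :: real and A :: "real^'d \<Rightarrow> real^'d^'d" and \<alpha> \<beta> :: real
      and u :: "real^'d \<Rightarrow> real" and n :: nat and v :: "nat \<Rightarrow> real^'d \<Rightarrow> real" and lam :: "nat \<Rightarrow> real"
      and h :: "nat \<Rightarrow> real^'d \<Rightarrow> real"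
    assume asm: "\<sigma> > 0 \<and> \<rho> > 0 \<and>
       coeff_matrix (cube c ((1 + \<rho>) * \<sigma>)) A \<alpha> \<beta> \<and>
       A_harmonic0 A (cube c ((1 + \<rho>) * \<sigma>)) u \<and>
       first_nonconst_eigs A (cube c ((1 + \<rho>) * \<sigma>)) n v lam \<and>
       (\<forall>i<n. harmonic_ext A (cube c ((1 + \<rho>) * \<sigma>)) (v i) (h i))"
    define L where "L = (1 + \<rho>) * \<sigma>"
    have s: "0 < \<sigma>" "\<rho> > 0" using asm by auto
    have Ls: "L - \<sigma> = \<rho> * \<sigma>" by (simp add: L_def algebra_simps)
    moreover have "0 < \<rho> * \<sigma>" using s by simp
    ultimately have L: "\<sigma> < L" "0 < L" "L - \<sigma> = \<rho> * \<sigma>" using s by linarith+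
    interpret big: coeff_cube c L A \<alpha> \<beta> by unfold_locales (use asm L in \<open>auto simp: L_def\<close>)
    interpret small: coeff_cube c \<sigma> A \<alpha> \<beta> by (rule big.coeff_cube_subset[OF s(1) less_imp_le[OF L(1)]])
    have bQ: "big.Q = cube c L" and sQ: "small.Q = cube c \<sigma>" by (simp_all add: big.Q_def small.Q_def)
    interpret en: psd_form "H1 (cube c \<sigma>)" "energy_ip A (cube c \<sigma>)" using small.psd_energy by (simp add: sQ)
    define w where "w i x = h i x - avg (cube c L) (h i)" for i x
    have hyp: "A_harmonic0 A big.Q u" "first_nonconst_eigs A big.Q n v lam" "\<And>i. i < n \<Longrightarrow> harmonic_ext A big.Q (v i) (h i)"
      using asm unfolding bQ unfolding L_def by blast+
    have sub: "H1 (cube c \<sigma>) f" if "H1 (cube c L) f" for f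
      by (rule h1pair_H1[OF h1pair_subset[OF open_cube open_cube cube_mono[OF less_imp_le[OF L(1)]] h1pair_grad[OF that]]])
    have Hu: "H1 (cube c \<sigma>) u" using hyp(1) by (auto simp: A_harmonic0_def A_harmonic_def bQ intro: sub)
    have Hw: "H1 (cube c \<sigma>) (w i)" if "i < n" for i
    proof -
      have "H1 (cube c \<sigma>) (h i)" using hyp(3)[OF that] by (auto simp: harmonic_ext_def A_harmonic_def bQ intro: sub)
      then show ?thesis
        unfolding w_def[abs_def] by (rule en.H_diff[OF _ h1pair_H1[OF h1pair_const]])
    qed
    have Hd: "H1 (cube c \<sigma>) (\<lambda>x. u x - (\<Sum>i<n. k i * w i x))" for k
      using Hw by (intro en.H_diff[OF Hu] en.H_sum) auto
    obtain k where k: "\<And>k'. energy_ip A (cube c \<sigma>) (\<lambda>x. u x - (\<Sum>i<n. k i * w i x)) (\<lambda>x. u x - (\<Sum>i<n. k i * w i x))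
       \<le> energy_ip A (cube c \<sigma>) (\<lambda>x. u x - (\<Sum>i<n. k' i * w i x)) (\<lambda>x. u x - (\<Sum>i<n. k' i * w i x))"
      by (rule en.best_approximation[where n=n and w=w, OF Hw Hu], assumption, rule that)
    define vu where "vu = (\<lambda>x. \<Sum>i<n. k i * w i x)"
    have F: "Fn (cube c L) n h = {f. \<exists>k. f = (\<lambda>x. \<Sum>i<n. k i * w i x)}" by (simp add: Fn_def w_def)
    have vuF: "vu \<in> Fn (cube c L) n h" unfolding F vu_def by blast
    have best: "energy_norm A (cube c \<sigma>) (\<lambda>x. u x - vu x) \<le> energy_norm A (cube c \<sigma>) (\<lambda>x. u x - f x)"
      if "f \<in> Fn (cube c L) n h" for f
      using that k unfolding F vu_def energy_norm_def by auto
    have "(INF f \<in> Fn (cube c L) n h. energy_norm A (cube c \<sigma>) (\<lambda>x. u x - f x)) = energy_norm A (cube c \<sigma>) (\<lambda>x. u x - vu x)"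
      by (rule cInf_eq_minimum) (use vuF best in auto)
    moreover have "energy_norm A (cube c \<sigma>) (\<lambda>x. u x - vu x)
      \<le> 2 * \<gamma> / sqrt pi * ((1 + \<rho>) / \<rho>) * sqrt (\<beta> / \<alpha>) * C n * energy_norm A (cube c L) u"
    proof -
      obtain k' where k': "energy_ip A (cube c \<sigma>) (\<lambda>x. u x - (\<Sum>i<n. k' i * w i x)) (\<lambda>x. u x - (\<Sum>i<n. k' i * w i x))
        \<le> (2 / (L - \<sigma>))\<^sup>2 * \<beta> * (real CARD('d) / 4 * (L / real (m n))\<^sup>2 / \<alpha>) * energy_ip A (cube c L) u u"
        using big.approximation_error[OF hyp m s(1) L(1)] unfolding w_def bQ by blast
      have "energy_norm A (cube c \<sigma>) (\<lambda>x. u x - vu x) \<le> energy_norm A (cube c \<sigma>) (\<lambda>x. u x - (\<Sum>i<n. k' i * w i x))"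
        by (rule best) (auto simp: F)
      also have "\<dots> \<le> sqrt ((2 / (L - \<sigma>))\<^sup>2 * \<beta> * (real CARD('d) / 4 * (L / real (m n))\<^sup>2 / \<alpha>) * energy_ip A (cube c L) u u)"
        unfolding energy_norm_def by (rule real_sqrt_le_mono[OF k'])
      also have "\<dots> = sqrt ((2 / (L - \<sigma>) * (sqrt (real CARD('d)) / 2) * (L / real (m n)))\<^sup>2 * (\<beta> / \<alpha>) * energy_ip A (cube c L) u u)"
      proof -
        have sq: "(T * (sqrt (real CARD('d)) / 2) * Y)\<^sup>2 = T\<^sup>2 * (real CARD('d) / 4 * Y\<^sup>2)" for T Y :: real
          by (simp add: power_mult_distrib power_divide)
        show ?thesis unfolding sq by (simp add: mult_ac)
      qed
      also have "\<dots> = (2 / (L - \<sigma>) * (sqrt (real CARD('d)) / 2) * (L / real (m n))) * sqrt (\<beta> / \<alpha>) * energy_norm A (cube c L) u"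
        unfolding energy_norm_def real_sqrt_mult using L by (simp add: real_sqrt_abs abs_of_pos)
      \<comment> \<open>The Caccioppoli factor 2 / (\<rho> \<sigma>) meets the cell size (1 +
        \<rho>) \<sigma> / m; \<sigma> cancels, and \<open>\<kappa>\<close> converts sqrt d / 2 into
        the claimed constant.\<close>
      also have "2 / (L - \<sigma>) * (sqrt (real CARD('d)) / 2) * (L / real (m n)) = 2 * \<gamma> / sqrt pi * ((1 + \<rho>) / \<rho>) * (\<kappa> / real (m n))"
        using s \<gamma>(1) m(1)[of n] unfolding L(3) unfolding L_def \<kappa>_def by (simp add: field_simps)
      also have "2 * \<gamma> / sqrt pi * ((1 + \<rho>) / \<rho>) * (\<kappa> / real (m n)) * sqrt (\<beta> / \<alpha>) * energy_norm A (cube c L) u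
        \<le> 2 * \<gamma> / sqrt pi * ((1 + \<rho>) / \<rho>) * C n * sqrt (\<beta> / \<alpha>) * energy_norm A (cube c L) u"
      proof (intro mult_right_mono mult_left_mono)
        show "\<kappa> / real (m n) \<le> C n" by (simp add: C_def)
        show "0 \<le> 2 * \<gamma> / sqrt pi * ((1 + \<rho>) / \<rho>)" using \<gamma>(1) s by simp
        show "0 \<le> sqrt (\<beta> / \<alpha>)" using big.bounds by simp
        have "H1 big.Q u" using hyp(1) by (auto simp: A_harmonic0_def A_harmonic_def)
        then have "0 \<le> energy_ip A big.Q u u" using big.energy_nonneg by blast
        then show "0 \<le> energy_norm A (cube c L) u" by (simp add: energy_norm_def bQ)
      qed
      finally show ?thesis by (simp add: mult_ac)
    qed
    ultimately show "\<exists>vu \<in> Fn (cube c ((1 + \<rho>) * \<sigma>)) n h.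
          energy_norm A (cube c \<sigma>) (\<lambda>x. u x - vu x)
            = (INF w \<in> Fn (cube c ((1 + \<rho>) * \<sigma>)) n h. energy_norm A (cube c \<sigma>) (\<lambda>x. u x - w x)) \<and>
          energy_norm A (cube c \<sigma>) (\<lambda>x. u x - vu x)
            \<le> 2 * (measure lebesgue (ball (0 :: real^'d) 1)) powr (1 / real CARD('d)) / sqrt pi
                * ((1 + \<rho>) / \<rho>) * sqrt (\<beta> / \<alpha>) * C n
                * energy_norm A (cube c ((1 + \<rho>) * \<sigma>)) u"
      using vuF unfolding \<gamma>_def L_def by (intro bexI[of _ vu] conjI) auto
  qed
qed

end
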